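(* Let $X$ be a compact complex manifold. Then the following are equivalent: (1) $X$ is a complex parallelizable manifold. (2) $X$ has Kodaira dimension $0$, and the holomorphic cotangent bundle $\Omega_X$ is strongly semiample. (3) There is some positive integer $m>0$ such that $\mathrm{Sym}^m\Omega_X$ is a trivial holomorphic vector bundle.
   Context: $\Omega_X=\Omega^1_X$ is the holomorphic cotangent bundle of $X$. $X$ is a complex parallelizable manifold if $\Omega^1_X$ is holomorphically trivial, i.e. $\Omega^1_X\cong\mathcal{O}_X^{\oplus n}$. A holomorphic vector bundle $E$ on $X$ is strongly semiample if $\mathrm{Sym}^m E$ is generated by its global holomorphic sections for some integer $m>0$. *)

theory Defs
  imports
    "HOL-Analysis.Analysis"
    "HOL-Library.Function_Algebras"
    "HOL-Combinatorics.Combinatorics"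
begin

section \<open>Holomorphic functions of several variables\<close>

text \<open>
  A manifold of dimension \<open>n\<close> is modelled on the coordinate space of \<open>complex ^ 'n\<close> spanned by a
  set \<open>I\<close> of \<open>n\<close> coordinates. Index types are nonempty, so taking \<open>I\<close> to be a subset
  (instead of all of \<open>'n\<close>) is what makes dimension 0 available.
\<close>

definition coord_space :: "'n set \<Rightarrow> (complex ^ 'n) set" where
  "coord_space I = {z. \<forall>k. k \<notin> I \<longrightarrow> z $ k = 0}"

text \<open>
  Complex differentiability at every point of \<open>S\<close>. It is only used when \<open>S\<close> is open in some
  \<open>coord_space I\<close>; the derivative is then determined on \<open>coord_space I\<close>.
\<close>

definition holo_on :: "(complex ^ 'n::finite) set \<Rightarrow> (complex ^ 'n \<Rightarrow> complex) \<Rightarrow> bool" where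
  "holo_on S f \<longleftrightarrow>
     (\<forall>z\<in>S. \<exists>D. (f has_derivative D) (at z within S) \<and> (\<forall>c v. D (c *s v) = c * D v))"

definition partial_deriv :: "'n::finite \<Rightarrow> (complex ^ 'n \<Rightarrow> complex) \<Rightarrow> complex ^ 'n \<Rightarrow> complex" where
  "partial_deriv k f z = deriv (\<lambda>t. f (z + t *s axis k 1)) 0"


section \<open>Complex manifolds\<close>

type_synonym ('a, 'n) cchart = "'a set \<times> ('a \<Rightarrow> complex ^ 'n)"

record ('a, 'n) manifold_data =
  mtop :: "'a topology"
  coords :: "'n set"
  atlas :: "('a, 'n) cchart set"

abbreviation mdim :: "('a, 'n) manifold_data \<Rightarrow> nat" where
  "mdim M \<equiv> card (coords M)"

text \<open>The coordinate change \<open>\<psi> \<circ> \<phi>\<inverse>\<close> from the chart \<open>(U, \<phi>)\<close> to the chart \<open>(V, \<psi>)\<close>.\<close>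

definition chart_change ::
  "('a, 'n) cchart \<Rightarrow> ('a, 'n) cchart \<Rightarrow> complex ^ 'n \<Rightarrow> complex ^ 'n" where
  "chart_change c d = (case (c, d) of ((U, \<phi>), (V, \<psi>)) \<Rightarrow> \<lambda>z. \<psi> (inv_into U \<phi> z))"

definition complex_manifold :: "('a, 'n::finite) manifold_data \<Rightarrow> bool" where
  "complex_manifold M \<longleftrightarrow>
     Hausdorff_space (mtop M) \<and> second_countable (mtop M) \<and>
     (\<Union>(U, \<phi>)\<in>atlas M. U) = topspace (mtop M) \<and>
     (\<forall>(U, \<phi>)\<in>atlas M.
        openin (mtop M) U \<and>
        openin (top_of_set (coord_space (coords M))) (\<phi> ` U) \<and>
        homeomorphic_map (subtopology (mtop M) U) (top_of_set (\<phi> ` U)) \<phi>) \<and>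
     (\<forall>(U, \<phi>)\<in>atlas M. \<forall>(V, \<psi>)\<in>atlas M. \<forall>k.
        holo_on (\<phi> ` (U \<inter> V)) (\<lambda>z. chart_change (U, \<phi>) (V, \<psi>) z $ k))"

definition holo_fun :: "('a, 'n::finite) manifold_data \<Rightarrow> 'a set \<Rightarrow> ('a \<Rightarrow> complex) \<Rightarrow> bool" where
  "holo_fun M W f \<longleftrightarrow>
     (\<forall>(U, \<phi>)\<in>atlas M. holo_on (\<phi> ` (U \<inter> W)) (\<lambda>z. f (inv_into U \<phi> z)))"


section \<open>Holomorphic vector bundles\<close>

text \<open>
  A holomorphic vector bundle is given by a trivializing open cover, indexed by \<open>chart_index\<close>,
  and transition matrices whose rows and columns are indexed by the finite set \<open>frame_index\<close>.
  The convention is that a vector with components \<open>v\<^sub>j\<close> over \<open>cover j\<close> has components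
  \<open>v\<^sub>i a = (\<Sum>b. transition i j x a b * v\<^sub>j b)\<close> over \<open>cover i\<close>.
\<close>

record ('a, 'i, 'b) vbundle =
  chart_index :: "'i set"
  cover :: "'i \<Rightarrow> 'a set"
  frame_index :: "'b set"
  transition :: "'i \<Rightarrow> 'i \<Rightarrow> 'a \<Rightarrow> 'b \<Rightarrow> 'b \<Rightarrow> complex"

text \<open>
  A homomorphism \<open>\<Phi>\<close> of vector bundles is given, over \<open>cover E i \<inter> cover F j\<close>, by the
  matrix \<open>\<Phi> i j\<close> (rows indexed by \<open>F\<close>, columns by \<open>E\<close>).
\<close>

definition bundle_hom ::
  "('a, 'n::finite) manifold_data \<Rightarrow> ('a, 'i, 'b) vbundle \<Rightarrow> ('a, 'j, 'c) vbundle \<Rightarrow>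
   ('i \<Rightarrow> 'j \<Rightarrow> 'a \<Rightarrow> 'c \<Rightarrow> 'b \<Rightarrow> complex) \<Rightarrow> bool" where
  "bundle_hom M E F \<Phi> \<longleftrightarrow>
     (\<forall>i\<in>chart_index E. \<forall>j\<in>chart_index F. \<forall>c\<in>frame_index F. \<forall>b\<in>frame_index E.
        holo_fun M (cover E i \<inter> cover F j) (\<lambda>x. \<Phi> i j x c b)) \<and>
     (\<forall>i\<in>chart_index E. \<forall>i'\<in>chart_index E. \<forall>j\<in>chart_index F. \<forall>j'\<in>chart_index F.
      \<forall>x\<in>cover E i \<inter> cover E i' \<inter> cover F j \<inter> cover F j'.
      \<forall>c\<in>frame_index F. \<forall>b\<in>frame_index E.
        (\<Sum>a\<in>frame_index E. \<Phi> i j x c a * transition E i i' x a b) =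
        (\<Sum>d\<in>frame_index F. transition F j j' x c d * \<Phi> i' j' x d b))"

definition bundle_isomorphic ::
  "('a, 'n::finite) manifold_data \<Rightarrow> ('a, 'i, 'b) vbundle \<Rightarrow> ('a, 'j, 'c) vbundle \<Rightarrow> bool" where
  "bundle_isomorphic M E F \<longleftrightarrow>
     (\<exists>\<Phi> \<Psi>. bundle_hom M E F \<Phi> \<and> bundle_hom M F E \<Psi> \<and>
       (\<forall>i\<in>chart_index E. \<forall>j\<in>chart_index F. \<forall>x\<in>cover E i \<inter> cover F j.
          (\<forall>a\<in>frame_index E. \<forall>b\<in>frame_index E.
             (\<Sum>c\<in>frame_index F. \<Psi> j i x a c * \<Phi> i j x c b) = (if a = b then 1 else 0)) \<and>
          (\<forall>c\<in>frame_index F. \<forall>d\<in>frame_index F.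
             (\<Sum>a\<in>frame_index E. \<Phi> i j x c a * \<Psi> j i x a d) = (if c = d then 1 else 0))))"

definition trivial_bundle :: "('a, 'n) manifold_data \<Rightarrow> nat \<Rightarrow> ('a, unit, nat) vbundle" where
  "trivial_bundle M r =
     \<lparr>chart_index = {()}, cover = (\<lambda>_. topspace (mtop M)), frame_index = {..<r},
      transition = (\<lambda>_ _ _ a b. if a = b then 1 else 0)\<rparr>"

definition holo_trivial :: "('a, 'n::finite) manifold_data \<Rightarrow> ('a, 'i, 'b) vbundle \<Rightarrow> bool" where
  "holo_trivial M E \<longleftrightarrow> (\<exists>r. bundle_isomorphic M E (trivial_bundle M r))"


subsection \<open>Constructions\<close>

text \<open>
  Over a chart \<open>(U, \<phi>)\<close> the cotangent bundle has the frame \<open>d\<phi>\<^sub>a\<close>, and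
  \<open>d\<psi>\<^sub>b = (\<Sum>a. \<partial>\<psi>\<^sub>b/\<partial>\<phi>\<^sub>a d\<phi>\<^sub>a)\<close>.
\<close>

definition cotangent_bundle ::
  "('a, 'n::finite) manifold_data \<Rightarrow> ('a, ('a, 'n) cchart, 'n) vbundle" where
  "cotangent_bundle M =
     \<lparr>chart_index = atlas M, cover = fst, frame_index = coords M,
      transition = (\<lambda>c d x a b. partial_deriv a (\<lambda>z. chart_change c d z $ b) (snd c x))\<rparr>"

text \<open>The frame of \<open>E\<^sup>\<otimes>\<^sup>m\<close> induced by a frame \<open>e\<close> of \<open>E\<close> is \<open>e\<^bsub>as!0\<^esub> \<otimes> \<dots> \<otimes> e\<^bsub>as!(m-1)\<^esub>\<close>.\<close>

definition tensor_power :: "nat \<Rightarrow> ('a, 'i, 'b) vbundle \<Rightarrow> ('a, 'i, 'b list) vbundle" where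
  "tensor_power m E =
     \<lparr>chart_index = chart_index E, cover = cover E,
      frame_index = {as. set as \<subseteq> frame_index E \<and> length as = m},
      transition = (\<lambda>i j x as bs. \<Prod>k<m. transition E i j x (as ! k) (bs ! k))\<rparr>"

text \<open>
  \<open>Sym\<^sup>m E\<close> is the quotient of \<open>E\<^sup>\<otimes>\<^sup>m\<close> identifying the basis tensors that differ by a permutation;
  its frame consists of the monomials of degree \<open>m\<close> in the frame of \<open>E\<close>, encoded as multisets.
  The image of the monomial \<open>\<beta>\<close> does not depend on the list \<open>bs\<close> chosen to represent it.
\<close>

definition sym_power :: "nat \<Rightarrow> ('a, 'i, 'b) vbundle \<Rightarrow> ('a, 'i, 'b multiset) vbundle" where
  "sym_power m E =
     \<lparr>chart_index = chart_index E, cover = cover E,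
      frame_index = {\<alpha>. set_mset \<alpha> \<subseteq> frame_index E \<and> size \<alpha> = m},
      transition = (\<lambda>i j x \<alpha> \<beta>. \<Sum>as\<in>permutations_of_multiset \<alpha>.
        transition (tensor_power m E) i j x as (SOME bs. bs \<in> permutations_of_multiset \<beta>))\<rparr>"

text \<open>
  The top exterior power: the frame \<open>e\<^sub>1 \<and> \<dots> \<and> e\<^sub>r\<close> transforms by the determinant, written out
  by the Leibniz formula because \<^const>\<open>det\<close> is restricted to matrices indexed by a whole type.
\<close>

definition det_bundle :: "('a, 'i, 'b) vbundle \<Rightarrow> ('a, 'i, unit) vbundle" where
  "det_bundle E =
     \<lparr>chart_index = chart_index E, cover = cover E, frame_index = {()},
      transition = (\<lambda>i j x _ _. \<Sum>p\<in>{p. p permutes frame_index E}.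
        of_int (sign p) * (\<Prod>b\<in>frame_index E. transition E i j x b (p b)))\<rparr>"

definition canonical_bundle ::
  "('a, 'n::finite) manifold_data \<Rightarrow> ('a, ('a, 'n) cchart, unit) vbundle" where
  "canonical_bundle M = det_bundle (cotangent_bundle M)"


subsection \<open>Global sections\<close>

text \<open>
  A global section is the family of its component functions; they are set to 0 where they carry
  no meaning, so that distinct families are distinct sections.
\<close>

definition global_sections ::
  "('a, 'n::finite) manifold_data \<Rightarrow> ('a, 'i, 'b) vbundle \<Rightarrow> ('i \<Rightarrow> 'a \<Rightarrow> 'b \<Rightarrow> complex) set" where
  "global_sections M E = {s.
     (\<forall>i x b. \<not> (i \<in> chart_index E \<and> x \<in> cover E i \<and> b \<in> frame_index E) \<longrightarrow> s i x b = 0) \<and>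
     (\<forall>i\<in>chart_index E. \<forall>b\<in>frame_index E. holo_fun M (cover E i) (\<lambda>x. s i x b)) \<and>
     (\<forall>i\<in>chart_index E. \<forall>j\<in>chart_index E. \<forall>x\<in>cover E i \<inter> cover E j. \<forall>a\<in>frame_index E.
        s i x a = (\<Sum>b\<in>frame_index E. transition E i j x a b * s j x b))}"

definition globally_generated ::
  "('a, 'n::finite) manifold_data \<Rightarrow> ('a, 'i, 'b) vbundle \<Rightarrow> bool" where
  "globally_generated M E \<longleftrightarrow>
     (\<forall>i\<in>chart_index E. \<forall>x\<in>cover E i. \<forall>v.
        \<exists>s\<in>global_sections M E. \<forall>b\<in>frame_index E. s i x b = v b)"

definition strongly_semiample ::
  "('a, 'n::finite) manifold_data \<Rightarrow> ('a, 'i, 'b) vbundle \<Rightarrow> bool" where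
  "strongly_semiample M E \<longleftrightarrow> (\<exists>m>0. globally_generated M (sym_power m E))"

global_interpretation section_space:
  vector_space "\<lambda>(c::complex) (s :: 'i \<Rightarrow> 'a \<Rightarrow> 'b \<Rightarrow> complex) i x b. c * s i x b"
  by unfold_locales (simp_all add: fun_eq_iff algebra_simps)

text \<open>
  \<open>dim H\<^sup>0(X, E)\<close>, as an extended natural number because the library's \<open>dim\<close> is 0 for
  infinite-dimensional spaces.
\<close>

definition h0 :: "('a, 'n::finite) manifold_data \<Rightarrow> ('a, 'i, 'b) vbundle \<Rightarrow> enat" where
  "h0 M E =
     (if \<exists>B. finite B \<and> global_sections M E \<subseteq> section_space.span B
      then enat (section_space.dim (global_sections M E)) else \<infinity>)"


section \<open>Kodaira dimension and parallelizability\<close>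

definition plurigenus :: "('a, 'n::finite) manifold_data \<Rightarrow> nat \<Rightarrow> enat" where
  "plurigenus M m = h0 M (tensor_power m (canonical_bundle M))"

text \<open>
  \<open>-\<infinity>\<close> if all plurigenera vanish, and otherwise the smallest natural number \<open>k\<close> for which
  \<open>P\<^sub>m / m\<^sup>k\<close> is bounded.
\<close>

definition kodaira_dimension :: "('a, 'n::finite) manifold_data \<Rightarrow> ereal" where
  "kodaira_dimension M =
     (if \<forall>m>0. plurigenus M m = 0 then -\<infinity>
      else Inf {ereal (real k) |k. \<exists>C::nat. \<forall>m>0. plurigenus M m \<le> enat (C * m ^ k)})"

definition complex_parallelizable :: "('a, 'n::finite) manifold_data \<Rightarrow> bool" where
  "complex_parallelizable M \<longleftrightarrow>
     bundle_isomorphic M (cotangent_bundle M) (trivial_bundle M (mdim M))"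

end

theory Submission
  imports Defs "HOL-Complex_Analysis.Conformal_Mappings"
begin

text \<open>
  A holomorphic frame of \<open>\<Omega>\<close> trivializes all powers of the canonical bundle, whence (1) implies (2) and (3)
  with \<open>m = 1\<close>. For the converse let \<open>Sym\<^sup>m \<Omega>\<close> be globally generated. For every point \<open>x\<close> and tangent
  vector \<open>v\<close> at \<open>x\<close> there is a section of the dual of \<open>Sym\<^sup>m \<Omega>\<close> (over the connected component \<open>Q\<close> of \<open>x\<close>)
  with value \<open>v\<^sup>m\<close> at \<open>x\<close>: if \<open>Sym\<^sup>m \<Omega>\<close> is trivial this is clear. If the Kodaira dimension is 0, a
  pluricanonical form vanishes nowhere or identically on \<open>Q\<close>, because the monomials in two forms with a
  nonconstant quotient would be linearly independent; and the dual section arises from an invariant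
  that sends \<open>n\<close> tensors to a section of \<open>K\<^sup>m\<close>, by inserting generators into all arguments but one and
  dividing by a nowhere vanishing form.

  Pairing sections with dual sections gives holomorphic, hence constant, functions on \<open>Q\<close>. Therefore
  every polynomial identity that a global section satisfies at one point and that is expressed by such
  pairings holds everywhere. If \<open>f\<close> is \<open>\<xi>\<^sup>m\<close> at a point, then it is an \<open>m\<close>-th power of a (multivalued)
  form on \<open>Q\<close>, and varying \<open>\<xi>\<close> to first order yields a holomorphic frame of \<open>\<Omega>\<close> over \<open>Q\<close> that is unique
  up to a common \<open>m\<close>-th root of unity.

  The structure constants \<open>C\<close> of this frame are constant up to roots of unity. If one of them is not
  zero, normalizing its value makes the frame single-valued. If all vanish, the frame consists of closed
  forms, whose primitives make a finite covering \<open>Y\<close> of \<open>Q\<close> a space with local translations; by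
  compactness they extend to all translation vectors. A monodromy \<open>z \<noteq> 1\<close> would act like an affine map
  \<open>w \<mapsto> z w + v\<close>, which has a fixed point, whereas roots of unity act freely on \<open>Y\<close>. So the frame is again
  single-valued on \<open>Q\<close>.
\<close>

section \<open>Calculus of several complex variables\<close>

text \<open>The obstacle is the extraction of an \<open>m\<close>-th root: root and frame are fixed
  only up to \<open>z\<close> with \<open>z ^ m = 1\<close>, so the monodromy of the frame on
  \<open>Q\<close> is a scalar character. Being scalar is decisive. An affine map with linear part
  \<open>z\<close> times the identity, \<open>z \<noteq> 1\<close>, has a fixed point, while a free
  quotient of a torus may have nontrivial linear monodromy with an eigenvalue 1. The constants
  \<open>C\<close> scale by \<open>1/z\<close>, since \<open>d e\<close> is linear and the wedge
  product quadratic in the frame. That \<open>f\<close> is an \<open>m\<close>-th power is encoded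
  by \<open>f(v) f(y)^(m-1) = f(v,y,...,y)^m\<close>. Both sides contract the \<open>m\<close>-th
  tensor power of \<open>f\<close>, with its slots grouped differently, and for a power of one
  covector all slots are interchangeable. If \<open>f = w ^ m\<close>, its first-order variations
  are \<open>w^(m-1)\<close> times covectors. Replacing \<open>w\<close> by \<open>z w\<close>
  multiplies these quotients by \<open>z^(1-m) = z\<close>, so one root of unity serves the whole
  frame. Monodromy is treated without paths: multivalued objects are fibres with local branches, and
  global statements are proved on a component by open-and-closed arguments.\<close>

definition lin :: "('n \<Rightarrow> complex) \<Rightarrow> complex ^ 'n::finite \<Rightarrow> complex" where
  "lin g v = (\<Sum>k\<in>UNIV. g k * v $ k)"

text \<open>A real Frechet derivative on all of \<open>complex ^ 'n\<close> whose value is complex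
  linear. On the full space it determines the gradient; functions on \<open>coord_space I\<close>
  are brought into this form by composition with \<open>proj I\<close>.\<close>

definition has_cgrad :: "(complex ^ 'n::finite \<Rightarrow> complex) \<Rightarrow> ('n \<Rightarrow> complex) \<Rightarrow> complex ^ 'n \<Rightarrow> bool" where
  "has_cgrad f g z \<longleftrightarrow> (f has_derivative lin g) (at z)"

definition cdiff :: "(complex ^ 'n::finite \<Rightarrow> complex) \<Rightarrow> complex ^ 'n \<Rightarrow> bool" where
  "cdiff f z \<longleftrightarrow> (\<exists>g. has_cgrad f g z)"

lemma bounded_linear_vec_scale: "bounded_linear (\<lambda>t::complex. t *s (w :: complex ^ 'n::finite))"
  unfolding linear_conv_bounded_linear [symmetric]
  by (rule linearI) (auto simp: vec_eq_iff algebra_simps scaleR_conv_of_real [where 'a = complex])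

lemma bounded_linear_lin: "bounded_linear (lin g)"
  unfolding linear_conv_bounded_linear [symmetric]
  by (rule linearI)
     (auto simp: lin_def algebra_simps sum.distrib scaleR_conv_of_real [where 'a = complex] sum_distrib_left)

lemma lin_scale: "lin g (c *s v) = c * lin g v"
  by (simp add: lin_def sum_distrib_left algebra_simps)

lemma scale_axis: "t *s axis k (1::complex) = axis k t"
  by (simp add: vec_eq_iff axis_def)

lemma lin_axis [simp]: "lin g (axis k t) = g k * t"
  by (simp add: lin_def axis_def if_distrib sum.delta cong: if_cong)

lemma norm_vec_scale: "norm (c *s (v :: complex ^ 'n::finite)) = norm c * norm v"
  by (simp add: norm_vec_def norm_mult L2_set_right_distrib)

lemma norm_axis: "norm (axis k (t::complex) :: complex ^ 'n::finite) = norm t"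
  using norm_vec_scale [of t "axis k 1"] by (simp add: scale_axis norm_axis_1)

lemma continuous_on_axis [continuous_intros]:
  assumes "continuous_on S f"
  shows "continuous_on S (\<lambda>x. axis k (f x :: complex) :: complex ^ 'n::finite)"
  using bounded_linear.continuous_on [OF bounded_linear_vec_scale assms, of "axis k 1"]
  by (simp add: scale_axis)

lemma has_derivative_line:
  assumes "has_cgrad f g (z + t *s w)"
  shows "((\<lambda>t. f (z + t *s w)) has_field_derivative lin g w) (at t)"
proof -
  have 1: "((\<lambda>t. z + t *s w) has_derivative (\<lambda>t. t *s w)) (at t)"
    by (rule has_derivative_eq_rhs [OF has_derivative_add [OF has_derivative_const
          bounded_linear.has_derivative [OF bounded_linear_vec_scale has_derivative_ident]]]) simp
  have "((\<lambda>t. f (z + t *s w)) has_derivative (\<lambda>s. lin g (s *s w))) (at t)"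
    using has_derivative_compose [OF 1 assms[unfolded has_cgrad_def]] by simp
  then show ?thesis
    unfolding has_field_derivative_def lin_scale by (simp add: mult.commute [of _ "lin g w"])
qed

lemma partial_deriv_eq:
  assumes "has_cgrad f g z"
  shows "partial_deriv k f z = g k"
  using has_derivative_line [of f g z 0 "axis k 1"] assms
  by (simp add: partial_deriv_def DERIV_imp_deriv)

lemma cdiff_iff: "cdiff f z \<longleftrightarrow> has_cgrad f (\<lambda>k. partial_deriv k f z) z"
proof -
  have "(\<lambda>k. partial_deriv k f z) = g" if "has_cgrad f g z" for g
    using partial_deriv_eq [OF that] by auto
  then show ?thesis by (auto simp: cdiff_def)
qed

lemma complex_linear_eq_lin:
  assumes "bounded_linear D" "\<And>c v. D (c *s v) = c * D v"
  shows "D = lin (\<lambda>k. D (axis k 1))"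
proof
  fix v
  interpret bounded_linear D by fact
  have "D v = D (\<Sum>k\<in>UNIV. v $ k *s axis k 1)" by (simp add: basis_expansion)
  also have "\<dots> = lin (\<lambda>k. D (axis k 1)) v"
    by (simp add: sum assms lin_def mult.commute)
  finally show "D v = lin (\<lambda>k. D (axis k 1)) v" .
qed

lemma cdiffI:
  assumes "(f has_derivative D) (at z)" "\<And>c v. D (c *s v) = c * D v"
  shows "cdiff f z"
  using complex_linear_eq_lin [of D] assms has_derivative_bounded_linear
  unfolding cdiff_def has_cgrad_def by metis

lemma has_cgrad_cong:
  assumes "has_cgrad f g z" "open S" "z \<in> S" "\<And>w. w \<in> S \<Longrightarrow> f w = f' w"
  shows "has_cgrad f' g z"
  using assms unfolding has_cgrad_def by (rule has_derivative_transform_within_open)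

lemma cdiff_cong:
  assumes "cdiff f z" "open S" "z \<in> S" "\<And>w. w \<in> S \<Longrightarrow> f w = f' w"
  shows "cdiff f' z"
  using assms has_cgrad_cong unfolding cdiff_def by blast

lemma partial_deriv_cong:
  assumes "cdiff f z" "open S" "z \<in> S" "\<And>w. w \<in> S \<Longrightarrow> f w = f' w"
  shows "partial_deriv k f' z = partial_deriv k f z"
proof -
  obtain g where g: "has_cgrad f g z" using assms(1) by (auto simp: cdiff_def)
  show ?thesis
    unfolding partial_deriv_eq [OF g] by (rule partial_deriv_eq [OF has_cgrad_cong [OF g assms(2-4)]])
qed

lemma has_cgrad_const: "has_cgrad (\<lambda>_. c) (\<lambda>_. 0) z"
  unfolding has_cgrad_def lin_def by simp

lemma has_cgrad_nth: "has_cgrad (\<lambda>z. z $ j) (\<lambda>k. if k = j then 1 else 0) z"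
  unfolding has_cgrad_def lin_def
  by (rule has_derivative_eq_rhs [OF bounded_linear.has_derivative [OF bounded_linear_vec_nth has_derivative_ident]])
     (simp add: fun_eq_iff if_distrib [of "\<lambda>x. x * _"] sum.delta cong: if_cong)

lemma has_cgrad_add:
  assumes "has_cgrad f g z" "has_cgrad f' g' z"
  shows "has_cgrad (\<lambda>x. f x + f' x) (\<lambda>k. g k + g' k) z"
  using has_derivative_add [OF assms[unfolded has_cgrad_def]]
  unfolding has_cgrad_def lin_def by (simp add: algebra_simps sum.distrib)

lemma has_cgrad_mult:
  assumes "has_cgrad f g z" "has_cgrad f' g' z"
  shows "has_cgrad (\<lambda>x. f x * f' x) (\<lambda>k. f z * g' k + g k * f' z) z"
proof -
  have "lin (\<lambda>k. f z * g' k + g k * f' z) = (\<lambda>h. f z * lin g' h + lin g h * f' z)"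
    by (rule ext) (simp add: lin_def algebra_simps sum.distrib sum_distrib_left)
  then show ?thesis
    using has_derivative_mult [OF assms[unfolded has_cgrad_def]]
    unfolding has_cgrad_def by simp
qed

lemma has_cgrad_compose:
  assumes "has_cgrad f g z" "(h has_field_derivative h') (at (f z))"
  shows "has_cgrad (\<lambda>x. h (f x)) (\<lambda>k. h' * g k) z"
proof -
  have "lin (\<lambda>k. h' * g k) = (\<lambda>v. h' * lin g v)"
    by (rule ext) (simp add: lin_def sum_distrib_left algebra_simps)
  then show ?thesis
    using has_derivative_compose [OF assms(1)[unfolded has_cgrad_def] assms(2)[unfolded has_field_derivative_def]]
    unfolding has_cgrad_def by simp
qed

lemma has_derivative_vecI:
  fixes F :: "'a::euclidean_space \<Rightarrow> complex ^ 'n::finite"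
  assumes "\<And>k. ((\<lambda>z. F z $ k) has_derivative D k) (at z)"
  shows "(F has_derivative (\<lambda>v. \<chi> k. D k v)) (at z)"
proof -
  have eq: "x \<bullet> i = x $ k \<bullet> u" if "i = axis k u" for x i :: "complex ^ 'n" and k u
    by (simp add: that inner_axis)
  show ?thesis
    unfolding has_derivative_componentwise_within [of F]
  proof
    fix i :: "complex ^ 'n" assume "i \<in> Basis"
    then obtain k u where i: "i = axis k u" by (auto simp: Basis_vec_def)
    show "((\<lambda>x. F x \<bullet> i) has_derivative (\<lambda>x. (\<chi> k. D k x) \<bullet> i)) (at z)"
      using has_derivative_inner_left [OF assms [of k], of u] by (simp add: eq [OF i])
  qed
qed

lemma has_cgrad_compose_vec:
  fixes F :: "complex ^ 'm::finite \<Rightarrow> complex ^ 'n::finite"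
  assumes "\<And>k. has_cgrad (\<lambda>z. F z $ k) (G k) z" "has_cgrad f g (F z)"
  shows "has_cgrad (\<lambda>z. f (F z)) (\<lambda>j. \<Sum>k\<in>UNIV. g k * G k j) z"
proof -
  have "lin (\<lambda>j. \<Sum>k\<in>UNIV. g k * G k j) = (\<lambda>v. lin g (\<chi> k. lin (G k) v))"
  proof
    fix v
    have "lin (\<lambda>j. \<Sum>k\<in>UNIV. g k * G k j) v = (\<Sum>j\<in>UNIV. \<Sum>k\<in>UNIV. g k * G k j * v $ j)"
      by (simp add: lin_def sum_distrib_right)
    also have "\<dots> = (\<Sum>k\<in>UNIV. \<Sum>j\<in>UNIV. g k * G k j * v $ j)" by (rule sum.swap)
    finally show "lin (\<lambda>j. \<Sum>k\<in>UNIV. g k * G k j) v = lin g (\<chi> k. lin (G k) v)"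
      by (simp add: lin_def sum_distrib_left mult.assoc)
  qed
  then show ?thesis
    using has_derivative_compose [OF has_derivative_vecI [OF assms(1)[unfolded has_cgrad_def]]
        assms(2)[unfolded has_cgrad_def]]
    unfolding has_cgrad_def by simp
qed

lemma cdiff_const [intro, simp]: "cdiff (\<lambda>_. c) z"
  using has_cgrad_const cdiff_def by blast

lemma cdiff_add: "cdiff f z \<Longrightarrow> cdiff g z \<Longrightarrow> cdiff (\<lambda>x. f x + g x) z"
  using has_cgrad_add unfolding cdiff_def by blast

lemma cdiff_mult: "cdiff f z \<Longrightarrow> cdiff g z \<Longrightarrow> cdiff (\<lambda>x. f x * g x) z"
  using has_cgrad_mult unfolding cdiff_def by blast

lemma cdiff_sum: "(\<And>a. a \<in> A \<Longrightarrow> cdiff (f a) z) \<Longrightarrow> cdiff (\<lambda>x. \<Sum>a\<in>A. f a x) z"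
  by (induction A rule: infinite_finite_induct) (auto intro: cdiff_add)

lemma cdiff_prod: "(\<And>a. a \<in> A \<Longrightarrow> cdiff (f a) z) \<Longrightarrow> cdiff (\<lambda>x. \<Prod>a\<in>A. f a x) z"
  by (induction A rule: infinite_finite_induct) (auto intro: cdiff_mult)

lemma cdiff_compose:
  assumes "cdiff f z" "h field_differentiable (at (f z))"
  shows "cdiff (\<lambda>x. h (f x)) z"
  using assms has_cgrad_compose unfolding cdiff_def field_differentiable_def by blast

lemma cdiff_power: "cdiff f z \<Longrightarrow> cdiff (\<lambda>x. f x ^ n) z"
  by (induction n) (auto intro: cdiff_mult)

lemma cdiff_minus: "cdiff f z \<Longrightarrow> cdiff (\<lambda>x. - f x) z"
  using cdiff_mult [OF cdiff_const, of f z "-1"] by simp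

lemma cdiff_diff: "cdiff f z \<Longrightarrow> cdiff g z \<Longrightarrow> cdiff (\<lambda>x. f x - g x) z"
  using cdiff_add [OF _ cdiff_minus, of f z g] by simp

lemma cdiff_inverse: "cdiff f z \<Longrightarrow> f z \<noteq> 0 \<Longrightarrow> cdiff (\<lambda>x. inverse (f x)) z"
  by (rule cdiff_compose [where h = inverse]) (auto intro: field_differentiable_inverse)

lemma cdiff_divide: "cdiff f z \<Longrightarrow> cdiff g z \<Longrightarrow> g z \<noteq> 0 \<Longrightarrow> cdiff (\<lambda>x. f x / g x) z"
  unfolding divide_inverse by (intro cdiff_mult cdiff_inverse)

lemma cdiff_isCont: "cdiff f z \<Longrightarrow> isCont f z"
  unfolding cdiff_def has_cgrad_def using has_derivative_continuous by blast

lemma cdiff_continuous_on: "(\<And>z. z \<in> S \<Longrightarrow> cdiff f z) \<Longrightarrow> continuous_on S f"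
  by (simp add: cdiff_isCont continuous_at_imp_continuous_on)

lemma cdiff_holomorphic_line:
  assumes "\<And>t. t \<in> T \<Longrightarrow> cdiff f (z + t *s w)"
  shows "(\<lambda>t. f (z + t *s w)) holomorphic_on T"
  unfolding holomorphic_on_def field_differentiable_def
  using assms has_derivative_line has_field_derivative_at_within unfolding cdiff_def by metis

subsection \<open>Partial derivatives of holomorphic functions\<close>

text \<open>Cauchy's formula on a circle in the \<open>k\<close>-th coordinate line, parametrized
  over the unit interval. The radius stays fixed while \<open>z\<close> varies, so continuity and
  differentiability in \<open>z\<close> can be obtained under the integral sign.\<close>

lemma partial_deriv_integral:
  fixes f :: "complex ^ 'n::finite \<Rightarrow> complex"
  assumes "open S" "\<And>z. z \<in> S \<Longrightarrow> cdiff f z" "0 < R" "cball z R \<subseteq> S"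
  shows "partial_deriv k f z =
    integral {0..1} (\<lambda>x::real. f (z + axis k (R * exp (2 * pi * \<i> * x))) / (R * exp (2 * pi * \<i> * x)))"
proof -
  have inS: "z + t *s axis k 1 \<in> S" if "t \<in> cball 0 R" for t
    using that assms(4) by (auto simp: subset_iff dist_norm norm_vec_scale norm_axis)
  let ?h = "\<lambda>t. f (z + t *s axis k 1)"
  have hol: "?h holomorphic_on cball 0 R"
    by (rule cdiff_holomorphic_line) (use inS assms(2) in blast)
  have "(?h has_field_derivative (1 / (2 * of_real pi * \<i>) *
      contour_integral (circlepath 0 R) (\<lambda>u. ?h u / (u - 0)^2))) (at 0)"
    by (rule Cauchy_derivative_integral_circlepath)
       (use hol assms(3) in \<open>auto intro: holomorphic_on_imp_continuous_on holomorphic_on_subset\<close>)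
  then have "partial_deriv k f z =
      1 / (2 * of_real pi * \<i>) * contour_integral (circlepath 0 R) (\<lambda>u. ?h u / (u - 0)^2)"
    unfolding partial_deriv_def by (rule DERIV_imp_deriv)
  also have "\<dots> = integral {0..1} (\<lambda>x. 1 / (2 * of_real pi * \<i>) * (?h (circlepath 0 R x) / (circlepath 0 R x)\<^sup>2
      * vector_derivative (circlepath 0 R) (at x)))"
    unfolding contour_integral_integral integral_mult_right by simp
  also have "\<dots> = integral {0..1} (\<lambda>x::real. f (z + axis k (R * exp (2 * pi * \<i> * x))) / (R * exp (2 * pi * \<i> * x)))"
    using assms(3)
    by (intro integral_cong, unfold vector_derivative_circlepath)
       (simp add: circlepath scale_axis power2_eq_square field_simps)
  finally show ?thesis .
qed

text \<open>Half the radius of a ball around \<open>z0\<close>: one circle radius then serves all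
  centres near \<open>z0\<close> in the Cauchy integral.\<close>

lemma local_radius:
  fixes z0 :: "'a::{metric_space,real_normed_vector}"
  assumes "open S" "z0 \<in> S"
  obtains R where "R > 0" "\<And>z. z \<in> ball z0 R \<Longrightarrow> cball z R \<subseteq> S"
proof -
  obtain r where r: "r > 0" "cball z0 r \<subseteq> S" using assms open_contains_cball by blast
  show ?thesis
  proof
    show "cball z (r/2) \<subseteq> S" if z: "z \<in> ball z0 (r/2)" for z
    proof
      fix w assume "w \<in> cball z (r/2)"
      with z have "dist z0 w \<le> r" using dist_triangle [of z0 w z] by auto
      with r show "w \<in> S" by auto
    qed
  qed (use r in auto)
qed

lemma partial_deriv_continuous:
  fixes f :: "complex ^ 'n::finite \<Rightarrow> complex"
  assumes "open S" "\<And>z. z \<in> S \<Longrightarrow> cdiff f z"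
  shows "continuous_on S (partial_deriv k f)"
proof -
  have cf: "continuous_on S f" using cdiff_continuous_on assms(2) by blast
  have "isCont (partial_deriv k f) z0" if z0: "z0 \<in> S" for z0
  proof -
    obtain R where R: "R > 0" "\<And>z. z \<in> ball z0 R \<Longrightarrow> cball z R \<subseteq> S"
      using local_radius [OF assms(1) z0] by blast
    have inS: "z + axis k (R * exp (2 * pi * \<i> * complex_of_real x)) \<in> S" if "z \<in> ball z0 R" for z x
    proof -
      have "z + axis k (R * exp (2 * pi * \<i> * complex_of_real x)) \<in> cball z R"
        using R(1) by (simp add: dist_norm norm_axis norm_mult)
      then show ?thesis using R(2) that by blast
    qed
    have "continuous_on (ball z0 R) (\<lambda>z. integral (cbox 0 1)
        (\<lambda>x::real. f (z + axis k (R * exp (2 * pi * \<i> * x))) / (R * exp (2 * pi * \<i> * x))))"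
      by (rule integral_continuous_on_param)
         (use R inS in \<open>auto simp: split_beta intro!: continuous_intros continuous_on_compose2 [OF cf]\<close>)
    then have "continuous_on (ball z0 R) (partial_deriv k f)"
      by (rule continuous_on_cong [THEN iffD1, rotated -1])
         (use partial_deriv_integral [OF assms R(1) R(2)] in \<open>auto simp: cbox_interval\<close>)
    then show ?thesis using R(1) by (simp add: continuous_on_eq_continuous_at)
  qed
  then show ?thesis by (simp add: continuous_at_imp_continuous_on)
qed

text \<open>Leibniz' rule applied to the Cauchy integral. The gradient is stated explicitly because
  its \<open>j\<close>-th component is again a Cauchy integral, namely that of
  \<open>partial_deriv k (partial_deriv j f)\<close>; this yields the symmetry of second derivatives
  along with holomorphy.\<close>

lemma partial_deriv_aux:
  fixes f :: "complex ^ 'n::finite \<Rightarrow> complex"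
  assumes "open S" "\<And>z. z \<in> S \<Longrightarrow> cdiff f z" "z0 \<in> S"
  shows "\<exists>R>0. cball z0 R \<subseteq> S \<and> has_cgrad (partial_deriv k f) (\<lambda>j. integral {0..1}
     (\<lambda>x::real. partial_deriv j f (z0 + axis k (R * exp (2 * pi * \<i> * x))) / (R * exp (2 * pi * \<i> * x)))) z0"
proof -
  have cf: "continuous_on S f" using cdiff_continuous_on assms(2) by blast
  note cp = partial_deriv_continuous [OF assms(1,2)]
  obtain R where R: "R > 0" "\<And>z. z \<in> ball z0 R \<Longrightarrow> cball z R \<subseteq> S"
    using local_radius [OF assms(1,3)] by blast
  define u where "u = (\<lambda>x::real. R * exp (2 * pi * \<i> * x))"
  have u0 [simp]: "u x \<noteq> 0" and nu: "norm (u x) = R" for x using R(1) by (auto simp: u_def norm_mult)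
  have cu [continuous_intros]: "continuous_on X (\<lambda>y. u (h y))" if "continuous_on X h" for X :: "'z::topological_space set" and h
    unfolding u_def using that by (intro continuous_intros)
  have inS: "z + axis k (u x) \<in> S" if "z \<in> ball z0 R" for z x
  proof -
    have "z + axis k (u x) \<in> cball z R"
      using R(1) by (simp add: dist_norm norm_axis nu)
    then show ?thesis using R(2) that by blast
  qed
  define D where "D = (\<lambda>z x. Blinfun (\<lambda>v. lin (\<lambda>j. partial_deriv j f (z + axis k (u x))) v / u x))"
  have bl: "bounded_linear (\<lambda>v. lin (\<lambda>j. partial_deriv j f (z + axis k (u x))) v / u x)" for z x
    by (intro bounded_linear_intros bounded_linear_divide bounded_linear_compose [OF bounded_linear_divide bounded_linear_lin])
  have Dapp: "blinfun_apply (D z x) = (\<lambda>v. lin (\<lambda>j. partial_deriv j f (z + axis k (u x))) v / u x)" for z x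
    unfolding D_def by (rule bounded_linear_Blinfun_apply [OF bl])
  have contD: "continuous_on (ball z0 R \<times> cbox 0 1) (\<lambda>(z, x). D z x)"
    by (rule continuous_on_blinfun_componentwise)
       (auto simp: split_beta Dapp lin_def [of "\<lambda>j. partial_deriv j f _"] intro!: continuous_intros continuous_on_compose2 [OF cp] inS)
  have "((\<lambda>z. integral (cbox 0 1) (\<lambda>x. f (z + axis k (u x)) / u x)) has_derivative
      integral (cbox 0 1) (D z0)) (at z0 within ball z0 R)"
  proof (rule leibniz_rule [OF _ _ contD])
    fix z x assume z: "z \<in> ball z0 R"
    have "((\<lambda>z. z + axis k (u x)) has_derivative (\<lambda>v. v)) (at z)"
      by (rule has_derivative_eq_rhs [OF has_derivative_add [OF has_derivative_ident has_derivative_const]]) simp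
    moreover have "(f has_derivative lin (\<lambda>j. partial_deriv j f (z + axis k (u x)))) (at (z + axis k (u x)))"
      using assms(2) [OF inS [OF z]] unfolding cdiff_iff has_cgrad_def .
    ultimately have "((\<lambda>z. f (z + axis k (u x))) has_derivative lin (\<lambda>j. partial_deriv j f (z + axis k (u x)))) (at z)"
      using has_derivative_compose [of "\<lambda>z. z + axis k (u x)" "\<lambda>v. v" z UNIV f] by simp
    then have "((\<lambda>z. f (z + axis k (u x)) / u x) has_derivative blinfun_apply (D z x)) (at z)"
      unfolding Dapp by (rule bounded_linear.has_derivative [OF bounded_linear_divide])
    then show "((\<lambda>z. f (z + axis k (u x)) / u x) has_derivative blinfun_apply (D z x)) (at z within ball z0 R)"
      by (rule has_derivative_at_withinI)
  next
    fix z assume "z \<in> ball z0 R"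
    then show "(\<lambda>x. f (z + axis k (u x)) / u x) integrable_on cbox 0 1"
      by (intro integrable_continuous) (auto intro!: continuous_intros continuous_on_compose2 [OF cf] inS)
  qed (use R in auto)
  then have "((\<lambda>z. integral (cbox 0 1) (\<lambda>x. f (z + axis k (u x)) / u x)) has_derivative
      integral (cbox 0 1) (D z0)) (at z0)"
    using R(1) by (simp add: at_within_open [of z0 "ball z0 R"])
  then have der: "(partial_deriv k f has_derivative integral (cbox 0 1) (D z0)) (at z0)"
    by (rule has_derivative_transform_within_open [of _ _ _ _ "ball z0 R"])
       (use R partial_deriv_integral [OF assms(1,2) R(1) R(2)] in \<open>auto simp: u_def cbox_interval\<close>)
  have intD: "D z0 integrable_on cbox 0 1"
  proof (rule integrable_continuous)
    show "continuous_on (cbox 0 1) (D z0)"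
      using continuous_on_compose2 [OF contD, of "cbox 0 1" "\<lambda>x. (z0, x)"] R(1)
        by (auto simp: continuous_on_Pair image_subset_iff)
  qed
  have app: "integral (cbox 0 1) (D z0) v = integral {0..1} (\<lambda>x. lin (\<lambda>j. partial_deriv j f (z0 + axis k (u x))) v / u x)" for v
    using blinfun_apply_integral [OF intD, of v] by (simp add: Dapp cbox_interval)
  have "blinfun_apply (integral (cbox 0 1) (D z0)) = lin (\<lambda>k. blinfun_apply (integral (cbox 0 1) (D z0)) (axis k 1))"
  proof (rule complex_linear_eq_lin [OF blinfun.bounded_linear_right])
    fix c v
    show "integral (cbox 0 1) (D z0) (c *s v) = c * integral (cbox 0 1) (D z0) v"
      unfolding app lin_scale by (simp flip: integral_mult_right)
  qed
  then have eq: "blinfun_apply (integral (cbox 0 1) (D z0)) =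
      lin (\<lambda>j. integral {0..1} (\<lambda>x. partial_deriv j f (z0 + axis k (u x)) / u x))"
    unfolding app lin_axis by simp
  have "has_cgrad (partial_deriv k f) (\<lambda>j. integral {0..1} (\<lambda>x. partial_deriv j f (z0 + axis k (u x)) / u x)) z0"
    using der unfolding has_cgrad_def eq .
  moreover have "cball z0 R \<subseteq> S" using R by auto
  ultimately show ?thesis
    using R(1) unfolding u_def by blast
qed

lemma cdiff_partial_deriv:
  fixes f :: "complex ^ 'n::finite \<Rightarrow> complex"
  assumes "open S" "\<And>z. z \<in> S \<Longrightarrow> cdiff f z" "z \<in> S"
  shows "cdiff (partial_deriv k f) z"
  using partial_deriv_aux [OF assms] unfolding cdiff_def by blast

lemma partial_deriv_commute:
  fixes f :: "complex ^ 'n::finite \<Rightarrow> complex"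
  assumes "open S" "\<And>z. z \<in> S \<Longrightarrow> cdiff f z" "z \<in> S"
  shows "partial_deriv j (partial_deriv k f) z = partial_deriv k (partial_deriv j f) z"
proof -
  obtain R where R: "R > 0" "cball z R \<subseteq> S" and g: "has_cgrad (partial_deriv k f) (\<lambda>j. integral {0..1}
     (\<lambda>x::real. partial_deriv j f (z + axis k (R * exp (2 * pi * \<i> * x))) / (R * exp (2 * pi * \<i> * x)))) z"
    using partial_deriv_aux [OF assms] by blast
  show ?thesis
    unfolding partial_deriv_eq [OF g]
    by (rule partial_deriv_integral [symmetric, OF assms(1) _ R]) (rule cdiff_partial_deriv [OF assms(1,2)])
qed

subsection \<open>Zero derivative, maximum principle, primitives, local inverses\<close>

lemma has_cgrad_zero_const:
  assumes "convex S" "\<And>z. z \<in> S \<Longrightarrow> has_cgrad f (\<lambda>_. 0) z" "x \<in> S" "y \<in> S"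
  shows "f x = f y"
proof -
  have "\<exists>c. \<forall>x\<in>S. f x = c"
    by (rule has_derivative_zero_constant [OF assms(1)])
       (use assms(2) in \<open>auto simp: has_cgrad_def lin_def [abs_def] intro: has_derivative_at_withinI\<close>)
  then show ?thesis using assms by auto
qed

text \<open>Restriction to the complex line through \<open>z0\<close> and \<open>z\<close> reduces
  this to the maximum modulus principle in one variable.\<close>

lemma maximum_principle_ball:
  fixes f :: "complex ^ 'n::finite \<Rightarrow> complex"
  assumes "\<And>z. z \<in> ball z0 r \<Longrightarrow> cdiff f z" "\<And>z. z \<in> ball z0 r \<Longrightarrow> norm (f z) \<le> norm (f z0)"
    and "z \<in> ball z0 r"
  shows "f z = f z0"
proof (cases "z = z0")
  case False
  define w where "w = z - z0"
  have w: "w \<noteq> 0" "norm w < r" using False assms(3) by (auto simp: w_def dist_norm norm_minus_commute)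
  define T where "T = ball (0::complex) (r / norm w)"
  have inB: "z0 + t *s w \<in> ball z0 r" if "t \<in> T" for t
    using that w by (auto simp: T_def dist_norm norm_vec_scale field_simps)
  have "0 < r" using w(2) norm_ge_zero [of w] by linarith
  have "(\<lambda>t. f (z0 + t *s w)) constant_on T"
  proof (rule maximum_modulus_principle [of _ T T 0])
    show "(\<lambda>t. f (z0 + t *s w)) holomorphic_on T"
      by (rule cdiff_holomorphic_line) (use inB assms(1) in blast)
    show "0 \<in> T" using w \<open>0 < r\<close> by (auto simp: T_def)
    show "norm (f (z0 + t *s w)) \<le> norm (f (z0 + 0 *s w))" if "t \<in> T" for t
      using assms(2) [OF inB [OF that]] by simp
  qed (auto simp: T_def)
  moreover have "0 \<in> T" "1 \<in> T" using w \<open>0 < r\<close> by (auto simp: T_def)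
  ultimately have "f (z0 + 0 *s w) = f (z0 + 1 *s w)"
    unfolding constant_on_def by metis
  then show ?thesis by (simp add: w_def)
qed simp

text \<open>The primitive is the integral of the form along the segment from \<open>z0\<close> to
  \<open>z\<close>. Differentiating under the integral gives \<open>D\<close>, and closedness turns
  \<open>D\<close> into a total derivative along the segment.\<close>

lemma poincare_lemma:
  fixes H :: "'n::finite \<Rightarrow> complex ^ 'n \<Rightarrow> complex"
  assumes cd: "\<And>a z. z \<in> ball z0 r \<Longrightarrow> cdiff (H a) z"
    and closed: "\<And>a b z. z \<in> ball z0 r \<Longrightarrow> partial_deriv a (H b) z = partial_deriv b (H a) z"
  shows "\<exists>f. \<forall>z\<in>ball z0 r. has_cgrad f (\<lambda>a. H a z) z"
proof -
  have cH: "continuous_on (ball z0 r) (H a)" for a using cd cdiff_continuous_on by blast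
  have cP: "continuous_on (ball z0 r) (partial_deriv b (H a))" for a b
    by (rule partial_deriv_continuous) (use cd in auto)
  define p where "p = (\<lambda>z (t::real). z0 + t *\<^sub>R (z - z0))"
  have pin: "p z t \<in> ball z0 r" if "z \<in> ball z0 r" "t \<in> {0..1}" for z t
  proof -
    have "norm (t *\<^sub>R (z - z0)) \<le> 1 * norm (z - z0)" unfolding norm_scaleR
      by (rule mult_right_mono) (use that in auto)
    then show ?thesis using that by (auto simp: p_def dist_norm norm_minus_commute)
  qed
  have cp [continuous_intros]: "continuous_on X (\<lambda>y. p (h y) (k y))" if "continuous_on X h" "continuous_on X k"
    for X :: "'z::topological_space set" and h k unfolding p_def using that by (intro continuous_intros)
  define D where "D = (\<lambda>z t. \<lambda>v. lin (\<lambda>a. H a (p z t)) v +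
      (\<Sum>a\<in>UNIV. (t *\<^sub>R lin (\<lambda>b. partial_deriv b (H a) (p z t)) v) * (z - z0) $ a))"
  have bl: "bounded_linear (D z t)" for z t
    unfolding D_def
    by (intro bounded_linear_add bounded_linear_lin bounded_linear_sum
        bounded_linear_compose [OF bounded_linear_mult_left bounded_linear_compose [OF bounded_linear_scaleR_right bounded_linear_lin]])
  have Dapp: "blinfun_apply (Blinfun (D z t)) = D z t" for z t
    by (rule bounded_linear_Blinfun_apply [OF bl])
  define f where "f = (\<lambda>z. integral (cbox 0 1) (\<lambda>t. lin (\<lambda>a. H a (p z t)) (z - z0)))"
  have contD: "continuous_on (ball z0 r \<times> cbox 0 1) (\<lambda>(z, t). Blinfun (D z t))"
    by (rule continuous_on_blinfun_componentwise)
       (auto simp: split_beta Dapp, auto simp: D_def lin_def intro!: continuous_intros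
          continuous_on_compose2 [OF cH] continuous_on_compose2 [OF cP] pin)
  have "has_cgrad f (\<lambda>a. H a z) z" if z: "z \<in> ball z0 r" for z
  proof -
    have "(f has_derivative integral (cbox 0 1) (\<lambda>t. Blinfun (D z t))) (at z within ball z0 r)"
      unfolding f_def
    proof (rule leibniz_rule [OF _ _ contD z])
      fix z and t::real assume zt: "z \<in> ball z0 r" "t \<in> cbox 0 1"
      have dp: "((\<lambda>z. p z t) has_derivative (\<lambda>v. t *\<^sub>R v)) (at z)"
        unfolding p_def by (auto intro!: derivative_eq_intros)
      have dH: "((\<lambda>z. H a (p z t)) has_derivative (\<lambda>v. t *\<^sub>R lin (\<lambda>b. partial_deriv b (H a) (p z t)) v)) (at z)" for a
      proof -
        have "(H a has_derivative lin (\<lambda>b. partial_deriv b (H a) (p z t))) (at (p z t))"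
          using cd [OF pin, of z t a] zt unfolding cdiff_iff has_cgrad_def by simp
        from has_derivative_compose [OF dp this] show ?thesis
          by (simp add: linear_cmul [OF bounded_linear.linear [OF bounded_linear_lin]])
      qed
      have dn: "((\<lambda>z. (z - z0) $ a) has_derivative (\<lambda>v. v $ a)) (at z)" for a
        by (rule has_derivative_eq_rhs [OF bounded_linear.has_derivative [OF bounded_linear_vec_nth
            has_derivative_diff [OF has_derivative_ident has_derivative_const]]]) simp
      have "((\<lambda>z. lin (\<lambda>a. H a (p z t)) (z - z0)) has_derivative D z t) (at z)"
        unfolding lin_def [of "\<lambda>a. H a (p _ t)"]
        by (rule has_derivative_eq_rhs [OF has_derivative_sum [OF has_derivative_mult [OF dH dn]]])
           (simp add: D_def sum.distrib lin_def [of "\<lambda>a. H a (p _ t)"] fun_eq_iff)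
      then show "((\<lambda>z. lin (\<lambda>a. H a (p z t)) (z - z0)) has_derivative blinfun_apply (Blinfun (D z t))) (at z within ball z0 r)"
        unfolding Dapp by (rule has_derivative_at_withinI)
    next
      fix z assume "z \<in> ball z0 r"
      then show "(\<lambda>t. lin (\<lambda>a. H a (p z t)) (z - z0)) integrable_on cbox 0 1"
        unfolding lin_def
        by (intro integrable_continuous) (auto intro!: continuous_intros continuous_on_compose2 [OF cH] pin)
    qed auto
    then have der: "(f has_derivative integral (cbox 0 1) (\<lambda>t. Blinfun (D z t))) (at z)"
      using z by (simp add: at_within_open [of z "ball z0 r"])
    have intD: "(\<lambda>t. Blinfun (D z t)) integrable_on cbox 0 1"
    proof (rule integrable_continuous)
      show "continuous_on (cbox 0 1) (\<lambda>t. Blinfun (D z t))"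
        using continuous_on_compose2 [OF contD, of "cbox 0 1" "\<lambda>x. (z, x)"] z
        by (auto simp: continuous_on_Pair image_subset_iff)
    qed
    have "integral (cbox 0 1) (\<lambda>t. Blinfun (D z t)) v = lin (\<lambda>a. H a z) v" for v
    proof -
      \<comment> \<open>By closedness the integrand is the derivative of \<open>t\<close> times the
        form at \<open>p z t\<close> applied to \<open>v\<close>, so only the endpoint
        \<open>t = 1\<close> contributes.\<close>
      have "((\<lambda>t. D z t v) has_integral (1 *\<^sub>R lin (\<lambda>a. H a (p z 1)) v - 0 *\<^sub>R lin (\<lambda>a. H a (p z 0)) v)) {0..1}"
      proof (rule fundamental_theorem_of_calculus)
        fix t :: real assume t: "t \<in> {0..1}"
        have dpt: "((\<lambda>t. p z t) has_derivative (\<lambda>s. s *\<^sub>R (z - z0))) (at t within {0..1})"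
          unfolding p_def by (auto intro!: derivative_eq_intros)
        have dH: "((\<lambda>t. H a (p z t)) has_vector_derivative lin (\<lambda>b. partial_deriv b (H a) (p z t)) (z - z0)) (at t within {0..1})" for a
        proof -
          have "(H a has_derivative lin (\<lambda>b. partial_deriv b (H a) (p z t))) (at (p z t))"
            using cd [OF pin, of z t a] z t unfolding cdiff_iff has_cgrad_def by simp
          from has_derivative_compose [OF dpt this] show ?thesis
            by (simp add: has_vector_derivative_def linear_cmul [OF bounded_linear.linear [OF bounded_linear_lin]])
        qed
        have "((\<lambda>t. lin (\<lambda>a. H a (p z t)) v) has_vector_derivative
            (\<Sum>a\<in>UNIV. lin (\<lambda>b. partial_deriv b (H a) (p z t)) (z - z0) * v $ a)) (at t within {0..1})"
          unfolding lin_def [of "\<lambda>a. H a (p z _)"]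
          by (intro has_vector_derivative_sum has_vector_derivative_mult_left dH)
        then have "((\<lambda>t. t *\<^sub>R lin (\<lambda>a. H a (p z t)) v) has_vector_derivative
            t *\<^sub>R (\<Sum>a\<in>UNIV. lin (\<lambda>b. partial_deriv b (H a) (p z t)) (z - z0) * v $ a) +
            1 *\<^sub>R lin (\<lambda>a. H a (p z t)) v) (at t within {0..1})"
          by (intro has_vector_derivative_scaleR) (auto intro!: derivative_eq_intros)
        moreover have "(\<Sum>a\<in>UNIV. lin (\<lambda>b. partial_deriv b (H a) (p z t)) (z - z0) * v $ a)
            = (\<Sum>a\<in>UNIV. lin (\<lambda>b. partial_deriv b (H a) (p z t)) v * (z - z0) $ a)"
        proof -
          have "(\<Sum>a\<in>UNIV. lin (\<lambda>b. partial_deriv b (H a) (p z t)) (z - z0) * v $ a)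
             = (\<Sum>a\<in>UNIV. \<Sum>b\<in>UNIV. partial_deriv b (H a) (p z t) * (z - z0) $ b * v $ a)"
            by (simp add: lin_def sum_distrib_right)
          also have "\<dots> = (\<Sum>b\<in>UNIV. \<Sum>a\<in>UNIV. partial_deriv b (H a) (p z t) * (z - z0) $ b * v $ a)"
            by (rule sum.swap)
          also have "\<dots> = (\<Sum>b\<in>UNIV. \<Sum>a\<in>UNIV. partial_deriv a (H b) (p z t) * v $ a * (z - z0) $ b)"
            using closed [OF pin [OF z t]] by (intro sum.cong) auto
          finally show ?thesis by (simp add: lin_def sum_distrib_right)
        qed
        ultimately show "((\<lambda>t. t *\<^sub>R lin (\<lambda>a. H a (p z t)) v) has_vector_derivative D z t v) (at t within {0..1})"
          by (simp add: D_def scaleR_sum_right add.commute)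
      qed simp
      then have "integral {0..1} (\<lambda>t. D z t v) = lin (\<lambda>a. H a z) v"
        by (simp add: integral_unique p_def)
      then show ?thesis
        using blinfun_apply_integral [OF intD, of v] by (simp add: Dapp cbox_interval)
    qed
    then have "blinfun_apply (integral (cbox 0 1) (\<lambda>t. Blinfun (D z t))) = lin (\<lambda>a. H a z)" by auto
    with der show ?thesis unfolding has_cgrad_def by simp
  qed
  then show ?thesis by blast
qed

text \<open>The complex partial derivatives are continuous, so the inverse function theorem for real
  normed spaces applies, with the complex Jacobian matrix acting as a bounded linear map.\<close>

lemma holomorphic_local_homeomorphism:
  fixes G :: "complex ^ 'n::finite \<Rightarrow> complex ^ 'n"
  assumes "open S" "\<And>z k. z \<in> S \<Longrightarrow> cdiff (\<lambda>z. G z $ k) z" "z0 \<in> S"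
    and inv: "B ** (\<chi> k a. partial_deriv a (\<lambda>z. G z $ k) z0) = mat 1"
  obtains U V h where "open U" "U \<subseteq> S" "z0 \<in> U" "open V" "homeomorphism U V G h"
proof -
  define A where "A = (\<lambda>z. (\<chi> k a. partial_deriv a (\<lambda>z. G z $ k) z) :: complex ^ 'n ^ 'n)"
  have bl: "bounded_linear ((*v) (C :: complex ^ 'n ^ 'n))" for C
    unfolding linear_conv_bounded_linear [symmetric]
    by (rule linearI)
       (auto simp: vec_eq_iff matrix_vector_mult_def algebra_simps sum.distrib scaleR_conv_of_real [where 'a = complex] sum_distrib_left)
  have app: "blinfun_apply (Blinfun ((*v) C)) = (*v) C" for C :: "complex ^ 'n ^ 'n"
    by (rule bounded_linear_Blinfun_apply [OF bl])
  have Alin: "A z *v v = (\<chi> k. lin (\<lambda>a. partial_deriv a (\<lambda>z. G z $ k) z) v)" for z v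
    by (simp add: A_def matrix_vector_mult_def lin_def vec_eq_iff)
  have der: "(G has_derivative blinfun_apply (Blinfun ((*v) (A z)))) (at z)" if "z \<in> S" for z
    unfolding app using has_derivative_vecI [of G "\<lambda>k. lin (\<lambda>a. partial_deriv a (\<lambda>z. G z $ k) z)" z]
      assms(2) [OF that] unfolding cdiff_iff has_cgrad_def by (simp add: Alin [abs_def])
  have cont: "continuous_on S (\<lambda>z. Blinfun ((*v) (A z)))"
  proof (rule continuous_on_blinfun_componentwise)
    fix i :: "complex ^ 'n"
    have "continuous_on S (\<lambda>z. lin (\<lambda>a. partial_deriv a (\<lambda>z. G z $ k) z) i)" for k
      unfolding lin_def by (intro continuous_intros partial_deriv_continuous assms(1,2))
    then show "continuous_on S (\<lambda>z. blinfun_apply (Blinfun ((*v) (A z))) i)"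
      unfolding app Alin by (rule continuous_on_vec_lambda)
  qed
  have "Blinfun ((*v) B) o\<^sub>L Blinfun ((*v) (A z0)) = id_blinfun"
    by (rule blinfun_eqI) (use inv in \<open>simp add: app matrix_vector_mul_assoc A_def\<close>)
  from inverse_function_theorem [OF assms(1) der cont assms(3) this]
  show ?thesis using that by metis
qed

section \<open>Holomorphic functions on a complex manifold\<close>

text \<open>A proper \<open>coord_space I\<close> has empty interior in \<open>complex ^ 'n\<close>.
  Composition with this projection extends functions to open cylinders, constant in the missing
  directions, where ordinary derivatives make sense.\<close>

definition proj :: "'n set \<Rightarrow> complex ^ 'n \<Rightarrow> complex ^ 'n::finite" where
  "proj I z = (\<chi> k. if k \<in> I then z $ k else 0)"

lemma proj_nth [simp]: "proj I z $ k = (if k \<in> I then z $ k else 0)"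
  by (simp add: proj_def)

lemma proj_in [simp]: "proj I z \<in> coord_space I"
  by (simp add: coord_space_def)

lemma proj_id: "z \<in> coord_space I \<Longrightarrow> proj I z = z"
  by (auto simp: coord_space_def vec_eq_iff)

lemma proj_add: "proj I (v + w) = proj I v + proj I w"
  by (simp add: vec_eq_iff)

lemma proj_scale: "proj I (c *s v) = c *s proj I v"
  by (simp add: vec_eq_iff)

lemma bounded_linear_proj: "bounded_linear (proj I)"
  unfolding linear_conv_bounded_linear [symmetric] by (rule linearI) (auto simp: vec_eq_iff)

lemma continuous_on_proj [continuous_intros]: "continuous_on S f \<Longrightarrow> continuous_on S (\<lambda>x. proj I (f x))"
  by (rule bounded_linear.continuous_on [OF bounded_linear_proj])

lemma open_proj_vimage:
  assumes "openin (top_of_set (coord_space I)) S"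
  shows "open {z. proj I z \<in> S}"
proof -
  obtain T where T: "open T" "S = coord_space I \<inter> T" using assms by (auto simp: openin_open)
  have "open (proj I -` T)"
    by (rule open_vimage [OF T(1)]) (intro continuous_intros)
  moreover have "{z. proj I z \<in> S} = proj I -` T" using T by auto
  ultimately show ?thesis by simp
qed

lemma holo_on_iff:
  assumes S: "openin (top_of_set (coord_space I)) S"
  shows "holo_on S f \<longleftrightarrow> (\<forall>z\<in>S. cdiff (\<lambda>w. f (proj I w)) z)"
proof -
  have sub: "S \<subseteq> coord_space I" using openin_imp_subset [OF S] .
  let ?O = "{z. proj I z \<in> S}"
  note op = open_proj_vimage [OF S]
  show ?thesis
  proof
    assume h: "holo_on S f"
    show "\<forall>z\<in>S. cdiff (\<lambda>w. f (proj I w)) z"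
    proof
      fix z assume z: "z \<in> S"
      then obtain D where D: "(f has_derivative D) (at z within S)" "\<And>c v. D (c *s v) = c * D v"
        using h unfolding holo_on_def by blast
      have pz: "proj I z = z" using z sub proj_id by blast
      have "((\<lambda>w. f (proj I w)) has_derivative (\<lambda>v. D (proj I v))) (at z within ?O)"
        by (rule has_derivative_in_compose [where g = f, OF bounded_linear.has_derivative [OF bounded_linear_proj has_derivative_ident]])
           (use D(1) pz in \<open>auto intro: has_derivative_subset\<close>)
      then have "((\<lambda>w. f (proj I w)) has_derivative (\<lambda>v. D (proj I v))) (at z)"
        using at_within_open [OF _ op, of z] z pz by simp
      then show "cdiff (\<lambda>w. f (proj I w)) z"
        by (rule cdiffI) (simp add: proj_scale D(2))
    qed
  next
    assume h: "\<forall>z\<in>S. cdiff (\<lambda>w. f (proj I w)) z"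
    show "holo_on S f" unfolding holo_on_def
    proof
      fix z assume z: "z \<in> S"
      then obtain g where g: "((\<lambda>w. f (proj I w)) has_derivative lin g) (at z)"
        using h unfolding cdiff_def has_cgrad_def by blast
      have "(f has_derivative lin g) (at z within S)"
        by (rule has_derivative_transform [OF z _ has_derivative_at_withinI [OF g]])
           (use sub proj_id in \<open>metis subsetD\<close>)
      then show "\<exists>D. (f has_derivative D) (at z within S) \<and> (\<forall>c v. D (c *s v) = c * D v)"
        using lin_scale by blast
    qed
  qed
qed

locale cmanifold =
  fixes M :: "('a, 'n::finite) manifold_data"
  assumes cm: "complex_manifold M"
begin

abbreviation "I \<equiv> coords M"
abbreviation "X \<equiv> topspace (mtop M)"

text \<open>The inverse chart is extended along \<open>proj I\<close> to the cylinder over the chart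
  image; \<open>cdom c W\<close> is the part of this cylinder over \<open>W\<close>, an open set of
  the full space when \<open>W\<close> is open.\<close>

definition cinv :: "('a, 'n) cchart \<Rightarrow> complex ^ 'n \<Rightarrow> 'a" where
  "cinv c z = inv_into (fst c) (snd c) (proj I z)"

definition cdom :: "('a, 'n) cchart \<Rightarrow> 'a set \<Rightarrow> (complex ^ 'n) set" where
  "cdom c W = {z. proj I z \<in> snd c ` (fst c \<inter> W)}"

lemma chart_open: "c \<in> atlas M \<Longrightarrow> openin (mtop M) (fst c)"
  using cm unfolding complex_manifold_def by auto

lemma chart_sub: "c \<in> atlas M \<Longrightarrow> fst c \<subseteq> X"
  using chart_open openin_subset by blast

lemma chart_image: "c \<in> atlas M \<Longrightarrow> openin (top_of_set (coord_space I)) (snd c ` fst c)"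
  using cm unfolding complex_manifold_def by auto

lemma chart_homeo: "c \<in> atlas M \<Longrightarrow>
   homeomorphic_map (subtopology (mtop M) (fst c)) (top_of_set (snd c ` fst c)) (snd c)"
  using cm unfolding complex_manifold_def by auto

lemma chart_at:
  assumes "x \<in> X"
  obtains c where "c \<in> atlas M" "x \<in> fst c"
proof -
  have "(\<Union>(U, \<phi>)\<in>atlas M. U) = X" using cm unfolding complex_manifold_def by blast
  then have "x \<in> (\<Union>c\<in>atlas M. fst c)" using assms(1) by (simp add: split_beta)
  then show ?thesis using that by blast
qed

lemma chart_inj: "c \<in> atlas M \<Longrightarrow> inj_on (snd c) (fst c)"
  using homeomorphic_imp_injective_map [OF chart_homeo, of c] chart_sub [of c]
  by (simp add: Int_absorb1)

lemma chart_coord: "c \<in> atlas M \<Longrightarrow> x \<in> fst c \<Longrightarrow> snd c x \<in> coord_space I"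
  using openin_imp_subset [OF chart_image] by blast

lemma proj_chart [simp]: "c \<in> atlas M \<Longrightarrow> x \<in> fst c \<Longrightarrow> proj I (snd c x) = snd c x"
  using chart_coord proj_id by blast

lemma chart_change_holo:
  "c \<in> atlas M \<Longrightarrow> d \<in> atlas M \<Longrightarrow> holo_on (snd c ` (fst c \<inter> fst d)) (\<lambda>z. chart_change c d z $ k)"
proof -
  assume cd: "c \<in> atlas M" "d \<in> atlas M"
  have "\<forall>(U, \<phi>)\<in>atlas M. \<forall>(V, \<psi>)\<in>atlas M. \<forall>k.
      holo_on (\<phi> ` (U \<inter> V)) (\<lambda>z. chart_change (U, \<phi>) (V, \<psi>) z $ k)"
    using cm unfolding complex_manifold_def by blast
  then show ?thesis using cd by (auto simp: split_beta)
qed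

lemma cinv_chart [simp]: "c \<in> atlas M \<Longrightarrow> x \<in> fst c \<Longrightarrow> cinv c (snd c x) = x"
  by (simp add: cinv_def chart_inj)

lemma cdom_cinv:
  assumes "c \<in> atlas M" "z \<in> cdom c W"
  shows "cinv c z \<in> fst c" "cinv c z \<in> W" "snd c (cinv c z) = proj I z"
proof -
  obtain y where y: "y \<in> fst c" "y \<in> W" "proj I z = snd c y"
    using assms by (auto simp: cdom_def)
  then have "cinv c z = y" by (simp add: cinv_def chart_inj [OF assms(1)])
  with y show "cinv c z \<in> fst c" "cinv c z \<in> W" "snd c (cinv c z) = proj I z" by auto
qed

lemma chart_in_cdom: "c \<in> atlas M \<Longrightarrow> x \<in> fst c \<Longrightarrow> x \<in> W \<Longrightarrow> snd c x \<in> cdom c W"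
  by (simp add: cdom_def)

lemma chart_image_open:
  assumes "c \<in> atlas M" "openin (mtop M) W"
  shows "openin (top_of_set (coord_space I)) (snd c ` (fst c \<inter> W))"
proof -
  have "openin (subtopology (mtop M) (fst c)) (fst c \<inter> W)"
    using assms(2) by (simp add: openin_subtopology_Int2)
  then have "openin (top_of_set (snd c ` fst c)) (snd c ` (fst c \<inter> W))"
    using homeomorphic_map_openness [OF chart_homeo [OF assms(1)], of "fst c \<inter> W"]
      chart_sub [OF assms(1)] by (auto simp: topspace_subtopology)
  then show ?thesis using chart_image [OF assms(1)] openin_trans by blast
qed

lemma cdom_open: "c \<in> atlas M \<Longrightarrow> openin (mtop M) W \<Longrightarrow> open (cdom c W)"
  unfolding cdom_def by (rule open_proj_vimage [OF chart_image_open])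

lemma cinv_continuous:
  assumes c: "c \<in> atlas M"
  shows "continuous_map (top_of_set (cdom c X)) (mtop M) (cinv c)"
proof -
  have eq: "fst c \<inter> X = fst c" using chart_sub [OF c] by auto
  obtain g where g: "homeomorphic_maps (subtopology (mtop M) (fst c)) (top_of_set (snd c ` fst c)) (snd c) g"
    using chart_homeo [OF c] homeomorphic_map_maps by blast
  have "continuous_map (top_of_set (snd c ` fst c)) (mtop M) g"
    using g unfolding homeomorphic_maps_def by (auto simp: continuous_map_in_subtopology)
  moreover have "continuous_map (top_of_set (cdom c X)) (top_of_set (snd c ` fst c)) (proj I)"
    by (auto simp: cdom_def eq intro!: continuous_intros)
  ultimately have "continuous_map (top_of_set (cdom c X)) (mtop M) (g \<circ> proj I)"
    by (rule continuous_map_compose [rotated])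
  moreover have "(g \<circ> proj I) z = cinv c z" if "z \<in> topspace (top_of_set (cdom c X))" for z
  proof -
    have z: "z \<in> cdom c X" using that by simp
    have "cinv c z \<in> topspace (subtopology (mtop M) (fst c))"
      using cdom_cinv [OF c z] by simp
    then have "g (snd c (cinv c z)) = cinv c z"
      using g cdom_cinv [OF c z] chart_sub [OF c] unfolding homeomorphic_maps_def
      by blast
    then show ?thesis using cdom_cinv [OF c z] by simp
  qed
  ultimately show ?thesis by (rule continuous_map_eq)
qed

definition pull :: "('a, 'n) cchart \<Rightarrow> ('a \<Rightarrow> complex) \<Rightarrow> complex ^ 'n \<Rightarrow> complex" where
  "pull c F z = F (cinv c z)"

text \<open>Complex differentiability at the single point \<open>x\<close>; it becomes holomorphy
  when demanded on an open set. The pointwise form lets the calculus rules be stated without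
  domains, and by \<open>hol_atI\<close> one chart is enough to check.\<close>

definition hol_at :: "('a \<Rightarrow> complex) \<Rightarrow> 'a \<Rightarrow> bool" where
  "hol_at F x \<longleftrightarrow> (\<forall>c\<in>atlas M. x \<in> fst c \<longrightarrow> cdiff (pull c F) (snd c x))"

definition mgrad :: "('a \<Rightarrow> complex) \<Rightarrow> ('a, 'n) cchart \<Rightarrow> 'a \<Rightarrow> 'n \<Rightarrow> complex" where
  "mgrad F c x a = partial_deriv a (pull c F) (snd c x)"

lemma hol_atD: "hol_at F x \<Longrightarrow> c \<in> atlas M \<Longrightarrow> x \<in> fst c \<Longrightarrow> cdiff (pull c F) (snd c x)"
  by (simp add: hol_at_def)

lemma has_cgrad_mgrad:
  "hol_at F x \<Longrightarrow> c \<in> atlas M \<Longrightarrow> x \<in> fst c \<Longrightarrow> has_cgrad (pull c F) (mgrad F c x) (snd c x)"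
  using hol_atD [of F x c] unfolding cdiff_iff mgrad_def [abs_def] by simp

lemma mgrad_eqI: "has_cgrad (pull c F) g (snd c x) \<Longrightarrow> mgrad F c x = g"
  unfolding mgrad_def [abs_def] using partial_deriv_eq by (intro ext) blast

lemma holo_fun_iff:
  assumes "openin (mtop M) W"
  shows "holo_fun M W F \<longleftrightarrow> (\<forall>x\<in>W. hol_at F x)"
proof -
  have "holo_on (snd c ` (fst c \<inter> W)) (\<lambda>z. F (inv_into (fst c) (snd c) z)) \<longleftrightarrow>
     (\<forall>x\<in>fst c \<inter> W. cdiff (pull c F) (snd c x))" if "c \<in> atlas M" for c
    unfolding holo_on_iff [OF chart_image_open [OF that assms]] pull_def [abs_def] cinv_def by simp
  then show ?thesis
    unfolding holo_fun_def hol_at_def by (auto simp: split_beta)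
qed

lemma coord_change_cdiff:
  assumes "c \<in> atlas M" "d \<in> atlas M" "x \<in> fst c" "x \<in> fst d"
  shows "cdiff (\<lambda>z. snd d (cinv c z) $ k) (snd c x)"
proof -
  have "\<forall>z\<in>snd c ` (fst c \<inter> fst d). cdiff (\<lambda>w. chart_change c d (proj I w) $ k) z"
    using chart_change_holo [OF assms(1,2), of k]
    unfolding holo_on_iff [OF chart_image_open [OF assms(1) chart_open [OF assms(2)]]] .
  then have "cdiff (\<lambda>w. chart_change c d (proj I w) $ k) (snd c x)" using assms by blast
  then show ?thesis by (simp add: chart_change_def cinv_def split_beta)
qed

lemma pull_change:
  assumes "c \<in> atlas M" "d \<in> atlas M" "z \<in> cdom d (fst c)"
  shows "pull c F (snd c (cinv d z)) = pull d F z"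
  using cdom_cinv [OF assms(2,3)] assms(1) by (simp add: pull_def)

lemma has_cgrad_change:
  assumes c: "c \<in> atlas M" "x \<in> fst c" and d: "d \<in> atlas M" "x \<in> fst d"
    and F: "cdiff (pull c F) (snd c x)"
  shows "has_cgrad (pull d F) (\<lambda>a. \<Sum>k\<in>UNIV. mgrad F c x k * mgrad (\<lambda>y. snd c y $ k) d x a) (snd d x)"
proof -
  have 1: "has_cgrad (\<lambda>z. snd c (cinv d z) $ k) (mgrad (\<lambda>y. snd c y $ k) d x) (snd d x)" for k
    using coord_change_cdiff [OF d(1) c(1) d(2) c(2), of k]
    unfolding cdiff_iff mgrad_def [abs_def] pull_def [abs_def] by simp
  have 2: "has_cgrad (pull c F) (mgrad F c x) (snd c (cinv d (snd d x)))"
    using F d unfolding cdiff_iff mgrad_def [abs_def] by simp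
  show ?thesis
    by (rule has_cgrad_cong [OF has_cgrad_compose_vec [OF 1 2] cdom_open [OF d(1) chart_open [OF c(1)]]])
       (use c d in \<open>auto simp: pull_change intro: chart_in_cdom\<close>)
qed

lemma hol_atI:
  assumes "c \<in> atlas M" "x \<in> fst c" "cdiff (pull c F) (snd c x)"
  shows "hol_at F x"
  unfolding hol_at_def using has_cgrad_change [OF assms(1,2) _ _ assms(3)] unfolding cdiff_def by blast

lemma hol_at_cong:
  assumes "hol_at F x" "openin (mtop M) W" "x \<in> W" "\<And>y. y \<in> W \<Longrightarrow> F y = G y"
  shows "hol_at G x"
  unfolding hol_at_def
proof (intro ballI impI)
  fix c assume c: "c \<in> atlas M" "x \<in> fst c"
  show "cdiff (pull c G) (snd c x)"
    by (rule cdiff_cong [OF hol_atD [OF assms(1) c] cdom_open [OF c(1) assms(2)]])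
       (use c assms cdom_cinv(2) [OF c(1)] in \<open>auto simp: pull_def intro: chart_in_cdom\<close>)
qed

lemma mgrad_cong:
  assumes "hol_at F x" "openin (mtop M) W" "x \<in> W" "\<And>y. y \<in> W \<Longrightarrow> F y = G y"
    and "c \<in> atlas M" "x \<in> fst c"
  shows "mgrad G c x = mgrad F c x"
proof
  fix a
  have "partial_deriv a (pull c G) (snd c x) = partial_deriv a (pull c F) (snd c x)"
    by (rule partial_deriv_cong [OF hol_atD [OF assms(1,5,6)] cdom_open [OF assms(5,2)]])
       (use assms cdom_cinv(2) [OF assms(5)] in \<open>auto simp: pull_def intro: chart_in_cdom\<close>)
  then show "mgrad G c x a = mgrad F c x a" by (simp add: mgrad_def)
qed

lemma hol_at_const [simp, intro]: "hol_at (\<lambda>_. k) x"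
  by (simp add: hol_at_def pull_def [abs_def])

lemma hol_at_diff: "hol_at F x \<Longrightarrow> hol_at G x \<Longrightarrow> hol_at (\<lambda>y. F y - G y) x"
  by (auto simp: hol_at_def pull_def [abs_def] intro: cdiff_diff)

lemma hol_at_mult: "hol_at F x \<Longrightarrow> hol_at G x \<Longrightarrow> hol_at (\<lambda>y. F y * G y) x"
  by (auto simp: hol_at_def pull_def [abs_def] intro: cdiff_mult)

lemma hol_at_power: "hol_at F x \<Longrightarrow> hol_at (\<lambda>y. F y ^ n) x"
  by (auto simp: hol_at_def pull_def [abs_def] intro: cdiff_power)

lemma hol_at_sum: "(\<And>a. a \<in> A \<Longrightarrow> hol_at (F a) x) \<Longrightarrow> hol_at (\<lambda>y. \<Sum>a\<in>A. F a y) x"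
  by (simp add: hol_at_def pull_def [abs_def] cdiff_sum)

lemma hol_at_prod: "(\<And>a. a \<in> A \<Longrightarrow> hol_at (F a) x) \<Longrightarrow> hol_at (\<lambda>y. \<Prod>a\<in>A. F a y) x"
  by (simp add: hol_at_def pull_def [abs_def] cdiff_prod)

lemma hol_at_compose:
  assumes "hol_at F x" "h field_differentiable (at (F x))"
  shows "hol_at (\<lambda>y. h (F y)) x"
  unfolding hol_at_def
proof (intro ballI impI)
  fix c assume c: "c \<in> atlas M" "x \<in> fst c"
  have "cdiff (\<lambda>z. h (pull c F z)) (snd c x)"
    by (rule cdiff_compose [OF hol_atD [OF assms(1) c]]) (use assms c in \<open>simp add: pull_def\<close>)
  then show "cdiff (pull c (\<lambda>y. h (F y))) (snd c x)" by (simp add: pull_def [abs_def])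
qed

lemma hol_at_divide: "hol_at F x \<Longrightarrow> hol_at G x \<Longrightarrow> G x \<noteq> 0 \<Longrightarrow> hol_at (\<lambda>y. F y / G y) x"
  by (simp add: hol_at_def pull_def [abs_def] cdiff_divide)

lemma hol_at_coord:
  assumes "d \<in> atlas M" "x \<in> fst d"
  shows "hol_at (\<lambda>y. snd d y $ k) x"
  unfolding hol_at_def pull_def [abs_def] using coord_change_cdiff assms by blast

lemma mgrad_add:
  assumes "hol_at F x" "hol_at G x" "c \<in> atlas M" "x \<in> fst c"
  shows "mgrad (\<lambda>y. F y + G y) c x = (\<lambda>a. mgrad F c x a + mgrad G c x a)"
  using has_cgrad_add [OF has_cgrad_mgrad [OF assms(1,3,4)] has_cgrad_mgrad [OF assms(2,3,4)]]
  by (intro mgrad_eqI) (simp add: pull_def [abs_def])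

lemma mgrad_mult:
  assumes "hol_at F x" "hol_at G x" "c \<in> atlas M" "x \<in> fst c"
  shows "mgrad (\<lambda>y. F y * G y) c x = (\<lambda>a. F x * mgrad G c x a + mgrad F c x a * G x)"
  using has_cgrad_mult [OF has_cgrad_mgrad [OF assms(1,3,4)] has_cgrad_mgrad [OF assms(2,3,4)]] assms(3,4)
  by (intro mgrad_eqI) (simp add: pull_def [abs_def])

lemma mgrad_const [simp]: "mgrad (\<lambda>_. k) c x = (\<lambda>_. 0)"
  by (rule mgrad_eqI) (simp add: pull_def [abs_def] has_cgrad_const)

lemma mgrad_sum:
  assumes "\<And>i. i \<in> A \<Longrightarrow> hol_at (F i) x" "c \<in> atlas M" "x \<in> fst c"
  shows "mgrad (\<lambda>y. \<Sum>i\<in>A. F i y) c x a = (\<Sum>i\<in>A. mgrad (F i) c x a)"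
  using assms(1)
proof (induction A rule: infinite_finite_induct)
  case (insert i A)
  then have "mgrad (\<lambda>y. F i y + (\<Sum>i\<in>A. F i y)) c x = (\<lambda>a. mgrad (F i) c x a + mgrad (\<lambda>y. \<Sum>i\<in>A. F i y) c x a)"
    by (intro mgrad_add assms(2,3) hol_at_sum) auto
  with insert show ?case by simp
qed auto

lemma partial_deriv_pull_outside:
  assumes "a \<notin> I"
  shows "partial_deriv a (pull c F) z = 0"
proof -
  have "proj I (z + t *s axis a 1) = proj I z" for t :: complex
    using assms by (auto simp: vec_eq_iff axis_def)
  then have "pull c F (z + t *s axis a 1) = pull c F z" for t
    unfolding pull_def cinv_def by simp
  then show ?thesis by (simp add: partial_deriv_def)
qed

lemma mgrad_outside: "a \<notin> I \<Longrightarrow> mgrad F c x a = 0"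
  by (simp add: mgrad_def partial_deriv_pull_outside)

definition Jac :: "('a, 'n) cchart \<Rightarrow> ('a, 'n) cchart \<Rightarrow> 'a \<Rightarrow> 'n \<Rightarrow> 'n \<Rightarrow> complex" where
  "Jac c d x a b = mgrad (\<lambda>y. snd d y $ b) c x a"

text \<open>Moving along an axis of \<open>I\<close> stays inside \<open>coord_space I\<close>,
  where \<open>proj I\<close> is the identity, so extending the coordinate change to the cylinder
  leaves these derivatives unchanged.\<close>

lemma transition_eq_Jac:
  assumes "c \<in> atlas M" "x \<in> fst c" "a \<in> I"
  shows "transition (cotangent_bundle M) c d x a b = Jac c d x a b"
proof -
  have "proj I (snd c x + t *s axis a 1) = snd c x + t *s axis a 1" for t :: complex
    using assms by (simp add: proj_add) (auto simp: vec_eq_iff axis_def)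
  then have "pull c (\<lambda>y. snd d y $ b) (snd c x + t *s axis a 1) =
      chart_change c d (snd c x + t *s axis a 1) $ b" for t
    unfolding pull_def cinv_def by (simp add: chart_change_def split_beta)
  then show ?thesis
    by (simp add: Jac_def mgrad_def cotangent_bundle_def partial_deriv_def)
qed

lemma mgrad_change:
  assumes F: "hol_at F x" and c: "c \<in> atlas M" "x \<in> fst c" and d: "d \<in> atlas M" "x \<in> fst d"
  shows "mgrad F c x a = (\<Sum>k\<in>I. Jac c d x a k * mgrad F d x k)"
proof -
  have "mgrad F c x a = (\<Sum>k\<in>UNIV. mgrad F d x k * mgrad (\<lambda>y. snd d y $ k) c x a)"
    using mgrad_eqI [OF has_cgrad_change [OF d c hol_atD [OF F d]]] by simp
  also have "\<dots> = (\<Sum>k\<in>I. mgrad F d x k * mgrad (\<lambda>y. snd d y $ k) c x a)"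
    by (rule sum.mono_neutral_right) (auto simp: mgrad_outside)
  finally show ?thesis by (simp add: Jac_def mult.commute)
qed

lemma Jac_cocycle:
  assumes "c \<in> atlas M" "x \<in> fst c" "d \<in> atlas M" "x \<in> fst d" "e \<in> atlas M" "x \<in> fst e"
  shows "Jac c e x a b = (\<Sum>k\<in>I. Jac c d x a k * Jac d e x k b)"
  using mgrad_change [OF hol_at_coord [OF assms(5,6)] assms(1-4)] by (simp add: Jac_def)

lemma Jac_self:
  assumes c: "c \<in> atlas M" "x \<in> fst c" and ab: "a \<in> I" "b \<in> I"
  shows "Jac c c x a b = (if a = b then 1 else 0)"
proof -
  have "has_cgrad (pull c (\<lambda>y. snd c y $ b)) (\<lambda>k. if k = b then 1 else 0) (snd c x)"
  proof (rule has_cgrad_cong [OF has_cgrad_nth cdom_open [OF c(1) chart_open [OF c(1)]]])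
    show "snd c x \<in> cdom c (fst c)" using c chart_in_cdom by blast
    show "w $ b = pull c (\<lambda>y. snd c y $ b) w" if "w \<in> cdom c (fst c)" for w
      using cdom_cinv(3) [OF c(1) that] ab by (simp add: pull_def)
  qed
  then show ?thesis unfolding Jac_def by (simp add: mgrad_eqI)
qed

text \<open>\<open>hol_at\<close> speaks of points of \<open>coord_space I\<close> only. A point
  \<open>z\<close> of the cylinder is moved there by the translation with
  \<open>proj I z - z\<close>, under which \<open>pull c F\<close> is invariant.\<close>

lemma pull_cdiff_cdom:
  assumes c: "c \<in> atlas M" and hol: "\<And>x. x \<in> W \<Longrightarrow> hol_at F x" and z: "z \<in> cdom c W"
  shows "has_cgrad (pull c F) (mgrad F c (cinv c z)) z"
proof -
  note zz = cdom_cinv [OF c z]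
  let ?T = "\<lambda>w. w + (proj I z - z)"
  have h: "has_cgrad (pull c F) (mgrad F c (cinv c z)) (?T z)"
    using has_cgrad_mgrad [OF hol [OF zz(2)] c zz(1)] zz(3) by simp
  have T: "has_cgrad (\<lambda>w. ?T w $ k) (\<lambda>j. if j = k then 1 else 0) z" for k
    using has_cgrad_add [OF has_cgrad_nth [of k z] has_cgrad_const [of "(proj I z - z) $ k" z]] by simp
  have "proj I (?T w) = proj I w" for w
    by (simp add: vec_eq_iff)
  then have "pull c F (?T w) = pull c F w" for w unfolding pull_def cinv_def by simp
  then show ?thesis
    using has_cgrad_compose_vec [of ?T _ z "pull c F", OF T h]
    by (simp add: if_distrib [of "\<lambda>x. _ * x"] sum.delta' cong: if_cong)
qed

lemma mgrad_pull:
  assumes c: "c \<in> atlas M" and hol: "\<And>x. x \<in> W \<Longrightarrow> hol_at F x" and z: "z \<in> cdom c W"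
  shows "pull c (\<lambda>y. mgrad F c y a) z = partial_deriv a (pull c F) z"
  using partial_deriv_eq [OF pull_cdiff_cdom [OF c hol z]] by (simp add: pull_def)

lemma hol_at_mgrad:
  assumes c: "c \<in> atlas M" "x \<in> fst c" and W: "openin (mtop M) W" "x \<in> W"
    and hol: "\<And>x. x \<in> W \<Longrightarrow> hol_at F x"
  shows "hol_at (\<lambda>y. mgrad F c y a) x"
proof (rule hol_atI [OF c])
  note op = cdom_open [OF c(1) W(1)]
  have "cdiff (partial_deriv a (pull c F)) (snd c x)"
    by (rule cdiff_partial_deriv [OF op])
       (use pull_cdiff_cdom [OF c(1) hol] c W chart_in_cdom in \<open>auto simp: cdiff_def\<close>)
  then show "cdiff (pull c (\<lambda>y. mgrad F c y a)) (snd c x)"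
    by (rule cdiff_cong [OF _ op]) (use mgrad_pull [OF c(1) hol] c W chart_in_cdom in auto)
qed

lemma mgrad_mgrad_commute:
  assumes c: "c \<in> atlas M" "x \<in> fst c" and W: "openin (mtop M) W" "x \<in> W"
    and hol: "\<And>x. x \<in> W \<Longrightarrow> hol_at F x"
  shows "mgrad (\<lambda>y. mgrad F c y a) c x b = mgrad (\<lambda>y. mgrad F c y b) c x a"
proof -
  note op = cdom_open [OF c(1) W(1)]
  have xx: "snd c x \<in> cdom c W" using c W chart_in_cdom by blast
  have cd: "\<And>z. z \<in> cdom c W \<Longrightarrow> cdiff (pull c F) z"
    using pull_cdiff_cdom [OF c(1) hol] unfolding cdiff_def by blast
  have "mgrad (\<lambda>y. mgrad F c y a) c x b = partial_deriv b (partial_deriv a (pull c F)) (snd c x)" for a b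
    unfolding mgrad_def [of "\<lambda>y. mgrad F c y a"]
    by (rule partial_deriv_cong [OF cdiff_partial_deriv [OF op cd xx] op xx])
       (simp_all add: mgrad_pull [OF c(1) hol])
  then show ?thesis using partial_deriv_commute [OF op cd xx, of b a] by simp
qed

lemma hol_at_Jac:
  assumes "c \<in> atlas M" "x \<in> fst c" "d \<in> atlas M" "x \<in> fst d"
  shows "hol_at (\<lambda>y. Jac c d y a b) x"
  unfolding Jac_def
  by (rule hol_at_mgrad [OF assms(1,2) chart_open [OF assms(3)] assms(4) hol_at_coord [OF assms(3)]])

subsection \<open>Local and global topology\<close>

text \<open>By \<open>cball_at_eq\<close> this is also the image under \<open>cinv c\<close> of a
  convex ball of the full space, which makes it connected.\<close>

definition cball_at :: "('a, 'n) cchart \<Rightarrow> 'a \<Rightarrow> real \<Rightarrow> 'a set" where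
  "cball_at c x r = {y \<in> fst c. dist (snd c x) (snd c y) < r}"

lemma norm_proj_le: "norm (proj I z) \<le> norm z"
  unfolding norm_vec_def by (rule L2_set_mono) auto

lemma coord_ball:
  assumes c: "c \<in> atlas M" "x \<in> fst c" and W: "openin (mtop M) W" "x \<in> W"
  obtains r where "r > 0" "ball (snd c x) r \<subseteq> cdom c W"
  using cdom_open [OF c(1) W(1)] chart_in_cdom [OF c W(2)] open_contains_ball by metis

lemma cball_at_eq:
  assumes c: "c \<in> atlas M" "x \<in> fst c" and r: "r > 0" "ball (snd c x) r \<subseteq> cdom c W"
  shows "cball_at c x r = cinv c ` ball (snd c x) r"
proof (intro equalityI subsetI)
  fix y assume "y \<in> cball_at c x r"
  then show "y \<in> cinv c ` ball (snd c x) r" using c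
    by (auto simp: cball_at_def intro!: image_eqI [of _ _ "snd c y"])
next
  fix y assume "y \<in> cinv c ` ball (snd c x) r"
  then obtain z where z: "y = cinv c z" "z \<in> ball (snd c x) r" by auto
  then have zz: "z \<in> cdom c W" using r by auto
  have "dist (snd c x) (proj I z) = norm (proj I (snd c x - z))"
    using c by (simp add: dist_norm linear_diff [OF bounded_linear.linear [OF bounded_linear_proj]])
  also have "\<dots> \<le> dist (snd c x) z" unfolding dist_norm by (rule norm_proj_le)
  finally show "y \<in> cball_at c x r" using z cdom_cinv [OF c(1) zz] by (auto simp: cball_at_def)
qed

lemma cball_at:
  assumes c: "c \<in> atlas M" "x \<in> fst c" and r: "r > 0" "ball (snd c x) r \<subseteq> cdom c W"
  shows "openin (mtop M) (cball_at c x r)" "x \<in> cball_at c x r" "cball_at c x r \<subseteq> W"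
    "cball_at c x r \<subseteq> fst c" "connectedin (mtop M) (cball_at c x r)"
proof -
  have "openin (subtopology (mtop M) (fst c)) {y \<in> topspace (subtopology (mtop M) (fst c)). snd c y \<in> snd c ` fst c \<inter> ball (snd c x) r}"
    by (rule openin_continuous_map_preimage [OF homeomorphic_imp_continuous_map [OF chart_homeo [OF c(1)]]]) auto
  moreover have "{y \<in> topspace (subtopology (mtop M) (fst c)). snd c y \<in> snd c ` fst c \<inter> ball (snd c x) r} = cball_at c x r"
    using chart_sub [OF c(1)] by (auto simp: cball_at_def)
  ultimately show "openin (mtop M) (cball_at c x r)"
    using openin_trans_full chart_open [OF c(1)] by metis
  show "x \<in> cball_at c x r" using c r by (auto simp: cball_at_def)
  show "cball_at c x r \<subseteq> fst c" by (auto simp: cball_at_def)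
  show "cball_at c x r \<subseteq> W"
    unfolding cball_at_eq [OF assms] using cdom_cinv(2) [OF c(1)] r by auto
  have "ball (snd c x) r \<subseteq> cdom c X"
    using r(2) chart_sub [OF c(1)] by (auto simp: cdom_def)
  then have "connectedin (top_of_set (cdom c X)) (ball (snd c x) r)"
    by (simp add: connectedin_subtopology)
  then show "connectedin (mtop M) (cball_at c x r)"
    unfolding cball_at_eq [OF assms] by (rule connectedin_continuous_map_image [OF cinv_continuous [OF c(1)]])
qed

lemma hol_at_nbhd:
  assumes "hol_at F x" "openin (mtop M) W" "x \<in> W" "open T" "F x \<in> T"
  obtains N where "openin (mtop M) N" "x \<in> N" "N \<subseteq> W" "F ` N \<subseteq> T"
proof -
  obtain c where c: "c \<in> atlas M" "x \<in> fst c" using chart_at openin_subset assms by blast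
  have "isCont (pull c F) (snd c x)" using cdiff_isCont hol_atD [OF assms(1) c] by blast
  moreover have "pull c F (snd c x) \<in> T" using assms c by (simp add: pull_def)
  ultimately have "\<forall>\<^sub>F z in nhds (snd c x). pull c F z \<in> T"
    using assms(4) by (simp add: continuous_within topological_tendstoD tendsto_at_iff_tendsto_nhds)
  then obtain S where S: "open S" "snd c x \<in> S" "\<And>z. z \<in> S \<Longrightarrow> pull c F z \<in> T"
    unfolding eventually_nhds by blast
  have "open (S \<inter> cdom c W)" "snd c x \<in> S \<inter> cdom c W"
    using S cdom_open [OF c(1) assms(2)] chart_in_cdom [OF c assms(3)] by auto
  then obtain r where r: "r > 0" "ball (snd c x) r \<subseteq> S \<inter> cdom c W"
    using open_contains_ball by metis
  then have r': "ball (snd c x) r \<subseteq> cdom c W" by auto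
  note cb = cball_at [OF c r(1) r']
  have "F ` cball_at c x r \<subseteq> T"
  proof
    fix t assume "t \<in> F ` cball_at c x r"
    then obtain y where y: "t = F y" "y \<in> fst c" "snd c y \<in> ball (snd c x) r" by (auto simp: cball_at_def)
    then have "pull c F (snd c y) \<in> T" using r S by auto
    then show "t \<in> T" using y c by (simp add: pull_def)
  qed
  then show ?thesis using that cb by metis
qed

lemma hol_continuous_map:
  assumes "\<And>x. x \<in> W \<Longrightarrow> hol_at F x" "openin (mtop M) W"
  shows "continuous_map (subtopology (mtop M) W) euclidean F"
  unfolding continuous_map_def
proof safe
  fix T :: "complex set" assume "openin euclidean T"
  then have T: "open T" by simp
  have "openin (mtop M) {x \<in> W. F x \<in> T}"
  proof (subst openin_subopen, safe)
    fix x assume x: "x \<in> W" "F x \<in> T"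
    obtain N where "openin (mtop M) N" "x \<in> N" "N \<subseteq> W" "F ` N \<subseteq> T"
      using hol_at_nbhd [OF assms(1) [OF x(1)] assms(2) x(1) T x(2)] .
    then show "\<exists>N. openin (mtop M) N \<and> x \<in> N \<and> N \<subseteq> {x \<in> W. F x \<in> T}" by blast
  qed
  moreover have "{x \<in> topspace (subtopology (mtop M) W). F x \<in> T} = {x \<in> W. F x \<in> T}"
    using openin_subset [OF assms(2)] by auto
  ultimately show "openin (subtopology (mtop M) W) {x \<in> topspace (subtopology (mtop M) W). F x \<in> T}"
    using openin_subtopology_Int2 [of "mtop M" _ W] by (metis (no_types, lifting) Int_absorb1 mem_Collect_eq subsetI)
qed auto

definition comp_of :: "'a \<Rightarrow> 'a set" where
  "comp_of p = connected_component_of_set (mtop M) p"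

lemma comp_of_sub: "comp_of p \<subseteq> X"
  by (simp add: comp_of_def connected_component_of_subset_topspace)

lemma comp_of_self: "p \<in> X \<Longrightarrow> p \<in> comp_of p"
  by (simp add: comp_of_def connected_component_of_refl)

lemma comp_of_eq: "q \<in> comp_of p \<Longrightarrow> comp_of q = comp_of p"
  unfolding comp_of_def using connected_component_of_equiv [of "mtop M" p q] by simp

lemma comp_of_connected: "connectedin (mtop M) (comp_of p)"
  by (simp add: comp_of_def connectedin_connected_component_of)

text \<open>Local connectedness: a coordinate ball lies in the component of its centre.\<close>

lemma comp_of_open: "openin (mtop M) (comp_of p)"
proof (subst openin_subopen, safe)
  fix x assume x: "x \<in> comp_of p"
  obtain c where c: "c \<in> atlas M" "x \<in> fst c" using chart_at comp_of_sub x by blast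
  have xX: "x \<in> X" using comp_of_sub x by blast
  obtain r where r: "r > 0" "ball (snd c x) r \<subseteq> cdom c X" using coord_ball [OF c _ xX] by auto
  note cb = cball_at [OF c r]
  have "cball_at c x r \<subseteq> comp_of x"
    unfolding comp_of_def using cb connected_component_of_maximal by metis
  then show "\<exists>T. openin (mtop M) T \<and> x \<in> T \<and> T \<subseteq> comp_of p"
    using cb comp_of_eq [OF x] by blast
qed

text \<open>The type of values is arbitrary. With a Boolean \<open>f\<close> this is induction over
  a component, which carries a property from one point to all others.\<close>

lemma comp_of_local_const:
  assumes "\<And>x. x \<in> comp_of p \<Longrightarrow> \<exists>N. openin (mtop M) N \<and> x \<in> N \<and> (\<forall>y\<in>N. f y = f x)"
    and "x \<in> comp_of p" "y \<in> comp_of p"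
  shows "f x = f y"
proof (rule ccontr)
  assume ne: "f x \<noteq> f y"
  define A where "A = {z \<in> comp_of p. f z = f x}"
  define B where "B = {z \<in> comp_of p. f z \<noteq> f x}"
  have op: "openin (mtop M) {z \<in> comp_of p. P (f z)}" for P
  proof (subst openin_subopen, safe)
    fix z assume z: "z \<in> comp_of p" "P (f z)"
    then obtain N where N: "openin (mtop M) N" "z \<in> N" "\<forall>y\<in>N. f y = f z" using assms(1) by blast
    have "N \<inter> comp_of p \<subseteq> {z \<in> comp_of p. P (f z)}"
    proof
      fix y assume y: "y \<in> N \<inter> comp_of p"
      then have "f y = f z" using N(3) by blast
      with y z show "y \<in> {z \<in> comp_of p. P (f z)}" by simp
    qed
    then show "\<exists>T. openin (mtop M) T \<and> z \<in> T \<and> T \<subseteq> {z \<in> comp_of p. P (f z)}"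
      using N z comp_of_open [of p] by blast
  qed
  have "openin (mtop M) A" "openin (mtop M) B" unfolding A_def B_def
    using op [of "\<lambda>v. v = f x"] op [of "\<lambda>v. v \<noteq> f x"] by auto
  moreover have "comp_of p \<subseteq> A \<union> B" "A \<inter> B \<inter> comp_of p = {}" "A \<inter> comp_of p \<noteq> {}" "B \<inter> comp_of p \<noteq> {}"
    using assms(2,3) ne by (auto simp: A_def B_def)
  ultimately show False using comp_of_connected [of p] unfolding connectedin by blast
qed

text \<open>A component is closed, hence compact, so the modulus attains its maximum at some
  \<open>q\<close>. The set where \<open>F\<close> equals \<open>F q\<close> is open by the maximum
  principle, and its complement is open by continuity.\<close>

lemma hol_const:
  assumes cpt: "compact_space (mtop M)" and hol: "\<And>x. x \<in> comp_of p \<Longrightarrow> hol_at F x"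
    and xy: "x \<in> comp_of p" "y \<in> comp_of p"
  shows "F x = F y"
proof -
  have "compactin (mtop M) (comp_of p)"
    using closedin_compact_space [OF cpt] by (simp add: comp_of_def closedin_connected_component_of)
  then have "compactin (subtopology (mtop M) (comp_of p)) (comp_of p)"
    by (simp add: compactin_subtopology)
  then have "compactin euclidean (F ` comp_of p)"
    by (rule image_compactin [OF _ hol_continuous_map [OF hol comp_of_open]])
  then have "compact ((\<lambda>z. norm z) ` F ` comp_of p)"
    by (intro compact_continuous_image continuous_intros) auto
  moreover have "(\<lambda>z. norm z) ` F ` comp_of p \<noteq> {}" using xy by auto
  ultimately obtain q where q: "q \<in> comp_of p" "\<And>z. z \<in> comp_of p \<Longrightarrow> norm (F z) \<le> norm (F q)"
    using compact_attains_sup [of "(\<lambda>z. norm z) ` F ` comp_of p"] by auto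
  have "(F x = F q) = (F q = F q)" if "x \<in> comp_of p" for x
  proof (rule comp_of_local_const [of p "\<lambda>x. F x = F q", OF _ that q(1)])
    fix z assume z: "z \<in> comp_of p"
    show "\<exists>N. openin (mtop M) N \<and> z \<in> N \<and> (\<forall>y\<in>N. (F y = F q) = (F z = F q))"
    proof (cases "F z = F q")
      case True
      obtain c where c: "c \<in> atlas M" "z \<in> fst c" using chart_at comp_of_sub z by blast
      obtain r where r: "r > 0" "ball (snd c z) r \<subseteq> cdom c (comp_of p)"
        using coord_ball [OF c comp_of_open z] .
      note cb = cball_at [OF c r]
      have "F y = F q" if y: "y \<in> cball_at c z r" for y
      proof -
        have "pull c F (snd c y) = pull c F (snd c z)"
        proof (rule maximum_principle_ball)
          fix w assume w: "w \<in> ball (snd c z) r"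
          then show "cdiff (pull c F) w"
            using pull_cdiff_cdom [OF c(1) hol] r unfolding cdiff_def by blast
          have "cinv c w \<in> comp_of p" using w r cdom_cinv(2) [OF c(1)] by auto
          then show "norm (pull c F w) \<le> norm (pull c F (snd c z))"
            using q(2) True c by (simp add: pull_def)
        qed (use y in \<open>auto simp: cball_at_def\<close>)
        then show ?thesis using y c True by (simp add: pull_def cball_at_def)
      qed
      then show ?thesis using cb True by (intro exI [of _ "cball_at c z r"]) auto
    next
      case False
      have op: "open (- {F q})" by (simp add: open_Compl)
      have Fz: "F z \<in> - {F q}" using False by simp
      obtain N where N: "openin (mtop M) N" "z \<in> N" "F ` N \<subseteq> - {F q}"
        by (rule hol_at_nbhd [OF hol [OF z] comp_of_open z op Fz])
      then have "\<forall>y\<in>N. F y \<noteq> F q" by (metis ComplD image_eqI singletonI subsetD)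
      then show ?thesis using False N by (intro exI [of _ N]) simp
    qed
  qed
  then show ?thesis using xy by metis
qed

lemma mgrad_zero_locally_const:
  assumes W: "openin (mtop M) W" "x \<in> W" and hol: "\<And>y. y \<in> W \<Longrightarrow> hol_at F y"
    and zero: "\<And>c y a. y \<in> W \<Longrightarrow> c \<in> atlas M \<Longrightarrow> y \<in> fst c \<Longrightarrow> mgrad F c y a = 0"
  obtains N where "openin (mtop M) N" "x \<in> N" "N \<subseteq> W" "\<And>y. y \<in> N \<Longrightarrow> F y = F x"
proof -
  obtain c where c: "c \<in> atlas M" "x \<in> fst c" using chart_at openin_subset W by blast
  obtain r where r: "r > 0" "ball (snd c x) r \<subseteq> cdom c W" using coord_ball [OF c W] .
  note cb = cball_at [OF c r]
  have "F y = F x" if y: "y \<in> cball_at c x r" for y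
  proof -
    have "pull c F (snd c y) = pull c F (snd c x)"
    proof (rule has_cgrad_zero_const [OF convex_ball [of "snd c x" r]])
      fix w assume w: "w \<in> ball (snd c x) r"
      then have w': "w \<in> cdom c W" using r by auto
      show "has_cgrad (pull c F) (\<lambda>_. 0) w"
        using pull_cdiff_cdom [OF c(1) hol w'] zero [OF cdom_cinv(2) [OF c(1) w'] c(1) cdom_cinv(1) [OF c(1) w']]
        by (metis (no_types, lifting) ext)
    qed (use y r in \<open>auto simp: cball_at_def\<close>)
    then show ?thesis using y c by (simp add: pull_def cball_at_def)
  qed
  then show ?thesis using that cb by metis
qed

end

section \<open>Matrices indexed by a subset of a finite type\<close>

text \<open>The block over \<open>I\<close> is padded by an identity block, so that determinants and
  inverses over the whole index type compute those of the block.\<close>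

definition xmat :: "'n set \<Rightarrow> ('n \<Rightarrow> 'n \<Rightarrow> complex) \<Rightarrow> complex ^ 'n ^ 'n::finite" where
  "xmat I A = (\<chi> i j. if i \<in> I \<and> j \<in> I then A i j else if i = j then 1 else 0)"

lemma xmat_nth: "xmat I A $ i $ j = (if i \<in> I \<and> j \<in> I then A i j else if i = j then 1 else 0)"
  by (simp add: xmat_def)

lemma xmat_cong: "(\<And>i j. i \<in> I \<Longrightarrow> j \<in> I \<Longrightarrow> A i j = B i j) \<Longrightarrow> xmat I A = xmat I B"
  by (simp add: xmat_def vec_eq_iff)

lemma xmat_transpose: "transpose (xmat I A) = xmat I (\<lambda>i j. A j i)"
  by (auto simp: vec_eq_iff transpose_def xmat_nth)

lemma xmat_mult: "xmat I A ** xmat I B = xmat I (\<lambda>i k. \<Sum>j\<in>I. A i j * B j k)"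
proof -
  have "(\<Sum>j\<in>UNIV. xmat I A $ i $ j * xmat I B $ j $ k) = xmat I (\<lambda>i k. \<Sum>j\<in>I. A i j * B j k) $ i $ k" for i k
  proof (cases "i \<in> I")
    case True
    then have "(\<Sum>j\<in>UNIV. xmat I A $ i $ j * xmat I B $ j $ k) = (\<Sum>j\<in>I. xmat I A $ i $ j * xmat I B $ j $ k)"
      by (intro sum.mono_neutral_right) (auto simp: xmat_nth)
    then show ?thesis using True by (cases "k \<in> I") (auto simp: xmat_nth intro!: sum.neutral)
  next
    case False
    then have "(\<Sum>j\<in>UNIV. xmat I A $ i $ j * xmat I B $ j $ k) = (\<Sum>j\<in>{i}. xmat I A $ i $ j * xmat I B $ j $ k)"
      by (intro sum.mono_neutral_right) (auto simp: xmat_nth)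
    then show ?thesis using False by (simp add: xmat_nth)
  qed
  then show ?thesis by (simp add: vec_eq_iff matrix_matrix_mult_def)
qed

text \<open>A permutation that moves an index outside \<open>I\<close> meets a zero of the padding
  and drops out of the Leibniz sum.\<close>

lemma det_xmat:
  "det (xmat I A) = (\<Sum>p\<in>{p. p permutes I}. of_int (sign p) * (\<Prod>b\<in>I. A b (p b)))"
proof -
  have "det (xmat I A) = (\<Sum>p\<in>{p. p permutes I}. of_int (sign p) * (\<Prod>i\<in>UNIV. xmat I A $ i $ p i))"
    unfolding det_def
  proof (rule sum.mono_neutral_right)
    show "\<forall>p\<in>{p. p permutes UNIV} - {p. p permutes I}. of_int (sign p) * (\<Prod>i\<in>UNIV. xmat I A $ i $ p i) = 0"
    proof
      fix p assume p: "p \<in> {p. p permutes (UNIV :: 'a set)} - {p. p permutes I}"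
      then obtain i where "i \<notin> I" "p i \<noteq> i" by (auto simp: permutes_def)
      then have "xmat I A $ i $ p i = 0" by (auto simp: xmat_nth)
      then show "of_int (sign p) * (\<Prod>i\<in>UNIV. xmat I A $ i $ p i) = 0"
        by (simp add: prod_zero_iff) blast
    qed
  qed (auto simp: permutes_def)
  also have "\<dots> = (\<Sum>p\<in>{p. p permutes I}. of_int (sign p) * (\<Prod>b\<in>I. A b (p b)))"
  proof (rule sum.cong [OF refl])
    fix p assume p: "p \<in> {p. p permutes I}"
    have "(\<Prod>i\<in>UNIV. xmat I A $ i $ p i) = (\<Prod>i\<in>I. xmat I A $ i $ p i)"
      by (rule prod.mono_neutral_right) (use p in \<open>auto simp: xmat_nth permutes_def\<close>)
    also have "\<dots> = (\<Prod>b\<in>I. A b (p b))"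
      by (rule prod.cong) (use p in \<open>auto simp: xmat_nth permutes_in_image\<close>)
    finally show "of_int (sign p) * (\<Prod>i\<in>UNIV. xmat I A $ i $ p i) = of_int (sign p) * (\<Prod>b\<in>I. A b (p b))"
      by simp
  qed
  finally show ?thesis .
qed

text \<open>The inverse matrix by Cramer's rule. As an explicit quotient of determinants it is
  visibly holomorphic in holomorphic entries.\<close>

definition minv :: "'n set \<Rightarrow> ('n \<Rightarrow> 'n \<Rightarrow> complex) \<Rightarrow> 'n \<Rightarrow> 'n::finite \<Rightarrow> complex" where
  "minv I A k j = det (\<chi> r s. if s = k then axis j 1 $ r else xmat I A $ r $ s) / det (xmat I A)"

lemma minv:
  assumes d: "det (xmat I A) \<noteq> 0" and ij: "i \<in> I" "j \<in> I"
  shows "(\<Sum>l\<in>I. A i l * minv I A l j) = (if i = j then 1 else 0)"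
    and "(\<Sum>l\<in>I. minv I A i l * A l j) = (if i = j then 1 else 0)"
proof -
  define N where "N = (\<chi> k j. minv I A k j)"
  have col: "xmat I A *v (\<chi> k. minv I A k j) = axis j 1" for j
    using cramer [OF d, of "\<chi> k. minv I A k j" "axis j 1"] by (simp add: minv_def)
  have "(xmat I A ** N) $ i $ j = mat 1 $ i $ j" for i j
  proof -
    have "(xmat I A ** N) $ i $ j = (xmat I A *v (\<chi> k. minv I A k j)) $ i"
      by (simp add: matrix_matrix_mult_def matrix_vector_mult_def N_def)
    then show ?thesis by (simp add: col mat_def axis_def)
  qed
  then have AN: "xmat I A ** N = mat 1" by (simp add: vec_eq_iff)
  then have NA: "N ** xmat I A = mat 1" by (simp add: matrix_left_right_inverse)
  have "(\<Sum>l\<in>I. A i l * minv I A l j) = (\<Sum>l\<in>UNIV. xmat I A $ i $ l * N $ l $ j)"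
    by (rule sum.mono_neutral_cong_left) (use ij in \<open>auto simp: xmat_nth N_def\<close>)
  also have "\<dots> = (xmat I A ** N) $ i $ j" by (simp add: matrix_matrix_mult_def)
  finally show "(\<Sum>l\<in>I. A i l * minv I A l j) = (if i = j then 1 else 0)" by (simp add: AN mat_def)
  have "(\<Sum>l\<in>I. minv I A i l * A l j) = (\<Sum>l\<in>UNIV. N $ i $ l * xmat I A $ l $ j)"
    by (rule sum.mono_neutral_cong_left) (use ij in \<open>auto simp: xmat_nth N_def\<close>)
  also have "\<dots> = (N ** xmat I A) $ i $ j" by (simp add: matrix_matrix_mult_def)
  finally show "(\<Sum>l\<in>I. minv I A i l * A l j) = (if i = j then 1 else 0)" by (simp add: NA mat_def)
qed

lemma minv_unique:
  assumes d: "det (xmat I A) \<noteq> 0" and y: "\<And>k'. k' \<in> I \<Longrightarrow> (\<Sum>b\<in>I. A k' b * y b) = z k'" and b: "b \<in> I"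
  shows "y b = (\<Sum>k\<in>I. minv I A b k * z k)"
proof -
  have "(\<Sum>k\<in>I. minv I A b k * z k) = (\<Sum>k\<in>I. \<Sum>b'\<in>I. minv I A b k * A k b' * y b')"
    by (rule sum.cong) (auto simp: y [symmetric] sum_distrib_left mult.assoc)
  also have "\<dots> = (\<Sum>b'\<in>I. \<Sum>k\<in>I. minv I A b k * A k b' * y b')" by (rule sum.swap)
  also have "\<dots> = (\<Sum>b'\<in>I. (if b = b' then 1 else 0) * y b')"
    by (rule sum.cong) (simp_all add: minv(2) [OF d b] flip: sum_distrib_right)
  also have "\<dots> = y b" using b by (simp add: if_distrib [of "\<lambda>x. x * _"] cong: if_cong)
  finally show ?thesis by simp
qed

text \<open>Independence of the rows: linear relations between the covectors of a frame can be
  inserted directly, and the criterion is unaffected by rescaling all rows.\<close>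

lemma det_xmat_nonzero_iff:
  "det (xmat I A) \<noteq> 0 \<longleftrightarrow>
     (\<forall>t. (\<forall>a\<in>I. (\<Sum>k\<in>I. t k * A k a) = 0) \<longrightarrow> (\<forall>k\<in>I. t k = 0))" (is "?L \<longleftrightarrow> ?R")
proof
  assume d: ?L
  show ?R
  proof (intro allI impI ballI)
    fix t k assume t: "\<forall>a\<in>I. (\<Sum>k\<in>I. t k * A k a) = 0" and k: "k \<in> I"
    have "det (xmat I (\<lambda>i j. A j i)) \<noteq> 0" using d by (metis det_transpose xmat_transpose)
    from minv_unique [OF this, of t "\<lambda>_. 0" k] t k show "t k = 0" by (simp add: mult.commute)
  qed
next
  assume R: ?R
  show ?L
  proof
    assume "det (xmat I A) = 0"
    then have "\<not> invertible (transpose (xmat I A))"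
      by (simp add: invertible_det_nz)
    then obtain x where x: "transpose (xmat I A) *v x = 0" "x \<noteq> 0"
      using matrix_left_invertible_ker invertible_left_inverse by blast
    have e: "(\<Sum>k\<in>UNIV. xmat I A $ k $ a * x $ k) = 0" for a
      using x(1) by (simp add: vec_eq_iff matrix_vector_mult_def transpose_def)
    have 1: "x $ a = 0" if "a \<notin> I" for a
    proof -
      have "(\<Sum>k\<in>UNIV. xmat I A $ k $ a * x $ k) = (\<Sum>k\<in>{a}. xmat I A $ k $ a * x $ k)"
        by (rule sum.mono_neutral_right) (use that in \<open>auto simp: xmat_nth\<close>)
      then show ?thesis using e [of a] that by (simp add: xmat_nth)
    qed
    have "(\<Sum>k\<in>I. x $ k * A k a) = 0" if "a \<in> I" for a
    proof -
      have "(\<Sum>k\<in>UNIV. xmat I A $ k $ a * x $ k) = (\<Sum>k\<in>I. x $ k * A k a)"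
        by (rule sum.mono_neutral_cong_right) (use that in \<open>auto simp: xmat_nth\<close>)
      then show ?thesis using e [of a] by simp
    qed
    then have "\<forall>k\<in>I. x $ k = 0" using R by blast
    with 1 x(2) show False by (auto simp: vec_eq_iff)
  qed
qed

context cmanifold
begin

lemma hol_at_det:
  assumes "\<And>i j. hol_at (\<lambda>y. A y i j) x"
  shows "hol_at (\<lambda>y. det (\<chi> i j. A y i j)) x"
  unfolding det_def by (simp add: hol_at_sum hol_at_mult hol_at_prod assms)

lemma hol_at_det_xmat:
  assumes "\<And>i j. i \<in> I \<Longrightarrow> j \<in> I \<Longrightarrow> hol_at (\<lambda>y. A y i j) x"
  shows "hol_at (\<lambda>y. det (xmat I (A y))) x"
  unfolding xmat_def
proof (rule hol_at_det)
  fix i j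
  show "hol_at (\<lambda>y. if i \<in> I \<and> j \<in> I then A y i j else if i = j then 1 else 0) x"
    using assms by (cases "i \<in> I"; cases "j \<in> I"; cases "i = j") simp_all
qed

lemma hol_at_minv:
  assumes "\<And>i j. i \<in> I \<Longrightarrow> j \<in> I \<Longrightarrow> hol_at (\<lambda>y. A y i j) x" "det (xmat I (A x)) \<noteq> 0"
  shows "hol_at (\<lambda>y. minv I (A y) k j) x"
  unfolding minv_def
proof (intro hol_at_divide hol_at_det hol_at_det_xmat assms)
  fix i ja
  show "hol_at (\<lambda>y. if ja = k then axis j 1 $ i else xmat I (A y) $ i $ ja) x"
    by (cases "ja = k"; cases "i \<in> I"; cases "ja \<in> I") (auto simp: xmat_nth assms)
qed

subsection \<open>Frames of the cotangent bundle\<close>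

definition cov_section :: "'a set \<Rightarrow> (('a, 'n) cchart \<Rightarrow> 'a \<Rightarrow> 'n \<Rightarrow> complex) \<Rightarrow> bool" where
  "cov_section Q w \<longleftrightarrow>
     (\<forall>c\<in>atlas M. \<forall>x\<in>fst c \<inter> Q. \<forall>a\<in>I. hol_at (\<lambda>y. w c y a) x) \<and>
     (\<forall>c\<in>atlas M. \<forall>d\<in>atlas M. \<forall>x\<in>fst c \<inter> fst d \<inter> Q. \<forall>a\<in>I.
        w c x a = (\<Sum>b\<in>I. Jac c d x a b * w d x b))"

definition frame_on :: "'a set \<Rightarrow> ('n \<Rightarrow> ('a, 'n) cchart \<Rightarrow> 'a \<Rightarrow> 'n \<Rightarrow> complex) \<Rightarrow> bool" where
  "frame_on Q e \<longleftrightarrow> (\<forall>k\<in>I. cov_section Q (e k)) \<and>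
     (\<forall>c\<in>atlas M. \<forall>x\<in>fst c \<inter> Q. det (xmat I (\<lambda>k a. e k c x a)) \<noteq> 0)"

lemma fst_inter_X: "c \<in> atlas M \<Longrightarrow> fst c \<inter> X = fst c" "c \<in> atlas M \<Longrightarrow> X \<inter> fst c = fst c"
  using chart_sub [of c] by blast+

lemma cotangent_simps [simp]:
  "chart_index (cotangent_bundle M) = atlas M" "cover (cotangent_bundle M) = fst"
  "frame_index (cotangent_bundle M) = I"
  by (simp_all add: cotangent_bundle_def)

lemma trivial_simps [simp]:
  "chart_index (trivial_bundle M r) = {()}" "cover (trivial_bundle M r) i = X"
  "frame_index (trivial_bundle M r) = {..<r}"
  "transition (trivial_bundle M r) i j x a b = (if a = b then 1 else 0)"
  by (simp_all add: trivial_bundle_def)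

lemma sum_delta_mult:
  assumes "finite A" "a \<in> A"
  shows "(\<Sum>b\<in>A. f b * (if b = a then 1 else 0 :: complex)) = f a"
    "(\<Sum>b\<in>A. (if a = b then 1 else 0 :: complex) * f b) = f a"
  using assms by (simp_all add: if_distrib [of "\<lambda>x. _ * x"] if_distrib [of "\<lambda>x. x * _"] cong: if_cong)

lemma bundle_hom_to_trivial:
  assumes [simp]: "chart_index E = atlas M" "cover E = fst"
  shows "bundle_hom M E (trivial_bundle M n) \<Phi> \<longleftrightarrow>
    (\<forall>c\<in>atlas M. \<forall>r<n. \<forall>b\<in>frame_index E. \<forall>x\<in>fst c. hol_at (\<lambda>x. \<Phi> c () x r b) x) \<and>
    (\<forall>c\<in>atlas M. \<forall>d\<in>atlas M. \<forall>x\<in>fst c \<inter> fst d. \<forall>r<n. \<forall>b\<in>frame_index E.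
       (\<Sum>a\<in>frame_index E. \<Phi> c () x r a * transition E c d x a b) = \<Phi> d () x r b)"
proof -
  have B: "fst c \<inter> fst d \<inter> X = fst c \<inter> fst d" if "c \<in> atlas M" for c d :: "('a, 'n) cchart"
    using chart_sub [OF that] by blast
  show ?thesis
    unfolding bundle_hom_def
    by (simp add: holo_fun_iff chart_open fst_inter_X B sum_delta_mult lessThan_def)
qed

lemma bundle_hom_from_trivial:
  assumes [simp]: "chart_index E = atlas M" "cover E = fst"
  shows "bundle_hom M (trivial_bundle M n) E \<Psi> \<longleftrightarrow>
    (\<forall>c\<in>atlas M. \<forall>b\<in>frame_index E. \<forall>r<n. \<forall>x\<in>fst c. hol_at (\<lambda>x. \<Psi> () c x b r) x) \<and>
    (\<forall>c\<in>atlas M. \<forall>d\<in>atlas M. \<forall>x\<in>fst c \<inter> fst d. \<forall>a\<in>frame_index E. \<forall>r<n.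
       \<Psi> () c x a r = (\<Sum>b\<in>frame_index E. transition E c d x a b * \<Psi> () d x b r))"
proof -
  have B: "X \<inter> fst c \<inter> fst d = fst c \<inter> fst d" if "c \<in> atlas M" for c d :: "('a, 'n) cchart"
    using chart_sub [OF that] by blast
  show ?thesis
    unfolding bundle_hom_def
    by (simp add: holo_fun_iff chart_open fst_inter_X B sum_delta_mult lessThan_def)
qed

lemma bundle_isomorphic_trivial_iff:
  assumes [simp]: "chart_index E = atlas M" "cover E = fst"
  shows "bundle_isomorphic M E (trivial_bundle M n) \<longleftrightarrow>
    (\<exists>\<Phi> \<Psi>. bundle_hom M E (trivial_bundle M n) \<Phi> \<and> bundle_hom M (trivial_bundle M n) E \<Psi> \<and>
      (\<forall>c\<in>atlas M. \<forall>x\<in>fst c.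
        (\<forall>a\<in>frame_index E. \<forall>b\<in>frame_index E.
           (\<Sum>r<n. \<Psi> () c x a r * \<Phi> c () x r b) = (if a = b then 1 else 0)) \<and>
        (\<forall>r<n. \<forall>s<n. (\<Sum>a\<in>frame_index E. \<Phi> c () x r a * \<Psi> () c x a s) = (if r = s then 1 else 0))))"
  unfolding bundle_isomorphic_def by (simp add: fst_inter_X lessThan_def)

text \<open>\<open>\<Psi>\<close> maps the standard basis to the frame and \<open>\<Phi>\<close>
  takes coordinates with respect to it. The bijection \<open>\<beta>\<close> numbers
  \<open>I\<close>, since the trivial bundle is indexed by natural numbers.\<close>

lemma parallelizable_if_frame:
  assumes "frame_on X e"
  shows "complex_parallelizable M"
proof -
  define n where "n = mdim M"
  obtain \<beta> where \<beta>: "bij_betw \<beta> {..<n} I"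
    using ex_bij_betw_nat_finite [of I] by (auto simp: n_def atLeast0LessThan)
  have \<beta>I: "\<beta> r \<in> I" if "r < n" for r using bij_betwE [OF \<beta>] that by auto
  have \<beta>eq: "\<beta> r = \<beta> s \<longleftrightarrow> r = s" if "r < n" "s < n" for r s
    using \<beta> that by (auto simp: bij_betw_def inj_on_def)
  have reindex: "(\<Sum>r<n. h (\<beta> r)) = (\<Sum>k\<in>I. h k :: complex)" for h
    by (rule sum.reindex_bij_betw [OF \<beta>])
  define E where "E = (\<lambda>c x k a. e k c x a)"
  have hol: "hol_at (\<lambda>y. E c y k a) x" if "c \<in> atlas M" "x \<in> fst c" "k \<in> I" "a \<in> I" for c x k a
    using assms that chart_sub unfolding frame_on_def cov_section_def E_def by blast
  have tr: "E c x k a = (\<Sum>b\<in>I. Jac c d x a b * E d x k b)"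
    if "c \<in> atlas M" "x \<in> fst c" "d \<in> atlas M" "x \<in> fst d" "k \<in> I" "a \<in> I" for c d x k a
    using assms that chart_sub unfolding frame_on_def cov_section_def E_def by blast
  have det: "det (xmat I (E c x)) \<noteq> 0" if "c \<in> atlas M" "x \<in> fst c" for c x
    using assms that chart_sub unfolding frame_on_def E_def by blast
  define \<Phi> where "\<Phi> = (\<lambda>(c::('a,'n) cchart) (j::unit) x r a. minv I (E c x) a (\<beta> r))"
  define \<Psi> where "\<Psi> = (\<lambda>(j::unit) (c::('a,'n) cchart) x a r. E c x (\<beta> r) a)"
  have 1: "bundle_hom M (cotangent_bundle M) (trivial_bundle M n) \<Phi>"
    unfolding bundle_hom_to_trivial [OF cotangent_simps(1,2)] cotangent_simps
  proof (intro conjI ballI allI impI)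
    fix c x r a assume *: "c \<in> atlas M" "a \<in> I" "r < n" "x \<in> fst c"
    show "hol_at (\<lambda>x. \<Phi> c () x r a) x"
      unfolding \<Phi>_def by (intro hol_at_minv hol det *)
  next
    fix c d x r b assume *: "c \<in> atlas M" "d \<in> atlas M" "x \<in> fst c \<inter> fst d" "b \<in> I" "r < n"
    \<comment> \<open>The claim is obtained from the uniqueness of the solution of a linear system
      with matrix \<open>E d x\<close>; this avoids inverting the transition matrix.\<close>
    have "(\<Sum>b\<in>I. E d x k b * (\<Sum>a\<in>I. \<Phi> c () x r a * Jac c d x a b)) = (if k = \<beta> r then 1 else 0)"
      if k: "k \<in> I" for k
    proof -
      have "(\<Sum>b\<in>I. E d x k b * (\<Sum>a\<in>I. \<Phi> c () x r a * Jac c d x a b)) =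
          (\<Sum>b\<in>I. \<Sum>a\<in>I. \<Phi> c () x r a * (Jac c d x a b * E d x k b))"
        by (simp add: sum_distrib_left mult_ac)
      also have "\<dots> = (\<Sum>a\<in>I. \<Sum>b\<in>I. \<Phi> c () x r a * (Jac c d x a b * E d x k b))" by (rule sum.swap)
      also have "\<dots> = (\<Sum>a\<in>I. E c x k a * minv I (E c x) a (\<beta> r))"
        by (rule sum.cong) (use * k in \<open>auto simp: \<Phi>_def tr [of c x d k] sum_distrib_left mult_ac\<close>)
      finally show ?thesis using minv(1) [OF det k \<beta>I] * by simp
    qed
    from minv_unique [OF det this \<open>b \<in> I\<close>] have "(\<Sum>a\<in>I. \<Phi> c () x r a * Jac c d x a b) = \<Phi> d () x r b"
      using * \<beta>I by (simp add: \<Phi>_def sum_delta_mult)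
    then show "(\<Sum>a\<in>I. \<Phi> c () x r a * transition (cotangent_bundle M) c d x a b) = \<Phi> d () x r b"
      using * by (simp add: transition_eq_Jac)
  qed
  have 2: "bundle_hom M (trivial_bundle M n) (cotangent_bundle M) \<Psi>"
    unfolding bundle_hom_from_trivial [OF cotangent_simps(1,2)] cotangent_simps
  proof (intro conjI ballI allI impI)
    fix c x r a assume *: "c \<in> atlas M" "a \<in> I" "r < n" "x \<in> fst c"
    show "hol_at (\<lambda>x. \<Psi> () c x a r) x"
      unfolding \<Psi>_def by (intro hol \<beta>I *)
  next
    fix c d x r b assume *: "c \<in> atlas M" "d \<in> atlas M" "x \<in> fst c \<inter> fst d" "b \<in> I" "r < n"
    then show "\<Psi> () c x b r = (\<Sum>a\<in>I. transition (cotangent_bundle M) c d x b a * \<Psi> () d x a r)"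
      using tr [of c x d "\<beta> r" b] \<beta>I by (simp add: transition_eq_Jac \<Psi>_def)
  qed
  have 3: "(\<Sum>c'<n. \<Psi> () c x a c' * \<Phi> c () x c' b) = (if a = b then 1 else 0)"
    if "c \<in> atlas M" "x \<in> fst c" "a \<in> I" "b \<in> I" for c x a b
  proof -
    have "(\<Sum>c'<n. \<Psi> () c x a c' * \<Phi> c () x c' b) = (\<Sum>k\<in>I. minv I (E c x) b k * E c x k a)"
      using reindex [of "\<lambda>k. minv I (E c x) b k * E c x k a"] by (simp add: \<Psi>_def \<Phi>_def mult.commute)
    then show ?thesis using minv(2) [OF det] that by simp
  qed
  have 4: "(\<Sum>a\<in>I. \<Phi> c () x r a * \<Psi> () c x a s) = (if r = s then 1 else 0)"
    if "c \<in> atlas M" "x \<in> fst c" "r < n" "s < n" for c x r s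
  proof -
    have "(\<Sum>a\<in>I. \<Phi> c () x r a * \<Psi> () c x a s) = (\<Sum>a\<in>I. E c x (\<beta> s) a * minv I (E c x) a (\<beta> r))"
      by (simp add: \<Psi>_def \<Phi>_def mult.commute)
    then show ?thesis using minv(1) [OF det] that \<beta>I \<beta>eq by (simp add: eq_commute)
  qed
  show ?thesis
    unfolding complex_parallelizable_def n_def [symmetric] bundle_isomorphic_trivial_iff [OF cotangent_simps(1,2)]
    using 1 2 3 4 by (intro exI [of _ \<Phi>] exI [of _ \<Psi>]) simp
qed

lemma frame_if_parallelizable:
  assumes "complex_parallelizable M"
  obtains e where "frame_on X e"
proof -
  define n where "n = mdim M"
  obtain \<beta> where \<beta>: "bij_betw \<beta> {..<n} I"
    using ex_bij_betw_nat_finite [of I] by (auto simp: n_def atLeast0LessThan)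
  define \<gamma> where "\<gamma> = inv_into {..<n} \<beta>"
  have \<gamma>: "\<gamma> k < n" "\<beta> (\<gamma> k) = k" if "k \<in> I" for k
    using \<beta> that bij_betw_inv_into_right [OF \<beta>] bij_betwE [OF bij_betw_inv_into [OF \<beta>]] by (auto simp: \<gamma>_def)
  have \<gamma>eq: "\<gamma> k = \<gamma> l \<longleftrightarrow> k = l" if "k \<in> I" "l \<in> I" for k l using \<gamma>(2) that by metis
  obtain \<Phi> \<Psi> where P: "bundle_hom M (trivial_bundle M n) (cotangent_bundle M) \<Psi>"
    and inv: "\<And>c x r s. c \<in> atlas M \<Longrightarrow> x \<in> fst c \<Longrightarrow> r < n \<Longrightarrow> s < n \<Longrightarrow>
       (\<Sum>a\<in>I. \<Phi> c () x r a * \<Psi> () c x a s) = (if r = s then 1 else 0)"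
    using assms unfolding complex_parallelizable_def n_def [symmetric] bundle_isomorphic_trivial_iff [OF cotangent_simps(1,2)]
    by simp blast
  note P = P [unfolded bundle_hom_from_trivial [OF cotangent_simps(1,2)] cotangent_simps]
  define e where "e = (\<lambda>k (c::('a,'n) cchart) x a. \<Psi> () c x a (\<gamma> k))"
  have "frame_on X e"
    unfolding frame_on_def cov_section_def
  proof (intro conjI ballI)
    fix k c x a assume *: "k \<in> I" "c \<in> atlas M" "x \<in> fst c \<inter> X" "a \<in> I"
    then show "hol_at (\<lambda>y. e k c y a) x"
      unfolding e_def using P \<gamma> by simp
  next
    fix k c d x a assume *: "k \<in> I" "c \<in> atlas M" "d \<in> atlas M" "x \<in> fst c \<inter> fst d \<inter> X" "a \<in> I"
    then have "\<Psi> () c x a (\<gamma> k) = (\<Sum>b\<in>I. transition (cotangent_bundle M) c d x a b * \<Psi> () d x b (\<gamma> k))"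
      using P \<gamma>(1) [of k] by blast
    then show "e k c x a = (\<Sum>b\<in>I. Jac c d x a b * e k d x b)"
      unfolding e_def using * by (simp add: transition_eq_Jac)
  next
    fix c x assume *: "c \<in> atlas M" "x \<in> fst c \<inter> X"
    have "xmat I (\<lambda>k a. \<Phi> c () x (\<gamma> k) a) ** xmat I (\<lambda>a k. e k c x a) = xmat I (\<lambda>k l. if k = l then 1 else 0)"
      unfolding xmat_mult by (rule xmat_cong) (use inv * \<gamma> \<gamma>eq in \<open>simp add: e_def\<close>)
    also have "\<dots> = mat 1" by (auto simp: xmat_nth mat_def vec_eq_iff)
    finally have "det (xmat I (\<lambda>k a. \<Phi> c () x (\<gamma> k) a)) * det (xmat I (\<lambda>a k. e k c x a)) = 1"
      by (metis det_I det_mul)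
    then have "det (xmat I (\<lambda>a k. e k c x a)) \<noteq> 0" by auto
    then show "det (xmat I (\<lambda>k a. e k c x a)) \<noteq> 0"
      by (metis det_transpose xmat_transpose)
  qed
  then show ?thesis by (rule that)
qed

text \<open>Components are open and disjoint, so frames on different ones are automatically
  compatible. The choice \<open>\<epsilon>\<close> depends on the component as a set and is
  therefore the same frame near each point.\<close>

lemma frame_glue:
  assumes "\<And>p. p \<in> X \<Longrightarrow> \<exists>e. frame_on (comp_of p) e"
  obtains e where "frame_on X e"
proof -
  define \<epsilon> where "\<epsilon> = (\<lambda>Q. SOME e. frame_on Q e)"
  have \<epsilon>: "frame_on (comp_of p) (\<epsilon> (comp_of p))" if "p \<in> X" for p
    unfolding \<epsilon>_def using assms [OF that] by (rule someI_ex)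
  have "frame_on X (\<lambda>k c x a. \<epsilon> (comp_of x) k c x a)"
    unfolding frame_on_def cov_section_def
  proof (intro conjI ballI)
    fix k c x a assume *: "k \<in> I" "c \<in> atlas M" "x \<in> fst c \<inter> X" "a \<in> I"
    have "hol_at (\<lambda>y. \<epsilon> (comp_of x) k c y a) x"
      using \<epsilon> [of x] * comp_of_self [of x] unfolding frame_on_def cov_section_def by blast
    then show "hol_at (\<lambda>y. \<epsilon> (comp_of y) k c y a) x"
      by (rule hol_at_cong [OF _ comp_of_open]) (use * comp_of_self comp_of_eq in auto)
  next
    fix k c d x a assume *: "k \<in> I" "c \<in> atlas M" "d \<in> atlas M" "x \<in> fst c \<inter> fst d \<inter> X" "a \<in> I"
    then show "\<epsilon> (comp_of x) k c x a = (\<Sum>b\<in>I. Jac c d x a b * \<epsilon> (comp_of x) k d x b)"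
      using \<epsilon> [of x] comp_of_self [of x] unfolding frame_on_def cov_section_def by blast
  next
    fix c x assume *: "c \<in> atlas M" "x \<in> fst c \<inter> X"
    then show "det (xmat I (\<lambda>k a. \<epsilon> (comp_of x) k c x a)) \<noteq> 0"
      using \<epsilon> [of x] comp_of_self [of x] unfolding frame_on_def by blast
  qed
  then show ?thesis by (rule that)
qed

subsection \<open>The first symmetric power\<close>

lemma sym_power_simps [simp]:
  "chart_index (sym_power m E) = chart_index E" "cover (sym_power m E) = cover E"
  "frame_index (sym_power m E) = {\<alpha>. set_mset \<alpha> \<subseteq> frame_index E \<and> size \<alpha> = m}"
  by (simp_all add: sym_power_def)

lemma sym1_index: "{\<alpha>. set_mset \<alpha> \<subseteq> S \<and> size \<alpha> = 1} = (\<lambda>a. {#a#}) ` S"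
proof (intro equalityI subsetI)
  fix \<alpha> assume \<alpha>: "\<alpha> \<in> {\<alpha>. set_mset \<alpha> \<subseteq> S \<and> size \<alpha> = 1}"
  then obtain a where "\<alpha> = {#a#}" using size_1_singleton_mset by blast
  with \<alpha> show "\<alpha> \<in> (\<lambda>a. {#a#}) ` S" by auto
qed auto

lemma sym1_transition: "transition (sym_power 1 E) i j x {#a#} {#b#} = transition E i j x a b"
  by (simp add: sym_power_def tensor_power_def)

definition the_single :: "'b multiset \<Rightarrow> 'b" where
  "the_single \<alpha> = (THE a. \<alpha> = {#a#})"

lemma the_single [simp]: "the_single {#a#} = a"
  by (simp add: the_single_def)

lemma trivial_sym1:
  assumes "complex_parallelizable M"
  shows "holo_trivial M (sym_power 1 (cotangent_bundle M))"
proof -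
  define n where "n = mdim M"
  obtain \<Phi> \<Psi> where P: "bundle_hom M (cotangent_bundle M) (trivial_bundle M n) \<Phi>"
    "bundle_hom M (trivial_bundle M n) (cotangent_bundle M) \<Psi>"
    and inv: "\<forall>c\<in>atlas M. \<forall>x\<in>fst c.
        (\<forall>a\<in>I. \<forall>b\<in>I. (\<Sum>r<n. \<Psi> () c x a r * \<Phi> c () x r b) = (if a = b then 1 else 0)) \<and>
        (\<forall>r<n. \<forall>s<n. (\<Sum>a\<in>I. \<Phi> c () x r a * \<Psi> () c x a s) = (if r = s then 1 else 0))"
    using assms unfolding complex_parallelizable_def n_def [symmetric] bundle_isomorphic_trivial_iff [OF cotangent_simps(1,2)]
    by (simp only: cotangent_simps) blast
  note P = P [unfolded bundle_hom_from_trivial [OF cotangent_simps(1,2)] bundle_hom_to_trivial [OF cotangent_simps(1,2)] cotangent_simps]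
  have idx: "chart_index (sym_power 1 (cotangent_bundle M)) = atlas M" "cover (sym_power 1 (cotangent_bundle M)) = fst"
    "frame_index (sym_power 1 (cotangent_bundle M)) = (\<lambda>a. {#a#}) ` I"
    unfolding sym_power_simps sym1_index by simp_all
  have sm: "(\<Sum>\<alpha>\<in>(\<lambda>a. {#a#}) ` I. f \<alpha>) = (\<Sum>a\<in>I. f {#a#})" for f :: "'n multiset \<Rightarrow> complex"
    by (subst sum.reindex) (auto simp: inj_on_def)
  show ?thesis
    unfolding holo_trivial_def bundle_isomorphic_trivial_iff [OF idx(1,2)]
      bundle_hom_from_trivial [OF idx(1,2)] bundle_hom_to_trivial [OF idx(1,2)] idx(3) sm
    using P inv
    by (intro exI [of _ n] exI [of _ "\<lambda>c j x r \<alpha>. \<Phi> c j x r (the_single \<alpha>)"] exI [of _ "\<lambda>j c x \<alpha> r. \<Psi> j c x (the_single \<alpha>) r"])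
       (simp add: sym1_transition del: One_nat_def)
qed

end

section \<open>Plurigenera\<close>

lemma sum_fun3: "(\<Sum>a\<in>A. f a :: 'x \<Rightarrow> 'y \<Rightarrow> 'z \<Rightarrow> complex) = (\<lambda>i x b. \<Sum>a\<in>A. f a i x b)"
  by (induction A rule: infinite_finite_induct) (auto simp: fun_eq_iff)

text \<open>A finite bound on \<open>h0\<close> excludes its infinite case; the dimension is then
  that of a finite basis and bounds every independent set.\<close>

lemma h0_bounds_independent:
  assumes "h0 M E \<le> enat C" "S \<subseteq> global_sections M E" "section_space.independent S"
  shows "card S \<le> C"
proof -
  obtain B0 where B0: "finite B0" "global_sections M E \<subseteq> section_space.span B0"
    using assms(1) unfolding h0_def by (auto split: if_splits)
  then have d: "section_space.dim (global_sections M E) \<le> C"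
    using assms(1) unfolding h0_def by (auto split: if_splits)
  obtain B where B: "B \<subseteq> global_sections M E" "section_space.independent B"
    "global_sections M E \<subseteq> section_space.span B" "card B = section_space.dim (global_sections M E)"
    using section_space.basis_exists by blast
  have "finite B" using section_space.independent_span_bound [OF B0(1) B(2)] B(1) B0(2) by blast
  then have "card S \<le> card B"
    using section_space.independent_span_bound [OF _ assms(3)] assms(2) B(3) by blast
  then show ?thesis using d B(4) by simp
qed

lemma independent_family:
  fixes v :: "nat \<Rightarrow> 'i \<Rightarrow> 'a \<Rightarrow> 'b \<Rightarrow> complex"
  assumes "\<And>c. (\<lambda>i x b. \<Sum>a\<le>k. c a * v a i x b) = (\<lambda>_ _ _. 0) \<Longrightarrow> \<forall>a\<le>k. c a = 0"
  shows "inj_on v {..k}" "section_space.independent (v ` {..k})"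
proof -
  show inj: "inj_on v {..k}"
  proof (rule inj_onI, rule ccontr)
    fix a b assume ab: "a \<in> {..k}" "b \<in> {..k}" "v a = v b" "a \<noteq> b"
    define c :: "nat \<Rightarrow> complex" where "c = (\<lambda>j. (if j = a then 1 else 0) - (if j = b then 1 else 0))"
    have "(\<lambda>i x b'. \<Sum>j\<le>k. c j * v j i x b') = (\<lambda>_ _ _. 0)"
    proof (intro ext)
      fix i x b'
      have "(\<Sum>j\<le>k. c j * v j i x b') = v a i x b' - v b i x b'"
        using ab by (simp add: c_def left_diff_distrib sum_subtractf if_distrib [of "\<lambda>x. x * _"] cong: if_cong)
      then show "(\<Sum>j\<le>k. c j * v j i x b') = 0" using ab(3) by simp
    qed
    from assms [OF this] have "c a = 0" using ab by blast
    then show False using ab(4) by (simp add: c_def)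
  qed
  show "section_space.independent (v ` {..k})"
  proof
    assume "section_space.dependent (v ` {..k})"
    then obtain u where u: "\<exists>w\<in>v ` {..k}. u w \<noteq> 0"
      "(\<Sum>w\<in>v ` {..k}. (\<lambda>i x b. u w * w i x b)) = 0"
      using section_space.dependent_finite [of "v ` {..k}"] by auto
    have "(\<lambda>i x b. \<Sum>a\<le>k. u (v a) * v a i x b) = (\<lambda>_ _ _. 0)"
      using u(2) unfolding sum.reindex [OF inj] sum_fun3 by (simp add: zero_fun_def)
    from assms [OF this] u(1) show False by auto
  qed
qed

text \<open>The infimum runs over natural exponents, so it can be 0 only if the exponent 0 itself is
  admissible; otherwise every member is at least 1.\<close>

lemma kodaira_zero_bounded:
  assumes "kodaira_dimension M = 0"
  shows "\<exists>C. \<forall>m>0. plurigenus M m \<le> enat C"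
proof -
  let ?S = "{ereal (real k) |k. \<exists>C::nat. \<forall>m>0. plurigenus M m \<le> enat (C * m ^ k)}"
  have inf: "Inf ?S = 0"
    using assms unfolding kodaira_dimension_def by (auto split: if_splits)
  have "\<exists>C. \<forall>m>0. plurigenus M m \<le> enat (C * m ^ 0)"
  proof (rule ccontr)
    assume no: "\<not> ?thesis"
    have "1 \<le> Inf ?S"
    proof (rule Inf_greatest)
      fix y assume "y \<in> ?S"
      then obtain k where k: "y = ereal (real k)" "\<exists>C::nat. \<forall>m>0. plurigenus M m \<le> enat (C * m ^ k)" by blast
      then have "k \<noteq> 0" using no by metis
      then show "1 \<le> y" using k(1) by (simp add: one_ereal_def)
    qed
    then show False using inf by simp
  qed
  then show ?thesis by simp
qed

section \<open>Pluricanonical forms as functions in charts\<close>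

context cmanifold
begin

definition det_Jac :: "('a, 'n) cchart \<Rightarrow> ('a, 'n) cchart \<Rightarrow> 'a \<Rightarrow> complex" where
  "det_Jac c d x = det (xmat I (Jac c d x))"

definition kform :: "nat \<Rightarrow> (('a, 'n) cchart \<Rightarrow> 'a \<Rightarrow> complex) \<Rightarrow> bool" where
  "kform m u \<longleftrightarrow> (\<forall>c\<in>atlas M. \<forall>x\<in>fst c. hol_at (u c) x) \<and>
     (\<forall>c\<in>atlas M. \<forall>d\<in>atlas M. \<forall>x\<in>fst c \<inter> fst d. u c x = det_Jac c d x ^ m * u d x)"

text \<open>A power of a line bundle has a single frame index, the list
  \<open>replicate m ()\<close>. The zeros elsewhere are the normalization demanded of global
  sections.\<close>

definition ksec :: "nat \<Rightarrow> (('a, 'n) cchart \<Rightarrow> 'a \<Rightarrow> complex) \<Rightarrow> ('a, 'n) cchart \<Rightarrow> 'a \<Rightarrow> unit list \<Rightarrow> complex" where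
  "ksec m u = (\<lambda>c x as. if c \<in> atlas M \<and> x \<in> fst c \<and> as = replicate m () then u c x else 0)"

lemma canonical_simps [simp]:
  "chart_index (tensor_power m (canonical_bundle M)) = atlas M"
  "cover (tensor_power m (canonical_bundle M)) = fst"
  "frame_index (tensor_power m (canonical_bundle M)) = {replicate m ()}"
  by (auto simp: tensor_power_def canonical_bundle_def det_bundle_def intro!: nth_equalityI)

lemma canonical_transition:
  assumes "c \<in> atlas M" "x \<in> fst c"
  shows "transition (tensor_power m (canonical_bundle M)) c d x as bs = det_Jac c d x ^ m"
proof -
  have "transition (canonical_bundle M) c d x u v = det_Jac c d x" for u v
  proof -
    have "(\<Prod>b\<in>I. transition (cotangent_bundle M) c d x b (p b)) = (\<Prod>b\<in>I. Jac c d x b (p b))" for p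
      by (rule prod.cong) (use assms in \<open>auto simp: transition_eq_Jac\<close>)
    then show ?thesis
      unfolding det_Jac_def det_xmat by (simp add: canonical_bundle_def det_bundle_def)
  qed
  then show ?thesis by (simp add: tensor_power_def)
qed

lemma ksec_section:
  assumes "kform m u"
  shows "ksec m u \<in> global_sections M (tensor_power m (canonical_bundle M))"
  unfolding global_sections_def
proof (intro CollectI conjI ballI allI impI; (unfold canonical_simps)?)
  fix c b assume c: "c \<in> atlas M" "b \<in> {replicate m ()}"
  show "holo_fun M (fst c) (\<lambda>x. ksec m u c x b)"
    unfolding holo_fun_iff [OF chart_open [OF c(1)]]
  proof
    fix x assume x: "x \<in> fst c"
    have "hol_at (u c) x" using assms c x unfolding kform_def by blast
    then show "hol_at (\<lambda>x. ksec m u c x b) x"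
      by (rule hol_at_cong [OF _ chart_open [OF c(1)] x]) (use c in \<open>simp add: ksec_def\<close>)
  qed
next
  fix c d x a assume *: "c \<in> atlas M" "d \<in> atlas M" "x \<in> fst c \<inter> fst d" "a \<in> {replicate m ()}"
  then have "u c x = det_Jac c d x ^ m * u d x" using assms unfolding kform_def by blast
  then show "ksec m u c x a = (\<Sum>b\<in>{replicate m ()}. transition (tensor_power m (canonical_bundle M)) c d x a b * ksec m u d x b)"
    using * by (simp add: canonical_transition ksec_def)
qed (auto simp: ksec_def)

lemma section_ksec:
  assumes s: "s \<in> global_sections M (tensor_power m (canonical_bundle M))"
  shows "kform m (\<lambda>c x. s c x (replicate m ()))" "s = ksec m (\<lambda>c x. s c x (replicate m ()))"
proof -
  note s' = s [unfolded global_sections_def mem_Collect_eq canonical_simps]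
  show "kform m (\<lambda>c x. s c x (replicate m ()))"
    unfolding kform_def
  proof (intro conjI ballI)
    fix c x assume c: "c \<in> atlas M" "x \<in> fst c"
    then have "holo_fun M (fst c) (\<lambda>x. s c x (replicate m ()))" using s' by blast
    then show "hol_at (\<lambda>x. s c x (replicate m ())) x"
      using c by (simp add: holo_fun_iff chart_open)
  next
    fix c d x assume c: "c \<in> atlas M" "d \<in> atlas M" "x \<in> fst c \<inter> fst d"
    then have "s c x (replicate m ()) = (\<Sum>b\<in>{replicate m ()}.
       transition (tensor_power m (canonical_bundle M)) c d x (replicate m ()) b * s d x b)"
      using s' by blast
    then show "s c x (replicate m ()) = det_Jac c d x ^ m * s d x (replicate m ())"
      using c by (simp add: canonical_transition)
  qed
  show "s = ksec m (\<lambda>c x. s c x (replicate m ()))"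
    using s' by (auto simp: ksec_def fun_eq_iff)
qed

lemma kformD:
  assumes "kform m u" "c \<in> atlas M" "x \<in> fst c"
  shows "hol_at (u c) x" "d \<in> atlas M \<Longrightarrow> x \<in> fst d \<Longrightarrow> u c x = det_Jac c d x ^ m * u d x"
  using assms unfolding kform_def by blast+

lemma kform_mult_power:
  assumes "kform m s" "kform m t" "a \<le> k"
  shows "kform (k * m) (\<lambda>c x. s c x ^ a * t c x ^ (k - a))"
  unfolding kform_def
proof (intro conjI ballI)
  fix c x assume "c \<in> atlas M" "x \<in> fst c"
  then show "hol_at (\<lambda>x. s c x ^ a * t c x ^ (k - a)) x"
    using assms unfolding kform_def by (intro hol_at_mult hol_at_power) blast+
next
  fix c d x assume *: "c \<in> atlas M" "d \<in> atlas M" "x \<in> fst c \<inter> fst d"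
  then have "s c x = det_Jac c d x ^ m * s d x" "t c x = det_Jac c d x ^ m * t d x"
    using assms unfolding kform_def by blast+
  then have "s c x ^ a * t c x ^ (k - a) = (det_Jac c d x ^ m) ^ (a + (k - a)) * (s d x ^ a * t d x ^ (k - a))"
    by (simp add: power_mult_distrib power_add mult_ac)
  then show "s c x ^ a * t c x ^ (k - a) = det_Jac c d x ^ (k * m) * (s d x ^ a * t d x ^ (k - a))"
    using assms(3) by (simp add: mult.commute flip: power_mult)
qed

text \<open>
  If \<open>s/t\<close> were a nonconstant function near \<open>p\<close>, then the monomials \<open>s\<^sup>a t\<^sup>b\<close> with \<open>a + b = k\<close>
  would be linearly independent, and the plurigenera would be unbounded.
\<close>

lemma kform_zero_near:
  assumes kod: "kodaira_dimension M = 0" and m: "m > 0" and s: "kform m s" and t: "kform m t"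
    and c: "c \<in> atlas M" "p \<in> fst c" and sp: "s c p = 0" and tp: "t c p \<noteq> 0"
  obtains N where "openin (mtop M) N" "p \<in> N" "N \<subseteq> fst c" "\<And>y. y \<in> N \<Longrightarrow> s c y = 0"
proof -
  obtain C where C: "\<And>m. m > 0 \<Longrightarrow> plurigenus M m \<le> enat C"
    using kodaira_zero_bounded [OF kod] by blast
  \<comment> \<open>The \<open>k + 1 = C + 2\<close> monomials exceed the bound \<open>C\<close>,
    and \<open>k > 0\<close> keeps the weight \<open>k * m\<close> positive, as the bound
    requires.\<close>
  define k where "k = Suc C"
  define v where "v = (\<lambda>a. ksec (k * m) (\<lambda>c x. s c x ^ a * t c x ^ (k - a)))"
  have vin: "v a \<in> global_sections M (tensor_power (k * m) (canonical_bundle M))" if "a \<le> k" for a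
    unfolding v_def by (rule ksec_section [OF kform_mult_power [OF s t that]])
  have "\<exists>f. (\<lambda>i x b. \<Sum>a\<le>k. f a * v a i x b) = (\<lambda>_ _ _. 0) \<and> \<not> (\<forall>a\<le>k. f a = 0)"
  proof (rule ccontr)
    assume no: "\<not> ?thesis"
    then have "inj_on v {..k}" "section_space.independent (v ` {..k})"
      using independent_family [of v k] by blast+
    moreover have "h0 M (tensor_power (k * m) (canonical_bundle M)) \<le> enat C"
      using C [of "k * m"] m unfolding plurigenus_def by (simp add: k_def)
    ultimately have "card {..k} \<le> C"
      using h0_bounds_independent [of M _ C "v ` {..k}"] vin by (auto simp: card_image)
    then show False by (simp add: k_def)
  qed
  then obtain f where f0: "(\<lambda>i x b. \<Sum>a\<le>k. f a * v a i x b) = (\<lambda>_ _ _. 0)" and f: "\<exists>a\<le>k. f a \<noteq> 0" by blast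
  have rel: "(\<Sum>a\<le>k. f a * (s c y ^ a * t c y ^ (k - a))) = 0" if "y \<in> fst c" for y
    using fun_cong [OF fun_cong [OF fun_cong [OF f0, of c], of y], of "replicate (k * m) ()"] that c
    by (simp add: v_def ksec_def)
  have hs: "hol_at (s c) y" "hol_at (t c) y" if "y \<in> fst c" for y
    using s t c that unfolding kform_def by blast+
  have T: "open (- {0::complex})" "t c p \<in> - {0}" using tp by auto
  obtain N0 where N0: "openin (mtop M) N0" "p \<in> N0" "N0 \<subseteq> fst c" "t c ` N0 \<subseteq> - {0}"
    by (rule hol_at_nbhd [OF hs(2) [OF c(2)] chart_open [OF c(1)] c(2) T])
  obtain r where r: "r > 0" "ball (snd c p) r \<subseteq> cdom c N0" using coord_ball [OF c N0(1,2)] .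
  note cb = cball_at [OF c r]
  let ?N = "cball_at c p r"
  have tn: "t c y \<noteq> 0" if "y \<in> ?N" for y using that cb(3) N0(4) by blast
  define g where "g = (\<lambda>y. s c y / t c y)"
  have hg: "hol_at g y" if "y \<in> ?N" for y
    unfolding g_def using that cb(4) by (intro hol_at_divide hs tn) auto
  \<comment> \<open>Dividing the relation by \<open>t ^ k\<close> shows that all values of the
    quotient \<open>g\<close> are roots of one fixed nonzero polynomial; on a connected ball
    \<open>g\<close> is then constant.\<close>
  have "g ` ?N \<subseteq> {z. (\<Sum>a\<le>k. f a * z ^ a) = 0}"
  proof safe
    fix y assume y: "y \<in> ?N"
    have "s c y ^ a * t c y ^ (k - a) = g y ^ a * t c y ^ k" if "a \<le> k" for a
    proof -
      have "t c y ^ k = t c y ^ a * t c y ^ (k - a)" using that by (simp flip: power_add)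
      then show ?thesis using tn [OF y] by (simp add: g_def power_divide)
    qed
    then have "(\<Sum>a\<le>k. f a * g y ^ a) * t c y ^ k = 0"
      using rel [of y] y cb(4) by (auto simp: sum_distrib_right mult.assoc intro!: sum.cong)
    then show "(\<Sum>a\<le>k. f a * g y ^ a) = 0" using tn [OF y] by simp
  qed
  moreover have "finite {z. (\<Sum>a\<le>k. f a * z ^ a) = 0}"
    using polyfun_finite_roots [of f k] f by blast
  ultimately have fin: "finite (g ` ?N)" by (rule finite_subset)
  have "connectedin (subtopology (mtop M) ?N) ?N" using cb(5) by (simp add: connectedin_subtopology)
  then have "connectedin euclidean (g ` ?N)"
    using connectedin_continuous_map_image [OF hol_continuous_map [OF hg cb(1)]] by blast
  then have "connected (g ` ?N)" by simp
  then obtain b where b: "g ` ?N = {b}"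
    using connected_finite_iff_sing fin cb(2) by blast
  have "g p = 0" by (simp add: g_def sp)
  then have "b = 0" using b cb(2) by auto
  have "s c y = 0" if "y \<in> ?N" for y
  proof -
    have "g y \<in> g ` ?N" using that by (rule imageI)
    then have "g y = 0" using b \<open>b = 0\<close> by simp
    then show ?thesis using tn [OF that] by (simp add: g_def)
  qed
  then show ?thesis using that cb by blast
qed

section \<open>Kodaira dimension of a parallelizable manifold\<close>

definition edet :: "('n \<Rightarrow> ('a, 'n) cchart \<Rightarrow> 'a \<Rightarrow> 'n \<Rightarrow> complex) \<Rightarrow> ('a, 'n) cchart \<Rightarrow> 'a \<Rightarrow> complex" where
  "edet e c x = det (xmat I (\<lambda>k a. e k c x a))"

lemma frame_edet:
  assumes e: "frame_on X e"
  shows "kform 1 (edet e)" "c \<in> atlas M \<Longrightarrow> x \<in> fst c \<Longrightarrow> edet e c x \<noteq> 0"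
proof -
  show "c \<in> atlas M \<Longrightarrow> x \<in> fst c \<Longrightarrow> edet e c x \<noteq> 0"
    using e chart_sub unfolding frame_on_def edet_def by blast
  show "kform 1 (edet e)"
    unfolding kform_def
  proof (intro conjI ballI)
    fix c x assume c: "c \<in> atlas M" "x \<in> fst c"
    show "hol_at (edet e c) x"
      unfolding edet_def
      by (rule hol_at_det_xmat) (use e c chart_sub in \<open>unfold frame_on_def cov_section_def, blast\<close>)
  next
    fix c d x assume *: "c \<in> atlas M" "d \<in> atlas M" "x \<in> fst c \<inter> fst d"
    have tr: "e k c x a = (\<Sum>b\<in>I. Jac c d x a b * e k d x b)" if "k \<in> I" "a \<in> I" for k a
      using e * that chart_sub unfolding frame_on_def cov_section_def by blast
    have "xmat I (\<lambda>k a. e k c x a) = xmat I (\<lambda>k b. e k d x b) ** transpose (xmat I (Jac c d x))"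
      unfolding xmat_transpose xmat_mult by (rule xmat_cong) (simp add: tr mult.commute)
    then show "edet e c x = det_Jac c d x ^ 1 * edet e d x"
      unfolding edet_def det_Jac_def by (simp add: det_mul)
  qed
qed

lemma finite_components:
  assumes "compact_space (mtop M)"
  shows "finite (comp_of ` X)"
proof -
  have "\<forall>U\<in>comp_of ` X. openin (mtop M) U" using comp_of_open by auto
  moreover have "X \<subseteq> \<Union>(comp_of ` X)" using comp_of_self by auto
  ultimately obtain F where F: "finite F" "F \<subseteq> comp_of ` X" "X \<subseteq> \<Union>F"
    using assms unfolding compact_space_def compactin_def by meson
  have "comp_of ` X \<subseteq> F"
  proof safe
    fix x assume "x \<in> X"
    then obtain q where q: "q \<in> F" "x \<in> q" using F(3) by blast
    then obtain y where "q = comp_of y" using F(2) by blast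
    then show "comp_of x \<in> F" using q comp_of_eq [of x y] by simp
  qed
  then show ?thesis using F finite_subset by blast
qed

text \<open>Division by the \<open>m\<close>-th power of the nowhere vanishing determinant
  \<open>\<delta>\<close> turns an \<open>m\<close>-canonical form into a function, constant on each
  component. So the restrictions of \<open>\<delta> ^ m\<close> to the finitely many components
  span, with a bound independent of \<open>m\<close>.\<close>

lemma frame_plurigenus:
  assumes cpt: "compact_space (mtop M)" and e: "frame_on X e"
  shows "\<exists>B. finite B \<and> card B \<le> card (comp_of ` X) \<and>
     global_sections M (tensor_power m (canonical_bundle M)) \<subseteq> section_space.span B"
proof -
  note ed = frame_edet [OF e]
  define \<delta> where "\<delta> = edet e"
  have \<delta>: "\<And>c x. c \<in> atlas M \<Longrightarrow> x \<in> fst c \<Longrightarrow> hol_at (\<delta> c) x"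
    "\<And>c d x. c \<in> atlas M \<Longrightarrow> d \<in> atlas M \<Longrightarrow> x \<in> fst c \<Longrightarrow> x \<in> fst d \<Longrightarrow> \<delta> c x = det_Jac c d x * \<delta> d x"
    "\<And>c x. c \<in> atlas M \<Longrightarrow> x \<in> fst c \<Longrightarrow> \<delta> c x \<noteq> 0"
    using kformD [OF ed(1)] ed(2) unfolding \<delta>_def power_one_right by blast+
  define b where "b = (\<lambda>q. ksec m (\<lambda>c x. if x \<in> q then \<delta> c x ^ m else 0))"
  let ?Q = "comp_of ` X"
  note finQ = finite_components [OF cpt]
  have "s \<in> section_space.span (b ` ?Q)"
    if s: "s \<in> global_sections M (tensor_power m (canonical_bundle M))" for s
  proof -
    define u where "u = (\<lambda>c x. s c x (replicate m ()))"
    have u: "\<And>c x. c \<in> atlas M \<Longrightarrow> x \<in> fst c \<Longrightarrow> hol_at (u c) x"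
      "\<And>c d x. c \<in> atlas M \<Longrightarrow> d \<in> atlas M \<Longrightarrow> x \<in> fst c \<Longrightarrow> x \<in> fst d \<Longrightarrow> u c x = det_Jac c d x ^ m * u d x"
      using kformD [OF section_ksec(1) [OF s]] unfolding u_def by blast+
    have su: "s = ksec m u" using section_ksec(2) [OF s] unfolding u_def .
    define ch where "ch = (\<lambda>x. SOME c. c \<in> atlas M \<and> x \<in> fst c)"
    have ch: "ch x \<in> atlas M" "x \<in> fst (ch x)" if "x \<in> X" for x
      using someI_ex [of "\<lambda>c. c \<in> atlas M \<and> x \<in> fst c"] chart_at [OF that] unfolding ch_def by blast+
    define g where "g = (\<lambda>x. u (ch x) x / \<delta> (ch x) x ^ m)"
    have g: "g x = u c x / \<delta> c x ^ m" if "c \<in> atlas M" "x \<in> fst c" for c x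
    proof -
      have x: "x \<in> X" using that chart_sub by blast
      have "det_Jac (ch x) c x \<noteq> 0" using \<delta>(2) [OF ch(1) [OF x] that(1) ch(2) [OF x] that(2)] \<delta>(3) [OF ch [OF x]] by auto
      then show ?thesis
        unfolding g_def \<delta>(2) [OF ch(1) [OF x] that(1) ch(2) [OF x] that(2)] u(2) [OF ch(1) [OF x] that(1) ch(2) [OF x] that(2)]
        by (simp add: power_mult_distrib)
    qed
    have hg: "hol_at g x" if "x \<in> X" for x
    proof -
      note c = ch [OF that]
      have "hol_at (\<lambda>y. u (ch x) y / \<delta> (ch x) y ^ m) x"
        by (intro hol_at_divide hol_at_power u \<delta> c) (use \<delta>(3) [OF c] in simp)
      then show ?thesis by (rule hol_at_cong [OF _ chart_open [OF c(1)] c(2)]) (simp add: g [OF c(1)])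
    qed
    define l where "l = (\<lambda>q. g (SOME x. x \<in> q))"
    have l: "g x = l (comp_of x)" if "x \<in> X" for x
      unfolding l_def using hol_const [OF cpt, of x g x "SOME y. y \<in> comp_of x"] hg comp_of_sub comp_of_self [OF that]
      by (metis someI_ex subsetD)
    have "s = (\<Sum>q\<in>?Q. (\<lambda>i x a. l q * b q i x a))"
      unfolding sum_fun3
    proof (intro ext)
      fix c x as
      show "s c x as = (\<Sum>q\<in>?Q. l q * b q c x as)"
      proof (cases "c \<in> atlas M \<and> x \<in> fst c \<and> as = replicate m ()")
        case True
        then have x: "x \<in> X" using chart_sub by blast
        have "(\<Sum>q\<in>?Q. l q * b q c x as) = (\<Sum>q\<in>{comp_of x}. l q * b q c x as)"
        proof (rule sum.mono_neutral_right [OF finQ])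
          show "\<forall>q\<in>?Q - {comp_of x}. l q * b q c x as = 0"
            using comp_of_eq by (auto simp: b_def ksec_def)
        qed (use x in auto)
        also have "\<dots> = g x * \<delta> c x ^ m"
          using True x by (simp add: l b_def ksec_def comp_of_self)
        also have "\<dots> = u c x" using True \<delta>(3) [of c x] by (simp add: g [of c x])
        finally show ?thesis using True by (simp add: u_def)
      next
        case False
        then have "\<And>q. b q c x as = 0" by (auto simp: b_def ksec_def)
        moreover have "s c x as = 0" using False unfolding su ksec_def by auto
        ultimately show ?thesis by simp
      qed
    qed
    also have "\<dots> \<in> section_space.span (b ` ?Q)"
      by (intro section_space.span_sum section_space.span_scale section_space.span_base) auto
    finally show ?thesis .
  qed
  then show ?thesis using finQ card_image_le [OF finQ, of b] by (intro exI [of _ "b ` ?Q"]) auto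
qed

text \<open>The number of components bounds all plurigenera, which makes the exponent 0 admissible.
  The determinant of the frame shows that the first plurigenus is nonzero, where
  \<open>X \<noteq> {}\<close> enters.\<close>

lemma kodaira_zero_if_frame:
  assumes cpt: "compact_space (mtop M)" and ne: "X \<noteq> {}" and e: "frame_on X e"
  shows "kodaira_dimension M = 0"
proof -
  have dimB: "\<exists>B. finite B \<and> B \<subseteq> GS \<and> GS \<subseteq> section_space.span B \<and> plurigenus M m = enat (card B)
        \<and> card B \<le> card (comp_of ` X)"
    if GS: "GS = global_sections M (tensor_power m (canonical_bundle M))" for m GS
  proof -
    obtain B0 where B0: "finite B0" "card B0 \<le> card (comp_of ` X)" "GS \<subseteq> section_space.span B0"
      using frame_plurigenus [OF cpt e, of m] GS by blast
    obtain B where B: "B \<subseteq> GS" "section_space.independent B"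
      "GS \<subseteq> section_space.span B" "card B = section_space.dim GS"
      using section_space.basis_exists by blast
    have "finite B" "card B \<le> card B0"
      using section_space.independent_span_bound [OF B0(1) B(2)] B(1) B0(3) by blast+
    moreover have "plurigenus M m = enat (card B)"
      unfolding plurigenus_def h0_def using B0 B GS by auto
    ultimately show ?thesis using B B0 by (intro exI [of _ B]) auto
  qed
  have "plurigenus M 1 \<noteq> 0"
  proof
    assume 0: "plurigenus M 1 = 0"
    obtain B where "finite B" "plurigenus M 1 = enat (card B)"
      "global_sections M (tensor_power 1 (canonical_bundle M)) \<subseteq> section_space.span B"
      using dimB [OF refl, of 1] by blast
    then have "global_sections M (tensor_power 1 (canonical_bundle M)) \<subseteq> {0}"
      using 0 by (auto simp: zero_enat_def)
    then have z: "ksec 1 (edet e) = 0"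
      using ksec_section [OF frame_edet(1) [OF e]] by blast
    obtain x where "x \<in> X" using ne by blast
    then obtain c where c: "c \<in> atlas M" "x \<in> fst c" using chart_at by blast
    have "ksec 1 (edet e) c x (replicate 1 ()) = 0" using z by simp
    then show False using frame_edet(2) [OF e c] c by (simp add: ksec_def)
  qed
  then have "\<not> (\<forall>m>0. plurigenus M m = 0)" by auto
  moreover have "Inf {ereal (real k) |k. \<exists>C::nat. \<forall>m>0. plurigenus M m \<le> enat (C * m ^ k)} = 0" (is "Inf ?S = 0")
  proof (rule antisym)
    have "plurigenus M m \<le> enat (card (comp_of ` X))" for m
      using dimB [OF refl, of m] by auto
    then have "\<exists>C::nat. \<forall>m>0. plurigenus M m \<le> enat (C * m ^ 0)"
      by (intro exI [of _ "card (comp_of ` X)"]) simp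
    then have "ereal (real 0) \<in> ?S" by blast
    then show "Inf ?S \<le> 0" by (simp add: Inf_lower zero_ereal_def)
    show "0 \<le> Inf ?S" by (rule Inf_greatest) auto
  qed
  ultimately show ?thesis unfolding kodaira_dimension_def by (simp del: not_all)
qed

end

section \<open>Frames determined up to a root of unity\<close>

text \<open>
  \<open>Fr x\<close> consists of the values at \<open>x\<close> of a frame of the cotangent bundle that is only determined up
  to a common \<open>m\<close>-th root of unity: \<open>e k c a\<close> is the component along \<open>dz\<^sub>a\<close>, in the chart \<open>c\<close>, of the
  \<open>k\<close>-th covector of the frame \<open>e\<close>.
\<close>

type_synonym ('a, 'n) coframe = "'n \<Rightarrow> ('a, 'n) cchart \<Rightarrow> 'n \<Rightarrow> complex"

definition zmul :: "complex \<Rightarrow> ('a, 'n) coframe \<Rightarrow> ('a, 'n) coframe" where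
  "zmul z e = (\<lambda>k c a. z * e k c a)"

lemma zmul_apply [simp]: "zmul z e k c a = z * e k c a"
  unfolding zmul_def by (rule refl)

lemma zmul_1 [simp]: "zmul 1 e = e"
  by (intro ext) simp

lemma zmul_zmul [simp]: "zmul z (zmul w e) = zmul (z * w) e"
  by (intro ext) simp

text \<open>In topological terms, the sets \<open>Fr x\<close> form a principal covering of the
  component with group the \<open>m\<close>-th roots of unity: \<open>Fr_scale\<close> and
  \<open>Fr_unique\<close> give transitive fibres, \<open>Fr_branch\<close> the local sections.
  Positive dimension (\<open>I_ne\<close>) makes the action free.\<close>

locale multiframe = cmanifold M for M :: "('a, 'n::finite) manifold_data" +
  fixes p :: 'a and m :: nat and Fr :: "'a \<Rightarrow> ('a, 'n) coframe set"
  assumes cpt: "compact_space (mtop M)"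
    and pX: "p \<in> X"
    and m_pos: "m > 0"
    and I_ne: "I \<noteq> {}"
    and Fr_ne: "x \<in> comp_of p \<Longrightarrow> Fr x \<noteq> {}"
    and Fr_scale: "x \<in> comp_of p \<Longrightarrow> e \<in> Fr x \<Longrightarrow> z ^ m = 1 \<Longrightarrow> zmul z e \<in> Fr x"
    and Fr_unique: "x \<in> comp_of p \<Longrightarrow> e \<in> Fr x \<Longrightarrow> e' \<in> Fr x \<Longrightarrow> \<exists>z. z ^ m = 1 \<and> e' = zmul z e"
    and Fr_change: "x \<in> comp_of p \<Longrightarrow> e \<in> Fr x \<Longrightarrow> c \<in> atlas M \<Longrightarrow> d \<in> atlas M \<Longrightarrow>
        x \<in> fst c \<Longrightarrow> x \<in> fst d \<Longrightarrow> k \<in> I \<Longrightarrow> a \<in> I \<Longrightarrow> e k c a = (\<Sum>b\<in>I. Jac c d x a b * e k d b)"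
    and Fr_det: "x \<in> comp_of p \<Longrightarrow> e \<in> Fr x \<Longrightarrow> c \<in> atlas M \<Longrightarrow> x \<in> fst c \<Longrightarrow> det (xmat I (\<lambda>k a. e k c a)) \<noteq> 0"
    and Fr_branch: "x \<in> comp_of p \<Longrightarrow> e \<in> Fr x \<Longrightarrow> \<exists>N E. openin (mtop M) N \<and> x \<in> N \<and> N \<subseteq> comp_of p \<and> E x = e \<and>
        (\<forall>y\<in>N. E y \<in> Fr y) \<and>
        (\<forall>c\<in>atlas M. \<forall>y\<in>N \<inter> fst c. \<forall>k\<in>I. \<forall>a\<in>I. hol_at (\<lambda>y. E y k c a) y)"
begin

abbreviation "Q \<equiv> comp_of p"

definition branch :: "'a set \<Rightarrow> ('a \<Rightarrow> ('a, 'n) coframe) \<Rightarrow> bool" where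
  "branch N E \<longleftrightarrow> openin (mtop M) N \<and> N \<subseteq> Q \<and> (\<forall>y\<in>N. E y \<in> Fr y) \<and>
     (\<forall>c\<in>atlas M. \<forall>y\<in>N \<inter> fst c. \<forall>k\<in>I. \<forall>a\<in>I. hol_at (\<lambda>y. E y k c a) y)"

lemma branchD:
  assumes "branch N E"
  shows "openin (mtop M) N" "N \<subseteq> Q" "y \<in> N \<Longrightarrow> y \<in> Q" "y \<in> N \<Longrightarrow> E y \<in> Fr y"
    "c \<in> atlas M \<Longrightarrow> y \<in> N \<Longrightarrow> y \<in> fst c \<Longrightarrow> k \<in> I \<Longrightarrow> a \<in> I \<Longrightarrow> hol_at (\<lambda>y. E y k c a) y"
  using assms unfolding branch_def by blast+

lemma branch_subset: "branch N E \<Longrightarrow> openin (mtop M) N' \<Longrightarrow> N' \<subseteq> N \<Longrightarrow> branch N' E"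
  unfolding branch_def by blast

lemma branch_at:
  assumes "x \<in> Q" "e \<in> Fr x"
  obtains N E where "branch N E" "x \<in> N" "E x = e"
  using Fr_branch [OF assms] unfolding branch_def by blast

lemma branch_scale:
  assumes "branch N E" "z ^ m = 1"
  shows "branch N (\<lambda>y. zmul z (E y))"
  using assms Fr_scale unfolding branch_def by (auto simp: zmul_def intro!: hol_at_mult)

lemma Fr_nonzero:
  assumes "x \<in> Q" "e \<in> Fr x" "c \<in> atlas M" "x \<in> fst c"
  obtains k a where "k \<in> I" "a \<in> I" "e k c a \<noteq> 0"
proof -
  obtain k0 where k0: "k0 \<in> I" using I_ne by auto
  have "\<exists>k\<in>I. \<exists>a\<in>I. e k c a \<noteq> 0"
  proof (rule ccontr)
    assume "\<not> ?thesis"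
    then have "\<forall>a\<in>I. (\<Sum>k\<in>I. 1 * e k c a) = 0" by simp
    moreover have "\<forall>t. (\<forall>a\<in>I. (\<Sum>k\<in>I. t k * e k c a) = 0) \<longrightarrow> (\<forall>k\<in>I. t k = 0)"
      using Fr_det [OF assms] unfolding det_xmat_nonzero_iff .
    ultimately have "\<forall>k\<in>I. (1::complex) = 0"
      by (elim allE [of _ "\<lambda>_. 1"]) blast
    with k0 show False by auto
  qed
  then show ?thesis using that by blast
qed

lemma zmul_free:
  assumes "x \<in> Q" "e \<in> Fr x" "zmul z e = e"
  shows "z = 1"
proof -
  obtain c where c: "c \<in> atlas M" "x \<in> fst c" using chart_at comp_of_sub assms(1) by blast
  obtain k a where "e k c a \<noteq> 0" using Fr_nonzero [OF assms(1,2) c] by blast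
  moreover have "z * e k c a = e k c a" using assms(3) zmul_apply by metis
  ultimately show ?thesis by simp
qed

lemma roots_finite: "finite {z::complex. z ^ m = 1}"
  using finite_nth_roots [OF m_pos, of 1] .

text \<open>Near \<open>x\<close> the quotient of a nonvanishing component of the two branches is
  holomorphic with values in the finite set of roots of unity. It is 1 at \<open>x\<close>, hence 1
  nearby.\<close>

lemma branch_unique:
  assumes E: "branch N E" "x \<in> N" and E': "branch N' E'" "x \<in> N'" and eq: "E x = E' x"
  obtains N0 where "openin (mtop M) N0" "x \<in> N0" "N0 \<subseteq> N \<inter> N'" "\<And>y. y \<in> N0 \<Longrightarrow> E' y = E y"
proof -
  note b = branchD [OF E(1)] and b' = branchD [OF E'(1)]
  obtain c where c: "c \<in> atlas M" "x \<in> fst c" using chart_at comp_of_sub b(2) E(2) by blast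
  obtain k a where ka: "k \<in> I" "a \<in> I" "E x k c a \<noteq> 0"
    using Fr_nonzero [OF b(3) [OF E(2)] b(4) [OF E(2)] c] .
  let ?W = "N \<inter> N' \<inter> fst c"
  have W: "openin (mtop M) ?W" "x \<in> ?W" using openin_Int [OF openin_Int [OF b(1) b'(1)] chart_open [OF c(1)]] c E(2) E'(2) by simp_all
  have T: "open (- {0::complex})" "E x k c a \<in> - {0}" using ka by auto
  obtain N1 where N1: "openin (mtop M) N1" "x \<in> N1" "N1 \<subseteq> ?W" "(\<lambda>y. E y k c a) ` N1 \<subseteq> - {0}"
    using hol_at_nbhd [OF b(5) [OF c(1) E(2) c(2) ka(1,2)] W T] by blast
  have nz: "E y k c a \<noteq> 0" if "y \<in> N1" for y using N1(4) that by blast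
  define \<rho> where "\<rho> = (\<lambda>y. E' y k c a / E y k c a)"
  have h\<rho>: "hol_at \<rho> y" if "y \<in> N1" for y
    unfolding \<rho>_def using that N1(3) c ka nz by (intro hol_at_divide b(5) b'(5)) auto
  let ?T = "- ({z. z ^ m = 1} - {1::complex})"
  have T': "open ?T" by (intro open_Compl finite_imp_closed finite_Diff roots_finite)
  have "\<rho> x = 1" using ka eq by (simp add: \<rho>_def)
  then have \<rho>x: "\<rho> x \<in> ?T" by simp
  obtain N2 where N2: "openin (mtop M) N2" "x \<in> N2" "N2 \<subseteq> N1" "\<rho> ` N2 \<subseteq> ?T"
    using hol_at_nbhd [OF h\<rho> [OF N1(2)] N1(1,2) T' \<rho>x] by blast
  have "E' y = E y" if y: "y \<in> N2" for y
  proof -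
    have y': "y \<in> N1" "y \<in> N" "y \<in> N'" using y N2 N1 by auto
    obtain z where z: "z ^ m = 1" "E' y = zmul z (E y)"
      using Fr_unique [OF b(3) b(4) b'(4)] y' by blast
    have "\<rho> y = z" using z(2) nz [OF y'(1)] by (simp add: \<rho>_def)
    then have "z = 1" using N2(4) y z(1) by blast
    then show ?thesis using z(2) by simp
  qed
  then show ?thesis using that [of N2] N2 N1 by blast
qed

subsection \<open>Structure constants\<close>

definition ext_deriv :: "('a \<Rightarrow> ('a, 'n) coframe) \<Rightarrow> ('a, 'n) cchart \<Rightarrow> 'a \<Rightarrow> 'n \<Rightarrow> 'n \<Rightarrow> 'n \<Rightarrow> complex" where
  "ext_deriv E c x k a b = mgrad (\<lambda>y. E y k c b) c x a - mgrad (\<lambda>y. E y k c a) c x b"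

text \<open>The derivative of the Jacobian produces second derivatives of the coordinate change;
  they are symmetric in \<open>a\<close> and \<open>b\<close> and cancel in the
  antisymmetrization.\<close>

lemma ext_deriv_change:
  assumes E: "branch N E" "x \<in> N" and c: "c \<in> atlas M" "x \<in> fst c" and d: "d \<in> atlas M" "x \<in> fst d"
    and k: "k \<in> I" and ab: "a \<in> I" "b \<in> I"
  shows "ext_deriv E c x k a b = (\<Sum>\<alpha>\<in>I. \<Sum>\<beta>\<in>I. Jac c d x a \<alpha> * Jac c d x b \<beta> * ext_deriv E d x k \<alpha> \<beta>)"
proof -
  note br = branchD [OF E(1)]
  have W: "openin (mtop M) (N \<inter> fst c \<inter> fst d)" "x \<in> N \<inter> fst c \<inter> fst d"
    using openin_Int [OF openin_Int [OF br(1) chart_open [OF c(1)]] chart_open [OF d(1)]] c d E(2) by simp_all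
  have hE: "hol_at (\<lambda>y. E y k d \<beta>) x" if "\<beta> \<in> I" for \<beta>
    by (rule br(5) [OF d(1) E(2) d(2) k that])
  have J2: "mgrad (\<lambda>y. Jac c d y b \<beta>) c x a = mgrad (\<lambda>y. Jac c d y a \<beta>) c x b" for a b \<beta>
    unfolding Jac_def
    by (rule mgrad_mgrad_commute [OF c chart_open [OF d(1)] d(2) hol_at_coord [OF d(1)]])
  have g: "mgrad (\<lambda>y. E y k c b) c x a =
      (\<Sum>\<beta>\<in>I. E x k d \<beta> * mgrad (\<lambda>y. Jac c d y b \<beta>) c x a) +
      (\<Sum>\<alpha>\<in>I. \<Sum>\<beta>\<in>I. Jac c d x a \<alpha> * Jac c d x b \<beta> * mgrad (\<lambda>y. E y k d \<beta>) d x \<alpha>)"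
    if ab: "a \<in> I" "b \<in> I" for a b
  proof -
    have "mgrad (\<lambda>y. E y k c b) c x a = mgrad (\<lambda>y. \<Sum>\<beta>\<in>I. Jac c d y b \<beta> * E y k d \<beta>) c x a"
    proof (rule fun_cong [OF mgrad_cong [OF _ W _ c]])
      show "hol_at (\<lambda>y. \<Sum>\<beta>\<in>I. Jac c d y b \<beta> * E y k d \<beta>) x"
        by (intro hol_at_sum hol_at_mult hol_at_Jac c d hE)
      show "(\<Sum>\<beta>\<in>I. Jac c d y b \<beta> * E y k d \<beta>) = E y k c b" if "y \<in> N \<inter> fst c \<inter> fst d" for y
        by (rule Fr_change [OF br(3) br(4) c(1) d(1) _ _ k ab(2), symmetric]) (use that in simp_all)
    qed
    also have "\<dots> = (\<Sum>\<beta>\<in>I. mgrad (\<lambda>y. Jac c d y b \<beta> * E y k d \<beta>) c x a)"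
      by (intro mgrad_sum hol_at_mult hol_at_Jac c d hE)
    also have "\<dots> = (\<Sum>\<beta>\<in>I. Jac c d x b \<beta> * mgrad (\<lambda>y. E y k d \<beta>) c x a +
        mgrad (\<lambda>y. Jac c d y b \<beta>) c x a * E x k d \<beta>)"
      by (rule sum.cong) (simp_all add: mgrad_mult hol_at_Jac c d hE)
    also have "\<dots> = (\<Sum>\<beta>\<in>I. E x k d \<beta> * mgrad (\<lambda>y. Jac c d y b \<beta>) c x a) +
        (\<Sum>\<beta>\<in>I. Jac c d x b \<beta> * mgrad (\<lambda>y. E y k d \<beta>) c x a)"
      by (simp add: sum.distrib mult.commute add.commute)
    also have "(\<Sum>\<beta>\<in>I. Jac c d x b \<beta> * mgrad (\<lambda>y. E y k d \<beta>) c x a) =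
        (\<Sum>\<beta>\<in>I. \<Sum>\<alpha>\<in>I. Jac c d x a \<alpha> * Jac c d x b \<beta> * mgrad (\<lambda>y. E y k d \<beta>) d x \<alpha>)"
      by (rule sum.cong) (simp_all add: mgrad_change [OF hE c d] sum_distrib_left mult_ac)
    also have "\<dots> = (\<Sum>\<alpha>\<in>I. \<Sum>\<beta>\<in>I. Jac c d x a \<alpha> * Jac c d x b \<beta> * mgrad (\<lambda>y. E y k d \<beta>) d x \<alpha>)"
      by (rule sum.swap)
    finally show ?thesis .
  qed
  have sw: "(\<Sum>\<alpha>\<in>I. \<Sum>\<beta>\<in>I. Jac c d x b \<alpha> * Jac c d x a \<beta> * mgrad (\<lambda>y. E y k d \<beta>) d x \<alpha>) =
      (\<Sum>\<alpha>\<in>I. \<Sum>\<beta>\<in>I. Jac c d x a \<alpha> * Jac c d x b \<beta> * mgrad (\<lambda>y. E y k d \<alpha>) d x \<beta>)"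
    by (subst sum.swap) (simp add: mult_ac)
  show ?thesis
    unfolding ext_deriv_def g [OF ab] g [OF ab(2,1)] sw J2 [of b _ a]
    by (simp add: algebra_simps sum_subtractf)
qed

text \<open>\<open>d e\<^sub>k = (\<Sum>q r. C\<^bsub>kqr\<^esub> e\<^sub>q \<and> e\<^sub>r) / 2\<close> for the frame \<open>e\<close> given by \<open>E\<close>.\<close>

definition struct_const :: "('a, 'n) cchart \<Rightarrow> ('a \<Rightarrow> ('a, 'n) coframe) \<Rightarrow> 'a \<Rightarrow> 'n \<Rightarrow> 'n \<Rightarrow> 'n \<Rightarrow> complex" where
  "struct_const c E x k q r = (\<Sum>a\<in>I. \<Sum>b\<in>I. ext_deriv E c x k a b *
      minv I (\<lambda>k a. E x k c a) a q * minv I (\<lambda>k a. E x k c a) b r)"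

lemma struct_const_spec:
  assumes E: "branch N E" "x \<in> N" and c: "c \<in> atlas M" "x \<in> fst c" and ab: "a \<in> I" "b \<in> I"
  shows "ext_deriv E c x k a b = (\<Sum>q\<in>I. \<Sum>r\<in>I. struct_const c E x k q r * E x q c a * E x r c b)"
proof -
  note br = branchD [OF E(1)]
  define V where "V = minv I (\<lambda>k a. E x k c a)"
  have V: "(\<Sum>l\<in>I. V i l * E x l c j) = (if i = j then 1 else 0)" if "i \<in> I" "j \<in> I" for i j
    unfolding V_def using minv(2) [OF Fr_det [OF br(3) br(4) c] that] E(2) by simp
  have "(\<Sum>q\<in>I. \<Sum>r\<in>I. struct_const c E x k q r * E x q c a * E x r c b)
      = (\<Sum>q\<in>I. \<Sum>r\<in>I. \<Sum>\<alpha>\<in>I. \<Sum>\<beta>\<in>I. ext_deriv E c x k \<alpha> \<beta> * (V \<alpha> q * E x q c a) * (V \<beta> r * E x r c b))"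
    by (simp add: struct_const_def V_def sum_distrib_right sum_distrib_left mult_ac)
  also have "\<dots> = (\<Sum>q\<in>I. \<Sum>\<alpha>\<in>I. \<Sum>r\<in>I. \<Sum>\<beta>\<in>I. ext_deriv E c x k \<alpha> \<beta> * (V \<alpha> q * E x q c a) * (V \<beta> r * E x r c b))"
    by (rule sum.cong [OF refl], rule sum.swap)
  also have "\<dots> = (\<Sum>\<alpha>\<in>I. \<Sum>q\<in>I. \<Sum>r\<in>I. \<Sum>\<beta>\<in>I. ext_deriv E c x k \<alpha> \<beta> * (V \<alpha> q * E x q c a) * (V \<beta> r * E x r c b))"
    by (rule sum.swap)
  also have "\<dots> = (\<Sum>\<alpha>\<in>I. \<Sum>q\<in>I. \<Sum>\<beta>\<in>I. \<Sum>r\<in>I. ext_deriv E c x k \<alpha> \<beta> * (V \<alpha> q * E x q c a) * (V \<beta> r * E x r c b))"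
    by (rule sum.cong [OF refl], rule sum.cong [OF refl], rule sum.swap)
  also have "\<dots> = (\<Sum>\<alpha>\<in>I. \<Sum>q\<in>I. \<Sum>\<beta>\<in>I. ext_deriv E c x k \<alpha> \<beta> * (V \<alpha> q * E x q c a) * (if \<beta> = b then 1 else 0))"
    by (intro sum.cong refl) (simp add: V ab flip: sum_distrib_left)
  also have "\<dots> = (\<Sum>\<alpha>\<in>I. \<Sum>q\<in>I. ext_deriv E c x k \<alpha> b * (V \<alpha> q * E x q c a))"
    using ab by (simp add: sum_delta_mult)
  also have "\<dots> = (\<Sum>\<alpha>\<in>I. ext_deriv E c x k \<alpha> b * (if \<alpha> = a then 1 else 0))"
    by (intro sum.cong refl) (simp add: V ab flip: sum_distrib_left)
  also have "\<dots> = ext_deriv E c x k a b" using ab by (simp add: sum_delta_mult)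
  finally show ?thesis by simp
qed

text \<open>The products \<open>A q a * A r b\<close> are linearly independent; nondegeneracy of
  \<open>A\<close> is applied to one slot after the other. Structure constants are thereby compared
  through the equation they satisfy instead of through inverse matrices.\<close>

lemma bilinear_unique:
  assumes det: "det (xmat I A) \<noteq> 0"
    and eq: "\<And>a b. a \<in> I \<Longrightarrow> b \<in> I \<Longrightarrow>
       (\<Sum>q\<in>I. \<Sum>r\<in>I. C q r * A q a * A r b) = (\<Sum>q\<in>I. \<Sum>r\<in>I. C' q r * A q a * A r b)"
    and "q \<in> I" "r \<in> I"
  shows "C q r = C' q r"
proof -
  have ker: "\<And>t. (\<And>a. a \<in> I \<Longrightarrow> (\<Sum>k\<in>I. t k * A k a) = 0) \<Longrightarrow> \<forall>k\<in>I. t k = 0"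
    using det unfolding det_xmat_nonzero_iff by blast
  define D where "D = (\<lambda>q r. C q r - C' q r)"
  have 0: "(\<Sum>q\<in>I. (\<Sum>r\<in>I. D q r * A r b) * A q a) = 0" if "a \<in> I" "b \<in> I" for a b
  proof -
    have "(\<Sum>q\<in>I. (\<Sum>r\<in>I. D q r * A r b) * A q a) =
        (\<Sum>q\<in>I. \<Sum>r\<in>I. C q r * A q a * A r b) - (\<Sum>q\<in>I. \<Sum>r\<in>I. C' q r * A q a * A r b)"
      unfolding D_def sum_subtractf [symmetric] sum_distrib_right
      by (intro sum.cong refl) (simp add: algebra_simps)
    then show ?thesis using eq [OF that] by simp
  qed
  have "\<forall>q\<in>I. (\<Sum>r\<in>I. D q r * A r b) = 0" if "b \<in> I" for b
    by (rule ker) (rule 0 [OF _ that])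
  then have "\<forall>r\<in>I. D q r = 0" using assms(3) by (intro ker) blast
  then show ?thesis using assms(4) by (simp add: D_def)
qed

lemma struct_const_chart:
  assumes E: "branch N E" "x \<in> N" and c: "c \<in> atlas M" "x \<in> fst c" and d: "d \<in> atlas M" "x \<in> fst d"
    and k: "k \<in> I" and qr: "q \<in> I" "r \<in> I"
  shows "struct_const c E x k q r = struct_const d E x k q r"
proof (rule bilinear_unique [of "\<lambda>k a. E x k c a", OF _ _ qr])
  note br = branchD [OF E(1)]
  show "det (xmat I (\<lambda>k a. E x k c a)) \<noteq> 0" using Fr_det [OF br(3) br(4) c] E(2) by simp
  fix a b assume ab: "a \<in> I" "b \<in> I"
  have Ec: "E x q c a = (\<Sum>\<alpha>\<in>I. Jac c d x a \<alpha> * E x q d \<alpha>)" if "q \<in> I" "a \<in> I" for q a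
    using Fr_change [OF br(3) br(4) c(1) d(1) c(2) d(2) that] E(2) by simp
  have "(\<Sum>q\<in>I. \<Sum>r\<in>I. struct_const c E x k q r * E x q c a * E x r c b) = ext_deriv E c x k a b"
    by (rule struct_const_spec [OF E c ab, symmetric])
  also have "\<dots> = (\<Sum>\<alpha>\<in>I. \<Sum>\<beta>\<in>I. Jac c d x a \<alpha> * Jac c d x b \<beta> * ext_deriv E d x k \<alpha> \<beta>)"
    by (rule ext_deriv_change [OF E c d k ab])
  also have "\<dots> = (\<Sum>\<alpha>\<in>I. \<Sum>\<beta>\<in>I. \<Sum>q\<in>I. \<Sum>r\<in>I.
      Jac c d x a \<alpha> * Jac c d x b \<beta> * (struct_const d E x k q r * E x q d \<alpha> * E x r d \<beta>))"
    by (intro sum.cong refl) (simp add: struct_const_spec [OF E d] sum_distrib_left)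
  also have "\<dots> = (\<Sum>\<alpha>\<in>I. \<Sum>q\<in>I. \<Sum>\<beta>\<in>I. \<Sum>r\<in>I.
      Jac c d x a \<alpha> * Jac c d x b \<beta> * (struct_const d E x k q r * E x q d \<alpha> * E x r d \<beta>))"
    by (rule sum.cong [OF refl], rule sum.swap)
  also have "\<dots> = (\<Sum>q\<in>I. \<Sum>\<alpha>\<in>I. \<Sum>\<beta>\<in>I. \<Sum>r\<in>I.
      Jac c d x a \<alpha> * Jac c d x b \<beta> * (struct_const d E x k q r * E x q d \<alpha> * E x r d \<beta>))"
    by (rule sum.swap)
  also have "\<dots> = (\<Sum>q\<in>I. \<Sum>\<alpha>\<in>I. \<Sum>r\<in>I. \<Sum>\<beta>\<in>I.
      Jac c d x a \<alpha> * Jac c d x b \<beta> * (struct_const d E x k q r * E x q d \<alpha> * E x r d \<beta>))"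
    by (rule sum.cong [OF refl], rule sum.cong [OF refl], rule sum.swap)
  also have "\<dots> = (\<Sum>q\<in>I. \<Sum>r\<in>I. \<Sum>\<alpha>\<in>I. \<Sum>\<beta>\<in>I.
      Jac c d x a \<alpha> * Jac c d x b \<beta> * (struct_const d E x k q r * E x q d \<alpha> * E x r d \<beta>))"
    by (rule sum.cong [OF refl], rule sum.swap)
  also have "\<dots> = (\<Sum>q\<in>I. \<Sum>r\<in>I. struct_const d E x k q r * E x q c a * E x r c b)"
    by (intro sum.cong refl) (simp add: Ec ab sum_distrib_left sum_distrib_right mult_ac)
  finally show "(\<Sum>q\<in>I. \<Sum>r\<in>I. struct_const c E x k q r * E x q c a * E x r c b) =
      (\<Sum>q\<in>I. \<Sum>r\<in>I. struct_const d E x k q r * E x q c a * E x r c b)" .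
qed

lemma ext_deriv_scale:
  assumes E: "branch N E" "x \<in> N" and c: "c \<in> atlas M" "x \<in> fst c" and k: "k \<in> I" and ab: "a \<in> I" "b \<in> I"
  shows "ext_deriv (\<lambda>y. zmul z (E y)) c x k a b = z * ext_deriv E c x k a b"
proof -
  have "mgrad (\<lambda>y. z * E y k c b) c x a = z * mgrad (\<lambda>y. E y k c b) c x a" if "b \<in> I" for a b
    using mgrad_mult [OF hol_at_const branchD(5) [OF E(1) c(1) E(2) c(2) k that] c, of z] by simp
  then show ?thesis using ab by (simp add: ext_deriv_def algebra_simps)
qed

text \<open>The exterior derivative is linear and the product of two covectors quadratic in the
  frame, so one factor \<open>z\<close> is left over.\<close>

lemma struct_const_scale:
  assumes E: "branch N E" "x \<in> N" and z: "z ^ m = 1" and c: "c \<in> atlas M" "x \<in> fst c"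
    and k: "k \<in> I" and qr: "q \<in> I" "r \<in> I"
  shows "z * struct_const c (\<lambda>y. zmul z (E y)) x k q r = struct_const c E x k q r"
proof -
  note br = branchD [OF E(1)]
  have z0: "z \<noteq> 0" using z m_pos by (auto simp: power_0_left)
  have "z * struct_const c (\<lambda>y. zmul z (E y)) x k q r = struct_const c E x k q r"
  proof (rule bilinear_unique [of "\<lambda>k a. E x k c a" "\<lambda>q r. z * struct_const c (\<lambda>y. zmul z (E y)) x k q r", OF _ _ qr])
    show "det (xmat I (\<lambda>k a. E x k c a)) \<noteq> 0" using Fr_det [OF br(3) br(4) c] E(2) by simp
    fix a b assume ab: "a \<in> I" "b \<in> I"
    have "z * (\<Sum>q\<in>I. \<Sum>r\<in>I. z * struct_const c (\<lambda>y. zmul z (E y)) x k q r * E x q c a * E x r c b) =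
        (\<Sum>q\<in>I. \<Sum>r\<in>I. struct_const c (\<lambda>y. zmul z (E y)) x k q r * zmul z (E x) q c a * zmul z (E x) r c b)"
      by (simp add: sum_distrib_left mult_ac)
    also have "\<dots> = ext_deriv (\<lambda>y. zmul z (E y)) c x k a b"
      by (rule struct_const_spec [OF branch_scale [OF E(1) z] E(2) c ab, symmetric])
    also have "\<dots> = z * ext_deriv E c x k a b" by (rule ext_deriv_scale [OF E c k ab])
    also have "ext_deriv E c x k a b = (\<Sum>q\<in>I. \<Sum>r\<in>I. struct_const c E x k q r * E x q c a * E x r c b)"
      by (rule struct_const_spec [OF E c ab])
    finally show "(\<Sum>q\<in>I. \<Sum>r\<in>I. z * struct_const c (\<lambda>y. zmul z (E y)) x k q r * E x q c a * E x r c b) =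
        (\<Sum>q\<in>I. \<Sum>r\<in>I. struct_const c E x k q r * E x q c a * E x r c b)"
      unfolding mult_left_cancel [OF z0] .
  qed
  then show ?thesis .
qed

lemma struct_const_cong:
  assumes E: "branch N E" "x \<in> N" and W: "openin (mtop M) W" "x \<in> W" "\<And>y. y \<in> W \<Longrightarrow> E' y = E y"
    and c: "c \<in> atlas M" "x \<in> fst c" and k: "k \<in> I"
  shows "struct_const c E' x k q r = struct_const c E x k q r"
proof -
  have "mgrad (\<lambda>y. E' y k c b) c x = mgrad (\<lambda>y. E y k c b) c x" if "b \<in> I" for b
    by (rule mgrad_cong [OF branchD(5) [OF E(1) c(1) E(2) c(2) k that] W(1,2) _ c]) (simp add: W(3))
  then have "ext_deriv E' c x k a b = ext_deriv E c x k a b" if "a \<in> I" "b \<in> I" for a b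
    using that by (simp add: ext_deriv_def)
  then show ?thesis unfolding struct_const_def using W by (intro sum.cong refl) simp
qed

lemma hol_at_struct_const:
  assumes E: "branch N E" "x \<in> N" and c: "c \<in> atlas M" "x \<in> fst c" and k: "k \<in> I"
  shows "hol_at (\<lambda>y. struct_const c E y k q r) x"
proof -
  note br = branchD [OF E(1)]
  have W: "openin (mtop M) (N \<inter> fst c)" "x \<in> N \<inter> fst c" using openin_Int [OF br(1) chart_open [OF c(1)]] c E(2) by simp_all
  have "hol_at (\<lambda>y. mgrad (\<lambda>y. E y k c b) c y a) x" if "b \<in> I" for a b
    by (rule hol_at_mgrad [OF c W]) (use br(5) [OF c(1) _ _ k that] in blast)
  moreover have "hol_at (\<lambda>y. minv I (\<lambda>k a. E y k c a) a q) x" for a q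
    by (rule hol_at_minv) (use br(5) [OF c(1) E(2) c(2)] Fr_det [OF br(3) br(4) c] E(2) in auto)
  ultimately show ?thesis
    unfolding struct_const_def ext_deriv_def by (intro hol_at_sum hol_at_mult hol_at_diff) auto
qed

text \<open>
  The structure constants scale by the inverse root of unity, so multiplying the frame with one of
  them removes the ambiguity.
\<close>

lemma frame_if_structure_constant:
  assumes E0: "branch N0 E0" "x0 \<in> N0" and c0: "c0 \<in> atlas M" "x0 \<in> fst c0"
    and kqr: "k \<in> I" "q \<in> I" "r \<in> I" and nz: "struct_const c0 E0 x0 k q r \<noteq> 0"
  shows "\<exists>e. frame_on Q e"
proof -
  define ok where "ok = (\<lambda>x NE. branch (fst NE) (snd NE) \<and> x \<in> fst NE)"
  define B where "B = (\<lambda>x. SOME NE. ok x NE)"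
  have B: "ok x (B x)" if xQ: "x \<in> Q" for x
  proof -
    obtain e where "e \<in> Fr x" using Fr_ne [OF xQ] by blast
    then obtain N E where "branch N E" "x \<in> N" using branch_at [OF xQ] by blast
    then have "ok x (N, E)" by (simp add: ok_def)
    then show ?thesis unfolding B_def by (rule someI)
  qed
  define ch where "ch = (\<lambda>x. SOME c. c \<in> atlas M \<and> x \<in> fst c)"
  have ch: "ch x \<in> atlas M" "x \<in> fst (ch x)" if "x \<in> Q" for x
    using someI_ex [of "\<lambda>c. c \<in> atlas M \<and> x \<in> fst c"] chart_at comp_of_sub that unfolding ch_def by blast+
  define Cx where "Cx = (\<lambda>x. struct_const (ch x) (snd (B x)) x k q r)"
  define th where "th = (\<lambda>l c x a. Cx x * snd (B x) x l c a)"
  have rel: "\<exists>z. z ^ m = 1 \<and> E x = zmul z (snd (B x) x) \<and> z * struct_const c E x k q r = Cx x"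
    if E: "branch N E" "x \<in> N" and c: "c \<in> atlas M" "x \<in> fst c" for N E x c
  proof -
    have x: "x \<in> Q" using branchD(3) [OF E(1)] E(2) by simp
    note BB = B [OF x, unfolded ok_def]
    obtain z where z: "z ^ m = 1" "E x = zmul z (snd (B x) x)"
      using Fr_unique [OF x branchD(4) [OF conjunct1 [OF BB] conjunct2 [OF BB]] branchD(4) [OF E]] by blast
    note sc = branch_scale [OF conjunct1 [OF BB] z(1)]
    obtain N1 where N1: "openin (mtop M) N1" "x \<in> N1" "N1 \<subseteq> N \<inter> fst (B x)"
      "\<And>y. y \<in> N1 \<Longrightarrow> zmul z (snd (B x) y) = E y"
      by (rule branch_unique [OF E sc conjunct2 [OF BB] z(2)], rule that) assumption+
    have "struct_const c E x k q r = struct_const c (\<lambda>y. zmul z (snd (B x) y)) x k q r"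
      by (rule struct_const_cong [OF sc conjunct2 [OF BB] N1(1,2) _ c kqr(1)]) (simp add: N1(4))
    also have "z * \<dots> = struct_const c (snd (B x)) x k q r"
      by (rule struct_const_scale [OF conjunct1 [OF BB] conjunct2 [OF BB] z(1) c kqr])
    also have "\<dots> = Cx x"
      unfolding Cx_def by (rule struct_const_chart [OF conjunct1 [OF BB] conjunct2 [OF BB] c ch [OF x] kqr])
    finally show ?thesis using z by blast
  qed
  \<comment> \<open>Another branch multiplies the frame by \<open>z\<close> and divides the
    structure constant by \<open>z\<close>; the product does not depend on the branch.\<close>
  have th: "th l d x a = struct_const c E x k q r * E x l d a" if h: "branch N E" "x \<in> N" "c \<in> atlas M" "x \<in> fst c" for N E x c d l a
  proof -
    obtain z where z: "E x = zmul z (snd (B x) x)" "z * struct_const c E x k q r = Cx x" using rel [OF h] by blast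
    show ?thesis unfolding th_def z(1) zmul_apply z(2) [symmetric] by (simp add: mult_ac)
  qed
  have Cm: "struct_const c E x k q r ^ m = Cx x ^ m" if h: "branch N E" "x \<in> N" "c \<in> atlas M" "x \<in> fst c" for N E x c
  proof -
    obtain z where "z ^ m = 1" "z * struct_const c E x k q r = Cx x" using rel [OF h] by blast
    then show ?thesis by (metis mult_1 power_mult_distrib)
  qed
  \<comment> \<open>The choice of branches in \<open>Cx\<close> need not be continuous, but its
    \<open>m\<close>-th power is independent of them. This power is a holomorphic function on
    \<open>Q\<close>, hence constant, and the nonzero value at \<open>x0\<close> makes
    \<open>Cx\<close> vanish nowhere.\<close>
  have "hol_at (\<lambda>y. Cx y ^ m) x" if x: "x \<in> Q" for x
  proof -
    note BB = B [OF x, unfolded ok_def] and c = ch [OF x]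
    let ?W = "fst (B x) \<inter> fst (ch x)"
    have W: "openin (mtop M) ?W" "x \<in> ?W" using openin_Int [OF branchD(1) [OF conjunct1 [OF BB]] chart_open [OF c(1)]] BB c by simp_all
    have "hol_at (\<lambda>y. struct_const (ch x) (snd (B x)) y k q r ^ m) x"
      by (intro hol_at_power hol_at_struct_const [OF conjunct1 [OF BB] conjunct2 [OF BB] c kqr(1)])
    then show ?thesis
      by (rule hol_at_cong [OF _ W]) (use Cm [OF conjunct1 [OF BB]] c in blast)
  qed
  then have "Cx x ^ m = Cx x0 ^ m" if "x \<in> Q" for x
    by (rule hol_const [OF cpt, of p "\<lambda>y. Cx y ^ m"]) (use that branchD(3) [OF E0(1) E0(2)] in auto)
  moreover have "Cx x0 ^ m \<noteq> 0" using Cm [OF E0 c0] nz by (metis power_not_zero)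
  ultimately have Cnz: "Cx x \<noteq> 0" if "x \<in> Q" for x
    using that m_pos by (metis power_eq_0_iff)
  have "frame_on Q th"
    unfolding frame_on_def cov_section_def
  proof (intro conjI ballI)
    fix l c x a assume *: "l \<in> I" "c \<in> atlas M" "x \<in> fst c \<inter> Q" "a \<in> I"
    then have x: "x \<in> Q" by blast
    note BB = B [OF x, unfolded ok_def]
    let ?W = "fst (B x) \<inter> fst c"
    have W: "openin (mtop M) ?W" "x \<in> ?W" using openin_Int [OF branchD(1) [OF conjunct1 [OF BB]] chart_open [OF *(2)]] BB * by simp_all
    have "hol_at (\<lambda>y. struct_const c (snd (B x)) y k q r * snd (B x) y l c a) x"
      by (intro hol_at_mult hol_at_struct_const [OF conjunct1 [OF BB] conjunct2 [OF BB]] branchD(5) [OF conjunct1 [OF BB]])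
         (use BB * kqr in auto)
    then show "hol_at (\<lambda>y. th l c y a) x"
      by (rule hol_at_cong [OF _ W]) (use th [OF conjunct1 [OF BB] _ *(2)] in auto)
  next
    fix l c d x a assume *: "l \<in> I" "c \<in> atlas M" "d \<in> atlas M" "x \<in> fst c \<inter> fst d \<inter> Q" "a \<in> I"
    then have x: "x \<in> Q" by blast
    note BB = B [OF x, unfolded ok_def]
    have "snd (B x) x l c a = (\<Sum>b\<in>I. Jac c d x a b * snd (B x) x l d b)"
      using Fr_change [OF x branchD(4) [OF conjunct1 [OF BB] conjunct2 [OF BB]] *(2,3) _ _ *(1,5)] * by blast
    then show "th l c x a = (\<Sum>b\<in>I. Jac c d x a b * th l d x b)"
      by (simp add: th_def sum_distrib_left mult_ac)
  next
    fix c x assume *: "c \<in> atlas M" "x \<in> fst c \<inter> Q"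
    then have x: "x \<in> Q" by blast
    note BB = B [OF x, unfolded ok_def]
    have "det (xmat I (\<lambda>l a. snd (B x) x l c a)) \<noteq> 0"
      using Fr_det [OF x branchD(4) [OF conjunct1 [OF BB] conjunct2 [OF BB]]] * by blast
    then show "det (xmat I (\<lambda>l a. th l c x a)) \<noteq> 0"
      unfolding det_xmat_nonzero_iff th_def
      using Cnz [OF x] by (simp add: mult.left_commute [of _ "Cx x"] flip: sum_distrib_left)
  qed
  then show ?thesis by blast
qed

end

section \<open>Multivalued frames of closed forms\<close>

lemma coord_space_closed:
  "0 \<in> coord_space I" "v \<in> coord_space I \<Longrightarrow> w \<in> coord_space I \<Longrightarrow> v + w \<in> coord_space I"
  "v \<in> coord_space I \<Longrightarrow> w \<in> coord_space I \<Longrightarrow> v - w \<in> coord_space I"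
  "v \<in> coord_space I \<Longrightarrow> z *s v \<in> coord_space I"
  "v \<in> coord_space I \<Longrightarrow> t *\<^sub>R v \<in> coord_space I"
  by (auto simp: coord_space_def)

definition cspball :: "'n set \<Rightarrow> real \<Rightarrow> (complex ^ 'n::finite) set" where
  "cspball I r = {v \<in> coord_space I. norm v < r}"

lemma cspball_eq: "cspball I r = coord_space I \<inter> ball 0 r"
  by (auto simp: cspball_def)

lemma openin_coord_contains_ball:
  assumes "openin (top_of_set (coord_space I)) S" "v \<in> S"
  obtains r where "r > 0" "\<And>u. u \<in> cspball I r \<Longrightarrow> v + u \<in> S"
proof -
  obtain T where T: "open T" "S = coord_space I \<inter> T" using assms by (auto simp: openin_open)
  then obtain r where r: "r > 0" "ball v r \<subseteq> T" using assms open_contains_ball by blast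
  have "v + u \<in> S" if "u \<in> cspball I r" for u
  proof -
    have "v + u \<in> ball v r" using that by (simp add: cspball_def dist_norm)
    moreover have "v + u \<in> coord_space I" using that assms(2) T(2) by (auto simp: cspball_def intro: coord_space_closed)
    ultimately show ?thesis using r T by blast
  qed
  then show ?thesis using that r by blast
qed

lemma norm_le_sum_components: "norm (v :: complex ^ 'n::finite) \<le> (\<Sum>k\<in>UNIV. norm (v $ k))"
  unfolding norm_vec_def by (rule L2_set_le_sum) simp

lemma norm_root: "m > 0 \<Longrightarrow> z ^ m = 1 \<Longrightarrow> norm (z::complex) = 1"
  by (metis norm_ge_zero norm_one norm_power power_eq_1_iff less_irrefl)

locale flat_multiframe = multiframe +
  assumes closed: "branch N E \<Longrightarrow> x \<in> N \<Longrightarrow> c \<in> atlas M \<Longrightarrow> x \<in> fst c \<Longrightarrow> k \<in> I \<Longrightarrow> a \<in> I \<Longrightarrow> b \<in> I \<Longrightarrow>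
      ext_deriv E c x k a b = 0"
begin

text \<open>A chart \<open>g\<close> whose differentials \<open>d g_k\<close> are the covectors of
  the branch \<open>E\<close>. Its image is a full round ball, which is preserved by multiplication
  with roots of unity and leaves room for translations.\<close>

definition flat :: "'a set \<Rightarrow> ('a \<Rightarrow> complex ^ 'b) \<Rightarrow> ('a \<Rightarrow> ('a, 'b) coframe) \<Rightarrow> real \<Rightarrow> bool" where
  "flat N g E \<rho> \<longleftrightarrow> branch N E \<and> 0 < \<rho> \<and> inj_on g N \<and> g ` N = cspball I \<rho> \<and>
     (\<forall>W. openin (mtop M) W \<longrightarrow> W \<subseteq> N \<longrightarrow> openin (top_of_set (coord_space I)) (g ` W)) \<and>
     (\<forall>y\<in>N. \<forall>k\<in>I. hol_at (\<lambda>y. g y $ k) y) \<and>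
     (\<forall>c\<in>atlas M. \<forall>y\<in>N \<inter> fst c. \<forall>k\<in>I. \<forall>a\<in>I. mgrad (\<lambda>y. g y $ k) c y a = E y k c a)"

lemma flatD:
  assumes "flat N g E \<rho>"
  shows "branch N E" "0 < \<rho>" "inj_on g N" "g ` N = cspball I \<rho>"
    "\<And>W. openin (mtop M) W \<Longrightarrow> W \<subseteq> N \<Longrightarrow> openin (top_of_set (coord_space I)) (g ` W)"
    "\<And>y k. y \<in> N \<Longrightarrow> k \<in> I \<Longrightarrow> hol_at (\<lambda>y. g y $ k) y"
    "\<And>c y k a. c \<in> atlas M \<Longrightarrow> y \<in> N \<Longrightarrow> y \<in> fst c \<Longrightarrow> k \<in> I \<Longrightarrow> a \<in> I \<Longrightarrow> mgrad (\<lambda>y. g y $ k) c y a = E y k c a"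
  using assms unfolding flat_def by blast+

lemma flat_coord: "flat N g E \<rho> \<Longrightarrow> y \<in> N \<Longrightarrow> g y \<in> coord_space I"
  using flatD(4) [of N g E \<rho>] unfolding cspball_def by blast

text \<open>Closedness gives primitives of the covectors in a coordinate ball. Their Jacobian at the
  centre is the matrix of the frame, which is invertible, so they serve as local
  coordinates.\<close>

lemma flat_exists:
  assumes x: "x \<in> Q" and e: "e \<in> Fr x"
  shows "\<exists>N g E \<rho>. flat N g E \<rho> \<and> x \<in> N \<and> g x = 0 \<and> E x = e"
proof -
  obtain N E where E: "branch N E" "x \<in> N" "E x = e" using branch_at [OF x e] .
  note br = branchD [OF E(1)]
  obtain c where c: "c \<in> atlas M" "x \<in> fst c" using chart_at comp_of_sub x by blast
  define z0 where "z0 = snd c x"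
  obtain s where s: "s > 0" "ball z0 s \<subseteq> cdom c N" using coord_ball [OF c br(1) E(2)] unfolding z0_def .
  have pz: "proj I z \<in> ball z0 s" if "z \<in> ball z0 s" for z
  proof -
    have "z0 - proj I z = proj I (z0 - z)"
      using proj_chart [OF c] by (simp add: z0_def linear_diff [OF bounded_linear.linear [OF bounded_linear_proj]])
    then have "dist z0 (proj I z) \<le> dist z0 z" unfolding dist_norm using norm_proj_le by metis
    then show ?thesis using that by auto
  qed
  define H where "H = (\<lambda>k a. if a \<in> I then pull c (\<lambda>y. E y k c a) else (\<lambda>_. 0))"
  have hW: "hol_at (\<lambda>y. E y k c a) y" if "k \<in> I" "a \<in> I" "y \<in> N \<inter> fst c" for k a y
    using br(5) [OF c(1) _ _ that(1,2)] that(3) by blast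
  have cdW: "cdom c (N \<inter> fst c) = cdom c N" unfolding cdom_def by (rule Collect_cong) (rule arg_cong [of _ _ "\<lambda>S. _ \<in> _ ` S"], blast)
  have grad: "has_cgrad (pull c (\<lambda>y. E y k c a)) (mgrad (\<lambda>y. E y k c a) c (cinv c z)) z"
    if "k \<in> I" "a \<in> I" "z \<in> ball z0 s" for k a z
    by (rule pull_cdiff_cdom [OF c(1), of "N \<inter> fst c"]) (use that s hW in \<open>auto simp: cdW\<close>)
  have cdH: "cdiff (H k a) z" if "k \<in> I" "z \<in> ball z0 s" for k a z
    using grad [OF that(1) _ that(2)] by (auto simp: H_def cdiff_def intro: has_cgrad_const)
  have clH: "partial_deriv a (H k b) z = partial_deriv b (H k a) z" if k: "k \<in> I" and z: "z \<in> ball z0 s" for k a b z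
  proof -
    have zc: "cinv c z \<in> fst c" "cinv c z \<in> N" using cdom_cinv [OF c(1)] s z by blast+
    have pd: "partial_deriv a (pull c (\<lambda>y. E y k c b)) z = mgrad (\<lambda>y. E y k c b) c (cinv c z) a" if "b \<in> I" for a b
      by (rule partial_deriv_eq [OF grad [OF k that z]])
    have p0: "partial_deriv a (\<lambda>_. 0) z = 0" for a by (rule partial_deriv_eq [OF has_cgrad_const])
    show ?thesis
    proof (cases "a \<in> I"; cases "b \<in> I")
      assume ab: "a \<in> I" "b \<in> I"
      show ?thesis using closed [OF E(1) zc(2) c(1) zc(1) k ab] ab by (simp add: H_def pd ext_deriv_def)
    qed (simp_all add: H_def p0 pd mgrad_outside)
  qed
  have "\<forall>k\<in>I. \<exists>f. \<forall>z\<in>ball z0 s. has_cgrad f (\<lambda>a. H k a z) z"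
    using poincare_lemma [of z0 s "H _"] cdH clH by blast
  then obtain f where f: "\<And>k z. k \<in> I \<Longrightarrow> z \<in> ball z0 s \<Longrightarrow> has_cgrad (f k) (\<lambda>a. H k a z) z"
    by metis
  \<comment> \<open>The coordinates outside \<open>I\<close> are kept, so that \<open>G\<close> is a
    map of the full space with Jacobian of the form \<open>xmat\<close>; it maps
    \<open>coord_space I\<close> and its complement to themselves.\<close>
  define G where "G = (\<lambda>z. \<chi> k. if k \<in> I then f k z - f k z0 else z $ k)"
  have Gk: "has_cgrad (\<lambda>z. G z $ k) (\<lambda>a. if k \<in> I then H k a z else if a = k then 1 else 0) z"
    if "z \<in> ball z0 s" for z k
  proof (cases "k \<in> I")
    case True
    then show ?thesis using has_cgrad_add [OF f [OF True that] has_cgrad_const [of "- f k z0"]] by (simp add: G_def)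
  next
    case False
    then show ?thesis using has_cgrad_nth [of k z] by (simp add: G_def)
  qed
  have z0s: "z0 \<in> ball z0 s" using s by simp
  have xm: "(\<chi> k a. partial_deriv a (\<lambda>z. G z $ k) z0) = xmat I (\<lambda>k a. e k c a)"
    unfolding partial_deriv_eq [OF Gk [OF z0s]] using c E(3)
    by (auto simp: vec_eq_iff xmat_nth H_def pull_def z0_def)
  have "invertible (xmat I (\<lambda>k a. e k c a))"
    unfolding invertible_det_nz using Fr_det [OF x e c] .
  then obtain A where A: "A ** (\<chi> k a. partial_deriv a (\<lambda>z. G z $ k) z0) = mat 1"
    unfolding xm invertible_def by blast
  obtain U V h where U: "open U" "U \<subseteq> ball z0 s" "z0 \<in> U" and V: "open V" and hom: "homeomorphism U V G h"
    by (rule holomorphic_local_homeomorphism [of "ball z0 s" G z0 A, OF open_ball _ z0s A])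
       (use Gk cdiff_def in blast)+
  have Gc: "G z \<in> coord_space I \<longleftrightarrow> z \<in> coord_space I" for z
    by (auto simp: coord_space_def G_def)
  have z0c: "z0 \<in> coord_space I" using chart_coord [OF c] by (simp add: z0_def)
  have G0: "G z0 = 0" using z0c by (auto simp: G_def vec_eq_iff coord_space_def)
  have "G z0 \<in> V" using hom U(3) unfolding homeomorphism_def by blast
  then have "0 \<in> V" by (simp add: G0)
  then obtain \<rho> where \<rho>: "\<rho> > 0" "ball 0 \<rho> \<subseteq> V" using V open_contains_ball by blast
  define g where "g = (\<lambda>y. G (snd c y))"
  \<comment> \<open>The neighbourhood is cut out by a condition on \<open>g\<close> itself, so that
    its image is exactly a ball.\<close>
  define N2 where "N2 = {y \<in> fst c. snd c y \<in> U \<and> g y \<in> ball 0 \<rho>}"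
  have UG: "open (U \<inter> {z. G z \<in> ball 0 \<rho>})"
  proof -
    have "openin (top_of_set U) (U \<inter> G -` ball 0 \<rho>)"
      using hom unfolding homeomorphism_def by (intro continuous_openin_preimage_gen) auto
    then show ?thesis using U(1) by (simp add: openin_open_eq vimage_def)
  qed
  have N2o: "openin (mtop M) N2"
  proof -
    have "openin (subtopology (mtop M) (fst c)) {y \<in> topspace (subtopology (mtop M) (fst c)). snd c y \<in> snd c ` fst c \<inter> (U \<inter> {z. G z \<in> ball 0 \<rho>})}"
      by (rule openin_continuous_map_preimage [OF homeomorphic_imp_continuous_map [OF chart_homeo [OF c(1)]]])
         (use UG openin_open in blast)
    moreover have "{y \<in> topspace (subtopology (mtop M) (fst c)). snd c y \<in> snd c ` fst c \<inter> (U \<inter> {z. G z \<in> ball 0 \<rho>})} = N2"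
      using chart_sub [OF c(1)] by (auto simp: N2_def g_def)
    ultimately show ?thesis using openin_trans_full chart_open [OF c(1)] by metis
  qed
  have N2N: "N2 \<subseteq> N"
  proof
    fix y assume y: "y \<in> N2"
    then have "snd c y \<in> cdom c N" using U s by (auto simp: N2_def)
    from cdom_cinv(2) [OF c(1) this] show "y \<in> N" using y c by (simp add: N2_def)
  qed
  have N2c: "N2 \<subseteq> fst c" by (auto simp: N2_def)
  have pullg: "has_cgrad (pull c (\<lambda>y. g y $ k)) (\<lambda>a. if a \<in> I then E y k c a else 0) (snd c y)"
    if y: "y \<in> N2" and k: "k \<in> I" for y k
  proof -
    have yc: "y \<in> fst c" "snd c y \<in> ball z0 s" using y U by (auto simp: N2_def)
    have 1: "has_cgrad (\<lambda>z. proj I z $ j) (\<lambda>a. if a = j \<and> j \<in> I then 1 else 0) z" for j z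
      using has_cgrad_nth [of j z] has_cgrad_const [of 0 z] by (cases "j \<in> I") auto
    have 2: "has_cgrad (\<lambda>z. G z $ k) (\<lambda>a. H k a (snd c y)) (proj I (snd c y))"
      using Gk [OF yc(2), of k] k proj_chart [OF c(1) yc(1)] by simp
    have "has_cgrad (\<lambda>z. G (proj I z) $ k) (\<lambda>a. \<Sum>j\<in>UNIV. H k j (snd c y) * (if a = j \<and> j \<in> I then 1 else 0)) (snd c y)"
      by (rule has_cgrad_compose_vec [OF 1 2])
    moreover have "(\<Sum>j\<in>UNIV. H k j (snd c y) * (if a = j \<and> j \<in> I then 1 else 0)) = (if a \<in> I then E y k c a else 0)" for a
    proof -
      have "(\<Sum>j\<in>UNIV. H k j (snd c y) * (if a = j \<and> j \<in> I then 1 else 0)) =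
          (\<Sum>j\<in>{a}. H k j (snd c y) * (if a = j \<and> j \<in> I then 1 else 0))"
        by (rule sum.mono_neutral_right) auto
      then show ?thesis using yc c by (simp add: H_def pull_def)
    qed
    ultimately have "has_cgrad (\<lambda>z. G (proj I z) $ k) (\<lambda>a. if a \<in> I then E y k c a else 0) (snd c y)" by simp
    then show ?thesis
    proof (rule has_cgrad_cong [OF _ cdom_open [OF c(1) chart_open [OF c(1)]]])
      show "snd c y \<in> cdom c (fst c)" using c yc chart_in_cdom by blast
      show "G (proj I w) $ k = pull c (\<lambda>y. g y $ k) w" if "w \<in> cdom c (fst c)" for w
        using cdom_cinv(3) [OF c(1) that] by (simp add: pull_def g_def)
    qed
  qed
  have "flat N2 g E \<rho>"
    unfolding flat_def
  proof (intro conjI allI impI ballI)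
    show "branch N2 E" by (rule branch_subset [OF E(1) N2o N2N])
    show "0 < \<rho>" by fact
    show "inj_on g N2"
    proof (rule inj_onI)
      fix y y' assume *: "y \<in> N2" "y' \<in> N2" "g y = g y'"
      then have "h (G (snd c y)) = h (G (snd c y'))" by (simp add: g_def)
      then have "snd c y = snd c y'" using * hom unfolding homeomorphism_def N2_def by auto
      then show "y = y'" using chart_inj [OF c(1)] * N2c by (meson inj_onD subsetD)
    qed
    have gim: "g ` W = G ` (cdom c W \<inter> U) \<inter> coord_space I \<inter> ball 0 \<rho>" if W: "W \<subseteq> N2" for W
    proof (intro equalityI subsetI)
      fix v assume "v \<in> g ` W"
      then obtain y where y: "y \<in> W" "v = g y" by blast
      then have "y \<in> fst c" "snd c y \<in> U" "g y \<in> ball 0 \<rho>" using W by (auto simp: N2_def)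
      then show "v \<in> G ` (cdom c W \<inter> U) \<inter> coord_space I \<inter> ball 0 \<rho>"
        using y c chart_in_cdom [OF c(1)] chart_coord [OF c(1)] Gc by (auto simp: g_def)
    next
      fix v assume "v \<in> G ` (cdom c W \<inter> U) \<inter> coord_space I \<inter> ball 0 \<rho>"
      then obtain z where z: "v = G z" "z \<in> cdom c W" "z \<in> coord_space I" using Gc by blast
      have "snd c (cinv c z) = z" using cdom_cinv(3) [OF c(1) z(2)] proj_id [OF z(3)] by simp
      then have "g (cinv c z) = v" using z(1) by (simp add: g_def)
      then show "v \<in> g ` W" using cdom_cinv(2) [OF c(1) z(2)] by blast
    qed
    show "g ` N2 = cspball I \<rho>"
    proof -
      have "v \<in> g ` N2" if v: "v \<in> coord_space I" "v \<in> ball 0 \<rho>" for v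
      proof -
        have hv: "h v \<in> U" "G (h v) = v" using v \<rho> hom unfolding homeomorphism_def by auto
        then have hc: "h v \<in> coord_space I" using Gc v by metis
        have "h v \<in> cdom c N" using hv U s by blast
        note zz = cdom_cinv [OF c(1) this]
        have "snd c (cinv c (h v)) = h v" using zz(3) proj_id [OF hc] by simp
        then show ?thesis using hv zz v by (intro image_eqI [of _ _ "cinv c (h v)"]) (auto simp: N2_def g_def)
      qed
      moreover have "g y \<in> coord_space I \<inter> ball 0 \<rho>" if "y \<in> N2" for y
        using that Gc chart_coord [OF c(1)] by (auto simp: N2_def g_def)
      ultimately show ?thesis unfolding cspball_eq by blast
    qed
    show "openin (top_of_set (coord_space I)) (g ` W)" if W: "openin (mtop M) W" "W \<subseteq> N2" for W
    proof -
      have "openin (top_of_set U) (cdom c W \<inter> U)"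
        using cdom_open [OF c(1) W(1)] by (simp add: openin_open Int_commute) blast
      then have "openin (top_of_set V) (G ` (cdom c W \<inter> U))"
        by (rule homeomorphism_imp_open_map [OF hom])
      then have "open (G ` (cdom c W \<inter> U))" using V by (simp add: openin_open_eq)
      then have "open (G ` (cdom c W \<inter> U) \<inter> ball 0 \<rho>)" by blast
      then show ?thesis unfolding gim [OF W(2)] openin_open by blast
    qed
    show "hol_at (\<lambda>y. g y $ k) y" if "y \<in> N2" "k \<in> I" for y k
      using hol_atI [OF c(1) _] pullg [OF that] N2c that unfolding cdiff_def by blast
    show "mgrad (\<lambda>y. g y $ k) d y a = E y k d a" if *: "d \<in> atlas M" "y \<in> N2 \<inter> fst d" "k \<in> I" "a \<in> I" for d y k a
    proof -
      have y: "y \<in> N2" "y \<in> fst c" "y \<in> fst d" "y \<in> N" using * N2c N2N by auto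
      have hol: "hol_at (\<lambda>y. g y $ k) y"
        using hol_atI [OF c(1) y(2)] pullg [OF y(1) *(3)] unfolding cdiff_def by blast
      have "mgrad (\<lambda>y. g y $ k) d y a = (\<Sum>b\<in>I. Jac d c y a b * mgrad (\<lambda>y. g y $ k) c y b)"
        by (rule mgrad_change [OF hol *(1) y(3) c(1) y(2)])
      also have "\<dots> = (\<Sum>b\<in>I. Jac d c y a b * E y k c b)"
        using mgrad_eqI [OF pullg [OF y(1) *(3)]] by (intro sum.cong) simp_all
      also have "\<dots> = E y k d a"
        by (rule Fr_change [OF br(3) [OF y(4)] br(4) [OF y(4)] *(1) c(1) y(3) y(2) *(3,4), symmetric])
      finally show ?thesis .
    qed
  qed
  moreover have "x \<in> N2" using c U(3) G0 \<rho> by (simp add: N2_def g_def z0_def)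
  moreover have "g x = 0" using G0 by (simp add: g_def z0_def)
  ultimately show ?thesis using E(3) by blast
qed

lemma flat_continuous:
  assumes fl: "flat N g E \<rho>" and O: "open O'"
  shows "openin (mtop M) {y \<in> N. g y \<in> O'}"
proof (subst openin_subopen, safe)
  fix y assume y: "y \<in> N" "g y \<in> O'"
  note f = flatD [OF fl]
  note No = branchD(1) [OF f(1)]
  obtain \<epsilon> where \<epsilon>: "\<epsilon> > 0" "ball (g y) \<epsilon> \<subseteq> O'" using O y open_contains_ball by blast
  \<comment> \<open>The norm is at most the sum of the norms of the \<open>CARD('b)\<close>
    components, each of which is kept below \<open>\<delta>\<close>.\<close>
  define \<delta> where "\<delta> = \<epsilon> / real (CARD('b))"
  have \<delta>: "\<delta> > 0" using \<epsilon> by (simp add: \<delta>_def)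
  have "\<exists>W. openin (mtop M) W \<and> y \<in> W \<and> W \<subseteq> N \<and> (\<lambda>y. g y $ k) ` W \<subseteq> ball (g y $ k) \<delta>" if k: "k \<in> I" for k
    by (rule hol_at_nbhd [OF f(6) [OF y(1) k] No y(1) open_ball]) (use \<delta> in auto)
  then obtain W where W: "\<And>k. k \<in> I \<Longrightarrow> openin (mtop M) (W k) \<and> y \<in> W k \<and> W k \<subseteq> N \<and> (\<lambda>y. g y $ k) ` W k \<subseteq> ball (g y $ k) \<delta>"
    by metis
  let ?W = "\<Inter>k\<in>I. W k"
  have "openin (mtop M) ?W" by (rule openin_INT2) (use W I_ne in auto)
  moreover have "?W \<subseteq> {y \<in> N. g y \<in> O'}"
  proof
    fix z assume z: "z \<in> ?W"
    then have zN: "z \<in> N" using W I_ne by blast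
    have "norm ((g y - g z) $ k) < \<delta>" for k
    proof (cases "k \<in> I")
      case True
      then have "g z $ k \<in> ball (g y $ k) \<delta>" using W [OF True] z by blast
      then show ?thesis by (simp add: dist_norm)
    next
      case False
      then show ?thesis using flat_coord [OF fl y(1)] flat_coord [OF fl zN] \<delta> by (simp add: coord_space_def)
    qed
    then have "(\<Sum>k\<in>UNIV. norm ((g y - g z) $ k)) < (\<Sum>k\<in>(UNIV::'b set). \<delta>)"
      by (intro sum_strict_mono) auto
    then have "norm (g y - g z) < \<epsilon>" using norm_le_sum_components [of "g y - g z"] by (simp add: \<delta>_def)
    then have "g z \<in> ball (g y) \<epsilon>" by (simp add: dist_norm)
    then show "z \<in> {y \<in> N. g y \<in> O'}" using \<epsilon> zN by blast
  qed
  moreover have "y \<in> ?W" using W by blast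
  ultimately show "\<exists>T. openin (mtop M) T \<and> y \<in> T \<and> T \<subseteq> {y \<in> N. g y \<in> O'}" by blast
qed

text \<open>Local inverses of the primitives, lifted to the covering \<open>Y\<close> of \<open>Q\<close> formed by the values of the frame.\<close>

definition flow :: "real \<Rightarrow> (complex ^ 'b \<Rightarrow> 'a \<times> ('a, 'b) coframe) \<Rightarrow> bool" where
  "flow \<rho> h \<longleftrightarrow> (\<exists>N g E. flat N g E \<rho> \<and> (\<forall>y\<in>N. h (g y) = (y, E y)))"

definition act :: "complex \<Rightarrow> 'a \<times> ('a, 'b) coframe \<Rightarrow> 'a \<times> ('a, 'b) coframe" where
  "act z y = (fst y, zmul z (snd y))"

text \<open>The total space of the covering of \<open>Q\<close> with fibres \<open>Fr x\<close>.
  Neighbourhoods in it are handled through flows and their projections to \<open>Q\<close>.\<close>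

definition Y :: "('a \<times> ('a, 'b) coframe) set" where
  "Y = {(x, e). x \<in> Q \<and> e \<in> Fr x}"

lemma act_simps [simp]: "act 1 y = y" "act z (act w y) = act (z * w) y" "fst (act z y) = fst y"
  by (simp_all add: act_def)

lemma act_Y: "z ^ m = 1 \<Longrightarrow> y \<in> Y \<Longrightarrow> act z y \<in> Y"
  using Fr_scale by (auto simp: Y_def act_def)

lemma act_free: "y \<in> Y \<Longrightarrow> act z y = y \<Longrightarrow> z = 1"
  using zmul_free unfolding Y_def act_def by (metis (mono_tags, lifting) case_prod_unfold mem_Collect_eq snd_conv)

lemma same_fibre:
  assumes "y \<in> Y" "y' \<in> Y" "fst y = fst y'"
  obtains z where "z ^ m = 1" "y' = act z y"
proof -
  have "fst y \<in> Q" "snd y \<in> Fr (fst y)" "snd y' \<in> Fr (fst y)" using assms by (auto simp: Y_def)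
  then obtain z where "z ^ m = 1" "snd y' = zmul z (snd y)" using Fr_unique by blast
  then show ?thesis using that assms(3) by (simp add: act_def prod_eq_iff)
qed

lemma flow_exists: "y \<in> Y \<Longrightarrow> \<exists>\<rho> h. \<rho> > 0 \<and> flow \<rho> h \<and> h 0 = y"
proof -
  assume y: "y \<in> Y"
  then obtain N g E \<rho> where f: "flat N g E \<rho>" "fst y \<in> N" "g (fst y) = 0" "E (fst y) = snd y"
    using flat_exists [of "fst y" "snd y"] by (auto simp: Y_def)
  define h where "h = (\<lambda>v. (inv_into N g v, E (inv_into N g v)))"
  have "\<forall>y\<in>N. h (g y) = (y, E y)" using flatD(3) [OF f(1)] by (simp add: h_def)
  then have "flow \<rho> h" "h 0 = y" using f unfolding flow_def by (blast, metis prod.collapse)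
  then show ?thesis using flatD(2) [OF f(1)] by blast
qed

lemma flow_Y: "flow \<rho> h \<Longrightarrow> v \<in> cspball I \<rho> \<Longrightarrow> h v \<in> Y"
proof -
  assume "flow \<rho> h" and v: "v \<in> cspball I \<rho>"
  then obtain N g E where f: "flat N g E \<rho>" "\<forall>y\<in>N. h (g y) = (y, E y)" unfolding flow_def by blast
  obtain y where y: "y \<in> N" "v = g y" using flatD(4) [OF f(1)] v by blast
  then have "h v = (y, E y)" using f(2) by blast
  then show ?thesis using branchD(3,4) [OF flatD(1) [OF f(1)] y(1)] y(1) by (simp add: Y_def)
qed

lemma flow_inj: "flow \<rho> h \<Longrightarrow> v \<in> cspball I \<rho> \<Longrightarrow> w \<in> cspball I \<rho> \<Longrightarrow> fst (h v) = fst (h w) \<Longrightarrow> v = w"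
proof -
  assume "flow \<rho> h" and v: "v \<in> cspball I \<rho>" "w \<in> cspball I \<rho>" and eq: "fst (h v) = fst (h w)"
  then obtain N g E where f: "flat N g E \<rho>" "\<forall>y\<in>N. h (g y) = (y, E y)" unfolding flow_def by blast
  obtain y where y: "y \<in> N" "v = g y" using flatD(4) [OF f(1)] v(1) by blast
  obtain y' where y': "y' \<in> N" "w = g y'" using flatD(4) [OF f(1)] v(2) by blast
  have "h (g y) = (y, E y)" "h (g y') = (y', E y')" using f(2) y y' by blast+
  then show ?thesis using eq y y' by simp
qed

lemma flow_open_image:
  assumes "flow \<rho> h" "open O'"
  shows "openin (mtop M) ((\<lambda>v. fst (h v)) ` (cspball I \<rho> \<inter> O'))"
proof -
  obtain N g E where f: "flat N g E \<rho>" "\<forall>y\<in>N. h (g y) = (y, E y)" using assms unfolding flow_def by blast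
  have "(\<lambda>v. fst (h v)) ` (cspball I \<rho> \<inter> O') = {y \<in> N. g y \<in> O'}"
  proof (intro equalityI subsetI)
    fix x assume "x \<in> (\<lambda>v. fst (h v)) ` (cspball I \<rho> \<inter> O')"
    then obtain y where y: "y \<in> N" "g y \<in> O'" "x = fst (h (g y))"
      unfolding flatD(4) [OF f(1), symmetric] by blast
    moreover have "h (g y) = (y, E y)" using f(2) y(1) by blast
    ultimately show "x \<in> {y \<in> N. g y \<in> O'}" by simp
  next
    fix y assume y: "y \<in> {y \<in> N. g y \<in> O'}"
    then have "h (g y) = (y, E y)" using f(2) by blast
    then show "y \<in> (\<lambda>v. fst (h v)) ` (cspball I \<rho> \<inter> O')"
      using y unfolding flatD(4) [OF f(1), symmetric] by (intro image_eqI [of _ _ "g y"]) auto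
  qed
  then show ?thesis using flat_continuous [OF f(1) assms(2)] by simp
qed

lemma flow_preimage:
  assumes "flow \<rho> h" "openin (mtop M) W" "v \<in> cspball I \<rho>" "fst (h v) \<in> W"
  obtains \<epsilon> where "\<epsilon> > 0" "\<And>u. u \<in> cspball I \<epsilon> \<Longrightarrow> v + u \<in> cspball I \<rho> \<and> fst (h (v + u)) \<in> W"
proof -
  obtain N g E where f: "flat N g E \<rho>" "\<forall>y\<in>N. h (g y) = (y, E y)" using assms unfolding flow_def by blast
  have "openin (top_of_set (coord_space I)) (g ` (N \<inter> W))"
    using flatD(5) [OF f(1)] branchD(1) [OF flatD(1) [OF f(1)]] assms(2) by blast
  moreover have "v \<in> g ` (N \<inter> W)"
  proof -
    obtain y where y: "y \<in> N" "v = g y" using flatD(4) [OF f(1)] assms(3) by blast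
    then have "h v = (y, E y)" using f(2) by blast
    then show ?thesis using assms(4) y by auto
  qed
  ultimately obtain \<epsilon> where \<epsilon>: "\<epsilon> > 0" "\<And>u. u \<in> cspball I \<epsilon> \<Longrightarrow> v + u \<in> g ` (N \<inter> W)"
    using openin_coord_contains_ball by metis
  have "v + u \<in> cspball I \<rho> \<and> fst (h (v + u)) \<in> W" if u: "u \<in> cspball I \<epsilon>" for u
  proof -
    obtain y where y: "y \<in> N" "y \<in> W" "v + u = g y" using \<epsilon>(2) [OF u] by blast
    then have "h (v + u) = (y, E y)" using f(2) by metis
    then show ?thesis using y flatD(4) [OF f(1)] by (metis fst_conv imageI)
  qed
  then show ?thesis using that \<epsilon> by blast
qed

text \<open>Recentring: primitives may be changed by the constant \<open>z\<close> without affecting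
  their differentials. The smaller radius lets the new ball fit into the old one.\<close>

lemma flow_translate:
  assumes "flow \<rho> h" "z \<in> cspball I \<rho>" "0 < \<rho>'" "norm z + \<rho>' \<le> \<rho>"
  shows "flow \<rho>' (\<lambda>u. h (z + u))"
proof -
  obtain N g E where f: "flat N g E \<rho>" "\<forall>y\<in>N. h (g y) = (y, E y)" using assms unfolding flow_def by blast
  note fl = flatD [OF f(1)]
  define N' where "N' = {y \<in> N. g y \<in> ball z \<rho>'}"
  define g' where "g' = (\<lambda>y. g y - z)"
  have zc: "z \<in> coord_space I" using assms(2) by (simp add: cspball_def)
  have N'o: "openin (mtop M) N'" unfolding N'_def by (rule flat_continuous [OF f(1)]) simp
  have N'N: "N' \<subseteq> N" by (auto simp: N'_def)
  have "flat N' g' E \<rho>'"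
    unfolding flat_def
  proof (intro conjI allI impI ballI)
    show "branch N' E" by (rule branch_subset [OF fl(1) N'o N'N])
    show "0 < \<rho>'" by fact
    show "inj_on g' N'" using fl(3) by (auto simp: inj_on_def g'_def N'_def)
    show "g' ` N' = cspball I \<rho>'"
    proof (intro equalityI subsetI)
      fix v assume "v \<in> g' ` N'"
      then obtain y where y: "y \<in> N" "g y \<in> ball z \<rho>'" "v = g y - z" by (auto simp: N'_def g'_def)
      then show "v \<in> cspball I \<rho>'"
        using flat_coord [OF f(1)] zc coord_space_closed(3) by (auto simp: cspball_def dist_norm norm_minus_commute)
    next
      fix v assume v: "v \<in> cspball I \<rho>'"
      then have "z + v \<in> cspball I \<rho>"
        using zc assms(4) coord_space_closed(2) norm_triangle_ineq [of z v] by (auto simp: cspball_def)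
      then obtain y where "y \<in> N" "g y = z + v" using fl(4) by (metis imageE)
      then show "v \<in> g' ` N'"
        using v by (intro image_eqI [of _ _ y]) (auto simp: N'_def g'_def dist_norm cspball_def)
    qed
    show "openin (top_of_set (coord_space I)) (g' ` W)" if W: "openin (mtop M) W" "W \<subseteq> N'" for W
    proof -
      obtain T where T: "open T" "g ` W = coord_space I \<inter> T"
        using fl(5) [OF W(1)] W(2) N'N unfolding openin_open by blast
      have "g' ` W = coord_space I \<inter> ((\<lambda>v. v - z) ` T)"
      proof -
        have "g' ` W = (\<lambda>v. v - z) ` (coord_space I \<inter> T)" unfolding T(2) [symmetric] g'_def by blast
        also have "\<dots> = coord_space I \<inter> ((\<lambda>v. v - z) ` T)"
        proof (intro equalityI subsetI)
          fix v assume "v \<in> coord_space I \<inter> ((\<lambda>v. v - z) ` T)"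
          then obtain t where t: "t \<in> T" "v = t - z" "v \<in> coord_space I" by blast
          then have "t \<in> coord_space I" using coord_space_closed(2) [of v I z] zc by simp
          then show "v \<in> (\<lambda>v. v - z) ` (coord_space I \<inter> T)" using t by blast
        qed (use zc coord_space_closed(3) in auto)
        finally show ?thesis .
      qed
      then show ?thesis using open_translation_subtract [OF T(1)] by (auto simp: openin_open)
    qed
    show "hol_at (\<lambda>y. g' y $ k) y" if "y \<in> N'" "k \<in> I" for y k
      unfolding g'_def using that N'N fl(6) by (auto intro!: hol_at_diff)
    show "mgrad (\<lambda>y. g' y $ k) c y a = E y k c a" if *: "c \<in> atlas M" "y \<in> N' \<inter> fst c" "k \<in> I" "a \<in> I" for c y k a
    proof -
      have y: "y \<in> N" "y \<in> fst c" using * N'N by auto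
      show ?thesis
        using mgrad_add [OF fl(6) [OF y(1) *(3)] hol_at_const *(1) y(2), of "- (z $ k)"] fl(7) [OF *(1) y *(3,4)]
        by (simp add: g'_def)
    qed
  qed
  moreover have "\<forall>y\<in>N'. h (z + g' y) = (y, E y)" using f(2) N'N by (auto simp: g'_def)
  ultimately show ?thesis unfolding flow_def by blast
qed

text \<open>The primitives of \<open>z\<close> times the frame are \<open>z\<close> times the old
  ones, so the inverse map has its argument divided by \<open>z\<close>. Roots of unity have norm 1,
  which keeps the ball.\<close>

lemma flow_scale:
  assumes "flow \<rho> h" and z: "z ^ m = 1"
  shows "flow \<rho> (\<lambda>u. act z (h (inverse z *s u)))"
proof -
  obtain N g E where f: "flat N g E \<rho>" "\<forall>y\<in>N. h (g y) = (y, E y)" using assms unfolding flow_def by blast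
  note fl = flatD [OF f(1)]
  have nz: "norm z = 1" using norm_root [OF m_pos z] .
  have z0: "z \<noteq> 0" using nz by auto
  have zz: "inverse z *s (z *s v) = v" "z *s (inverse z *s v) = v" for v :: "complex ^ 'b"
    using z0 by (simp_all add: vec_eq_iff)
  define g' where "g' = (\<lambda>y. z *s g y)"
  define E' where "E' = (\<lambda>y. zmul z (E y))"
  have "flat N g' E' \<rho>"
    unfolding flat_def
  proof (intro conjI allI impI ballI)
    show "branch N E'" unfolding E'_def by (rule branch_scale [OF fl(1) z])
    show "0 < \<rho>" by (rule fl(2))
    show "inj_on g' N"
    proof (rule inj_onI)
      fix x y assume *: "x \<in> N" "y \<in> N" "g' x = g' y"
      then have "g x = g y" using zz(1) unfolding g'_def by metis
      then show "x = y" using fl(3) * by (meson inj_onD)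
    qed
    show "g' ` N = cspball I \<rho>"
    proof -
      have "g' ` N = (\<lambda>v. z *s v) ` cspball I \<rho>" unfolding fl(4) [symmetric] g'_def by blast
      also have "\<dots> = cspball I \<rho>"
      proof (intro equalityI subsetI)
        fix v assume v: "v \<in> cspball I \<rho>"
        then have "inverse z *s v \<in> cspball I \<rho>"
          using nz by (auto simp: cspball_def norm_vec_scale norm_inverse intro: coord_space_closed)
        then show "v \<in> (\<lambda>v. z *s v) ` cspball I \<rho>" using zz(2) by (metis imageI)
      qed (use nz in \<open>auto simp: cspball_def norm_vec_scale intro: coord_space_closed\<close>)
      finally show ?thesis .
    qed
    show "openin (top_of_set (coord_space I)) (g' ` W)" if W: "openin (mtop M) W" "W \<subseteq> N" for W
    proof -
      obtain T where T: "open T" "g ` W = coord_space I \<inter> T"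
        using fl(5) [OF W] unfolding openin_open by blast
      have "g' ` W = (\<lambda>v. z *s v) ` (coord_space I \<inter> T)" unfolding T(2) [symmetric] g'_def by blast
      also have "\<dots> = coord_space I \<inter> ((\<lambda>v. inverse z *s v) -` T)"
      proof (intro equalityI subsetI)
        fix v assume "v \<in> coord_space I \<inter> ((\<lambda>v. inverse z *s v) -` T)"
        then show "v \<in> (\<lambda>v. z *s v) ` (coord_space I \<inter> T)"
          using zz(2) [of v] by (intro image_eqI [of _ _ "inverse z *s v"]) (auto intro: coord_space_closed)
      qed (use zz in \<open>auto intro: coord_space_closed\<close>)
      finally have "g' ` W = coord_space I \<inter> ((\<lambda>v. inverse z *s v) -` T)" .
      moreover have "open ((\<lambda>v. inverse z *s v) -` T)"
      proof (rule open_vimage [OF T(1)])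
        have "bounded_linear (\<lambda>v :: complex ^ 'b. inverse z *s v)"
          unfolding linear_conv_bounded_linear [symmetric]
          by (rule linearI) (auto simp: vec_eq_iff algebra_simps)
        then show "continuous_on UNIV (\<lambda>v :: complex ^ 'b. inverse z *s v)" by (rule linear_continuous_on)
      qed
      ultimately show ?thesis by (auto simp: openin_open)
    qed
    show "hol_at (\<lambda>y. g' y $ k) y" if "y \<in> N" "k \<in> I" for y k
      unfolding g'_def using that fl(6) by (auto intro!: hol_at_mult)
    show "mgrad (\<lambda>y. g' y $ k) c y a = E' y k c a" if *: "c \<in> atlas M" "y \<in> N \<inter> fst c" "k \<in> I" "a \<in> I" for c y k a
    proof -
      have y: "y \<in> N" "y \<in> fst c" using * by auto
      show ?thesis
        using mgrad_mult [OF hol_at_const fl(6) [OF y(1) *(3)] *(1) y(2), of z] fl(7) [OF *(1) y *(3,4)]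
        by (simp add: g'_def E'_def)
    qed
  qed
  moreover have "\<forall>y\<in>N. act z (h (inverse z *s g' y)) = (y, E' y)" using f(2) z0 by (simp add: g'_def E'_def act_def)
  ultimately show ?thesis unfolding flow_def by blast
qed

text \<open>The branches agree near the common centre by \<open>branch_unique\<close>; there the
  difference of the primitives has zero gradient and vanishes at the centre.\<close>

lemma flow_local_unique:
  assumes "flow \<rho> h" "flow \<rho>' h'" "h 0 = h' 0"
  obtains \<epsilon> where "\<epsilon> > 0" "\<And>u. u \<in> cspball I \<epsilon> \<Longrightarrow> h u = h' u"
proof -
  obtain N g E where f: "flat N g E \<rho>" "\<forall>y\<in>N. h (g y) = (y, E y)" using assms unfolding flow_def by blast
  obtain N' g' E' where f': "flat N' g' E' \<rho>'" "\<forall>y\<in>N'. h' (g' y) = (y, E' y)" using assms unfolding flow_def by blast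
  note fl = flatD [OF f(1)] and fl' = flatD [OF f'(1)]
  have "0 \<in> g ` N" "0 \<in> g' ` N'" using fl fl' by (auto simp: cspball_def coord_space_closed)
  then obtain x x' where x: "x \<in> N" "g x = 0" "x' \<in> N'" "g' x' = 0" by force
  have "h (g x) = (x, E x)" "h' (g' x') = (x', E' x')" using f(2) f'(2) x by blast+
  then have xx: "x' = x" "E' x = E x" using assms(3) x by auto
  obtain N0 where N0: "openin (mtop M) N0" "x \<in> N0" "N0 \<subseteq> N \<inter> N'" "\<And>y. y \<in> N0 \<Longrightarrow> E' y = E y"
    by (rule branch_unique [OF fl(1) x(1) fl'(1) x(3) [unfolded xx] xx(2) [symmetric]], rule that) assumption+
  have "\<exists>W. openin (mtop M) W \<and> x \<in> W \<and> W \<subseteq> N0 \<and> (\<forall>y\<in>W. g' y $ k - g y $ k = g' x $ k - g x $ k)" if k: "k \<in> I" for k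
  proof (rule mgrad_zero_locally_const [OF N0(1,2), of "\<lambda>y. g' y $ k - g y $ k"])
    show "hol_at (\<lambda>y. g' y $ k - g y $ k) y" if "y \<in> N0" for y
      using that N0(3) fl(6) fl'(6) k by (intro hol_at_diff) auto
    show "mgrad (\<lambda>y. g' y $ k - g y $ k) c y a = 0" if *: "y \<in> N0" "c \<in> atlas M" "y \<in> fst c" for c y a
    proof (cases "a \<in> I")
      case True
      have y: "y \<in> N" "y \<in> N'" using * N0(3) by auto
      have neg: "mgrad (\<lambda>y. - 1 * g y $ k) c y a = - mgrad (\<lambda>y. g y $ k) c y a"
        using mgrad_mult [OF hol_at_const fl(6) [OF y(1) k] *(2,3), of "-1"] by simp
      have "mgrad (\<lambda>y. g' y $ k + - 1 * g y $ k) c y a = mgrad (\<lambda>y. g' y $ k) c y a + mgrad (\<lambda>y. - 1 * g y $ k) c y a"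
        using mgrad_add [OF fl'(6) [OF y(2) k] hol_at_mult [OF hol_at_const fl(6) [OF y(1) k]] *(2,3), of "-1"] by simp
      also have "\<dots> = 0"
        unfolding neg using fl(7) [OF *(2) y(1) *(3) k True] fl'(7) [OF *(2) y(2) *(3) k True] N0(4) [OF *(1)] by simp
      finally show ?thesis by simp
    qed (simp add: mgrad_outside)
  qed blast
  then obtain W where W: "\<And>k. k \<in> I \<Longrightarrow> openin (mtop M) (W k) \<and> x \<in> W k \<and> W k \<subseteq> N0 \<and>
      (\<forall>y\<in>W k. g' y $ k - g y $ k = g' x $ k - g x $ k)" by metis
  let ?W = "\<Inter>k\<in>I. W k"
  have Wo: "openin (mtop M) ?W" by (rule openin_INT2) (use W I_ne in auto)
  have WN: "?W \<subseteq> N0" using W I_ne by blast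
  have gg: "g' y = g y" if y: "y \<in> ?W" for y
  proof -
    have yN: "y \<in> N" "y \<in> N'" using y WN N0(3) by auto
    have "g' y $ k = g y $ k" for k
    proof (cases "k \<in> I")
      case True
      then have "g' y $ k - g y $ k = g' x $ k - g x $ k" using W [OF True] y by blast
      then show ?thesis using x xx by simp
    next
      case False
      then show ?thesis using flat_coord [OF f(1) yN(1)] flat_coord [OF f'(1) yN(2)] by (simp add: coord_space_def)
    qed
    then show ?thesis by (simp add: vec_eq_iff)
  qed
  have "openin (top_of_set (coord_space I)) (g ` ?W)" using fl(5) [OF Wo] WN N0(3) by blast
  moreover have "0 \<in> g ` ?W" using W x by (metis INT_I imageI)
  ultimately obtain \<epsilon> where \<epsilon>: "\<epsilon> > 0" "\<And>u. u \<in> cspball I \<epsilon> \<Longrightarrow> 0 + u \<in> g ` ?W"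
    using openin_coord_contains_ball by metis
  have "h u = h' u" if "u \<in> cspball I \<epsilon>" for u
  proof -
    obtain y where y: "y \<in> ?W" "u = g y" using \<epsilon>(2) [OF \<open>u \<in> cspball I \<epsilon>\<close>] by auto
    have y0: "y \<in> N0" using y(1) WN by blast
    have "h u = (y, E y)" using f(2) y0 N0(3) y(2) by blast
    moreover have "h' u = (y, E' y)" using f'(2) y0 N0(3) y(2) gg [OF y(1)] by force
    ultimately show ?thesis using N0(4) [OF y0] by simp
  qed
  then show ?thesis using that \<epsilon>(1) by blast
qed

text \<open>
  Closed multivalued frames give \<open>Q\<close> a flat structure; its covering \<open>Y\<close> carries local translations,
  which by compactness can be concatenated to translations by arbitrary vectors.
\<close>

lemma cspball_neg: "v \<in> cspball I r \<Longrightarrow> - v \<in> cspball I r"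
  by (auto simp: cspball_def coord_space_def)

lemma cspball_root:
  assumes "v \<in> cspball I r" "z ^ m = 1"
  shows "z *s v \<in> cspball I r" "inverse z *s v \<in> cspball I r"
  using assms norm_root [OF m_pos assms(2)]
  by (auto simp: cspball_def norm_vec_scale norm_inverse intro: coord_space_closed)

lemma fst_Y: "y \<in> Y \<Longrightarrow> fst y \<in> Q"
  by (auto simp: Y_def)

text \<open>On the segment from 0 to \<open>u\<close>, agreement of the two flows is an open
  condition by local uniqueness. Disagreement is open as well: either the base points differ and are
  separated by the Hausdorff property, or the values lie on different sheets over one point and the
  free action keeps them apart.\<close>

lemma flow_unique:
  assumes h: "flow \<rho> h" and h': "flow \<rho>' h'" and eq: "h 0 = h' 0"
    and u: "u \<in> cspball I \<rho>" "u \<in> cspball I \<rho>'"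
  shows "h u = h' u"
proof -
  define P where "P = (\<lambda>t::real. h (t *\<^sub>R u) = h' (t *\<^sub>R u))"
  have uc: "u \<in> coord_space I" using u by (simp add: cspball_def)
  have loc: "\<exists>\<epsilon>>0. \<forall>s\<in>cspball I \<epsilon>. (h (t *\<^sub>R u + s) = h' (t *\<^sub>R u + s)) = P t" if t: "t \<in> {0..1}" for t
  proof -
    define v where "v = t *\<^sub>R u"
    have nv: "norm v \<le> norm u" using t by (simp add: v_def mult_left_le_one_le)
    then have v: "v \<in> cspball I \<rho>" "v \<in> cspball I \<rho>'"
      using u uc by (auto simp: cspball_def v_def intro: coord_space_closed)
    define r where "r = min (\<rho> - norm v) (\<rho>' - norm v)"
    have r: "0 < r" "norm v + r \<le> \<rho>" "norm v + r \<le> \<rho>'" using v by (auto simp: r_def cspball_def)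
    note h1 = flow_translate [OF h v(1) r(1,2)] and h1' = flow_translate [OF h' v(2) r(1,3)]
    have z0: "0 \<in> cspball I r" using r by (simp add: cspball_def coord_space_closed)
    show ?thesis
    proof (cases "h v = h' v")
      case True
      then obtain \<epsilon> where "\<epsilon> > 0" "\<And>s. s \<in> cspball I \<epsilon> \<Longrightarrow> h (v + s) = h' (v + s)"
        using flow_local_unique [OF h1 h1'] by (metis add.right_neutral)
      then show ?thesis using True unfolding P_def v_def by blast
    next
      case False
      show ?thesis
      proof (cases "fst (h v) = fst (h' v)")
        case False
        have "fst (h v) \<in> X" "fst (h' v) \<in> X"
          using subsetD [OF comp_of_sub fst_Y [OF flow_Y [OF h v(1)]]] subsetD [OF comp_of_sub fst_Y [OF flow_Y [OF h' v(2)]]]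
          by blast+
        moreover have "Hausdorff_space (mtop M)" using cm unfolding complex_manifold_def by blast
        ultimately obtain W W' where W: "openin (mtop M) W" "openin (mtop M) W'" "fst (h v) \<in> W" "fst (h' v) \<in> W'" "disjnt W W'"
          using False unfolding Hausdorff_space_def by blast
        obtain \<epsilon>1 where 1: "\<epsilon>1 > 0" "\<And>s. s \<in> cspball I \<epsilon>1 \<Longrightarrow> v + s \<in> cspball I \<rho> \<and> fst (h (v + s)) \<in> W"
          by (rule flow_preimage [OF h W(1) v(1) W(3)], rule that) assumption+
        obtain \<epsilon>2 where 2: "\<epsilon>2 > 0" "\<And>s. s \<in> cspball I \<epsilon>2 \<Longrightarrow> v + s \<in> cspball I \<rho>' \<and> fst (h' (v + s)) \<in> W'"
          by (rule flow_preimage [OF h' W(2) v(2) W(4)], rule that) assumption+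
        have "h (v + s) \<noteq> h' (v + s)" if "s \<in> cspball I (min \<epsilon>1 \<epsilon>2)" for s
        proof -
          have "s \<in> cspball I \<epsilon>1" "s \<in> cspball I \<epsilon>2" using that by (auto simp: cspball_def)
          then show ?thesis using 1(2) 2(2) W(5) unfolding disjnt_def by (metis IntI empty_iff)
        qed
        moreover have "min \<epsilon>1 \<epsilon>2 > 0" using 1 2 by simp
        moreover have "\<not> P t" using \<open>h v \<noteq> h' v\<close> by (simp add: P_def v_def)
        ultimately show ?thesis unfolding v_def by blast
      next
        case True
        obtain z where z: "z ^ m = 1" "h' v = act z (h v)"
          by (rule same_fibre [OF flow_Y [OF h v(1)] flow_Y [OF h' v(2)] True], rule that) assumption+
        have z1: "z \<noteq> 1" using z(2) False by auto
        have zn: "z \<noteq> 0" using z(1) m_pos by (auto simp: power_0_left)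
        note k = flow_scale [OF h1 z(1)]
        obtain \<epsilon> where \<epsilon>: "\<epsilon> > 0" "\<And>s. s \<in> cspball I \<epsilon> \<Longrightarrow> act z (h (v + inverse z *s s)) = h' (v + s)"
          by (rule flow_local_unique [OF k h1'], simp add: z(2), rule that) assumption+
        \<comment> \<open>Near \<open>v\<close> the second flow is the first one rotated by
          \<open>z\<close>. At a common value, injectivity on the base forces \<open>s\<close> to be
          fixed by the rotation, and then \<open>z\<close> fixes a point of
          \<open>Y\<close>.\<close>
        have "h (v + s) \<noteq> h' (v + s)" if s: "s \<in> cspball I (min \<epsilon> r)" for s
        proof
          assume e: "h (v + s) = h' (v + s)"
          have s': "s \<in> cspball I \<epsilon>" "s \<in> cspball I r" using s by (auto simp: cspball_def)
          have a: "h (v + s) = act z (h (v + inverse z *s s))" using \<epsilon>(2) [OF s'(1)] e by simp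
          then have "fst (h (v + s)) = fst (h (v + inverse z *s s))" by simp
          then have "s = inverse z *s s"
            using flow_inj [OF h1 s'(2) cspball_root(2) [OF s'(2) z(1)]] by simp
          then have "h (v + s) = act z (h (v + s))" using a by simp
          moreover have "h (v + s) \<in> Y" using flow_Y [OF h1 s'(2)] by simp
          ultimately show False using act_free [of "h (v + s)" z] z1 by simp
        qed
        moreover have "min \<epsilon> r > 0" using \<epsilon> r by simp
        moreover have "\<not> P t" using False by (simp add: P_def v_def)
        ultimately show ?thesis unfolding v_def by blast
      qed
    qed
  qed
  have "P 1"
  proof (rule connected_induction_simple [of "{0..1::real}" 0 1 P])
    show "P 0" using eq by (simp add: P_def)
    fix t :: real assume t: "t \<in> {0..1}"
    obtain \<epsilon> where \<epsilon>: "\<epsilon> > 0" "\<And>s. s \<in> cspball I \<epsilon> \<Longrightarrow> (h (t *\<^sub>R u + s) = h' (t *\<^sub>R u + s)) = P t"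
      using loc [OF t] by blast
    define \<delta> where "\<delta> = \<epsilon> / (norm u + 1)"
    have n1: "norm u + 1 > 0" using norm_ge_zero [of u] by linarith
    have \<delta>: "\<delta> > 0" using \<epsilon>(1) n1 by (simp add: \<delta>_def)
    have Pt: "P t' = P t" if t': "t' \<in> ball t \<delta>" for t'
    proof -
      have "\<bar>t' - t\<bar> * norm u \<le> \<bar>t' - t\<bar> * (norm u + 1)" by (simp add: mult_left_mono)
      also have "\<dots> < \<delta> * (norm u + 1)"
        using t' n1 by (intro mult_strict_right_mono) (auto simp: dist_real_def)
      also have "\<dots> = \<epsilon>" using n1 by (simp add: \<delta>_def)
      finally have "(t' - t) *\<^sub>R u \<in> cspball I \<epsilon>" using uc by (auto simp: cspball_def intro: coord_space_closed)
      from \<epsilon>(2) [OF this] show ?thesis by (simp add: P_def algebra_simps)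
    qed
    show "\<exists>T. openin (top_of_set {0..1}) T \<and> t \<in> T \<and> (\<forall>x\<in>T. \<forall>y\<in>T. P x \<longrightarrow> P y)"
    proof (intro exI [of _ "{0..1} \<inter> ball t \<delta>"] conjI ballI impI)
      show "openin (top_of_set {0..1}) ({0..1} \<inter> ball t \<delta>)" by (rule openin_open_Int) simp
      show "t \<in> {0..1} \<inter> ball t \<delta>" using t \<delta> by simp
      show "P y" if "x \<in> {0..1} \<inter> ball t \<delta>" "y \<in> {0..1} \<inter> ball t \<delta>" "P x" for x y
        using Pt [of x] Pt [of y] that by blast
    qed
  qed auto
  then show ?thesis by (simp add: P_def)
qed

text \<open>By compactness finitely many flow domains of half size cover \<open>Q\<close>.
  Recentring at a point of a half-size domain leaves half the radius, and scaling by roots of unity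
  reaches the other sheets.\<close>

lemma uniform_radius: "\<exists>r>0. \<forall>y\<in>Y. \<exists>h. flow r h \<and> h 0 = y"
proof -
  have pt: "\<forall>x\<in>Q. \<exists>\<rho> h. \<rho> > 0 \<and> flow \<rho> h \<and> fst (h 0) = x"
  proof
    fix x assume x: "x \<in> Q"
    then obtain e where "e \<in> Fr x" using Fr_ne by blast
    then have "(x, e) \<in> Y" using x by (simp add: Y_def)
    then show "\<exists>\<rho> h. \<rho> > 0 \<and> flow \<rho> h \<and> fst (h 0) = x" using flow_exists by (metis fst_conv)
  qed
  then obtain \<rho> h where H: "\<And>x. x \<in> Q \<Longrightarrow> \<rho> x > 0 \<and> flow (\<rho> x) (h x) \<and> fst (h x 0) = x" by metis
  define O' where "O' = (\<lambda>x. (\<lambda>v. fst (h x v)) ` (cspball I (\<rho> x) \<inter> ball 0 (\<rho> x / 2)))"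
  have Oo: "openin (mtop M) (O' x)" if "x \<in> Q" for x
    unfolding O'_def using H [OF that] by (intro flow_open_image) auto
  have xO: "x \<in> O' x" if "x \<in> Q" for x
    unfolding O'_def using H [OF that]
    by (intro image_eqI [of _ _ 0]) (auto simp: cspball_def coord_space_closed)
  have "compactin (mtop M) Q"
    using closedin_compact_space [OF cpt] by (simp add: comp_of_def closedin_connected_component_of)
  moreover have "Q \<subseteq> \<Union>(O' ` Q)" using xO by blast
  moreover have "\<forall>U\<in>O' ` Q. openin (mtop M) U" using Oo by blast
  ultimately obtain F where F: "finite F" "F \<subseteq> O' ` Q" "Q \<subseteq> \<Union>F"
    unfolding compactin_def by meson
  obtain S where S: "S \<subseteq> Q" "finite S" "F = O' ` S" using finite_subset_image [OF F(1,2)] by blast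
  have Sne: "S \<noteq> {}" using F(3) S(3) comp_of_self [OF pX] by blast
  define r where "r = Min (\<rho> ` S) / 2"
  have r0: "r > 0" using S Sne H by (auto simp: r_def)
  have rle: "r \<le> \<rho> x / 2" if "x \<in> S" for x using S that by (simp add: r_def)
  have "\<exists>h. flow r h \<and> h 0 = y" if y: "y \<in> Y" for y
  proof -
    have "fst y \<in> Q" using y by (auto simp: Y_def)
    then obtain x where x: "x \<in> S" "fst y \<in> O' x" using F(3) S(3) by blast
    then obtain v where v: "v \<in> cspball I (\<rho> x)" "norm v < \<rho> x / 2" "fst y = fst (h x v)"
      by (auto simp: O'_def)
    have Hx: "flow (\<rho> x) (h x)" using H x S by blast
    have nr: "norm v + r \<le> \<rho> x" using v(2) rle [OF x(1)] by linarith
    obtain z where z: "z ^ m = 1" "y = act z (h x v)"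
      by (rule same_fibre [OF flow_Y [OF Hx v(1)] y v(3) [symmetric]], rule that) assumption+
    from flow_scale [OF flow_translate [OF Hx v(1) r0 nr] z(1)]
    show ?thesis using z(2) by (intro exI [of _ "\<lambda>u. act z (h x (v + inverse z *s u))"]) simp
  qed
  then show ?thesis using r0 by blast
qed

section \<open>Small translations of the covering and their concatenations\<close>

definition rad :: real where
  "rad = (SOME r. r > 0 \<and> (\<forall>y\<in>Y. \<exists>h. flow r h \<and> h 0 = y))"

lemma rad: "rad > 0" "y \<in> Y \<Longrightarrow> \<exists>h. flow rad h \<and> h 0 = y"
proof -
  have "\<exists>r. r > 0 \<and> (\<forall>y\<in>Y. \<exists>h. flow r h \<and> h 0 = y)" using uniform_radius by blast
  from someI_ex [OF this] show "rad > 0" "y \<in> Y \<Longrightarrow> \<exists>h. flow rad h \<and> h 0 = y"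
    unfolding rad_def by blast+
qed

text \<open>The point whose flat coordinates relative to \<open>y\<close> are \<open>v\<close>,
  meaningful for \<open>v\<close> in the ball of radius \<open>rad\<close>. By
  \<open>flow_unique\<close> the chosen flow is determined on that ball.\<close>

definition T :: "complex ^ 'b \<Rightarrow> 'a \<times> ('a, 'b) coframe \<Rightarrow> 'a \<times> ('a, 'b) coframe" where
  "T v y = (SOME h. flow rad h \<and> h 0 = y) v"

lemma T_flow: "y \<in> Y \<Longrightarrow> flow rad (\<lambda>v. T v y)" "y \<in> Y \<Longrightarrow> T 0 y = y"
proof -
  assume "y \<in> Y"
  from someI_ex [OF rad(2) [OF this]]
  show "flow rad (\<lambda>v. T v y)" "T 0 y = y" unfolding T_def by simp_all
qed

lemma T_eq:
  assumes "flow \<rho> h" "v \<in> cspball I \<rho>" "v \<in> cspball I rad" "h 0 \<in> Y"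
  shows "T v (h 0) = h v"
  using flow_unique [OF T_flow(1) [OF assms(4)] assms(1) _ assms(3,2)] T_flow(2) [OF assms(4)] by simp

lemma T_Y: "y \<in> Y \<Longrightarrow> v \<in> cspball I rad \<Longrightarrow> T v y \<in> Y"
  by (rule flow_Y [OF T_flow(1)])

lemma T_add:
  assumes y: "y \<in> Y" and vw: "v \<in> coord_space I" "w \<in> coord_space I" "norm v + norm w < rad"
  shows "T w (T v y) = T (v + w) y"
proof -
  have "norm v < rad" "norm w < rad" using vw(3) norm_ge_zero [of v] norm_ge_zero [of w] by linarith+
  then have v: "v \<in> cspball I rad" "w \<in> cspball I rad"
    using vw by (auto simp: cspball_def)
  have "flow (rad - norm v) (\<lambda>u. T (v + u) y)"
    by (rule flow_translate [OF T_flow(1) [OF y] v(1)]) (use v in \<open>auto simp: cspball_def\<close>)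
  from T_eq [OF this _ v(2)] show ?thesis using T_Y [OF y v(1)] vw by (simp add: cspball_def)
qed

text \<open>Flat coordinates rotate with the sheet. Roots of unity and translations therefore
  compose like affine maps with scalar linear part.\<close>

lemma T_act:
  assumes y: "y \<in> Y" and z: "z ^ m = 1" and v: "v \<in> cspball I rad"
  shows "T (z *s v) (act z y) = act z (T v y)"
proof -
  have z0: "z \<noteq> 0" using z m_pos by (auto simp: power_0_left)
  define k where "k = (\<lambda>u. act z (T (inverse z *s u) y))"
  have k: "flow rad k" unfolding k_def by (rule flow_scale [OF T_flow(1) [OF y] z])
  have "inverse z *s (0 :: complex ^ 'b) = 0" by (simp add: vec_eq_iff)
  then have k0: "k 0 = act z y" unfolding k_def by (simp only: T_flow(2) [OF y])
  have "inverse z *s (z *s v) = v" using z0 by (simp add: vec_eq_iff)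
  then have kv: "k (z *s v) = act z (T v y)" unfolding k_def by (simp only:)
  have "T (z *s v) (k 0) = k (z *s v)"
    by (rule T_eq [OF k cspball_root(1) [OF v z] cspball_root(1) [OF v z]]) (simp only: k0 act_Y [OF z y])
  then show ?thesis unfolding k0 kv .
qed

text \<open>Half the uniform radius: any two such translations can be merged into one by
  \<open>T_add\<close>, and hence they commute.\<close>

abbreviation "small \<equiv> cspball I (rad / 2)"

lemma small: "v \<in> small \<Longrightarrow> v \<in> cspball I rad" "v \<in> small \<Longrightarrow> v \<in> coord_space I"
  using rad(1) by (auto simp: cspball_def)

lemma small_add: "y \<in> Y \<Longrightarrow> v \<in> small \<Longrightarrow> w \<in> small \<Longrightarrow> T w (T v y) = T (v + w) y"
  by (rule T_add) (auto simp: cspball_def)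

text \<open>\<open>T\<close> is controlled for short vectors only; a translation by a long vector is
  written as a list of small vectors with that sum.\<close>

definition translate :: "(complex ^ 'b) list \<Rightarrow> 'a \<times> ('a, 'b) coframe \<Rightarrow> 'a \<times> ('a, 'b) coframe" where
  "translate vs = fold T vs"

lemma translate_simps [simp]: "translate [] y = y" "translate (v # vs) y = translate vs (T v y)" "translate (vs @ ws) y = translate ws (translate vs y)"
  by (simp_all add: translate_def)

lemma translate_Y: "y \<in> Y \<Longrightarrow> set vs \<subseteq> small \<Longrightarrow> translate vs y \<in> Y"
proof (induction vs arbitrary: y)
  case (Cons v vs)
  then have "T v y \<in> Y" by (intro T_Y small) auto
  then show ?case using Cons by simp
qed simp

lemma translate_T_comm: "y \<in> Y \<Longrightarrow> set vs \<subseteq> small \<Longrightarrow> w \<in> small \<Longrightarrow> translate vs (T w y) = T w (translate vs y)"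
proof (induction vs arbitrary: y)
  case (Cons v vs)
  have "T v (T w y) = T w (T v y)" using Cons.prems by (simp add: small_add add.commute)
  then show ?case using Cons T_Y small by simp
qed simp

lemma translate_comm: "y \<in> Y \<Longrightarrow> set vs \<subseteq> small \<Longrightarrow> set ws \<subseteq> small \<Longrightarrow> translate vs (translate ws y) = translate ws (translate vs y)"
proof (induction ws arbitrary: y)
  case (Cons w ws)
  have w: "w \<in> small" "set ws \<subseteq> small" using Cons.prems by auto
  have Tw: "T w y \<in> Y" using Cons.prems(1) w by (intro T_Y small)
  have "translate vs (translate ws (T w y)) = translate ws (translate vs (T w y))" by (rule Cons.IH [OF Tw Cons.prems(2) w(2)])
  then show ?case by (simp only: translate_simps translate_T_comm [OF Cons.prems(1,2) w(1)])
qed simp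

lemma translate_act: "y \<in> Y \<Longrightarrow> z ^ m = 1 \<Longrightarrow> set vs \<subseteq> small \<Longrightarrow> translate (map ((*s) z) vs) (act z y) = act z (translate vs y)"
  by (induction vs arbitrary: y) (auto simp: T_act small T_Y)

lemma translate_inverse: "y \<in> Y \<Longrightarrow> set vs \<subseteq> small \<Longrightarrow> translate (rev (map uminus vs)) (translate vs y) = y"
proof (induction vs arbitrary: y)
  case (Cons v vs)
  have "translate (rev (map uminus vs)) (translate vs (T v y)) = T v y" using Cons T_Y small by simp
  moreover have "T (- v) (T v y) = y"
    using small_add [of y v "- v"] cspball_neg [of v "rad / 2"] Cons.prems T_flow(2) by simp
  ultimately show ?case by simp
qed simp

lemma translate_replicate_T:
  assumes w: "w \<in> coord_space I" and y: "y \<in> Y"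
  shows "real n * norm w < rad \<Longrightarrow> translate (replicate n w) y = T (of_nat n *s w) y"
  using y
proof (induction n arbitrary: y)
  case (Suc n)
  have n: "real n * norm w + norm w < rad" using Suc.prems(1) by (simp add: algebra_simps)
  then have "real n * norm w < rad" "norm w < rad" using norm_ge_zero [of w] by (smt (verit) mult_nonneg_nonneg of_nat_0_le_iff)+
  then have "translate (replicate (Suc n) w) y = T (of_nat n *s w) (T w y)"
    using Suc w by (simp add: T_Y cspball_def)
  also have "\<dots> = T (w + of_nat n *s w) y"
    using n w Suc.prems(2) by (intro T_add) (auto simp: norm_vec_scale intro: coord_space_closed)
  also have "w + of_nat n *s w = of_nat (Suc n) *s w" by (simp add: vec_eq_iff algebra_simps)
  finally show ?case .
qed (simp add: T_flow)

text \<open>Only single steps \<open>a\<close> and \<open>b\<close> are merged, after commuting them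
  next to each other; the total vectors may exceed the range of \<open>T\<close>.\<close>

lemma translate_replicate_add:
  assumes a: "a \<in> small" and b: "b \<in> small" and ab: "a + b \<in> small" and y: "y \<in> Y"
  shows "translate (replicate n a) (translate (replicate n b) y) = translate (replicate n (a + b)) y"
  using y
proof (induction n arbitrary: y)
  case (Suc n)
  have Tb: "T b y \<in> Y" using Suc.prems b T_Y small by blast
  have "translate (replicate (Suc n) a) (translate (replicate (Suc n) b) y) = translate (replicate n a) (T a (translate (replicate n b) (T b y)))"
    by simp
  also have "T a (translate (replicate n b) (T b y)) = translate (replicate n b) (T a (T b y))"
    using Tb a b by (intro translate_T_comm [symmetric]) auto
  also have "T a (T b y) = T (a + b) y" using small_add [OF Suc.prems b a] by (simp add: add.commute)
  also have "translate (replicate n a) (translate (replicate n b) (T (a + b) y)) = translate (replicate n (a + b)) (T (a + b) y)"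
    using Suc ab T_Y small by blast
  finally show ?case by simp
qed simp

text \<open>
  An affine map \<open>w \<mapsto> z w + v\<close> with \<open>z \<noteq> 1\<close> has the fixed point \<open>v/(1 - z)\<close>. A point over which two
  different sheets of \<open>Y\<close> lie in the same orbit would produce a fixed point of the free action of \<open>z\<close>.
\<close>

lemma translate_fixed_point:
  assumes z: "z ^ m = 1" "z \<noteq> 1"
  shows "set vs \<subseteq> small \<Longrightarrow> \<exists>ws. set ws \<subseteq> small \<and> (\<forall>y\<in>Y. translate (map ((*s) z) ws) (translate vs y) = translate ws y)"
proof (induction vs)
  case Nil
  show ?case by (intro exI [of _ "[]"]) simp
next
  case (Cons v vs)
  then obtain ws' where ws': "set ws' \<subseteq> small" "\<And>y. y \<in> Y \<Longrightarrow> translate (map ((*s) z) ws') (translate vs y) = translate ws' y" by auto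
  have vs: "v \<in> small" "set vs \<subseteq> small" using Cons.prems by auto
  have nz: "norm z = 1" by (rule norm_root [OF m_pos z(1)])
  have "norm (1 - z) > 0" using z by simp
  \<comment> \<open>The fixed point \<open>v / (1 - z)\<close> may be long. With this
    \<open>N\<close> its \<open>N\<close>-th part \<open>w\<close> is no longer than
    \<open>v\<close>, hence small.\<close>
  then obtain N where N: "real N * norm (1 - z) > 1" using ex_less_of_nat_mult by blast
  have N0: "N > 0" using N by (cases N) auto
  have N1: "1 \<le> real N" using N0 by simp
  define w where "w = (1 / (of_nat N * (1 - z))) *s v"
  have nw: "norm w \<le> norm v"
  proof -
    have "norm w = norm v / (real N * norm (1 - z))" by (simp add: w_def norm_vec_scale norm_divide norm_mult)
    also have "\<dots> \<le> norm v / 1" using N by (intro divide_left_mono) auto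
    finally show ?thesis by simp
  qed
  have wz: "(1 - z) *s w = (1 / of_nat N) *s v" using z N0 by (simp add: w_def vec_eq_iff)
  have wc: "w \<in> coord_space I" using small(2) [OF vs(1)] by (simp add: w_def coord_space_closed)
  have ws: "w \<in> small" using nw vs wc by (auto simp: cspball_def)
  have zw: "z *s w \<in> small" by (rule cspball_root(1) [OF ws z(1)])
  have "norm ((1 - z) *s w) \<le> norm v"
    unfolding wz norm_vec_scale using N1 by (simp add: norm_divide divide_le_eq mult_le_cancel_left1)
  then have zw': "(1 - z) *s w \<in> small" using vs wc by (auto simp: cspball_def intro: coord_space_closed)
  have sum: "z *s w + (1 - z) *s w = w" by (simp add: vec_eq_iff algebra_simps)
  \<comment> \<open>The step \<open>v\<close> is split into \<open>N\<close> steps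
    \<open>(1 - z) w\<close>; each is completed by a step \<open>z w\<close> to a step
    \<open>w\<close>. The induction hypothesis takes care of the remaining list.\<close>
  have "translate (map ((*s) z) (replicate N w @ ws')) (translate (v # vs) y) = translate (replicate N w @ ws') y" if y: "y \<in> Y" for y
  proof -
    have Tv: "T v y \<in> Y" using y vs T_Y small by blast
    have rep: "set (replicate N (z *s w)) \<subseteq> small" using zw by auto
    have "T v y = T (of_nat N *s ((1 - z) *s w)) y" unfolding wz using N0 by simp
    also have "\<dots> = translate (replicate N ((1 - z) *s w)) y"
    proof (rule translate_replicate_T [symmetric])
      show "real N * norm ((1 - z) *s w) < rad"
        unfolding wz norm_vec_scale using vs(1) N0 rad(1) by (simp add: norm_divide cspball_def)
    qed (use zw' small y in auto)
    finally have Tveq: "T v y = translate (replicate N ((1 - z) *s w)) y" .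
    have "translate (map ((*s) z) (replicate N w @ ws')) (translate (v # vs) y) =
        translate (map ((*s) z) ws') (translate (replicate N (z *s w)) (translate vs (T v y)))" by (simp add: map_replicate)
    also have "translate (replicate N (z *s w)) (translate vs (T v y)) = translate vs (translate (replicate N (z *s w)) (T v y))"
      by (rule translate_comm [OF Tv rep vs(2)])
    also have "translate (map ((*s) z) ws') \<dots> = translate ws' (translate (replicate N (z *s w)) (T v y))"
      by (rule ws'(2) [OF translate_Y [OF Tv rep]])
    also have "translate (replicate N (z *s w)) (T v y) = translate (replicate N w) y"
      unfolding Tveq translate_replicate_add [OF zw zw' _ y, unfolded sum, OF ws] by (rule refl)
    finally show ?thesis by simp
  qed
  moreover have "set (replicate N w @ ws') \<subseteq> small" using ws ws' by auto
  ultimately show ?case by blast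
qed

section \<open>A translation orbit as a single-valued section of the covering\<close>

lemma orbit_sheet:
  assumes y: "y \<in> Y" and vs: "set vs \<subseteq> small" and z: "z ^ m = 1" and eq: "act z y = translate vs y"
  shows "z = 1"
proof (rule ccontr)
  assume z1: "z \<noteq> 1"
  obtain ws where ws: "set ws \<subseteq> small" "\<And>y. y \<in> Y \<Longrightarrow> translate (map ((*s) z) ws) (translate vs y) = translate ws y"
    using translate_fixed_point [OF z z1 vs] by blast
  have "act z (translate ws y) = translate (map ((*s) z) ws) (act z y)" by (rule translate_act [OF y z ws(1), symmetric])
  also have "\<dots> = translate ws y" unfolding eq by (rule ws(2) [OF y])
  finally show False using act_free [OF translate_Y [OF y ws(1)]] z1 by blast
qed

text \<open>The translation orbit \<open>R\<close> of one point of \<open>Y\<close> meets every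
  fibre because \<open>Q\<close> is connected, and meets it only once by \<open>orbit_sheet\<close>.
  So it is the graph of a single-valued frame.\<close>

lemma frame_if_flat: "\<exists>e. frame_on Q e"
proof -
  obtain e0 where e0: "e0 \<in> Fr p" using Fr_ne comp_of_self [OF pX] by blast
  define y0 where "y0 = (p, e0)"
  have y0: "y0 \<in> Y" using e0 comp_of_self [OF pX] by (simp add: y0_def Y_def)
  define R where "R = {translate vs y0 |vs. set vs \<subseteq> small}"
  have RY: "y \<in> Y" if "y \<in> R" for y using that translate_Y [OF y0] by (auto simp: R_def)
  have RT: "T v y \<in> R" if yR: "y \<in> R" and v: "v \<in> small" for y v
  proof -
    obtain vs where vs: "set vs \<subseteq> small" "y = translate vs y0" using yR unfolding R_def by blast
    then have "T v y = translate (vs @ [v]) y0" by simp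
    then show ?thesis using vs v unfolding R_def by (intro CollectI exI [of _ "vs @ [v]"]) auto
  qed
  have Runique: "z = 1" if yR: "y \<in> R" and ayR: "act z y \<in> R" and z: "z ^ m = 1" for y z
  proof -
    obtain vs where vs: "set vs \<subseteq> small" "y = translate vs y0" using yR unfolding R_def by blast
    obtain us where us: "set us \<subseteq> small" "act z y = translate us y0" using ayR unfolding R_def by blast
    \<comment> \<open>The path goes back from \<open>y\<close> to the base point \<open>y0\<close>
      and out again to \<open>act z y\<close>.\<close>
    have "act z y = translate (rev (map uminus vs) @ us) y" using us(2) vs translate_inverse [OF y0 vs(1)] by simp
    moreover have "set (rev (map uminus vs) @ us) \<subseteq> small" using vs us cspball_neg by auto
    ultimately show ?thesis using orbit_sheet [OF RY [OF yR] _ z] by blast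
  qed
  have nb: "openin (mtop M) ((\<lambda>v. fst (T v y)) ` small)" "fst y \<in> (\<lambda>v. fst (T v y)) ` small" if "y \<in> Y" for y
  proof -
    have "small = cspball I rad \<inter> ball 0 (rad / 2)" using rad(1) by (auto simp: cspball_def)
    then show "openin (mtop M) ((\<lambda>v. fst (T v y)) ` small)"
      using flow_open_image [OF T_flow(1) [OF that] open_ball] by simp
    show "fst y \<in> (\<lambda>v. fst (T v y)) ` small"
      by (rule image_eqI [of _ _ 0]) (use T_flow(2) [OF that] rad(1) in \<open>auto simp: cspball_def coord_space_closed\<close>)
  qed
  have onto: "\<exists>e. (x, e) \<in> R" if x: "x \<in> Q" for x
  proof -
    have "(\<exists>e. (p, e) \<in> R) = (\<exists>e. (x, e) \<in> R)"
    proof (rule comp_of_local_const [of p "\<lambda>x. \<exists>e. (x, e) \<in> R", OF _ comp_of_self [OF pX] x])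
      fix x assume x: "x \<in> Q"
      obtain e1 where "e1 \<in> Fr x" using Fr_ne [OF x] by blast
      then have y: "(x, e1) \<in> Y" using x by (simp add: Y_def)
      \<comment> \<open>The sheet \<open>e1\<close> is arbitrary and need not belong to
        \<open>R\<close>. A point of \<open>R\<close> over \<open>x\<close> or \<open>x'\<close>
        differs from it or from its translate by a root \<open>z\<close>; rotating the vector by
        \<open>z\<close> moves the translation to the right sheet.\<close>
      have "(\<exists>e. (x', e) \<in> R) = (\<exists>e. (x, e) \<in> R)" if x': "x' \<in> (\<lambda>v. fst (T v (x, e1))) ` small" for x'
      proof -
        obtain v where v: "v \<in> small" "x' = fst (T v (x, e1))" using x' by blast
        have TY: "T v (x, e1) \<in> Y" using T_Y [OF y small(1) [OF v(1)]] .
        show ?thesis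
        proof
          assume "\<exists>e. (x', e) \<in> R"
          then obtain e where e: "(x', e) \<in> R" by blast
          obtain z where z: "z ^ m = 1" "(x', e) = act z (T v (x, e1))"
            by (rule same_fibre [OF TY RY [OF e]]) (use v in auto)
          have "(x', e) = T (z *s v) (act z (x, e1))"
            using T_act [OF y z(1) small(1) [OF v(1)]] z(2) by simp
          then have "T (- (z *s v)) (x', e) = act z (x, e1)"
            using translate_inverse [OF act_Y [OF z(1) y], of "[z *s v]"] cspball_root(1) [OF v(1) z(1)] by simp
          moreover have "T (- (z *s v)) (x', e) \<in> R"
            by (rule RT [OF e cspball_neg [OF cspball_root(1) [OF v(1) z(1)]]])
          ultimately show "\<exists>e. (x, e) \<in> R" by (auto simp: act_def)
        next
          assume "\<exists>e. (x, e) \<in> R"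
          then obtain e where e: "(x, e) \<in> R" by blast
          obtain z where z: "z ^ m = 1" "(x, e) = act z (x, e1)"
            by (rule same_fibre [OF y RY [OF e]]) auto
          have "T (z *s v) (x, e) = act z (T v (x, e1))"
            using T_act [OF y z(1) small(1) [OF v(1)]] z(2) by simp
          moreover have "T (z *s v) (x, e) \<in> R"
            by (rule RT [OF e cspball_root(1) [OF v(1) z(1)]])
          ultimately have "act z (T v (x, e1)) \<in> R" by simp
          then show "\<exists>e. (x', e) \<in> R" using v(2) by (auto simp: act_def)
        qed
      qed
      then show "\<exists>N. openin (mtop M) N \<and> x \<in> N \<and> (\<forall>x'\<in>N. (\<exists>e. (x', e) \<in> R) = (\<exists>e. (x, e) \<in> R))"
        using nb [OF y] by (metis fst_conv)
    qed
    moreover have "(p, e0) \<in> R" using y0_def by (auto simp: R_def intro!: exI [of _ "[]"])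
    ultimately show ?thesis by blast
  qed
  define \<sigma> where "\<sigma> = (\<lambda>x. SOME e. (x, e) \<in> R)"
  have \<sigma>: "(x, \<sigma> x) \<in> R" if "x \<in> Q" for x
    unfolding \<sigma>_def using onto [OF that] by (rule someI_ex)
  have \<sigma>F: "\<sigma> x \<in> Fr x" if "x \<in> Q" for x using RY [OF \<sigma> [OF that]] by (simp add: Y_def)
  have \<sigma>eq: "e = \<sigma> x" if e: "(x, e) \<in> R" for x e
  proof -
    have x: "x \<in> Q" using RY [OF e] by (simp add: Y_def)
    obtain z where z: "z ^ m = 1" "(x, e) = act z (x, \<sigma> x)"
      by (rule same_fibre [OF RY [OF \<sigma> [OF x]] RY [OF e]]) auto
    have "z = 1" using Runique [OF \<sigma> [OF x] _ z(1)] z(2) e by simp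
    then show ?thesis using z(2) by simp
  qed
  have hol: "hol_at (\<lambda>y. \<sigma> y k c a) x" if *: "k \<in> I" "c \<in> atlas M" "x \<in> fst c \<inter> Q" "a \<in> I" for k c x a
  proof -
    have y: "(x, \<sigma> x) \<in> R" using \<sigma> * by blast
    note yY = RY [OF y]
    obtain N g E where f: "flat N g E rad" "\<forall>x'\<in>N. T (g x') (x, \<sigma> x) = (x', E x')"
      using T_flow(1) [OF yY] unfolding flow_def by blast
    let ?W = "(\<lambda>v. fst (T v (x, \<sigma> x))) ` small"
    \<comment> \<open>\<open>R\<close> is closed under small translations, so the holomorphic branch
      given by the flow stays in \<open>R\<close> and coincides with \<open>\<sigma>\<close> near
      \<open>x\<close>.\<close>
    have W: "x' \<in> N \<and> E x' = \<sigma> x'" if x': "x' \<in> ?W" for x'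
    proof -
      obtain v where v: "v \<in> small" "x' = fst (T v (x, \<sigma> x))" using x' by blast
      obtain x'' where x'': "x'' \<in> N" "v = g x''" using flatD(4) [OF f(1)] small(1) [OF v(1)] by blast
      then have "T v (x, \<sigma> x) = (x'', E x'')" using f(2) by blast
      moreover have "T v (x, \<sigma> x) \<in> R" using RT [OF y v(1)] .
      ultimately show ?thesis using v(2) x''(1) \<sigma>eq by auto
    qed
    have xW: "x \<in> ?W" using nb(2) [OF yY] by simp
    have xN: "x \<in> N" using W [OF xW] by blast
    have xc: "x \<in> fst c" using * by blast
    have "hol_at (\<lambda>y. E y k c a) x"
      by (rule branchD(5) [OF flatD(1) [OF f(1)] *(2) xN xc *(1,4)])
    then show ?thesis by (rule hol_at_cong [OF _ nb(1) [OF yY] xW]) (use W in auto)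
  qed
  have "frame_on Q (\<lambda>k c x a. \<sigma> x k c a)"
    unfolding frame_on_def cov_section_def
  proof (intro conjI ballI)
    show "hol_at (\<lambda>y. \<sigma> y k c a) x" if "k \<in> I" "c \<in> atlas M" "x \<in> fst c \<inter> Q" "a \<in> I" for k c x a
      by (rule hol [OF that])
    show "\<sigma> x k c a = (\<Sum>b\<in>I. Jac c d x a b * \<sigma> x k d b)"
      if "k \<in> I" "c \<in> atlas M" "d \<in> atlas M" "x \<in> fst c \<inter> fst d \<inter> Q" "a \<in> I" for k c d x a
      by (rule Fr_change [OF _ \<sigma>F]) (use that in auto)
    show "det (xmat I (\<lambda>k a. \<sigma> x k c a)) \<noteq> 0" if "c \<in> atlas M" "x \<in> fst c \<inter> Q" for c x
      by (rule Fr_det [OF _ \<sigma>F]) (use that in auto)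
  qed
  then show ?thesis by blast
qed

end

theorem (in multiframe) frame_exists: "\<exists>e. frame_on Q e"
proof (cases "\<exists>N E x c k q r. branch N E \<and> x \<in> N \<and> c \<in> atlas M \<and> x \<in> fst c \<and> k \<in> I \<and> q \<in> I \<and> r \<in> I \<and> struct_const c E x k q r \<noteq> 0")
  case True
  then show ?thesis using frame_if_structure_constant by blast
next
  case False
  interpret flat_multiframe M p m Fr
  proof
    fix N E x c k a b
    assume *: "branch N E" "x \<in> N" "c \<in> atlas M" "x \<in> fst c" "k \<in> I" "a \<in> I" "b \<in> I"
    have "struct_const c E x k q r = 0" if "q \<in> I" "r \<in> I" for q r using False * that by blast
    then show "ext_deriv E c x k a b = 0" unfolding struct_const_spec [OF *(1,2,3,4,6,7)] by simp
  qed
  show ?thesis by (rule frame_if_flat)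
qed

section \<open>Symmetric tensors and their polynomial functions\<close>

lemma sum_prod_PiE:
  assumes "finite I"
  shows "(\<Prod>l<(m::nat). \<Sum>a\<in>I. f l a) = (\<Sum>i\<in>PiE {..<m} (\<lambda>_. I). \<Prod>l<m. f l (i l) :: complex)"
  using assms by (intro prod_sum_PiE) auto

lemma field_differentiable_exp_Ln: "m > 0 \<Longrightarrow> w \<notin> \<real>\<^sub>\<le>\<^sub>0 \<Longrightarrow> (\<lambda>w. exp (Ln w / of_nat m)) field_differentiable (at w)"
  unfolding field_differentiable_def by (rule exI) (auto intro!: derivative_eq_intros)

context cmanifold
begin

abbreviation TS :: "nat \<Rightarrow> (nat \<Rightarrow> 'n) set" where
  "TS m \<equiv> PiE {..<m} (\<lambda>_. I)"

lemma finite_TS: "finite (TS m)"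
  by (intro finite_PiE) auto

definition tens_section :: "nat \<Rightarrow> (('a, 'n) cchart \<Rightarrow> 'a \<Rightarrow> (nat \<Rightarrow> 'n) \<Rightarrow> complex) \<Rightarrow> bool" where
  "tens_section m t \<longleftrightarrow>
     (\<forall>c\<in>atlas M. \<forall>x\<in>fst c. \<forall>i\<in>TS m. hol_at (\<lambda>y. t c y i) x) \<and>
     (\<forall>c\<in>atlas M. \<forall>d\<in>atlas M. \<forall>x\<in>fst c \<inter> fst d. \<forall>i\<in>TS m.
        t c x i = (\<Sum>j\<in>TS m. (\<Prod>l<m. Jac c d x (i l) (j l)) * t d x j))"

text \<open>The homogeneous polynomial of degree \<open>m\<close> on tangent vectors that belongs to
  the tensor \<open>t\<close>.\<close>

definition ev :: "nat \<Rightarrow> ((nat \<Rightarrow> 'n) \<Rightarrow> complex) \<Rightarrow> ('n \<Rightarrow> complex) \<Rightarrow> complex" where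
  "ev m t v = (\<Sum>i\<in>TS m. t i * (\<Prod>l<m. v (i l)))"

text \<open>The polarized form, linear in \<open>v\<close> and of degree \<open>m - 1\<close> in \<open>y\<close>.\<close>

definition polar :: "nat \<Rightarrow> ((nat \<Rightarrow> 'n) \<Rightarrow> complex) \<Rightarrow> ('n \<Rightarrow> complex) \<Rightarrow> ('n \<Rightarrow> complex) \<Rightarrow> complex" where
  "polar m t y v = (\<Sum>i\<in>TS m. t i * (v (i 0) * (\<Prod>l\<in>{1..<m}. y (i l))))"

definition lin_form :: "('n \<Rightarrow> complex) \<Rightarrow> ('n \<Rightarrow> complex) \<Rightarrow> complex" where
  "lin_form w v = (\<Sum>a\<in>I. w a * v a)"

definition polar_coeff :: "nat \<Rightarrow> ((nat \<Rightarrow> 'n) \<Rightarrow> complex) \<Rightarrow> ('n \<Rightarrow> complex) \<Rightarrow> 'n \<Rightarrow> complex" where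
  "polar_coeff m t y a = polar m t y (\<lambda>b. if b = a then 1 else 0)"

lemma lin_form_delta: "a \<in> I \<Longrightarrow> lin_form w (\<lambda>b. if b = a then 1 else 0) = w a"
  by (simp add: lin_form_def sum_delta_mult)

lemma lin_form_lin: "lin_form w (\<lambda>a. v a + s * u a) = lin_form w v + s * lin_form w u"
  by (simp add: lin_form_def algebra_simps sum.distrib sum_distrib_left)

lemma lin_form_scale: "lin_form (\<lambda>a. z * w a) v = z * lin_form w v"
  by (simp add: lin_form_def sum_distrib_left mult.assoc)

lemma polar_lin_form:
  assumes "m > 0"
  shows "polar m t y v = lin_form (polar_coeff m t y) v"
proof -
  have "lin_form (polar_coeff m t y) v = (\<Sum>a\<in>I. \<Sum>i\<in>TS m. t i * ((if i 0 = a then 1 else 0) * (\<Prod>l\<in>{1..<m}. y (i l))) * v a)"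
    by (simp add: lin_form_def polar_coeff_def polar_def sum_distrib_right)
  also have "\<dots> = (\<Sum>i\<in>TS m. \<Sum>a\<in>I. (t i * (\<Prod>l\<in>{1..<m}. y (i l))) * ((if i 0 = a then 1 else 0) * v a))"
    by (subst sum.swap) (simp add: mult_ac)
  also have "\<dots> = (\<Sum>i\<in>TS m. (t i * (\<Prod>l\<in>{1..<m}. y (i l))) * v (i 0))"
  proof (rule sum.cong [OF refl])
    fix i assume "i \<in> TS m"
    then have "i 0 \<in> I" using assms by auto
    then show "(\<Sum>a\<in>I. (t i * (\<Prod>l\<in>{1..<m}. y (i l))) * ((if i 0 = a then 1 else 0) * v a)) =
        (t i * (\<Prod>l\<in>{1..<m}. y (i l))) * v (i 0)"
      by (simp add: sum_delta_mult flip: sum_distrib_left)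
  qed
  finally show ?thesis by (simp add: polar_def mult_ac)
qed

lemma polar_self:
  assumes "m > 0"
  shows "polar m t y y = ev m t y"
proof -
  have "{..<m} = insert 0 {1..<m}" using assms by auto
  then have "(\<Prod>l<m. y (i l)) = y (i 0) * (\<Prod>l\<in>{1..<m}. y (i l))" for i :: "nat \<Rightarrow> 'n" by simp
  then show ?thesis by (simp add: polar_def ev_def)
qed

lemma ev_change:
  assumes t: "tens_section m t" and cd: "c \<in> atlas M" "d \<in> atlas M" "x \<in> fst c" "x \<in> fst d"
  shows "ev m (t c x) v = ev m (t d x) (\<lambda>b. \<Sum>a\<in>I. Jac c d x a b * v a)"
proof -
  have "ev m (t c x) v = (\<Sum>i\<in>TS m. \<Sum>j\<in>TS m. (\<Prod>l<m. Jac c d x (i l) (j l)) * t d x j * (\<Prod>l<m. v (i l)))"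
    unfolding ev_def
  proof (rule sum.cong [OF refl])
    fix i assume "i \<in> TS m"
    then have "t c x i = (\<Sum>j\<in>TS m. (\<Prod>l<m. Jac c d x (i l) (j l)) * t d x j)"
      using t cd unfolding tens_section_def by blast
    then show "t c x i * (\<Prod>l<m. v (i l)) = (\<Sum>j\<in>TS m. (\<Prod>l<m. Jac c d x (i l) (j l)) * t d x j * (\<Prod>l<m. v (i l)))"
      by (simp add: sum_distrib_right)
  qed
  also have "\<dots> = (\<Sum>j\<in>TS m. \<Sum>i\<in>TS m. t d x j * (\<Prod>l<m. Jac c d x (i l) (j l) * v (i l)))"
    by (subst sum.swap) (simp add: prod.distrib mult_ac)
  also have "\<dots> = ev m (t d x) (\<lambda>b. \<Sum>a\<in>I. Jac c d x a b * v a)"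
    unfolding ev_def by (rule sum.cong) (simp_all add: sum_prod_PiE sum_distrib_left)
  finally show ?thesis .
qed

text \<open>Equal \<open>m\<close>-th powers have equal zeros, and every \<open>v\<close> can be
  moved into the kernel along \<open>y\<close>. So the two forms are proportional, with the factor
  read off at \<open>y\<close>.\<close>

lemma root_forms:
  assumes m: "m > 0" and eq: "\<And>v. lin_form w v ^ m = lin_form w' v ^ m" and y: "lin_form w y \<noteq> 0"
  obtains z where "z ^ m = 1" "\<And>v. lin_form w' v = z * lin_form w v"
proof -
  define z where "z = lin_form w' y / lin_form w y"
  have "z ^ m = 1" using y by (simp add: z_def power_divide eq [of y, symmetric])
  moreover have "lin_form w' v = z * lin_form w v" for v
  proof -
    let ?s = "- (lin_form w v / lin_form w y)"
    have "lin_form w (\<lambda>a. v a + ?s * y a) = 0" unfolding lin_form_lin using y by simp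
    then have "lin_form w' (\<lambda>a. v a + ?s * y a) ^ m = 0" using eq [of "\<lambda>a. v a + ?s * y a"] m by (metis zero_power)
    then have "lin_form w' v + ?s * lin_form w' y = 0" unfolding lin_form_lin by simp
    then show ?thesis using y by (simp add: z_def field_simps)
  qed
  ultimately show ?thesis by (rule that)
qed

text \<open>Where \<open>w\<close> vanishes, adding \<open>y\<close> leaves the zero set; linearity
  recovers the value at \<open>v\<close> from those at \<open>v + y\<close> and
  \<open>y\<close>.\<close>

lemma lin_form_cancel:
  assumes eq: "\<And>v. lin_form w v ^ n * lin_form u v = lin_form w v ^ n * lin_form u' v" and y: "lin_form w y \<noteq> 0"
  shows "lin_form u v = lin_form u' v"
proof (cases "lin_form w v = 0")
  case False
  then show ?thesis using eq [of v] by simp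
next
  case True
  have "lin_form w (\<lambda>a. v a + 1 * y a) \<noteq> 0" unfolding lin_form_lin using True y by simp
  then have "lin_form u v + lin_form u y = lin_form u' v + lin_form u' y"
    using eq [of "\<lambda>a. v a + 1 * y a"] unfolding lin_form_lin by simp
  moreover have "lin_form u y = lin_form u' y" using eq [of y] y by simp
  ultimately show ?thesis by simp
qed

text \<open>The components at \<open>x\<close> in all charts at once. The zeros at meaningless
  arguments make equal covectors equal as functions, which is needed for equations between
  coframes.\<close>

definition cov :: "'a \<Rightarrow> (('a, 'n) cchart \<Rightarrow> 'n \<Rightarrow> complex) \<Rightarrow> bool" where
  "cov x w \<longleftrightarrow> (\<forall>c a. \<not> (c \<in> atlas M \<and> x \<in> fst c \<and> a \<in> I) \<longrightarrow> w c a = 0) \<and>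
     (\<forall>c\<in>atlas M. \<forall>d\<in>atlas M. x \<in> fst c \<longrightarrow> x \<in> fst d \<longrightarrow> (\<forall>a\<in>I. w c a = (\<Sum>b\<in>I. Jac c d x a b * w d b)))"

lemma covD:
  assumes "cov x w" "c \<in> atlas M" "d \<in> atlas M" "x \<in> fst c" "x \<in> fst d" "a \<in> I"
  shows "w c a = (\<Sum>b\<in>I. Jac c d x a b * w d b)"
  using assms unfolding cov_def by blast

lemma cov_scale: "cov x w \<Longrightarrow> cov x (\<lambda>c a. z * w c a)"
  unfolding cov_def by (simp add: mult.left_commute [of _ z] flip: sum_distrib_left)

lemma cov_lin_form_change:
  assumes "cov x w" "c \<in> atlas M" "d \<in> atlas M" "x \<in> fst c" "x \<in> fst d"
  shows "lin_form (w c) v = lin_form (w d) (\<lambda>b. \<Sum>a\<in>I. Jac c d x a b * v a)"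
proof -
  have "lin_form (w c) v = (\<Sum>a\<in>I. \<Sum>b\<in>I. Jac c d x a b * w d b * v a)"
    unfolding lin_form_def by (rule sum.cong) (simp_all add: covD [OF assms] sum_distrib_right)
  also have "\<dots> = (\<Sum>b\<in>I. \<Sum>a\<in>I. Jac c d x a b * w d b * v a)" by (rule sum.swap)
  also have "\<dots> = lin_form (w d) (\<lambda>b. \<Sum>a\<in>I. Jac c d x a b * v a)"
    unfolding lin_form_def by (simp add: sum_distrib_left mult_ac)
  finally show ?thesis .
qed

lemma cov_eqI:
  assumes w: "cov x w" "cov x w'" and c: "c \<in> atlas M" "x \<in> fst c" and eq: "\<And>v. lin_form (w c) v = lin_form (w' c) v"
  shows "w = w'"
proof (intro ext)
  fix d a
  have 1: "w c b = w' c b" if "b \<in> I" for b using eq [of "\<lambda>j. if j = b then 1 else 0"] lin_form_delta [OF that] by simp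
  show "w d a = w' d a"
  proof (cases "d \<in> atlas M \<and> x \<in> fst d \<and> a \<in> I")
    case True
    then have d: "d \<in> atlas M" "x \<in> fst d" "a \<in> I" by auto
    show ?thesis
      unfolding covD [OF w(1) d(1) c(1) d(2) c(2) d(3)] covD [OF w(2) d(1) c(1) d(2) c(2) d(3)]
      by (rule sum.cong) (simp_all add: 1)
  next
    case False
    then show ?thesis using w unfolding cov_def by metis
  qed
qed

definition spread :: "('a, 'n) cchart \<Rightarrow> 'a \<Rightarrow> ('n \<Rightarrow> complex) \<Rightarrow> ('a, 'n) cchart \<Rightarrow> 'n \<Rightarrow> complex" where
  "spread c x w = (\<lambda>d a. if d \<in> atlas M \<and> x \<in> fst d \<and> a \<in> I then \<Sum>b\<in>I. Jac d c x a b * w b else 0)"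

lemma cov_spread:
  assumes c: "c \<in> atlas M" "x \<in> fst c"
  shows "cov x (spread c x w)" "lin_form (spread c x w c) v = lin_form w v"
proof -
  show "cov x (spread c x w)"
    unfolding cov_def
  proof (intro conjI allI ballI impI)
    fix d e a assume *: "d \<in> atlas M" "e \<in> atlas M" "x \<in> fst d" "x \<in> fst e" "a \<in> I"
    have "spread c x w d a = (\<Sum>b\<in>I. Jac d c x a b * w b)" using * by (simp add: spread_def)
    also have "\<dots> = (\<Sum>b\<in>I. \<Sum>k\<in>I. Jac d e x a k * Jac e c x k b * w b)"
      using * c by (intro sum.cong refl) (simp add: Jac_cocycle [of d x e c] sum_distrib_right)
    also have "\<dots> = (\<Sum>k\<in>I. \<Sum>b\<in>I. Jac d e x a k * Jac e c x k b * w b)" by (rule sum.swap)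
    also have "\<dots> = (\<Sum>k\<in>I. Jac d e x a k * spread c x w e k)"
      using * by (intro sum.cong refl) (simp add: spread_def sum_distrib_left mult.assoc)
    finally show "spread c x w d a = (\<Sum>k\<in>I. Jac d e x a k * spread c x w e k)" .
  qed (auto simp: spread_def)
  have "spread c x w c a = w a" if "a \<in> I" for a
    using that c by (simp add: spread_def Jac_self sum_delta_mult)
  then show "lin_form (spread c x w c) v = lin_form w v" by (simp add: lin_form_def)
qed

end

text \<open>\<open>id1\<close> makes \<open>f\<close> pointwise an \<open>m\<close>-th power of a
  covector \<open>w\<close>. \<open>id2\<close> is its derivative along a family with first-order
  term \<open>g k\<close> and makes \<open>g k\<close> divisible by \<open>w^(m-1)\<close>;
  \<open>g_ind\<close> makes the quotients independent.\<close>

locale power_data = cmanifold M for M :: "('a, 'n::finite) manifold_data" +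
  fixes p :: 'a and m :: nat and f :: "('a, 'n) cchart \<Rightarrow> 'a \<Rightarrow> (nat \<Rightarrow> 'n) \<Rightarrow> complex"
    and g :: "'n \<Rightarrow> ('a, 'n) cchart \<Rightarrow> 'a \<Rightarrow> (nat \<Rightarrow> 'n) \<Rightarrow> complex"
  assumes cpt: "compact_space (mtop M)" and pX: "p \<in> X" and m_pos: "m > 0" and I_ne: "I \<noteq> {}"
    and f: "tens_section m f" and g: "k \<in> I \<Longrightarrow> tens_section m (g k)"
    and id1: "x \<in> comp_of p \<Longrightarrow> c \<in> atlas M \<Longrightarrow> x \<in> fst c \<Longrightarrow>
        ev m (f c x) v * ev m (f c x) y ^ (m - 1) = polar m (f c x) y v ^ m"
    and id2: "x \<in> comp_of p \<Longrightarrow> c \<in> atlas M \<Longrightarrow> x \<in> fst c \<Longrightarrow> k \<in> I \<Longrightarrow>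
        ev m (g k c x) v * ev m (f c x) y ^ (m - 1) +
          of_nat (m - 1) * ev m (f c x) v * ev m (f c x) y ^ (m - 2) * ev m (g k c x) y =
        of_nat m * polar m (f c x) y v ^ (m - 1) * polar m (g k c x) y v"
    and f_ne: "x \<in> comp_of p \<Longrightarrow> c \<in> atlas M \<Longrightarrow> x \<in> fst c \<Longrightarrow> \<exists>v. ev m (f c x) v \<noteq> 0"
    and g_ind: "x \<in> comp_of p \<Longrightarrow> c \<in> atlas M \<Longrightarrow> x \<in> fst c \<Longrightarrow>
        (\<And>v. (\<Sum>k\<in>I. s k * ev m (g k c x) v) = 0) \<Longrightarrow> k \<in> I \<Longrightarrow> s k = 0"
begin

text \<open>
  The covector \<open>w\<close> is an \<open>m\<close>-th root of the section \<open>f\<close>, and \<open>e k\<close> is the quotient of the section \<open>g k\<close>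
  by \<open>w\<^bsup>m-1\<^esup>\<close>.
\<close>

definition root_at :: "'a \<Rightarrow> (('a, 'n) cchart \<Rightarrow> 'n \<Rightarrow> complex) \<Rightarrow> ('a, 'n) coframe \<Rightarrow> bool" where
  "root_at x w e \<longleftrightarrow> cov x w \<and> (\<forall>c\<in>atlas M. x \<in> fst c \<longrightarrow>
      (\<forall>v. ev m (f c x) v = lin_form (w c) v ^ m) \<and>
      (\<forall>k\<in>I. \<forall>v. ev m (g k c x) v = lin_form (w c) v ^ (m - 1) * lin_form (e k c) v))"

definition Fr :: "'a \<Rightarrow> ('a, 'n) coframe set" where
  "Fr x = {e. (\<forall>k. k \<notin> I \<longrightarrow> e k = (\<lambda>_ _. 0)) \<and> (\<forall>k. cov x (e k)) \<and> (\<exists>w. root_at x w e)}"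

lemma cov_zero: "cov x (\<lambda>_ _. 0)"
  by (simp add: cov_def)

lemma root_atI:
  assumes c: "c \<in> atlas M" "x \<in> fst c" and w: "cov x w" and e: "\<And>k. k \<in> I \<Longrightarrow> cov x (e k)"
    and 1: "\<And>v. ev m (f c x) v = lin_form (w c) v ^ m"
    and 2: "\<And>k v. k \<in> I \<Longrightarrow> ev m (g k c x) v = lin_form (w c) v ^ (m - 1) * lin_form (e k c) v"
  shows "root_at x w e"
  unfolding root_at_def
proof (intro conjI ballI impI allI)
  fix d v assume d: "d \<in> atlas M" "x \<in> fst d"
  show "ev m (f d x) v = lin_form (w d) v ^ m"
    unfolding ev_change [OF f d(1) c(1) d(2) c(2)] cov_lin_form_change [OF w d(1) c(1) d(2) c(2)] by (rule 1)
  fix k assume k: "k \<in> I"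
  show "ev m (g k d x) v = lin_form (w d) v ^ (m - 1) * lin_form (e k d) v"
    unfolding ev_change [OF g [OF k] d(1) c(1) d(2) c(2)] cov_lin_form_change [OF w d(1) c(1) d(2) c(2)]
      cov_lin_form_change [OF e [OF k] d(1) c(1) d(2) c(2)] by (rule 2 [OF k])
qed (rule w)

text \<open>Replacing \<open>w\<close> by \<open>z w\<close> divides the quotients of
  \<open>g k\<close> by \<open>z^(m-1)\<close>, which is the same as multiplying them by
  \<open>z\<close>.\<close>

lemma root_at_unique:
  assumes x: "x \<in> comp_of p" and c: "c \<in> atlas M" "x \<in> fst c"
    and r: "root_at x w e" "root_at x w' e'" and e: "\<And>k. cov x (e k)" "\<And>k. cov x (e' k)"
      "\<And>k. k \<notin> I \<Longrightarrow> e k = (\<lambda>_ _. 0)" "\<And>k. k \<notin> I \<Longrightarrow> e' k = (\<lambda>_ _. 0)"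
  shows "\<exists>z. z ^ m = 1 \<and> (\<forall>v. lin_form (w' c) v = z * lin_form (w c) v) \<and> e' = zmul z e"
proof -
  obtain y where "ev m (f c x) y \<noteq> 0" using f_ne [OF x c] by blast
  then have y: "lin_form (w c) y \<noteq> 0" using r(1) c m_pos unfolding root_at_def by auto
  have "lin_form (w c) v ^ m = lin_form (w' c) v ^ m" for v using r c unfolding root_at_def by metis
  then obtain z where z: "z ^ m = 1" "\<And>v. lin_form (w' c) v = z * lin_form (w c) v"
    using root_forms [OF m_pos _ y] by blast
  have zm: "z * z ^ (m - 1) = 1" using z(1) m_pos by (simp flip: power_Suc)
  then have z0: "z \<noteq> 0" by auto
  have "e' k = zmul z e k" for k
  proof (cases "k \<in> I")
    case True
    show ?thesis
    proof (rule cov_eqI [OF e(2) _ c])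
      show "cov x (zmul z e k)" using cov_scale [OF e(1)] unfolding zmul_def .
      have "lin_form (w c) v ^ (m - 1) * lin_form (\<lambda>a. z ^ (m - 1) * e' k c a) v = lin_form (w c) v ^ (m - 1) * lin_form (e k c) v" for v
      proof -
        have "lin_form (w c) v ^ (m - 1) * lin_form (e k c) v = lin_form (w' c) v ^ (m - 1) * lin_form (e' k c) v"
          using r c True unfolding root_at_def by metis
        then show ?thesis unfolding z(2) power_mult_distrib lin_form_scale by (simp only: mult_ac)
      qed
      from lin_form_cancel [OF this y] have "z ^ (m - 1) * lin_form (e' k c) v = lin_form (e k c) v" for v by (simp add: lin_form_scale)
      then have "(z * z ^ (m - 1)) * lin_form (e' k c) v = z * lin_form (e k c) v" for v by (simp only: mult.assoc)
      then show "lin_form (e' k c) v = lin_form (zmul z e k c) v" for v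
        unfolding zm zmul_def lin_form_scale by simp
    qed
  next
    case False
    then show ?thesis using e by (simp add: zmul_def)
  qed
  then show ?thesis using z by blast
qed

text \<open>For \<open>f = w ^ m\<close> the polar form is \<open>w(v) w(y)^(m-1)\<close>. With a
  chosen root \<open>r = w(y)\<close> of \<open>f(y)\<close>, division by \<open>r^(m-1)\<close>
  recovers \<open>w\<close>.\<close>

definition wform :: "('a, 'n) cchart \<Rightarrow> ('n \<Rightarrow> complex) \<Rightarrow> complex \<Rightarrow> 'a \<Rightarrow> 'n \<Rightarrow> complex" where
  "wform c y r x a = polar_coeff m (f c x) y a / r ^ (m - 1)"

text \<open>For \<open>f = w ^ m\<close>, \<open>g k = w^(m-1) e\<close> and
  \<open>r = w(y)\<close>, polarization gives
  \<open>m g(v,y,...,y) = r^(m-1) e(v) + (m-1) r^(m-2) w(v) e(y)\<close>. Here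
  \<open>e(y) = g(y) / r^(m-1)\<close>, and this is the equation solved for
  \<open>e(v)\<close>.\<close>

definition eform :: "('a, 'n) cchart \<Rightarrow> ('n \<Rightarrow> complex) \<Rightarrow> complex \<Rightarrow> 'a \<Rightarrow> 'n \<Rightarrow> 'n \<Rightarrow> complex" where
  "eform c y r x k a = (of_nat m * polar_coeff m (g k c x) y a -
     of_nat (m - 1) * (ev m (g k c x) y / ev m (f c x) y) * polar_coeff m (f c x) y a) / r ^ (m - 1)"

lemma forms_spec:
  assumes x: "x \<in> comp_of p" and c: "c \<in> atlas M" "x \<in> fst c" and r: "r ^ m = ev m (f c x) y" "r \<noteq> 0"
  shows "ev m (f c x) v = lin_form (wform c y r x) v ^ m"
    "k \<in> I \<Longrightarrow> ev m (g k c x) v = lin_form (wform c y r x) v ^ (m - 1) * lin_form (eform c y r x k) v"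
    "lin_form (wform c y r x) y = r"
proof -
  define F where "F = ev m (f c x) y"
  have F0: "F \<noteq> 0" unfolding F_def r(1) [symmetric] using r(2) by simp
  have w: "lin_form (wform c y r x) v = polar m (f c x) y v / r ^ (m - 1)" for v
    unfolding polar_lin_form [OF m_pos] lin_form_def wform_def by (simp add: sum_divide_distrib)
  have rm: "(r ^ (m - 1)) ^ m = F ^ (m - 1)"
    by (metis F_def mult.commute power_mult r(1))
  show f1: "ev m (f c x) v = lin_form (wform c y r x) v ^ m" for v
    using id1 [OF x c, of v y] F0 unfolding w power_divide rm by (simp add: F_def field_simps)
  show "lin_form (wform c y r x) y = r"
  proof -
    have "r ^ m = r * r ^ (m - 1)" using m_pos by (simp flip: power_Suc)
    then show ?thesis unfolding w polar_self [OF m_pos] r(1) [symmetric] using r(2) by simp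
  qed
  assume k: "k \<in> I"
  define G where "G = ev m (g k c x) y"
  have e: "lin_form (eform c y r x k) v = (of_nat m * polar m (g k c x) y v - of_nat (m - 1) * (G / F) * polar m (f c x) y v) / r ^ (m - 1)"
  proof -
    have "lin_form (eform c y r x k) v =
       (\<Sum>a\<in>I. of_nat m * (polar_coeff m (g k c x) y a * v a) / r ^ (m - 1) - of_nat (m - 1) * (G / F) * (polar_coeff m (f c x) y a * v a) / r ^ (m - 1))"
      unfolding lin_form_def eform_def F_def G_def by (rule sum.cong) (simp_all add: field_simps diff_divide_distrib)
    also have "\<dots> = of_nat m * polar m (g k c x) y v / r ^ (m - 1) - of_nat (m - 1) * (G / F) * polar m (f c x) y v / r ^ (m - 1)"
      unfolding polar_lin_form [OF m_pos] lin_form_def sum_subtractf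
      by (simp add: sum_distrib_left sum_divide_distrib)
    finally show ?thesis by (simp add: diff_divide_distrib)
  qed
  define u where "u = polar m (f c x) y v"
  have u: "u ^ m = ev m (f c x) v * F ^ (m - 1)" using id1 [OF x c, of v y] by (simp add: u_def F_def)
  have um: "u * u ^ (m - 1) = u ^ m" using m_pos by (simp flip: power_Suc)
  have "lin_form (wform c y r x) v ^ (m - 1) * lin_form (eform c y r x k) v
      = (of_nat m * u ^ (m - 1) * polar m (g k c x) y v - of_nat (m - 1) * (G / F) * (u * u ^ (m - 1))) / (r ^ (m - 1)) ^ Suc (m - 1)"
  proof -
    have "(u / R) ^ n * ((of_nat m * P - b * u) / R) = (of_nat m * u ^ n * P - b * (u * u ^ n)) / R ^ Suc n"
      for R P b :: complex and n
      unfolding power_divide times_divide_times_eq power_Suc2 by (simp add: algebra_simps)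
    then show ?thesis unfolding w e u_def [symmetric] by blast
  qed
  also have "(r ^ (m - 1)) ^ Suc (m - 1) = F ^ (m - 1)" using rm m_pos by simp
  also have "of_nat m * u ^ (m - 1) * polar m (g k c x) y v =
      ev m (g k c x) v * F ^ (m - 1) + of_nat (m - 1) * ev m (f c x) v * F ^ (m - 2) * G"
    using id2 [OF x c k, of v y] by (simp add: u_def F_def G_def)
  also have "of_nat (m - 1) * (G / F) * (u * u ^ (m - 1)) = of_nat (m - 1) * ev m (f c x) v * F ^ (m - 2) * G"
  \<comment> \<open>For \<open>m = 1\<close> the exponent \<open>m - 2\<close> is truncated, but
    both sides contain the factor \<open>m - 1 = 0\<close>.\<close>
  proof (cases "m = 1")
    case False
    then have "F ^ (m - 1) = F * F ^ (m - 2)" using m_pos by (simp add: numeral_2_eq_2 Suc_diff_Suc flip: power_Suc)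
    then show ?thesis unfolding um u using F0 by simp
  qed simp
  finally show "ev m (g k c x) v = lin_form (wform c y r x) v ^ (m - 1) * lin_form (eform c y r x k) v"
    using F0 by simp
qed

definition frame_of :: "('a, 'n) cchart \<Rightarrow> ('n \<Rightarrow> complex) \<Rightarrow> complex \<Rightarrow> 'a \<Rightarrow> ('a, 'n) coframe" where
  "frame_of c y r x = (\<lambda>k. if k \<in> I then spread c x (eform c y r x k) else (\<lambda>_ _. 0))"

lemma frame_of_root:
  assumes x: "x \<in> comp_of p" and c: "c \<in> atlas M" "x \<in> fst c" and r: "r ^ m = ev m (f c x) y" "r \<noteq> 0"
  shows "root_at x (spread c x (wform c y r x)) (frame_of c y r x)" "frame_of c y r x \<in> Fr x"
proof -
  show 1: "root_at x (spread c x (wform c y r x)) (frame_of c y r x)"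
    by (rule root_atI [OF c cov_spread(1) [OF c]])
       (simp_all add: frame_of_def cov_spread [OF c] forms_spec [OF x c r])
  show "frame_of c y r x \<in> Fr x"
    unfolding Fr_def using 1 by (auto simp: frame_of_def cov_spread [OF c] cov_zero)
qed

lemma tens_hol: "tens_section m t \<Longrightarrow> c \<in> atlas M \<Longrightarrow> x \<in> fst c \<Longrightarrow> i \<in> TS m \<Longrightarrow> hol_at (\<lambda>y. t c y i) x"
  unfolding tens_section_def by blast

lemma hol_ev: "tens_section m t \<Longrightarrow> c \<in> atlas M \<Longrightarrow> x \<in> fst c \<Longrightarrow> hol_at (\<lambda>x. ev m (t c x) v) x"
  unfolding ev_def by (intro hol_at_sum hol_at_mult tens_hol hol_at_const)

lemma hol_polar_coeff: "tens_section m t \<Longrightarrow> c \<in> atlas M \<Longrightarrow> x \<in> fst c \<Longrightarrow> hol_at (\<lambda>x. polar_coeff m (t c x) y a) x"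
  unfolding polar_coeff_def polar_def by (intro hol_at_sum hol_at_mult tens_hol hol_at_const)

text \<open>Divided by its value at \<open>x\<close>, the function lies near 1. On the right
  half-plane the principal logarithm gives a holomorphic root, which \<open>r0\<close> scales to the
  prescribed branch.\<close>

lemma local_root:
  assumes x: "x \<in> comp_of p" and c: "c \<in> atlas M" "x \<in> fst c" and r0: "r0 ^ m = ev m (f c x) y" "r0 \<noteq> 0"
  obtains N r where "openin (mtop M) N" "x \<in> N" "N \<subseteq> comp_of p \<inter> fst c" "r x = r0"
    "\<And>x'. x' \<in> N \<Longrightarrow> r x' ^ m = ev m (f c x') y" "\<And>x'. x' \<in> N \<Longrightarrow> r x' \<noteq> 0"
    "\<And>x'. x' \<in> N \<Longrightarrow> hol_at r x'"
proof -
  define F where "F = (\<lambda>x. ev m (f c x) y)"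
  have F0: "F x \<noteq> 0" unfolding F_def r0(1) [symmetric] using r0(2) by simp
  have hF: "hol_at F x'" if "x' \<in> fst c" for x' unfolding F_def by (rule hol_ev [OF f c(1) that])
  define q where "q = (\<lambda>x'. F x' / F x)"
  have hq: "hol_at q x'" if "x' \<in> fst c" for x' unfolding q_def using hF [OF that] F0 by (intro hol_at_divide) auto
  have W: "openin (mtop M) (comp_of p \<inter> fst c)" "x \<in> comp_of p \<inter> fst c"
    using x c openin_Int [OF comp_of_open chart_open [OF c(1)]] by simp_all
  have T: "open {w. Re w > 0}" "q x \<in> {w. Re w > 0}" using F0 by (auto simp: q_def open_halfspace_Re_gt)
  obtain N where N: "openin (mtop M) N" "x \<in> N" "N \<subseteq> comp_of p \<inter> fst c" "q ` N \<subseteq> {w. Re w > 0}"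
    by (rule hol_at_nbhd [OF hq [OF c(2)] W T], rule that) assumption+
  define r where "r = (\<lambda>x'. r0 * exp (Ln (q x') / of_nat m))"
  have qn: "q x' \<notin> \<real>\<^sub>\<le>\<^sub>0" "q x' \<noteq> 0" if "x' \<in> N" for x'
  proof -
    have "Re (q x') > 0" using that N(4) by blast
    then show "q x' \<notin> \<real>\<^sub>\<le>\<^sub>0" "q x' \<noteq> 0" by (auto simp: complex_nonpos_Reals_iff)
  qed
  have "r x = r0" using F0 by (simp add: r_def q_def)
  moreover have "r x' ^ m = ev m (f c x') y" if "x' \<in> N" for x'
  proof -
    have "exp (Ln (q x') / of_nat m) ^ m = q x'"
      using qn [OF that] m_pos by (simp flip: exp_of_nat_mult)
    then show ?thesis using F0 by (simp add: r_def power_mult_distrib r0(1) q_def F_def)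
  qed
  moreover have "r x' \<noteq> 0" if "x' \<in> N" for x' using r0 by (simp add: r_def)
  moreover have "hol_at r x'" if "x' \<in> N" for x'
    unfolding r_def using that N(3) qn
    by (intro hol_at_mult hol_at_const hol_at_compose [of q x' "\<lambda>w. exp (Ln w / of_nat m)"] hq field_differentiable_exp_Ln m_pos) auto
  ultimately show ?thesis using that N by blast
qed

lemma multiframe: "multiframe M p m Fr"
proof
  show "compact_space (mtop M)" "p \<in> X" "m > 0" "I \<noteq> {}" by (fact cpt pX m_pos I_ne)+
next
  fix x assume x: "x \<in> comp_of p"
  obtain c where c: "c \<in> atlas M" "x \<in> fst c" using chart_at comp_of_sub x by blast
  obtain y where y: "ev m (f c x) y \<noteq> 0" using f_ne [OF x c] by blast
  have "exp (Ln (ev m (f c x) y) / of_nat m) ^ m = ev m (f c x) y"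
    using y m_pos by (simp flip: exp_of_nat_mult)
  from frame_of_root(2) [OF x c this exp_not_eq_zero] show "Fr x \<noteq> {}" by blast
next
  fix x e z assume x: "x \<in> comp_of p" and e: "e \<in> Fr x" and z: "z ^ m = (1::complex)"
  obtain w where w: "root_at x w e" using e unfolding Fr_def by blast
  have cw: "cov x w" using w unfolding root_at_def by blast
  obtain c where c: "c \<in> atlas M" "x \<in> fst c" using chart_at comp_of_sub x by blast
  have ce: "cov x (e k)" for k using e unfolding Fr_def by blast
  have zm: "z ^ (m - 1) * z = 1" using z m_pos by (simp flip: power_Suc2)
  have "root_at x (\<lambda>c a. z * w c a) (zmul z e)"
  proof (rule root_atI [OF c cov_scale [OF cw]])
    show "cov x (zmul z e k)" for k using cov_scale [OF ce] unfolding zmul_def .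
    show "ev m (f c x) v = lin_form (\<lambda>a. z * w c a) v ^ m" for v
      using w c z unfolding root_at_def lin_form_scale power_mult_distrib by simp
    show "ev m (g k c x) v = lin_form (\<lambda>a. z * w c a) v ^ (m - 1) * lin_form (zmul z e k c) v" if k: "k \<in> I" for k v
    proof -
      have "ev m (g k c x) v = lin_form (w c) v ^ (m - 1) * lin_form (e k c) v" using w c k unfolding root_at_def by blast
      also have "\<dots> = (z ^ (m - 1) * z) * (lin_form (w c) v ^ (m - 1) * lin_form (e k c) v)" unfolding zm by simp
      finally show ?thesis unfolding zmul_def lin_form_scale power_mult_distrib by (simp add: mult_ac)
    qed
  qed
  then show "zmul z e \<in> Fr x"
    using e cov_scale [OF ce] unfolding Fr_def zmul_def by auto
next
  fix x e e' assume x: "x \<in> comp_of p" and e: "e \<in> Fr x" and e': "e' \<in> Fr x"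
  obtain w where w: "root_at x w e" using e unfolding Fr_def by blast
  obtain w' where w': "root_at x w' e'" using e' unfolding Fr_def by blast
  obtain c where c: "c \<in> atlas M" "x \<in> fst c" using chart_at comp_of_sub x by blast
  have "\<And>k. cov x (e k)" "\<And>k. cov x (e' k)" "\<And>k. k \<notin> I \<Longrightarrow> e k = (\<lambda>_ _. 0)" "\<And>k. k \<notin> I \<Longrightarrow> e' k = (\<lambda>_ _. 0)"
    using e e' unfolding Fr_def by blast+
  from root_at_unique [OF x c w w' this] show "\<exists>z. z ^ m = 1 \<and> e' = zmul z e" by blast
next
  fix x e c d k a
  assume "x \<in> comp_of p" "e \<in> Fr x" "c \<in> atlas M" "d \<in> atlas M" "x \<in> fst c" "x \<in> fst d" "k \<in> I" "a \<in> I"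
  then show "e k c a = (\<Sum>b\<in>I. Jac c d x a b * e k d b)"
    unfolding Fr_def by (intro covD) auto
next
  fix x e c assume x: "x \<in> comp_of p" and e: "e \<in> Fr x" and c: "c \<in> atlas M" "x \<in> fst c"
  obtain w where w: "root_at x w e" using e unfolding Fr_def by blast
  show "det (xmat I (\<lambda>k a. e k c a)) \<noteq> 0"
    unfolding det_xmat_nonzero_iff
  proof (intro allI impI ballI)
    fix t k assume t: "\<forall>a\<in>I. (\<Sum>k\<in>I. t k * e k c a) = 0" and k: "k \<in> I"
    \<comment> \<open>Multiplied by \<open>w^(m-1)\<close>, a relation between the covectors becomes
      a relation between the sections \<open>g k\<close>.\<close>
    have "(\<Sum>k\<in>I. t k * ev m (g k c x) v) = 0" for v
    proof -
      have "(\<Sum>k\<in>I. t k * ev m (g k c x) v) = (\<Sum>k\<in>I. lin_form (w c) v ^ (m - 1) * (t k * lin_form (e k c) v))"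
        using w c unfolding root_at_def by (intro sum.cong) auto
      also have "\<dots> = lin_form (w c) v ^ (m - 1) * (\<Sum>k\<in>I. \<Sum>a\<in>I. t k * e k c a * v a)"
        by (simp add: lin_form_def sum_distrib_left mult_ac)
      also have "(\<Sum>k\<in>I. \<Sum>a\<in>I. t k * e k c a * v a) = (\<Sum>a\<in>I. (\<Sum>k\<in>I. t k * e k c a) * v a)"
        by (subst sum.swap) (simp add: sum_distrib_right)
      also have "\<dots> = 0" using t by simp
      finally show ?thesis by simp
    qed
    from g_ind [OF x c this k] show "t k = 0" .
  qed
next
  fix x e assume x: "x \<in> comp_of p" and e: "e \<in> Fr x"
  obtain w where w: "root_at x w e" using e unfolding Fr_def by blast
  obtain c where c: "c \<in> atlas M" "x \<in> fst c" using chart_at comp_of_sub x by blast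
  obtain y where y: "ev m (f c x) y \<noteq> 0" using f_ne [OF x c] by blast
  \<comment> \<open>The root is started at the value on \<open>y\<close> of the covector belonging
    to \<open>e\<close>; this makes the branch pass through \<open>e\<close> itself and not through
    a multiple of it.\<close>
  define r0 where "r0 = lin_form (w c) y"
  have r0: "r0 ^ m = ev m (f c x) y" using w c unfolding root_at_def r0_def by simp
  have r00: "r0 \<noteq> 0" using r0 y m_pos by (auto simp: power_0_left)
  obtain N r where N: "openin (mtop M) N" "x \<in> N" "N \<subseteq> comp_of p \<inter> fst c" and rx: "r x = r0"
    and r: "\<And>x'. x' \<in> N \<Longrightarrow> r x' ^ m = ev m (f c x') y" "\<And>x'. x' \<in> N \<Longrightarrow> r x' \<noteq> 0" "\<And>x'. x' \<in> N \<Longrightarrow> hol_at r x'"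
    using local_root [OF x c r0 r00] by blast
  define E where "E = (\<lambda>x'. frame_of c y (r x') x')"
  have EF: "E x' \<in> Fr x'" if "x' \<in> N" for x'
    unfolding E_def using that N(3) c r by (intro frame_of_root(2)) auto
  have "E x = e"
  proof -
    note rt = frame_of_root [OF x c r0 r00]
    have "\<And>k. cov x (e k)" "\<And>k. cov x (frame_of c y r0 x k)" "\<And>k. k \<notin> I \<Longrightarrow> e k = (\<lambda>_ _. 0)"
      "\<And>k. k \<notin> I \<Longrightarrow> frame_of c y r0 x k = (\<lambda>_ _. 0)"
      using e rt(2) unfolding Fr_def by blast+
    from root_at_unique [OF x c w rt(1) this] obtain z where z: "\<And>v. lin_form (spread c x (wform c y r0 x) c) v = z * lin_form (w c) v"
      "frame_of c y r0 x = zmul z e" by blast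
    have "r0 = z * r0" using z(1) [of y] unfolding cov_spread [OF c] forms_spec(3) [OF x c r0 r00] r0_def [symmetric] .
    then have "z = 1" using r00 by simp
    then show ?thesis using z(2) by (simp add: E_def rx)
  qed
  moreover have "hol_at (\<lambda>y. E y k d a) x'" if *: "d \<in> atlas M" "x' \<in> N \<inter> fst d" "k \<in> I" "a \<in> I" for d x' k a
  proof -
    have x': "x' \<in> fst c" "x' \<in> fst d" "x' \<in> N" using * N(3) by auto
    have F0: "ev m (f c x') y \<noteq> 0" using r(1,2) [OF x'(3)] by (metis power_not_zero)
    have he: "hol_at (\<lambda>x'. eform c y (r x') x' k b) x'" for b
      unfolding eform_def using F0 r(2) [OF x'(3)] *(3) x'
      by (intro hol_at_divide hol_at_diff hol_at_mult hol_at_const hol_at_power hol_polar_coeff hol_ev f g c r(3)) auto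
    have "hol_at (\<lambda>y'. \<Sum>b\<in>I. Jac d c y' a b * eform c y (r y') y' k b) x'"
      by (intro hol_at_sum hol_at_mult he hol_at_Jac *(1) c(1) x')
    then show ?thesis
      by (rule hol_at_cong [OF _ chart_open [OF *(1)] x'(2)]) (use * in \<open>simp add: E_def frame_of_def spread_def\<close>)
  qed
  ultimately show "\<exists>N E. openin (mtop M) N \<and> x \<in> N \<and> N \<subseteq> comp_of p \<and> E x = e \<and> (\<forall>y\<in>N. E y \<in> Fr y) \<and>
      (\<forall>c\<in>atlas M. \<forall>y\<in>N \<inter> fst c. \<forall>k\<in>I. \<forall>a\<in>I. hol_at (\<lambda>y. E y k c a) y)"
    using N EF by (intro exI [of _ N] exI [of _ E]) blast
qed

lemma frame_exists: "\<exists>e. frame_on (comp_of p) e"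
  by (rule multiframe.frame_exists [OF multiframe])

end

section \<open>Invariants of generated symmetric powers\<close>

lemma coeff_1_prod_linear:
  assumes "finite A"
  shows "coeff (\<Prod>l\<in>A. [:a l, b l :: complex:]) 1 = (\<Sum>l\<in>A. b l * (\<Prod>k\<in>A - {l}. a k))"
  using assms
proof induction
  case (insert x A)
  have "coeff (\<Prod>l\<in>A. [:a l, b l:]) 0 = (\<Prod>l\<in>A. a l)"
    by (simp add: poly_0_coeff_0 [symmetric] poly_prod)
  moreover have "(\<Sum>l\<in>A. b l * (\<Prod>k\<in>insert x A - {l}. a k)) = a x * (\<Sum>l\<in>A. b l * (\<Prod>k\<in>A - {l}. a k))"
    unfolding sum_distrib_left
  proof (rule sum.cong [OF refl])
    fix l assume "l \<in> A"
    then have "insert x A - {l} = insert x (A - {l})" using insert by auto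
    then show "b l * (\<Prod>k\<in>insert x A - {l}. a k) = a x * (b l * (\<Prod>k\<in>A - {l}. a k))" using insert by simp
  qed
  moreover have "insert x A - {x} = A" using insert by auto
  ultimately show ?case using insert by simp
qed simp

lemma coeff_1_power_linear: "coeff ([:a, b :: complex:] ^ m) 1 = of_nat m * a ^ (m - 1) * b"
  using coeff_1_prod_linear [of "{..<m}" "\<lambda>_. a" "\<lambda>_. b"] by simp

lemma sum_linear_poly: "(\<Sum>a\<in>A. [:f a, g a :: complex:]) = [:\<Sum>a\<in>A. f a, \<Sum>a\<in>A. g a:]"
  by (induction A rule: infinite_finite_induct) auto

lemma poly_sum_upto:
  assumes "degree P \<le> m"
  shows "poly P s = (\<Sum>j\<le>m. s ^ j * coeff P j :: complex)"
proof -
  have "poly P s = (\<Sum>j\<le>degree P. coeff P j * s ^ j)" by (rule poly_altdef)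
  also have "\<dots> = (\<Sum>j\<le>m. coeff P j * s ^ j)"
    by (rule sum.mono_neutral_left) (use assms in \<open>auto simp: coeff_eq_0\<close>)
  finally show ?thesis by (simp add: mult.commute)
qed

context cmanifold
begin

definition tsym :: "nat \<Rightarrow> ((nat \<Rightarrow> 'n) \<Rightarrow> complex) \<Rightarrow> bool" where
  "tsym m t \<longleftrightarrow> (\<forall>\<pi>. \<pi> permutes {..<m} \<longrightarrow> (\<forall>i\<in>TS m. t (i \<circ> \<pi>) = t i))"

lemma TS_perm:
  assumes "i \<in> TS m" "\<pi> permutes {..<m}"
  shows "i \<circ> \<pi> \<in> TS m"
proof (rule PiE_I)
  fix l assume "l \<in> {..<m}"
  then show "(i \<circ> \<pi>) l \<in> I" using assms permutes_in_image [OF assms(2), of l] by (auto dest: PiE_mem)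
next
  fix l assume l: "l \<notin> {..<m}"
  then have "\<pi> l = l" using assms(2) by (meson permutes_not_in)
  then show "(i \<circ> \<pi>) l = undefined" using PiE_arb [OF assms(1) l] by simp
qed

lemma sum_TS_perm:
  assumes "\<pi> permutes {..<m}"
  shows "(\<Sum>i\<in>TS m. F (i \<circ> \<pi>)) = (\<Sum>i\<in>TS m. F i :: complex)"
  by (rule sum.reindex_bij_witness [of _ "\<lambda>i. i \<circ> inv \<pi>" "\<lambda>i. i \<circ> \<pi>"])
     (use assms TS_perm permutes_inv [OF assms] in \<open>auto simp: comp_assoc permutes_inv_o [OF assms]\<close>)

text \<open>Polarization, with one more slot made arbitrary in each step.\<close>

lemma polarization:
  assumes sym: "tsym m t" and 0: "\<And>v. ev m t v = 0" and i: "i \<in> TS m"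
  shows "t i = 0"
proof -
  define T where "T = (\<lambda>w. \<Sum>i\<in>TS m. t i * (\<Prod>l<m. w l (i l)))"
  have "j \<le> m \<Longrightarrow> T (\<lambda>l. if l < j then w l else x) = 0" for j w x
  proof (induction j arbitrary: w x)
    case 0
    then show ?case using assms(2) by (simp add: T_def ev_def)
  next
    case (Suc j)
    then have j: "j < m" by simp
    have split: "(\<Prod>l<m. h l) = (\<Prod>l<j. h l) * (\<Prod>l\<in>{j..<m}. h l)" for h :: "nat \<Rightarrow> complex"
      using j prod.atLeastLessThan_concat [of 0 j m h] by (simp add: lessThan_atLeast0)
    define y where "y = w j"
    define A where "A = (\<lambda>i. t i * (\<Prod>l<j. w l (i l)))"
    \<comment> \<open>The slots from \<open>j\<close> on receive \<open>x + s y\<close>. The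
      polynomial vanishes for all \<open>s\<close>; in its coefficient of \<open>s\<close> the
      vector \<open>y\<close> occupies one of \<open>m - j\<close> slots, and by symmetry each of
      them contributes the same as slot \<open>j\<close>.\<close>
    define P where "P = (\<Sum>i\<in>TS m. smult (A i) (\<Prod>l\<in>{j..<m}. [:x (i l), y (i l):]))"
    have "poly P s = T (\<lambda>l. if l < j then w l else (\<lambda>a. x a + s * y a))" for s
      unfolding P_def T_def split poly_sum by (intro sum.cong refl) (simp add: poly_prod A_def mult.assoc)
    then have "poly P s = 0" for s using Suc.IH [of w "\<lambda>a. x a + s * y a"] j by simp
    then have "P = 0" by (simp add: poly_all_0_iff_0 [symmetric])
    then have "0 = coeff P 1" by simp
    also have "\<dots> = (\<Sum>i\<in>TS m. A i * (\<Sum>l\<in>{j..<m}. y (i l) * (\<Prod>k\<in>{j..<m} - {l}. x (i k))))"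
      unfolding P_def by (simp add: coeff_sum coeff_1_prod_linear del: One_nat_def)
    also have "\<dots> = (\<Sum>l\<in>{j..<m}. \<Sum>i\<in>TS m. A i * (y (i l) * (\<Prod>k\<in>{j..<m} - {l}. x (i k))))"
      unfolding sum_distrib_left by (rule sum.swap)
    also have "\<dots> = (\<Sum>l\<in>{j..<m}. \<Sum>i\<in>TS m. A i * (y (i j) * (\<Prod>k\<in>{j..<m} - {j}. x (i k))))"
    proof (rule sum.cong [OF refl])
      fix l assume l: "l \<in> {j..<m}"
      define \<pi> where "\<pi> = Transposition.transpose j l"
      have \<pi>: "\<pi> permutes {..<m}" unfolding \<pi>_def using l j by (intro permutes_swap_id) auto
      have "(\<Sum>i\<in>TS m. A i * (y (i l) * (\<Prod>k\<in>{j..<m} - {l}. x (i k)))) =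
          (\<Sum>i\<in>TS m. A (i \<circ> \<pi>) * (y ((i \<circ> \<pi>) l) * (\<Prod>k\<in>{j..<m} - {l}. x ((i \<circ> \<pi>) k))))"
        by (rule sum_TS_perm [OF \<pi>, symmetric])
      also have "\<dots> = (\<Sum>i\<in>TS m. A i * (y (i j) * (\<Prod>k\<in>{j..<m} - {j}. x (i k))))"
      proof (rule sum.cong [OF refl])
        fix i assume i: "i \<in> TS m"
        have "(\<Prod>k<j. w k ((i \<circ> \<pi>) k)) = (\<Prod>k<j. w k (i k))"
          by (rule prod.cong) (use l in \<open>auto simp: \<pi>_def Transposition.transpose_def\<close>)
        then have "A (i \<circ> \<pi>) = A i" using sym i \<pi> unfolding A_def tsym_def by simp
        moreover have "(\<Prod>k\<in>{j..<m} - {l}. x ((i \<circ> \<pi>) k)) = (\<Prod>k\<in>{j..<m} - {j}. x (i k))"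
          by (rule prod.reindex_bij_witness [of _ \<pi> \<pi>]) (use l j in \<open>auto simp: \<pi>_def Transposition.transpose_def split: if_splits\<close>)
        moreover have "(i \<circ> \<pi>) l = i j" by (simp add: \<pi>_def)
        ultimately show "A (i \<circ> \<pi>) * (y ((i \<circ> \<pi>) l) * (\<Prod>k\<in>{j..<m} - {l}. x ((i \<circ> \<pi>) k))) =
            A i * (y (i j) * (\<Prod>k\<in>{j..<m} - {j}. x (i k)))" by simp
      qed
      finally show "(\<Sum>i\<in>TS m. A i * (y (i l) * (\<Prod>k\<in>{j..<m} - {l}. x (i k)))) = \<dots>" .
    qed
    also have "\<dots> = of_nat (m - j) * (\<Sum>i\<in>TS m. A i * (y (i j) * (\<Prod>k\<in>{j..<m} - {j}. x (i k))))" by simp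
    also have "(\<Sum>i\<in>TS m. A i * (y (i j) * (\<Prod>k\<in>{j..<m} - {j}. x (i k)))) = T (\<lambda>l. if l < Suc j then w l else x)"
      unfolding T_def split A_def
    proof (intro sum.cong refl)
      fix i
      have "j \<in> {j..<m}" using j by auto
      then have "(\<Prod>l\<in>{j..<m}. (if l < Suc j then w l else x) (i l)) = y (i j) * (\<Prod>l\<in>{j..<m} - {j}. (if l < Suc j then w l else x) (i l))"
        by (subst prod.remove [of "{j..<m}" j]) (simp_all add: y_def)
      also have "(\<Prod>l\<in>{j..<m} - {j}. (if l < Suc j then w l else x) (i l)) = (\<Prod>l\<in>{j..<m} - {j}. x (i l))"
        by (rule prod.cong) auto
      finally show "t i * (\<Prod>l<j. w l (i l)) * (y (i j) * (\<Prod>k\<in>{j..<m} - {j}. x (i k))) =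
         t i * ((\<Prod>l<j. (if l < Suc j then w l else x) (i l)) * (\<Prod>l\<in>{j..<m}. (if l < Suc j then w l else x) (i l)))"
        by simp
    qed
    finally show ?case using j by simp
  qed
  \<comment> \<open>With basis vectors in all \<open>m\<close> slots the multilinear form returns
    the single coefficient \<open>t i\<close>.\<close>
  from this [of m "\<lambda>l a. if a = i l then 1 else 0"]
  have "0 = T (\<lambda>l. if l < m then (\<lambda>a. if a = i l then 1 else 0) else undefined)" by simp
  also have "\<dots> = (\<Sum>i'\<in>TS m. t i' * (if i' = i then 1 else 0))"
    unfolding T_def
  proof (intro sum.cong refl)
    fix i' assume i': "i' \<in> TS m"
    have "(\<Prod>l<m. (if l < m then (\<lambda>a. if a = i l then 1 else 0) else undefined) (i' l)) = (if i' = i then 1 else 0 :: complex)"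
    proof (cases "i' = i")
      case False
      then obtain l where "l \<in> {..<m}" "i' l \<noteq> i l" using PiE_ext [OF i' i] by blast
      then show ?thesis using False by (auto intro!: prod_zero)
    qed simp
    then show "t i' * (\<Prod>l<m. (if l < m then (\<lambda>a. if a = i l then 1 else 0) else undefined) (i' l)) = t i' * (if i' = i then 1 else 0)" by simp
  qed
  also have "\<dots> = t i" using i finite_TS by (simp add: sum_delta_mult)
  finally show ?thesis by simp
qed

section \<open>Dual sections and constant pairings\<close>

definition dual_section :: "'a set \<Rightarrow> nat \<Rightarrow> (('a, 'n) cchart \<Rightarrow> 'a \<Rightarrow> (nat \<Rightarrow> 'n) \<Rightarrow> complex) \<Rightarrow> bool" where
  "dual_section Q m u \<longleftrightarrow>
     (\<forall>c\<in>atlas M. \<forall>x\<in>fst c \<inter> Q. \<forall>i\<in>TS m. hol_at (\<lambda>y. u c y i) x) \<and>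
     (\<forall>c\<in>atlas M. \<forall>d\<in>atlas M. \<forall>x\<in>fst c \<inter> fst d \<inter> Q. \<forall>j\<in>TS m.
        u d x j = (\<Sum>i\<in>TS m. u c x i * (\<Prod>l<m. Jac c d x (i l) (j l))))"

text \<open>An expression on which all charts agree is a holomorphic function on a compact
  component.\<close>

lemma invariant_const:
  assumes cpt: "compact_space (mtop M)"
    and hol: "\<And>c x. c \<in> atlas M \<Longrightarrow> x \<in> fst c \<Longrightarrow> x \<in> comp_of p \<Longrightarrow> hol_at (h c) x"
    and inv: "\<And>c d x. c \<in> atlas M \<Longrightarrow> d \<in> atlas M \<Longrightarrow> x \<in> fst c \<Longrightarrow> x \<in> fst d \<Longrightarrow> x \<in> comp_of p \<Longrightarrow> h c x = h d x"
    and c: "c \<in> atlas M" "x \<in> fst c" "x \<in> comp_of p" and d: "d \<in> atlas M" "y \<in> fst d" "y \<in> comp_of p"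
  shows "h c x = h d y"
proof -
  define ch where "ch = (\<lambda>x. SOME c. c \<in> atlas M \<and> x \<in> fst c)"
  have ch: "ch x \<in> atlas M" "x \<in> fst (ch x)" if "x \<in> comp_of p" for x
    using someI_ex [of "\<lambda>c. c \<in> atlas M \<and> x \<in> fst c"] chart_at comp_of_sub that unfolding ch_def by blast+
  define F where "F = (\<lambda>x. h (ch x) x)"
  have F: "F x = h c x" if "c \<in> atlas M" "x \<in> fst c" "x \<in> comp_of p" for c x
    unfolding F_def by (rule inv) (use that ch in auto)
  have "hol_at F x" if x: "x \<in> comp_of p" for x
  proof (rule hol_at_cong [OF hol [OF ch [OF x] x]])
    show "openin (mtop M) (fst (ch x) \<inter> comp_of p)"
      by (rule openin_Int [OF chart_open [OF ch(1) [OF x]] comp_of_open])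
    show "x \<in> fst (ch x) \<inter> comp_of p" using ch x by blast
    show "h (ch x) y = F y" if "y \<in> fst (ch x) \<inter> comp_of p" for y
      using F [OF ch(1) [OF x]] that by simp
  qed
  from hol_const [OF cpt this c(3) d(3)] show ?thesis using F c d by simp
qed

lemma pairing_change:
  assumes t: "tens_section m t" and u: "dual_section Q m u"
    and cd: "c \<in> atlas M" "d \<in> atlas M" "x \<in> fst c" "x \<in> fst d" "x \<in> Q"
  shows "(\<Sum>i\<in>TS m. u c x i * t c x i) = (\<Sum>i\<in>TS m. u d x i * t d x i)"
proof -
  have "(\<Sum>i\<in>TS m. u c x i * t c x i) = (\<Sum>i\<in>TS m. \<Sum>j\<in>TS m. u c x i * (\<Prod>l<m. Jac c d x (i l) (j l)) * t d x j)"
  proof (rule sum.cong [OF refl])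
    fix i assume "i \<in> TS m"
    then have e: "t c x i = (\<Sum>j\<in>TS m. (\<Prod>l<m. Jac c d x (i l) (j l)) * t d x j)"
      using t cd unfolding tens_section_def by blast
    show "u c x i * t c x i = (\<Sum>j\<in>TS m. u c x i * (\<Prod>l<m. Jac c d x (i l) (j l)) * t d x j)"
      unfolding e by (simp add: sum_distrib_left mult.assoc)
  qed
  also have "\<dots> = (\<Sum>j\<in>TS m. \<Sum>i\<in>TS m. u c x i * (\<Prod>l<m. Jac c d x (i l) (j l)) * t d x j)" by (rule sum.swap)
  also have "\<dots> = (\<Sum>j\<in>TS m. u d x j * t d x j)"
  proof (rule sum.cong [OF refl])
    fix j assume "j \<in> TS m"
    then have e: "u d x j = (\<Sum>i\<in>TS m. u c x i * (\<Prod>l<m. Jac c d x (i l) (j l)))"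
      using u cd unfolding dual_section_def by blast
    show "(\<Sum>i\<in>TS m. u c x i * (\<Prod>l<m. Jac c d x (i l) (j l)) * t d x j) = u d x j * t d x j"
      unfolding e by (simp add: sum_distrib_right)
  qed
  finally show ?thesis .
qed

text \<open>The slots of an \<open>m\<close>-fold product of \<open>m\<close>-tensors form a square,
  with factor \<open>j\<close> as its \<open>j\<close>-th row. This involution exchanges the first
  row with the first column and fixes the other slots.\<close>

definition swp :: "nat \<times> nat \<Rightarrow> nat \<times> nat" where
  "swp q = (if fst q = 0 \<or> snd q = 0 then (snd q, fst q) else q)"

lemma swp_swp [simp]: "swp (swp q) = q"
  by (cases q) (auto simp: swp_def)

lemma swp_in: "q \<in> {..<m} \<times> {..<m} \<Longrightarrow> swp q \<in> {..<m} \<times> {..<m}"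
  by (auto simp: swp_def)

lemma prod_swp: "(\<Prod>j<m. \<Prod>l<m. P (swp (j, l))) = (\<Prod>j<m. \<Prod>l<m. P (j, l) :: complex)"
  unfolding prod.cartesian_product
  by (rule prod.reindex_bij_witness [of _ swp swp]) (use swp_in in \<open>auto simp: split_beta\<close>)

definition star :: "nat \<Rightarrow> (nat \<Rightarrow> nat \<Rightarrow> 'n) \<Rightarrow> nat \<Rightarrow> nat \<Rightarrow> 'n" where
  "star m K = (\<lambda>j\<in>{..<m}. \<lambda>l\<in>{..<m}. K (fst (swp (j, l))) (snd (swp (j, l))))"

abbreviation KS :: "nat \<Rightarrow> (nat \<Rightarrow> nat \<Rightarrow> 'n) set" where
  "KS m \<equiv> PiE {..<m} (\<lambda>_. TS m)"

lemma star_apply: "j < m \<Longrightarrow> l < m \<Longrightarrow> star m K j l = K (fst (swp (j, l))) (snd (swp (j, l)))"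
  by (simp add: star_def)

lemma star_KS:
  assumes "K \<in> KS m"
  shows "star m K \<in> KS m"
proof -
  have "K (fst (swp (j, l))) (snd (swp (j, l))) \<in> I" if "j < m" "l < m" for j l
  proof -
    have "swp (j, l) \<in> {..<m} \<times> {..<m}" using that by (intro swp_in) auto
    then have q: "fst (swp (j, l)) \<in> {..<m}" "snd (swp (j, l)) \<in> {..<m}" by (auto simp: mem_Times_iff)
    show ?thesis by (rule PiE_mem [OF PiE_mem [OF assms q(1)] q(2)])
  qed
  then show ?thesis by (auto simp: star_def PiE_iff extensional_def)
qed

lemma star_star:
  assumes "K \<in> KS m"
  shows "star m (star m K) = K"
proof (rule PiE_ext [OF star_KS [OF star_KS [OF assms]] assms])
  fix j assume j: "j \<in> {..<m}"
  have KS: "star m (star m K) j \<in> TS m" "K j \<in> TS m"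
    using j PiE_mem [OF star_KS [OF star_KS [OF assms]]] PiE_mem [OF assms] by blast+
  show "star m (star m K) j = K j"
  proof (rule PiE_ext [OF KS])
    fix l assume l: "l \<in> {..<m}"
    have "swp (j, l) \<in> {..<m} \<times> {..<m}" using j l by (intro swp_in) auto
    then have "fst (swp (j, l)) < m" "snd (swp (j, l)) < m" by (auto simp: mem_Times_iff)
    then show "star m (star m K) j l = K j l" using j l by (simp add: star_apply)
  qed
qed

lemma sum_star: "(\<Sum>K\<in>KS m. F (star m K)) = (\<Sum>K\<in>KS m. F K :: complex)"
  by (rule sum.reindex_bij_witness [of _ "star m" "star m"]) (use star_KS star_star in auto)

lemma prod_star:
  "(\<Prod>j<m. \<Prod>l<m. G (star m K j l) (star m L j l)) = (\<Prod>j<m. \<Prod>l<m. G (K j l) (L j l) :: complex)"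
proof -
  have "(\<Prod>j<m. \<Prod>l<m. G (star m K j l) (star m L j l)) =
      (\<Prod>j<m. \<Prod>l<m. (\<lambda>q. G (K (fst q) (snd q)) (L (fst q) (snd q))) (swp (j, l)))"
    by (intro prod.cong refl) (simp add: star_apply)
  also have "\<dots> = (\<Prod>j<m. \<Prod>l<m. G (K j l) (L j l))"
    using prod_swp [of "\<lambda>q. G (K (fst q) (snd q)) (L (fst q) (snd q))" m] by simp
  finally show ?thesis .
qed

lemma prod_sum_KS: "(\<Prod>j<(m::nat). \<Sum>i\<in>TS m. F j i) = (\<Sum>K\<in>KS m. \<Prod>j<m. F j (K j) :: complex)"
  using finite_TS by (intro prod_sum_PiE) auto

text \<open>
  Contract the \<open>m\<close>-th tensor power of \<open>f\<close> with \<open>u 0 \<otimes> \<dots> \<otimes> u (m-1)\<close>, after a permutation of the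
  \<open>m\<^sup>2\<close> slots that moves one slot of each factor to the first factor.
\<close>

definition twist :: "nat \<Rightarrow> (nat \<Rightarrow> ('a, 'n) cchart \<Rightarrow> 'a \<Rightarrow> (nat \<Rightarrow> 'n) \<Rightarrow> complex) \<Rightarrow>
    (('a, 'n) cchart \<Rightarrow> 'a \<Rightarrow> (nat \<Rightarrow> 'n) \<Rightarrow> complex) \<Rightarrow> ('a, 'n) cchart \<Rightarrow> 'a \<Rightarrow> complex" where
  "twist m u f c x = (\<Sum>K\<in>KS m. (\<Prod>j<m. u j c x (K j)) * (\<Prod>j<m. f c x (star m K j)))"

text \<open>The same Jacobian acts on every slot, so its tensor power commutes with the permutation
  of the slots (\<open>prod_star\<close>).\<close>

lemma twist_change:
  assumes f: "tens_section m f" and u: "\<And>j. dual_section Q m (u j)"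
    and cd: "c \<in> atlas M" "d \<in> atlas M" "x \<in> fst c" "x \<in> fst d" "x \<in> Q"
  shows "twist m u f c x = twist m u f d x"
proof -
  have "twist m u f c x = (\<Sum>K\<in>KS m. \<Sum>L\<in>KS m. (\<Prod>j<m. u j c x (K j)) *
      ((\<Prod>j<m. \<Prod>l<m. Jac c d x (star m K j l) (L j l)) * (\<Prod>j<m. f d x (L j))))"
    unfolding twist_def
  proof (rule sum.cong [OF refl])
    fix K assume K: "K \<in> KS m"
    have "(\<Prod>j<m. f c x (star m K j)) = (\<Prod>j<m. \<Sum>i\<in>TS m. (\<Prod>l<m. Jac c d x (star m K j l) (i l)) * f d x i)"
    proof (rule prod.cong [OF refl])
      fix j assume "j \<in> {..<m}"
      then have "star m K j \<in> TS m" using PiE_mem [OF star_KS [OF K]] by blast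
      then show "f c x (star m K j) = (\<Sum>i\<in>TS m. (\<Prod>l<m. Jac c d x (star m K j l) (i l)) * f d x i)"
        using f cd unfolding tens_section_def by blast
    qed
    also have "\<dots> = (\<Sum>L\<in>KS m. (\<Prod>j<m. \<Prod>l<m. Jac c d x (star m K j l) (L j l)) * (\<Prod>j<m. f d x (L j)))"
      unfolding prod_sum_KS prod.distrib ..
    finally show "(\<Prod>j<m. u j c x (K j)) * (\<Prod>j<m. f c x (star m K j)) = (\<Sum>L\<in>KS m. (\<Prod>j<m. u j c x (K j)) *
      ((\<Prod>j<m. \<Prod>l<m. Jac c d x (star m K j l) (L j l)) * (\<Prod>j<m. f d x (L j))))"
      by (simp add: sum_distrib_left)
  qed
  also have "\<dots> = (\<Sum>K\<in>KS m. \<Sum>L\<in>KS m. (\<Prod>j<m. u j c x (K j)) *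
      ((\<Prod>j<m. \<Prod>l<m. Jac c d x (star m K j l) (star m L j l)) * (\<Prod>j<m. f d x (star m L j))))"
    by (rule sum.cong [OF refl], rule sum_star [symmetric])
  also have "\<dots> = (\<Sum>K\<in>KS m. \<Sum>L\<in>KS m. (\<Prod>j<m. u j c x (K j) * (\<Prod>l<m. Jac c d x (K j l) (L j l))) * (\<Prod>j<m. f d x (star m L j)))"
    unfolding prod_star by (simp add: prod.distrib mult.assoc)
  also have "\<dots> = (\<Sum>L\<in>KS m. \<Sum>K\<in>KS m. (\<Prod>j<m. u j c x (K j) * (\<Prod>l<m. Jac c d x (K j l) (L j l))) * (\<Prod>j<m. f d x (star m L j)))"
    by (rule sum.swap)
  also have "\<dots> = twist m u f d x"
    unfolding twist_def
  proof (rule sum.cong [OF refl])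
    fix L assume L: "L \<in> KS m"
    have "(\<Sum>K\<in>KS m. \<Prod>j<m. u j c x (K j) * (\<Prod>l<m. Jac c d x (K j l) (L j l))) =
        (\<Prod>j<m. \<Sum>i\<in>TS m. u j c x i * (\<Prod>l<m. Jac c d x (i l) (L j l)))"
      by (rule prod_sum_KS [symmetric])
    also have "\<dots> = (\<Prod>j<m. u j d x (L j))"
    proof (rule prod.cong [OF refl])
      fix j assume "j \<in> {..<m}"
      then have "L j \<in> TS m" using PiE_mem [OF L] by blast
      then have "u j d x (L j) = (\<Sum>i\<in>TS m. u j c x i * (\<Prod>l<m. Jac c d x (i l) (L j l)))"
        using u [of j] cd unfolding dual_section_def by blast
      then show "(\<Sum>i\<in>TS m. u j c x i * (\<Prod>l<m. Jac c d x (i l) (L j l))) = u j d x (L j)" by (rule sym)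
    qed
    finally show "(\<Sum>K\<in>KS m. (\<Prod>j<m. u j c x (K j) * (\<Prod>l<m. Jac c d x (K j l) (L j l))) * (\<Prod>j<m. f d x (star m L j))) =
        (\<Prod>j<m. u j d x (L j)) * (\<Prod>j<m. f d x (star m L j))"
      by (simp flip: sum_distrib_right)
  qed
  finally show ?thesis .
qed

end

text \<open>The common ground of the two converse implications: symmetric tensors at
  \<open>p\<close> extend to global sections, and the power of any tangent vector on the component
  extends to a dual section.\<close>

locale tensor_gen = cmanifold M for M :: "('a, 'n::finite) manifold_data" +
  fixes p :: 'a and m :: nat
  assumes cpt: "compact_space (mtop M)" and pX: "p \<in> X" and m_pos: "m > 0" and I_ne: "I \<noteq> {}"
    and gen: "c \<in> atlas M \<Longrightarrow> p \<in> fst c \<Longrightarrow> tsym m \<tau> \<Longrightarrow> \<exists>t. tens_section m t \<and> (\<forall>i\<in>TS m. t c p i = \<tau> i) \<and>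
        (\<forall>d\<in>atlas M. \<forall>x\<in>fst d. tsym m (t d x))"
    and dual: "x \<in> comp_of p \<Longrightarrow> c \<in> atlas M \<Longrightarrow> x \<in> fst c \<Longrightarrow>
        \<exists>u. dual_section (comp_of p) m u \<and> (\<forall>i\<in>TS m. u c x i = (\<Prod>l<m. v (i l)))"
begin

abbreviation "Q \<equiv> comp_of p"

lemma tensD:
  assumes "tens_section m t" "c \<in> atlas M" "x \<in> fst c" "i \<in> TS m"
  shows "hol_at (\<lambda>y. t c y i) x"
    "d \<in> atlas M \<Longrightarrow> x \<in> fst d \<Longrightarrow> t c x i = (\<Sum>j\<in>TS m. (\<Prod>l<m. Jac c d x (i l) (j l)) * t d x j)"
  using assms unfolding tens_section_def by blast+

lemma dual_hol: "dual_section Q m u \<Longrightarrow> c \<in> atlas M \<Longrightarrow> x \<in> fst c \<Longrightarrow> x \<in> Q \<Longrightarrow> i \<in> TS m \<Longrightarrow> hol_at (\<lambda>y. u c y i) x"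
  unfolding dual_section_def by blast

lemma pairing_const:
  assumes t: "tens_section m t" and u: "dual_section Q m u"
    and c: "c \<in> atlas M" "x \<in> fst c" "x \<in> Q" and d: "d \<in> atlas M" "y \<in> fst d" "y \<in> Q"
  shows "(\<Sum>i\<in>TS m. u c x i * t c x i) = (\<Sum>i\<in>TS m. u d y i * t d y i)"
proof (rule invariant_const [OF cpt _ _ c d, of "\<lambda>c x. \<Sum>i\<in>TS m. u c x i * t c x i"])
  show "hol_at (\<lambda>x. \<Sum>i\<in>TS m. u c x i * t c x i) x" if "c \<in> atlas M" "x \<in> fst c" "x \<in> Q" for c x
    using that by (intro hol_at_sum hol_at_mult tensD(1) [OF t] dual_hol [OF u])
qed (rule pairing_change [OF t u])

text \<open>The value at \<open>y\<close> is a pairing with a dual section that extends the power of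
  \<open>v\<close>, hence constant on \<open>Q\<close>. At \<open>x\<close> the tensor itself is
  zero by polarization.\<close>

lemma section_zero:
  assumes t: "tens_section m t" and sym: "tsym m (t c x)" and c: "c \<in> atlas M" "x \<in> fst c" "x \<in> Q"
    and 0: "\<And>v. ev m (t c x) v = 0" and d: "d \<in> atlas M" "y \<in> fst d" "y \<in> Q"
  shows "ev m (t d y) v = 0"
proof -
  from dual [OF d(3) d(1,2), of v] obtain u where u0: "dual_section Q m u \<and> (\<forall>i\<in>TS m. u d y i = (\<Prod>l<m. v (i l)))" ..
  then have u: "dual_section Q m u" "\<And>i. i \<in> TS m \<Longrightarrow> u d y i = (\<Prod>l<m. v (i l))" by blast+
  have "ev m (t d y) v = (\<Sum>i\<in>TS m. u d y i * t d y i)"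
    unfolding ev_def by (rule sum.cong) (simp_all add: u(2))
  also have "\<dots> = (\<Sum>i\<in>TS m. u c x i * t c x i)" by (rule pairing_const [OF t u(1) d c])
  also have "\<dots> = 0" using polarization [OF sym 0] by simp
  finally show ?thesis .
qed

text \<open>The \<open>m\<close>-th tensor power of \<open>f\<close> is contracted with the dual
  sections of one \<open>v\<close> and \<open>m - 1\<close> times \<open>y\<close>, once directly
  and once after regrouping the slots. The difference is constant on \<open>Q\<close>, and it is
  zero at \<open>p\<close>, where every slot of \<open>f\<close> carries the same covector
  \<open>\<xi>\<close>.\<close>

lemma power_identity:
  assumes f: "tens_section m f" and c0: "c0 \<in> atlas M" "p \<in> fst c0"
    and fp: "\<And>i. i \<in> TS m \<Longrightarrow> f c0 p i = (\<Prod>l<m. \<xi> (i l))"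
    and c: "c \<in> atlas M" "x \<in> fst c" "x \<in> Q"
  shows "ev m (f c x) v * ev m (f c x) y ^ (m - 1) = polar m (f c x) y v ^ m"
proof -
  from dual [OF c(3) c(1,2), of v] obtain uv where uv0: "dual_section Q m uv \<and> (\<forall>i\<in>TS m. uv c x i = (\<Prod>l<m. v (i l)))" ..
  then have uv: "dual_section Q m uv" "\<And>i. i \<in> TS m \<Longrightarrow> uv c x i = (\<Prod>l<m. v (i l))" by blast+
  from dual [OF c(3) c(1,2), of y] obtain uy where uy0: "dual_section Q m uy \<and> (\<forall>i\<in>TS m. uy c x i = (\<Prod>l<m. y (i l)))" ..
  then have uy: "dual_section Q m uy" "\<And>i. i \<in> TS m \<Longrightarrow> uy c x i = (\<Prod>l<m. y (i l))" by blast+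
  define u where "u = (\<lambda>j::nat. if j = 0 then uv else uy)"
  define w where "w = (\<lambda>j::nat. if j = 0 then v else y)"
  have u: "dual_section Q m (u j)" for j using uv uy by (simp add: u_def)
  have ux: "u j c x i = (\<Prod>l<m. w j (i l))" if "i \<in> TS m" for i j using uv uy that by (simp add: u_def w_def)
  define h where "h = (\<lambda>c x. twist m u f c x - (\<Prod>j<m. \<Sum>i\<in>TS m. u j c x i * f c x i))"
  have "h c x = h c0 p"
  proof (rule invariant_const [OF cpt _ _ c c0 comp_of_self [OF pX]])
    fix c x assume c: "c \<in> atlas M" "x \<in> fst c" "x \<in> Q"
    have 1: "hol_at (\<lambda>x. f c x (star m K j)) x" if "K \<in> KS m" "j \<in> {..<m}" for K j
      by (rule tensD(1) [OF f c(1,2) PiE_mem [OF star_KS [OF that(1)] that(2)]])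
    have 2: "hol_at (\<lambda>x. u j c x (K j)) x" if "K \<in> KS m" "j \<in> {..<m}" for K j
      by (rule dual_hol [OF u c PiE_mem [OF that]])
    show "hol_at (h c) x"
      unfolding h_def twist_def
      by (intro hol_at_diff hol_at_sum hol_at_mult hol_at_prod 1 2 tensD(1) [OF f c(1,2)] dual_hol [OF u c])
    fix d assume d: "d \<in> atlas M" "x \<in> fst d"
    show "h c x = h d x"
      unfolding h_def twist_change [OF f u c(1) d(1) c(2) d(2) c(3)] pairing_change [OF f u c(1) d(1) c(2) d(2) c(3)] ..
  qed
  also have "h c0 p = 0"
  proof -
    have "(\<Prod>j<m. f c0 p (star m K j)) = (\<Prod>j<m. f c0 p (K j))" if K: "K \<in> KS m" for K
    proof -
      have "(\<Prod>j<m. f c0 p (star m K j)) = (\<Prod>j<m. \<Prod>l<m. \<xi> (star m K j l))"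
        by (rule prod.cong) (use PiE_mem [OF star_KS [OF K]] fp in auto)
      also have "\<dots> = (\<Prod>j<m. \<Prod>l<m. \<xi> (K j l))" using prod_star [of "\<lambda>a _. \<xi> a" m K K] .
      also have "\<dots> = (\<Prod>j<m. f c0 p (K j))"
        by (rule prod.cong) (use PiE_mem [OF K] fp in auto)
      finally show ?thesis .
    qed
    then have "twist m u f c0 p = (\<Sum>K\<in>KS m. \<Prod>j<m. u j c0 p (K j) * f c0 p (K j))"
      unfolding twist_def prod.distrib by (intro sum.cong) auto
    then show ?thesis unfolding h_def prod_sum_KS by simp
  qed
  finally have eq: "twist m u f c x = (\<Prod>j<m. \<Sum>i\<in>TS m. u j c x i * f c x i)" by (simp add: h_def)
  have ml: "{..<m} = insert 0 {1..<m}" using m_pos by auto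
  have "(\<Prod>j<m. \<Sum>i\<in>TS m. u j c x i * f c x i) = (\<Prod>j<m. ev m (f c x) (w j))"
    unfolding ev_def by (intro prod.cong sum.cong refl) (simp add: ux)
  also have "\<dots> = ev m (f c x) v * ev m (f c x) y ^ (m - 1)"
    unfolding ml by (simp add: w_def)
  finally have r: "(\<Prod>j<m. \<Sum>i\<in>TS m. u j c x i * f c x i) = ev m (f c x) v * ev m (f c x) y ^ (m - 1)" .
  \<comment> \<open>The regrouping is moved from \<open>f\<close> to the dual sections. Afterwards
    each factor \<open>f\<close> has \<open>v\<close> in slot 0 and \<open>y\<close> in all others,
    which is the polar form.\<close>
  have "twist m u f c x = (\<Sum>K\<in>KS m. (\<Prod>j<m. u j c x (star m K j)) * (\<Prod>j<m. f c x (K j)))"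
    unfolding twist_def by (subst sum_star [symmetric]) (intro sum.cong refl, simp add: star_star)
  also have "\<dots> = (\<Sum>K\<in>KS m. \<Prod>j<m. (f c x (K j) * (\<Prod>l<m. w (fst (swp (j, l))) (K j l))))"
  proof (rule sum.cong [OF refl])
    fix K assume K: "K \<in> KS m"
    have "(\<Prod>j<m. u j c x (star m K j)) = (\<Prod>j<m. \<Prod>l<m. w j (star m K j l))"
      by (rule prod.cong) (use PiE_mem [OF star_KS [OF K]] ux in auto)
    also have "\<dots> = (\<Prod>j<m. \<Prod>l<m. (\<lambda>q. w (fst (swp q)) (K (fst q) (snd q))) (swp (j, l)))"
      by (intro prod.cong refl) (simp add: star_apply)
    also have "\<dots> = (\<Prod>j<m. \<Prod>l<m. w (fst (swp (j, l))) (K j l))"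
      using prod_swp [of "\<lambda>q. w (fst (swp q)) (K (fst q) (snd q))" m] by simp
    finally show "(\<Prod>j<m. u j c x (star m K j)) * (\<Prod>j<m. f c x (K j)) = (\<Prod>j<m. (f c x (K j) * (\<Prod>l<m. w (fst (swp (j, l))) (K j l))))"
      by (simp add: prod.distrib mult.commute)
  qed
  also have "\<dots> = (\<Prod>j<m. \<Sum>i\<in>TS m. f c x i * (\<Prod>l<m. w (fst (swp (j, l))) (i l)))" by (rule prod_sum_KS [symmetric])
  also have "\<dots> = (\<Prod>j<m. polar m (f c x) y v)"
    unfolding polar_def
  proof (intro prod.cong sum.cong refl)
    fix j i
    have "(\<Prod>l<m. w (fst (swp (j, l))) (i l)) = w (fst (swp (j, 0))) (i 0) * (\<Prod>l\<in>{1..<m}. w (fst (swp (j, l))) (i l))"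
      unfolding ml by simp
    also have "\<dots> = v (i 0) * (\<Prod>l\<in>{1..<m}. y (i l))"
      by (intro arg_cong2 [where f = "(*)"] prod.cong) (auto simp: swp_def w_def)
    finally show "f c x i * (\<Prod>l<m. w (fst (swp (j, l))) (i l)) = f c x i * (v (i 0) * (\<Prod>l\<in>{1..<m}. y (i l)))" by simp
  qed
  finally show ?thesis using eq r by simp
qed

lemma tens_section_combination:
  assumes "\<And>j. j \<in> A \<Longrightarrow> tens_section m (G j)"
  shows "tens_section m (\<lambda>c x i. \<Sum>j\<in>A. s j * G j c x i)"
  unfolding tens_section_def
proof (intro conjI ballI)
  fix c x i assume "c \<in> atlas M" "x \<in> fst c" "i \<in> TS m"
  then show "hol_at (\<lambda>y. \<Sum>j\<in>A. s j * G j c y i) x"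
    using tensD(1) [OF assms] by (intro hol_at_sum hol_at_mult) auto
next
  fix c d x i assume *: "c \<in> atlas M" "d \<in> atlas M" "x \<in> fst c \<inter> fst d" "i \<in> TS m"
  have "(\<Sum>j\<in>A. s j * G j c x i) = (\<Sum>j\<in>A. \<Sum>k\<in>TS m. s j * ((\<Prod>l<m. Jac c d x (i l) (k l)) * G j d x k))"
  proof (rule sum.cong [OF refl])
    fix j assume "j \<in> A"
    then show "s j * G j c x i = (\<Sum>k\<in>TS m. s j * ((\<Prod>l<m. Jac c d x (i l) (k l)) * G j d x k))"
      using tensD(2) [OF assms *(1) _ *(4) *(2)] * by (simp add: sum_distrib_left)
  qed
  also have "\<dots> = (\<Sum>k\<in>TS m. \<Sum>j\<in>A. s j * ((\<Prod>l<m. Jac c d x (i l) (k l)) * G j d x k))" by (rule sum.swap)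
  also have "\<dots> = (\<Sum>k\<in>TS m. (\<Prod>l<m. Jac c d x (i l) (k l)) * (\<Sum>j\<in>A. s j * G j d x k))"
    by (simp add: sum_distrib_left mult.left_commute)
  finally show "(\<Sum>j\<in>A. s j * G j c x i) = \<dots>" .
qed

lemma ev_combination: "ev m (\<lambda>i. \<Sum>j\<in>A. s j * G j i) v = (\<Sum>j\<in>A. s j * ev m (G j) v)"
  unfolding ev_def sum_distrib_right sum_distrib_left by (subst sum.swap) (simp add: mult.assoc)

lemma polar_combination: "polar m (\<lambda>i. \<Sum>j\<in>A. s j * G j i) y v = (\<Sum>j\<in>A. s j * polar m (G j) y v)"
  unfolding polar_def sum_distrib_right sum_distrib_left by (subst sum.swap) (simp add: mult.assoc)

text \<open>At \<open>p\<close> the powers of \<open>\<delta> k0 + s * \<delta> k\<close> form a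
  polynomial family in \<open>s\<close>, whose coefficients are extended to global sections.
  \<open>power_identity\<close> holds for every \<open>s\<close>; its value and derivative at
  \<open>s = 0\<close> are the two identities of \<open>power_data\<close>.\<close>

lemma frame_exists: "\<exists>e. frame_on Q e"
proof -
  obtain c0 where c0: "c0 \<in> atlas M" "p \<in> fst c0" using chart_at pX by blast
  obtain k0 where k0: "k0 \<in> I" using I_ne by blast
  define \<delta> :: "'n \<Rightarrow> 'n \<Rightarrow> complex" where "\<delta> = (\<lambda>k a. if a = k then 1 else 0)"
  define P where "P = (\<lambda>k i. \<Prod>l<m. [:\<delta> k0 (i l), \<delta> k (i l):])"
  define \<tau> where "\<tau> = (\<lambda>k j i. coeff (P k i) j)"
  have \<tau>sym: "tsym m (\<tau> k j)" for k j
    unfolding tsym_def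
  proof (intro allI impI ballI)
    fix \<pi> i assume \<pi>: "\<pi> permutes {..<m}"
    have "P k (i \<circ> \<pi>) = P k i"
      unfolding P_def using prod.permute [OF \<pi>, of "\<lambda>l. [:\<delta> k0 (i l), \<delta> k (i l):]"] by (simp add: comp_def)
    then show "\<tau> k j (i \<circ> \<pi>) = \<tau> k j i" by (simp add: \<tau>_def)
  qed
  have degP: "degree (P k i) \<le> m" for k i
  proof -
    have "degree (P k i) \<le> (\<Sum>l<m. degree [:\<delta> k0 (i l), \<delta> k (i l):])"
      unfolding P_def using degree_prod_sum_le [of "{..<m}" "\<lambda>l. [:\<delta> k0 (i l), \<delta> k (i l):]"] by (simp add: comp_def)
    also have "\<dots> \<le> (\<Sum>l<m. 1)" by (intro sum_mono) simp
    finally show ?thesis by simp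
  qed
  have P_sum: "(\<Sum>j\<le>m. s ^ j * \<tau> k j i) = (\<Prod>l<m. \<delta> k0 (i l) + s * \<delta> k (i l))" for s k i
    using poly_sum_upto [OF degP, of k i s] by (simp add: \<tau>_def P_def poly_prod)
  have \<tau>0: "\<tau> k 0 i = (\<Prod>l<m. \<delta> k0 (i l))" for k i
    by (simp add: \<tau>_def P_def poly_0_coeff_0 [symmetric] poly_prod)
  have "\<exists>G. \<forall>k j. tens_section m (G k j) \<and> (\<forall>i\<in>TS m. G k j c0 p i = \<tau> k j i) \<and>
      (\<forall>d\<in>atlas M. \<forall>x\<in>fst d. tsym m (G k j d x))"
    using gen [OF c0 \<tau>sym] by metis
  then obtain G0 where "\<forall>k j. tens_section m (G0 k j) \<and> (\<forall>i\<in>TS m. G0 k j c0 p i = \<tau> k j i) \<and>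
      (\<forall>d\<in>atlas M. \<forall>x\<in>fst d. tsym m (G0 k j d x))" ..
  then have G0: "\<And>k j. tens_section m (G0 k j)" "\<And>k j i. i \<in> TS m \<Longrightarrow> G0 k j c0 p i = \<tau> k j i"
    "\<And>k j d x. d \<in> atlas M \<Longrightarrow> x \<in> fst d \<Longrightarrow> tsym m (G0 k j d x)" by blast+
  define f where "f = G0 k0 0"
  \<comment> \<open>The extensions of the coefficient at \<open>j = 0\<close> could differ with
    \<open>k\<close>, although their values at \<open>p\<close> agree. \<open>power_data\<close>
    requires one \<open>f\<close> for all \<open>k\<close>.\<close>
  define G where "G = (\<lambda>k j. if j = 0 then f else G0 k j)"
  have G: "tens_section m (G k j)" "i \<in> TS m \<Longrightarrow> G k j c0 p i = \<tau> k j i"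
    "d \<in> atlas M \<Longrightarrow> x \<in> fst d \<Longrightarrow> tsym m (G k j d x)" for k j i d x
    using G0 \<tau>0 by (simp_all add: G_def f_def)
  define g where "g = (\<lambda>k. G k 1)"
  have evp: "ev m (f c0 p) v = v k0 ^ m" for v
  proof -
    have "ev m (f c0 p) v = (\<Sum>i\<in>TS m. \<Prod>l<m. \<delta> k0 (i l) * v (i l))"
      unfolding ev_def f_def by (rule sum.cong) (simp_all add: G0(2) \<tau>0 prod.distrib)
    also have "\<dots> = (\<Prod>l<m. \<Sum>a\<in>I. \<delta> k0 a * v a)" by (rule sum_prod_PiE [symmetric]) simp
    also have "(\<Sum>a\<in>I. \<delta> k0 a * v a) = v k0"
      using k0 by (simp add: \<delta>_def if_distrib [of "\<lambda>x. x * _"] cong: if_cong)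
    finally show ?thesis by simp
  qed
  have evg: "ev m (g k c0 p) v = of_nat m * v k0 ^ (m - 1) * v k" if k: "k \<in> I" for k v
  proof -
    have dv: "(\<Sum>a\<in>I. [:\<delta> k0 a * v a, \<delta> k a * v a:]) = [:v k0, v k:]"
    proof -
      show ?thesis unfolding sum_linear_poly using k k0 by (simp add: \<delta>_def if_distrib [of "\<lambda>x. x * _"] cong: if_cong)
    qed
    have "ev m (g k c0 p) v = (\<Sum>i\<in>TS m. coeff (P k i) 1 * (\<Prod>l<m. v (i l)))"
      unfolding ev_def g_def by (rule sum.cong) (simp_all add: G(2) \<tau>_def)
    also have "\<dots> = coeff (\<Sum>i\<in>TS m. \<Prod>l<m. [:\<delta> k0 (i l) * v (i l), \<delta> k (i l) * v (i l):]) 1"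
    proof -
      have "(\<Prod>l<m. [:\<delta> k0 (i l) * v (i l), \<delta> k (i l) * v (i l):]) = smult (\<Prod>l<m. v (i l)) (P k i)" for i
        unfolding P_def by (simp add: mult.commute flip: prod_smult)
      then show ?thesis by (simp add: coeff_sum mult.commute)
    qed
    also have "(\<Sum>i\<in>TS m. \<Prod>l<m. [:\<delta> k0 (i l) * v (i l), \<delta> k (i l) * v (i l):]) =
        (\<Prod>l<m. \<Sum>a\<in>I. [:\<delta> k0 a * v a, \<delta> k a * v a:])"
      by (rule prod_sum_PiE [symmetric]) auto
    also have "coeff \<dots> 1 = of_nat m * v k0 ^ (m - 1) * v k"
      unfolding dv using coeff_1_power_linear [of "v k0" "v k" m] by simp
    finally show ?thesis .
  qed
  have pQ: "p \<in> Q" by (rule comp_of_self [OF pX])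
  have id: "(\<Sum>j\<le>m. s ^ j * ev m (G k j c x) v) * (\<Sum>j\<le>m. s ^ j * ev m (G k j c x) y) ^ (m - 1) =
      (\<Sum>j\<le>m. s ^ j * polar m (G k j c x) y v) ^ m"
    if c: "c \<in> atlas M" "x \<in> fst c" "x \<in> Q" for c x k s v y
    using power_identity [OF tens_section_combination [of "{..m}" "G k" "\<lambda>j. s ^ j"] c0 _ c, of "\<lambda>a. \<delta> k0 a + s * \<delta> k a" v y]
    by (simp add: G P_sum ev_combination polar_combination)
  interpret power_data M p m f g
  proof
    show "compact_space (mtop M)" "p \<in> X" "m > 0" "I \<noteq> {}" by (fact cpt pX m_pos I_ne)+
    show "tens_section m f" by (simp add: f_def G0)
    show "tens_section m (g k)" for k by (simp add: g_def G)
    fix x c assume x: "x \<in> Q" and c: "c \<in> atlas M" "x \<in> fst c"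
    have z0: "(\<Sum>j\<le>m. 0 ^ j * F j) = (F 0 :: complex)" for F
      by (simp add: power_0_left if_distrib [of "\<lambda>x. x * _"] cong: if_cong)
    show "ev m (f c x) v * ev m (f c x) y ^ (m - 1) = polar m (f c x) y v ^ m" for v y
      using id [OF c x, of 0 k0 v y] unfolding z0 by (simp add: G_def)
    show "ev m (g k c x) v * ev m (f c x) y ^ (m - 1) +
          of_nat (m - 1) * ev m (f c x) v * ev m (f c x) y ^ (m - 2) * ev m (g k c x) y =
        of_nat m * polar m (f c x) y v ^ (m - 1) * polar m (g k c x) y v" for k v y
    proof -
      \<comment> \<open>At \<open>s = 0\<close> only the term \<open>j = 1\<close> survives, and
        \<open>m > 0\<close> puts it in range.\<close>
      have der: "((\<lambda>s. \<Sum>j\<le>m. s ^ j * F j) has_field_derivative F 1) (at 0)" for F :: "nat \<Rightarrow> complex"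
      proof -
        have "((\<lambda>s. \<Sum>j\<le>m. s ^ j * F j) has_field_derivative (\<Sum>j\<le>m. of_nat j * 0 ^ (j - 1) * F j)) (at 0)"
          by (auto intro!: derivative_eq_intros sum.cong)
        moreover have "(\<Sum>j\<le>m. of_nat j * 0 ^ (j - 1) * F j) = (\<Sum>j\<in>{1}. of_nat j * 0 ^ (j - 1) * F j)"
          using m_pos by (intro sum.mono_neutral_right) (auto simp: power_0_left)
        ultimately show ?thesis by simp
      qed
      define L where "L = (\<lambda>s. (\<Sum>j\<le>m. s ^ j * ev m (G k j c x) v) * (\<Sum>j\<le>m. s ^ j * ev m (G k j c x) y) ^ (m - 1))"
      have 1: "(L has_field_derivative (ev m (g k c x) v * ev m (f c x) y ^ (m - 1) +
          of_nat (m - 1) * ev m (f c x) v * ev m (f c x) y ^ (m - 2) * ev m (g k c x) y)) (at 0)"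
        unfolding L_def
        by (rule DERIV_cong [OF DERIV_mult [OF der DERIV_power [OF der]]])
           (unfold z0, simp add: g_def G_def numeral_2_eq_2)
      have "L = (\<lambda>s. (\<Sum>j\<le>m. s ^ j * polar m (G k j c x) y v) ^ m)" unfolding L_def id [OF c x] ..
      moreover have "((\<lambda>s. (\<Sum>j\<le>m. s ^ j * polar m (G k j c x) y v) ^ m) has_field_derivative
          of_nat m * polar m (f c x) y v ^ (m - 1) * polar m (g k c x) y v) (at 0)"
        by (rule DERIV_cong [OF DERIV_power [OF der]]) (unfold z0, simp add: g_def G_def)
      ultimately show ?thesis using DERIV_unique [OF 1] by simp
    qed
    show "\<exists>v. ev m (f c x) v \<noteq> 0"
    proof (rule ccontr)
      assume "\<not> ?thesis"
      then have "ev m (f c0 p) (\<delta> k0) = 0"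
        using section_zero [of f c x c0 p "\<delta> k0"] c x c0 pQ G0 by (simp add: f_def)
      then show False by (simp add: evp \<delta>_def)
    qed
    show "s k = 0" if 0: "\<And>v. (\<Sum>k\<in>I. s k * ev m (g k c x) v) = 0" and k: "k \<in> I" for s k
    proof -
      \<comment> \<open>A relation at \<open>x\<close> is carried to \<open>p\<close> by
        \<open>section_zero\<close>. There \<open>g k\<close> is \<open>m\<close> times the product
        of the \<open>k\<close>-th coordinate with a power of the \<open>k0\<close>-th, and test
        vectors with \<open>k0\<close>-th coordinate 1 separate the coefficients.\<close>
      define t where "t = (\<lambda>c x i. \<Sum>k\<in>I. s k * g k c x i)"
      have t: "tens_section m t" unfolding t_def by (rule tens_section_combination) (simp add: g_def G)
      have "tsym m (t c x)" using G(3) [OF c] unfolding t_def g_def tsym_def by simp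
      then have z: "ev m (t c0 p) v = 0" for v
        by (rule section_zero [OF t _ c x _ c0 pQ]) (use 0 in \<open>simp add: t_def ev_combination\<close>)
      have m0: "of_nat m \<noteq> (0::complex)" using m_pos by simp
      have ev: "of_nat m * (v k0 ^ (m - 1) * (\<Sum>k\<in>I. s k * v k)) = 0" for v
        using z [of v] unfolding t_def ev_combination
        by (simp add: evg sum_distrib_left mult_ac)
      have "(\<Sum>k\<in>I. s k * v k) = 0" if "v k0 = 1" for v using ev [of v] m0 that by simp
      note lin = this
      have sd: "(\<Sum>k\<in>I. s k * \<delta> l k) = s l" if "l \<in> I" for l
        using that by (simp add: \<delta>_def sum_delta_mult)
      have 1: "s k0 = 0" using lin [of "\<delta> k0"] sd [OF k0] by (simp add: \<delta>_def)
      show "s k = 0"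
      proof (cases "k = k0")
        case False
        have "(\<Sum>j\<in>I. s j * (\<delta> k0 j + \<delta> k j)) = 0" by (rule lin) (use False in \<open>auto simp: \<delta>_def\<close>)
        then show ?thesis using 1 sd [OF k0] sd [OF k] by (simp add: distrib_left sum.distrib)
      qed (use 1 in simp)
    qed
  qed
  show ?thesis by (rule frame_exists)
qed

end

section \<open>Symmetric powers of the cotangent bundle\<close>

context cmanifold
begin

definition monomial_of :: "nat \<Rightarrow> (nat \<Rightarrow> 'n) \<Rightarrow> 'n multiset" where
  "monomial_of m i = mset (map i [0..<m])"

definition monomials :: "nat \<Rightarrow> 'n multiset set" where
  "monomials m = {\<alpha>. set_mset \<alpha> \<subseteq> I \<and> size \<alpha> = m}"

definition fibre :: "nat \<Rightarrow> 'n multiset \<Rightarrow> (nat \<Rightarrow> 'n) set" where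
  "fibre m \<alpha> = {i \<in> TS m. monomial_of m i = \<alpha>}"

definition tensor_Jac :: "nat \<Rightarrow> ('a, 'n) cchart \<Rightarrow> ('a, 'n) cchart \<Rightarrow> 'a \<Rightarrow> (nat \<Rightarrow> 'n) \<Rightarrow> (nat \<Rightarrow> 'n) \<Rightarrow> complex" where
  "tensor_Jac m c d x i j = (\<Prod>l<m. Jac c d x (i l) (j l))"

abbreviation tuple_of :: "nat \<Rightarrow> 'n list \<Rightarrow> nat \<Rightarrow> 'n" where
  "tuple_of m as \<equiv> (\<lambda>l\<in>{..<m}. as ! l)"

lemma monomial_of_monomials: "i \<in> TS m \<Longrightarrow> monomial_of m i \<in> monomials m"
  using PiE_mem [of i "{..<m}" "\<lambda>_. I"] by (auto simp: monomial_of_def monomials_def)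

lemma map_tuple_of: "length as = m \<Longrightarrow> map (tuple_of m as) [0..<m] = as"
  by (intro nth_equalityI) auto

lemma tuple_of_map: "i \<in> TS m \<Longrightarrow> tuple_of m (map i [0..<m]) = i"
  using PiE_arb [of i "{..<m}" "\<lambda>_. I"] by (intro ext) (simp add: restrict_def)

lemma tuple_of_TS:
  assumes "length as = m" "set as \<subseteq> I"
  shows "tuple_of m as \<in> TS m"
proof (rule restrict_PiE_iff [THEN iffD2], rule ballI)
  fix l assume "l \<in> {..<m}"
  then have "as ! l \<in> set as" using assms by simp
  then show "as ! l \<in> I" using assms by blast
qed

lemma mset_monomials: "mset as = \<alpha> \<Longrightarrow> \<alpha> \<in> monomials m \<Longrightarrow> length as = m \<and> set as \<subseteq> I"
  by (auto simp: monomials_def)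

lemma tuple_of_fibre: "mset as = \<alpha> \<Longrightarrow> \<alpha> \<in> monomials m \<Longrightarrow> tuple_of m as \<in> fibre m \<alpha>"
  using mset_monomials [of as \<alpha> m] tuple_of_TS [of as m] map_tuple_of [of as m] by (simp add: fibre_def monomial_of_def del: mset_map)

lemma fibre_ne: "\<alpha> \<in> monomials m \<Longrightarrow> fibre m \<alpha> \<noteq> {}"
proof -
  assume a: "\<alpha> \<in> monomials m"
  obtain as where "mset as = \<alpha>" using ex_mset by blast
  from tuple_of_fibre [OF this a] show ?thesis by blast
qed

lemma finite_fibre: "finite (fibre m \<alpha>)"
  unfolding fibre_def using finite_TS by simp

lemma card_fibre: "\<alpha> \<in> monomials m \<Longrightarrow> of_nat (card (fibre m \<alpha>)) \<noteq> (0::complex)"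
  using fibre_ne finite_fibre by simp

lemma finite_monomials: "finite (monomials m)"
proof -
  have "monomials m \<subseteq> monomial_of m ` TS m"
  proof
    fix \<alpha> assume "\<alpha> \<in> monomials m"
    then obtain i where "i \<in> fibre m \<alpha>" using fibre_ne by blast
    then show "\<alpha> \<in> monomial_of m ` TS m" unfolding fibre_def by blast
  qed
  then show ?thesis using finite_TS finite_subset by blast
qed

lemma sum_fibres: "(\<Sum>\<alpha>\<in>monomials m. \<Sum>i\<in>fibre m \<alpha>. F i) = (\<Sum>i\<in>TS m. F i :: complex)"
  unfolding fibre_def by (rule sum.group [OF finite_TS finite_monomials]) (use monomial_of_monomials in blast)

lemma map_comp_permute: "\<pi> permutes {..<m} \<Longrightarrow> map (i \<circ> \<pi>) [0..<m] = permute_list \<pi> (map i [0..<m])"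
proof (intro nth_equalityI)
  fix l assume p: "\<pi> permutes {..<m}" and "l < length (map (i \<circ> \<pi>) [0..<m])"
  then have l: "l < m" by simp
  moreover have "\<pi> l < m" using permutes_in_image [OF p, of l] l by simp
  ultimately show "map (i \<circ> \<pi>) [0..<m] ! l = permute_list \<pi> (map i [0..<m]) ! l"
    using p by (simp add: permute_list_nth)
qed simp

lemma monomial_of_perm: "\<pi> permutes {..<m} \<Longrightarrow> monomial_of m (i \<circ> \<pi>) = monomial_of m i"
  unfolding monomial_of_def by (simp add: map_comp_permute)

lemma fibre_perm: "i \<in> fibre m \<alpha> \<Longrightarrow> \<pi> permutes {..<m} \<Longrightarrow> i \<circ> \<pi> \<in> fibre m \<alpha>"
  unfolding fibre_def using TS_perm monomial_of_perm by auto

lemma fibre_eq_perm: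
  assumes "i \<in> fibre m \<alpha>" "j \<in> fibre m \<alpha>"
  obtains \<pi> where "\<pi> permutes {..<m}" "i = j \<circ> \<pi>"
proof -
  have ij: "i \<in> TS m" "j \<in> TS m" using assms by (auto simp: fibre_def)
  have "mset (map i [0..<m]) = mset (map j [0..<m])" using assms by (simp add: fibre_def monomial_of_def)
  then obtain \<pi> where \<pi>: "\<pi> permutes {..<length (map j [0..<m])}" "permute_list \<pi> (map j [0..<m]) = map i [0..<m]"
    by (rule mset_eq_permutation)
  then have p: "\<pi> permutes {..<m}" by simp
  have "map i [0..<m] = map (j \<circ> \<pi>) [0..<m]" using \<pi>(2) map_comp_permute [OF p, of j] by (simp only:)
  then have "i l = (j \<circ> \<pi>) l" if "l \<in> {..<m}" for l using that by auto
  then have "i = j \<circ> \<pi>" by (rule PiE_ext [OF ij(1) TS_perm [OF ij(2) p]])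
  then show ?thesis using that p by blast
qed

lemma sum_fibre_perm:
  assumes "\<pi> permutes {..<m}"
  shows "(\<Sum>i\<in>fibre m \<alpha>. F (i \<circ> \<pi>)) = (\<Sum>i\<in>fibre m \<alpha>. F i :: complex)"
  by (rule sum.reindex_bij_witness [of _ "\<lambda>i. i \<circ> inv \<pi>" "\<lambda>i. i \<circ> \<pi>"])
     (use assms fibre_perm permutes_inv [OF assms] in \<open>auto simp: comp_assoc permutes_inv_o [OF assms]\<close>)

lemma tensor_Jac_perm: "\<pi> permutes {..<m} \<Longrightarrow> tensor_Jac m c d x (i \<circ> \<pi>) (j \<circ> \<pi>) = tensor_Jac m c d x i j"
  unfolding tensor_Jac_def using prod.permute [of \<pi> "{..<m}" "\<lambda>l. Jac c d x (i l) (j l)"] by (simp add: comp_def)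

lemma tensor_Jac_column:
  assumes "j \<in> fibre m \<beta>" "j' \<in> fibre m \<beta>"
  shows "(\<Sum>i\<in>fibre m \<alpha>. tensor_Jac m c d x i j) = (\<Sum>i\<in>fibre m \<alpha>. tensor_Jac m c d x i j')"
proof -
  obtain \<pi> where \<pi>: "\<pi> permutes {..<m}" "j = j' \<circ> \<pi>" using fibre_eq_perm [OF assms] .
  show ?thesis
    unfolding \<pi>(2) using sum_fibre_perm [OF \<pi>(1), of "\<lambda>i. tensor_Jac m c d x i (j' \<circ> \<pi>)" \<alpha>]
    by (simp add: tensor_Jac_perm [OF \<pi>(1)])
qed

lemma tensor_Jac_row:
  assumes "i \<in> fibre m \<alpha>" "i' \<in> fibre m \<alpha>"
  shows "(\<Sum>j\<in>fibre m \<beta>. tensor_Jac m c d x i j) = (\<Sum>j\<in>fibre m \<beta>. tensor_Jac m c d x i' j)"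
proof -
  obtain \<pi> where \<pi>: "\<pi> permutes {..<m}" "i = i' \<circ> \<pi>" using fibre_eq_perm [OF assms] .
  show ?thesis
    unfolding \<pi>(2) using sum_fibre_perm [OF \<pi>(1), of "\<lambda>j. tensor_Jac m c d x (i' \<circ> \<pi>) j" \<beta>]
    by (simp add: tensor_Jac_perm [OF \<pi>(1)])
qed

lemma sym_index: "frame_index (sym_power m (cotangent_bundle M)) = monomials m"
  by (simp add: monomials_def)

text \<open>Tuples with the same monomial have equal column sums over a fibre, so the list picked by
  choice in the definition of \<open>sym_power\<close> can be replaced by any tuple
  \<open>j\<close>.\<close>

lemma sym_transition:
  assumes c: "c \<in> atlas M" "x \<in> fst c" and \<alpha>: "\<alpha> \<in> monomials m" and j: "j \<in> fibre m \<beta>"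
  shows "transition (sym_power m (cotangent_bundle M)) c d x \<alpha> \<beta> = (\<Sum>i\<in>fibre m \<alpha>. tensor_Jac m c d x i j)"
proof -
  have \<beta>: "\<beta> \<in> monomials m" using j monomial_of_monomials by (auto simp: fibre_def)
  define bs where "bs = (SOME bs. bs \<in> permutations_of_multiset \<beta>)"
  have "\<exists>bs. bs \<in> permutations_of_multiset \<beta>" using ex_mset [of \<beta>] by (auto simp: permutations_of_multiset_def)
  then have "bs \<in> permutations_of_multiset \<beta>" unfolding bs_def by (rule someI_ex)
  then have bs: "mset bs = \<beta>" by (simp add: permutations_of_multiset_def)
  have "transition (sym_power m (cotangent_bundle M)) c d x \<alpha> \<beta> =
      (\<Sum>as\<in>permutations_of_multiset \<alpha>. \<Prod>k<m. transition (cotangent_bundle M) c d x (as ! k) (bs ! k))"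
    by (simp add: sym_power_def tensor_power_def bs_def)
  also have "\<dots> = (\<Sum>i\<in>fibre m \<alpha>. tensor_Jac m c d x i (tuple_of m bs))"
  proof (rule sum.reindex_bij_witness [of _ "\<lambda>i. map i [0..<m]" "tuple_of m"])
    fix as assume "as \<in> permutations_of_multiset \<alpha>"
    then have as: "mset as = \<alpha>" by (simp add: permutations_of_multiset_def)
    note l = mset_monomials [OF as \<alpha>]
    show "map (tuple_of m as) [0..<m] = as" using l map_tuple_of by blast
    show "tuple_of m as \<in> fibre m \<alpha>" by (rule tuple_of_fibre [OF as \<alpha>])
    show "tensor_Jac m c d x (tuple_of m as) (tuple_of m bs) = (\<Prod>k<m. transition (cotangent_bundle M) c d x (as ! k) (bs ! k))"
      unfolding tensor_Jac_def
    proof (rule prod.cong [OF refl])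
      fix k assume "k \<in> {..<m}"
      then have "as ! k \<in> I" "k < m" using l by auto
      then show "Jac c d x (tuple_of m as k) (tuple_of m bs k) = transition (cotangent_bundle M) c d x (as ! k) (bs ! k)"
        using c by (simp add: transition_eq_Jac)
    qed
  next
    fix i assume "i \<in> fibre m \<alpha>"
    then have i: "i \<in> TS m" "monomial_of m i = \<alpha>" by (auto simp: fibre_def)
    show "tuple_of m (map i [0..<m]) = i" by (rule tuple_of_map [OF i(1)])
    show "map i [0..<m] \<in> permutations_of_multiset \<alpha>" using i(2) by (simp add: monomial_of_def permutations_of_multiset_def)
  qed
  also have "\<dots> = (\<Sum>i\<in>fibre m \<alpha>. tensor_Jac m c d x i j)"
    by (rule tensor_Jac_column [OF tuple_of_fibre [OF bs \<beta>] j])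
  finally show ?thesis .
qed

text \<open>Double counting in the block of two fibres, within which all row sums agree and all
  column sums agree. The cardinalities are multinomial coefficients.\<close>

lemma sym_transition_row:
  assumes c: "c \<in> atlas M" "x \<in> fst c" and i: "i \<in> fibre m \<alpha>" and \<beta>: "\<beta> \<in> monomials m"
  shows "of_nat (card (fibre m \<beta>)) * transition (sym_power m (cotangent_bundle M)) c d x \<alpha> \<beta> =
    of_nat (card (fibre m \<alpha>)) * (\<Sum>j\<in>fibre m \<beta>. tensor_Jac m c d x i j)"
proof -
  have \<alpha>: "\<alpha> \<in> monomials m" using i monomial_of_monomials by (auto simp: fibre_def)
  have "of_nat (card (fibre m \<beta>)) * transition (sym_power m (cotangent_bundle M)) c d x \<alpha> \<beta> =
      (\<Sum>j\<in>fibre m \<beta>. \<Sum>i\<in>fibre m \<alpha>. tensor_Jac m c d x i j)"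
    by (simp add: sym_transition [OF c \<alpha>, symmetric])
  also have "\<dots> = (\<Sum>i'\<in>fibre m \<alpha>. \<Sum>j\<in>fibre m \<beta>. tensor_Jac m c d x i' j)" by (rule sum.swap)
  also have "\<dots> = (\<Sum>i'\<in>fibre m \<alpha>. \<Sum>j\<in>fibre m \<beta>. tensor_Jac m c d x i j)"
    by (rule sum.cong [OF refl]) (rule tensor_Jac_row [OF _ i])
  finally show ?thesis by simp
qed

text \<open>The identification of the quotient \<open>Sym^m\<close> with symmetric tensors: the
  coefficient of a monomial is distributed evenly over the tuples that represent it.\<close>

definition tens_of :: "nat \<Rightarrow> (('a, 'n) cchart \<Rightarrow> 'a \<Rightarrow> 'n multiset \<Rightarrow> complex) \<Rightarrow>
    ('a, 'n) cchart \<Rightarrow> 'a \<Rightarrow> (nat \<Rightarrow> 'n) \<Rightarrow> complex" where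
  "tens_of m s c x i = s c x (monomial_of m i) / of_nat (card (fibre m (monomial_of m i)))"

lemma tens_of_section:
  assumes s: "s \<in> global_sections M (sym_power m (cotangent_bundle M))"
  shows "tens_section m (tens_of m s)" "tsym m (tens_of m s c x)"
proof -
  have 0: "chart_index (sym_power m (cotangent_bundle M)) = atlas M" "cover (sym_power m (cotangent_bundle M)) = fst"
    by simp_all
  note s' = s [unfolded global_sections_def mem_Collect_eq sym_index 0]
  show "tsym m (tens_of m s c x)" unfolding tsym_def tens_of_def by (simp add: monomial_of_perm)
  show "tens_section m (tens_of m s)"
    unfolding tens_section_def
  proof (intro conjI ballI)
    fix c x i assume *: "c \<in> atlas M" "x \<in> fst c" "i \<in> TS m"
    have "holo_fun M (fst c) (\<lambda>x. s c x (monomial_of m i))" using s' * monomial_of_monomials by blast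
    then have "hol_at (\<lambda>x. s c x (monomial_of m i)) x" using * by (simp add: holo_fun_iff chart_open)
    then show "hol_at (\<lambda>y. tens_of m s c y i) x"
      unfolding tens_of_def by (rule hol_at_divide) (use card_fibre [OF monomial_of_monomials [OF *(3)]] in auto)
  next
    fix c d x i assume *: "c \<in> atlas M" "d \<in> atlas M" "x \<in> fst c \<inter> fst d" "i \<in> TS m"
    then have x: "x \<in> fst c" by blast
    define \<alpha> where "\<alpha> = monomial_of m i"
    have i: "i \<in> fibre m \<alpha>" and \<alpha>: "\<alpha> \<in> monomials m" using * monomial_of_monomials by (auto simp: fibre_def \<alpha>_def)
    let ?T = "transition (sym_power m (cotangent_bundle M)) c d x \<alpha>"
    have "(\<Sum>j\<in>TS m. tensor_Jac m c d x i j * tens_of m s d x j) = (\<Sum>\<beta>\<in>monomials m. \<Sum>j\<in>fibre m \<beta>. tensor_Jac m c d x i j * tens_of m s d x j)"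
      by (rule sum_fibres [symmetric])
    also have "\<dots> = (\<Sum>\<beta>\<in>monomials m. ?T \<beta> * s d x \<beta> / of_nat (card (fibre m \<alpha>)))"
    proof (rule sum.cong [OF refl])
      fix \<beta> assume \<beta>: "\<beta> \<in> monomials m"
      have "(\<Sum>j\<in>fibre m \<beta>. tensor_Jac m c d x i j * tens_of m s d x j) =
          (\<Sum>j\<in>fibre m \<beta>. tensor_Jac m c d x i j) * (s d x \<beta> / of_nat (card (fibre m \<beta>)))"
        unfolding sum_distrib_right by (rule sum.cong) (auto simp: fibre_def tens_of_def)
      also have "(\<Sum>j\<in>fibre m \<beta>. tensor_Jac m c d x i j) = of_nat (card (fibre m \<beta>)) * ?T \<beta> / of_nat (card (fibre m \<alpha>))"
        using sym_transition_row [OF *(1) x i \<beta>, of d] card_fibre [OF \<alpha>] by (simp add: field_simps)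
      finally show "(\<Sum>j\<in>fibre m \<beta>. tensor_Jac m c d x i j * tens_of m s d x j) = ?T \<beta> * s d x \<beta> / of_nat (card (fibre m \<alpha>))"
        using card_fibre [OF \<beta>] by simp
    qed
    also have "\<dots> = s c x \<alpha> / of_nat (card (fibre m \<alpha>))"
    proof -
      have "s c x \<alpha> = (\<Sum>\<beta>\<in>monomials m. ?T \<beta> * s d x \<beta>)" using s' *(1-3) \<alpha> by blast
      then show ?thesis by (simp add: sum_divide_distrib)
    qed
    finally show "tens_of m s c x i = (\<Sum>j\<in>TS m. (\<Prod>l<m. Jac c d x (i l) (j l)) * tens_of m s d x j)"
      by (simp add: tens_of_def \<alpha>_def tensor_Jac_def)
  qed
qed

text \<open>Summing a symmetric \<open>\<tau>\<close> over the tuples of a monomial gives the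
  coefficient to be realized; \<open>tens_of\<close> divides by their number again.\<close>

lemma generated_tensors:
  assumes gg: "globally_generated M (sym_power m (cotangent_bundle M))"
    and c: "c \<in> atlas M" "x \<in> fst c" and \<tau>: "tsym m \<tau>"
  shows "\<exists>t. tens_section m t \<and> (\<forall>i\<in>TS m. t c x i = \<tau> i) \<and> (\<forall>d\<in>atlas M. \<forall>y\<in>fst d. tsym m (t d y))"
proof -
  have "c \<in> chart_index (sym_power m (cotangent_bundle M))" "x \<in> cover (sym_power m (cotangent_bundle M)) c"
    using c by simp_all
  then have "\<exists>s\<in>global_sections M (sym_power m (cotangent_bundle M)).
      \<forall>\<alpha>\<in>frame_index (sym_power m (cotangent_bundle M)). s c x \<alpha> = (\<Sum>i\<in>fibre m \<alpha>. \<tau> i)"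
    using gg [unfolded globally_generated_def, rule_format, of c x "\<lambda>\<alpha>. \<Sum>i\<in>fibre m \<alpha>. \<tau> i"] by simp
  then obtain s where s: "s \<in> global_sections M (sym_power m (cotangent_bundle M))"
    "\<And>\<alpha>. \<alpha> \<in> monomials m \<Longrightarrow> s c x \<alpha> = (\<Sum>i\<in>fibre m \<alpha>. \<tau> i)"
    unfolding sym_index by blast
  have "tens_of m s c x i = \<tau> i" if i: "i \<in> TS m" for i
  proof -
    have if': "i \<in> fibre m (monomial_of m i)" using i by (simp add: fibre_def)
    have "\<tau> j = \<tau> i" if "j \<in> fibre m (monomial_of m i)" for j
    proof -
      obtain \<pi> where "\<pi> permutes {..<m}" "j = i \<circ> \<pi>" using fibre_eq_perm [OF \<open>j \<in> fibre m (monomial_of m i)\<close> if'] .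
      then show ?thesis using \<tau> i unfolding tsym_def by blast
    qed
    then have "(\<Sum>j\<in>fibre m (monomial_of m i). \<tau> j) = of_nat (card (fibre m (monomial_of m i))) * \<tau> i" by simp
    then show ?thesis using card_fibre [OF monomial_of_monomials [OF i]] by (simp add: tens_of_def s(2) [OF monomial_of_monomials [OF i]])
  qed
  then show ?thesis using tens_of_section [OF s(1)] by blast
qed

text \<open>Combinations with constant coefficients of the trivializing frame, or of its dual frame,
  are global; the inverse matrices at \<open>x\<close> supply the coefficients for a prescribed
  value.\<close>

lemma trivial_sym_generated:
  assumes "holo_trivial M (sym_power m (cotangent_bundle M))"
  shows "globally_generated M (sym_power m (cotangent_bundle M))"
    and "c \<in> atlas M \<Longrightarrow> x \<in> fst c \<Longrightarrow> \<exists>u. dual_section Q m u \<and> (\<forall>i\<in>TS m. u c x i = (\<Prod>l<m. v (i l)))"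
proof -
  let ?E = "sym_power m (cotangent_bundle M)"
  have E: "chart_index ?E = atlas M" "cover ?E = fst" by simp_all
  obtain n \<Phi> \<Psi> where 0: "bundle_hom M ?E (trivial_bundle M n) \<Phi>" "bundle_hom M (trivial_bundle M n) ?E \<Psi>"
    and inv': "\<forall>c\<in>atlas M. \<forall>x\<in>fst c. (\<forall>a\<in>monomials m. \<forall>b\<in>monomials m. (\<Sum>r<n. \<Psi> () c x a r * \<Phi> c () x r b) = (if a = b then 1 else 0)) \<and>
       (\<forall>r<n. \<forall>s<n. (\<Sum>a\<in>monomials m. \<Phi> c () x r a * \<Psi> () c x a s) = (if r = s then 1 else 0))"
    using assms unfolding holo_trivial_def bundle_isomorphic_trivial_iff [OF E] sym_index by (elim exE conjE)
  have inv: "(\<Sum>r<n. \<Psi> () c x a r * \<Phi> c () x r b) = (if a = b then 1 else 0)"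
    if "c \<in> atlas M" "x \<in> fst c" "a \<in> monomials m" "b \<in> monomials m" for c x a b
    using inv' that by blast
  note \<Phi> = 0(1) [unfolded bundle_hom_to_trivial [OF E] sym_index]
  note \<Psi> = 0(2) [unfolded bundle_hom_from_trivial [OF E] sym_index]
  show "globally_generated M ?E"
    unfolding globally_generated_def E sym_index
  proof (intro ballI allI)
    fix c x v assume c: "c \<in> atlas M" "x \<in> fst c"
    \<comment> \<open>The coordinates of the prescribed value in the trivialization at
      \<open>x\<close>.\<close>
    define b where "b = (\<lambda>r. \<Sum>\<beta>\<in>monomials m. \<Phi> c () x r \<beta> * v \<beta>)"
    define s where "s = (\<lambda>d y \<alpha>. if d \<in> atlas M \<and> y \<in> fst d \<and> \<alpha> \<in> monomials m then \<Sum>r<n. \<Psi> () d y \<alpha> r * b r else 0)"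
    have "s \<in> global_sections M ?E"
      unfolding global_sections_def E sym_index
    proof (intro CollectI conjI allI impI ballI)
      fix d \<beta> assume *: "d \<in> atlas M" "\<beta> \<in> monomials m"
      show "holo_fun M (fst d) (\<lambda>y. s d y \<beta>)"
        unfolding holo_fun_iff [OF chart_open [OF *(1)]]
      proof
        fix y assume y: "y \<in> fst d"
        have "hol_at (\<lambda>y. \<Sum>r<n. \<Psi> () d y \<beta> r * b r) y"
          using \<Psi> * y by (intro hol_at_sum hol_at_mult hol_at_const) auto
        then show "hol_at (\<lambda>y. s d y \<beta>) y"
          by (rule hol_at_cong [OF _ chart_open [OF *(1)] y]) (use * in \<open>simp add: s_def\<close>)
      qed
    next
      fix d e y \<alpha> assume *: "d \<in> atlas M" "e \<in> atlas M" "y \<in> fst d \<inter> fst e" "\<alpha> \<in> monomials m"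
      have "s d y \<alpha> = (\<Sum>r<n. \<Sum>\<beta>\<in>monomials m. transition ?E d e y \<alpha> \<beta> * (\<Psi> () e y \<beta> r * b r))"
      proof -
        have "\<Psi> () d y \<alpha> r * b r = (\<Sum>\<beta>\<in>monomials m. transition ?E d e y \<alpha> \<beta> * (\<Psi> () e y \<beta> r * b r))" if "r < n" for r
        proof -
          have r: "\<Psi> () d y \<alpha> r = (\<Sum>\<beta>\<in>monomials m. transition ?E d e y \<alpha> \<beta> * \<Psi> () e y \<beta> r)" using \<Psi> * that by blast
          show ?thesis unfolding r by (simp add: sum_distrib_right mult.assoc)
        qed
        then show ?thesis using * by (simp add: s_def)
      qed
      also have "\<dots> = (\<Sum>\<beta>\<in>monomials m. \<Sum>r<n. transition ?E d e y \<alpha> \<beta> * (\<Psi> () e y \<beta> r * b r))" by (rule sum.swap)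
      also have "\<dots> = (\<Sum>\<beta>\<in>monomials m. transition ?E d e y \<alpha> \<beta> * s e y \<beta>)"
        by (rule sum.cong) (use * in \<open>auto simp: s_def sum_distrib_left\<close>)
      finally show "s d y \<alpha> = \<dots>" .
    qed (auto simp: s_def)
    moreover have "s c x \<alpha> = v \<alpha>" if \<alpha>: "\<alpha> \<in> monomials m" for \<alpha>
    proof -
      have "s c x \<alpha> = (\<Sum>r<n. \<Sum>\<beta>\<in>monomials m. \<Psi> () c x \<alpha> r * \<Phi> c () x r \<beta> * v \<beta>)"
        using c \<alpha> by (simp add: s_def b_def sum_distrib_left mult.assoc)
      also have "\<dots> = (\<Sum>\<beta>\<in>monomials m. (\<Sum>r<n. \<Psi> () c x \<alpha> r * \<Phi> c () x r \<beta>) * v \<beta>)"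
        by (subst sum.swap) (simp add: sum_distrib_right)
      also have "\<dots> = v \<alpha>" using \<alpha> by (simp add: inv [OF c \<alpha>] sum_delta_mult finite_monomials)
      finally show ?thesis .
    qed
    ultimately show "\<exists>s\<in>global_sections M ?E. \<forall>b\<in>monomials m. s c x b = v b" by blast
  qed
  assume c: "c \<in> atlas M" "x \<in> fst c"
  define mon where "mon = (\<lambda>\<alpha>. prod_mset (image_mset v \<alpha>))"
  \<comment> \<open>The coordinates of the dual vector, given on monomials by \<open>mon\<close>, in
    the dual frame at \<open>x\<close>.\<close>
  define a where "a = (\<lambda>r. \<Sum>\<alpha>\<in>monomials m. mon \<alpha> * \<Psi> () c x \<alpha> r)"
  define u where "u = (\<lambda>d y i. \<Sum>r<n. a r * \<Phi> d () y r (monomial_of m i))"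
  have mon: "mon (monomial_of m i) = (\<Prod>l<m. v (i l))" for i
    unfolding mon_def monomial_of_def mset_map [symmetric] prod_mset_prod_list map_map
    by (simp add: prod.list_conv_set_nth atLeast0LessThan comp_def)
  have "dual_section Q m u"
    unfolding dual_section_def
  proof (intro conjI ballI)
    fix d y i assume "d \<in> atlas M" "y \<in> fst d \<inter> Q" "i \<in> TS m"
    then show "hol_at (\<lambda>y. u d y i) y"
      unfolding u_def using \<Phi> monomial_of_monomials by (intro hol_at_sum hol_at_mult hol_at_const) blast
  next
    fix d e y j assume *: "d \<in> atlas M" "e \<in> atlas M" "y \<in> fst d \<inter> fst e \<inter> Q" "j \<in> TS m"
    have jf: "j \<in> fibre m (monomial_of m j)" using * by (simp add: fibre_def)
    have y: "y \<in> fst d" using * by blast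
    have "(\<Sum>i\<in>TS m. u d y i * tensor_Jac m d e y i j) = (\<Sum>\<alpha>\<in>monomials m. \<Sum>i\<in>fibre m \<alpha>. u d y i * tensor_Jac m d e y i j)"
      by (rule sum_fibres [symmetric])
    also have "\<dots> = (\<Sum>\<alpha>\<in>monomials m. \<Sum>r<n. a r * (\<Phi> d () y r \<alpha> * transition ?E d e y \<alpha> (monomial_of m j)))"
    proof (rule sum.cong [OF refl])
      fix \<alpha> assume \<alpha>: "\<alpha> \<in> monomials m"
      have "(\<Sum>i\<in>fibre m \<alpha>. u d y i * tensor_Jac m d e y i j) = (\<Sum>r<n. a r * \<Phi> d () y r \<alpha>) * (\<Sum>i\<in>fibre m \<alpha>. tensor_Jac m d e y i j)"
        unfolding sum_distrib_left by (rule sum.cong) (auto simp: fibre_def u_def)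
      then show "(\<Sum>i\<in>fibre m \<alpha>. u d y i * tensor_Jac m d e y i j) = (\<Sum>r<n. a r * (\<Phi> d () y r \<alpha> * transition ?E d e y \<alpha> (monomial_of m j)))"
        unfolding sym_transition [OF *(1) y \<alpha> jf] by (simp add: sum_distrib_right mult.assoc)
    qed
    also have "\<dots> = (\<Sum>r<n. \<Sum>\<alpha>\<in>monomials m. a r * (\<Phi> d () y r \<alpha> * transition ?E d e y \<alpha> (monomial_of m j)))" by (rule sum.swap)
    also have "\<dots> = u e y j"
      unfolding u_def
    proof (rule sum.cong [OF refl])
      fix r assume "r \<in> {..<n}"
      then have "(\<Sum>\<alpha>\<in>monomials m. \<Phi> d () y r \<alpha> * transition ?E d e y \<alpha> (monomial_of m j)) = \<Phi> e () y r (monomial_of m j)"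
        using \<Phi> * monomial_of_monomials [OF *(4)] by blast
      then show "(\<Sum>\<alpha>\<in>monomials m. a r * (\<Phi> d () y r \<alpha> * transition ?E d e y \<alpha> (monomial_of m j))) = a r * \<Phi> e () y r (monomial_of m j)"
        by (simp flip: sum_distrib_left)
    qed
    finally show "u e y j = (\<Sum>i\<in>TS m. u d y i * (\<Prod>l<m. Jac d e y (i l) (j l)))" by (simp add: tensor_Jac_def)
  qed
  moreover have "u c x i = (\<Prod>l<m. v (i l))" if i: "i \<in> TS m" for i
  proof -
    have "u c x i = (\<Sum>r<n. \<Sum>\<alpha>\<in>monomials m. mon \<alpha> * (\<Psi> () c x \<alpha> r * \<Phi> c () x r (monomial_of m i)))"
      by (simp add: u_def a_def sum_distrib_right mult.assoc)
    also have "\<dots> = (\<Sum>\<alpha>\<in>monomials m. mon \<alpha> * (\<Sum>r<n. \<Psi> () c x \<alpha> r * \<Phi> c () x r (monomial_of m i)))"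
      by (subst sum.swap) (simp add: sum_distrib_left)
    also have "\<dots> = mon (monomial_of m i)"
      using monomial_of_monomials [OF i] by (simp add: inv [OF c _ monomial_of_monomials [OF i]] sum_delta_mult finite_monomials)
    finally show ?thesis by (simp add: mon)
  qed
  ultimately show "\<exists>u. dual_section Q m u \<and> (\<forall>i\<in>TS m. u c x i = (\<Prod>l<m. v (i l)))" by blast
qed

end

section \<open>Duals of tensors from pluricanonical forms\<close>

text \<open>
  The relative invariant of a tuple of \<open>m\<close>-tensors (one for each index in \<open>I\<close>) that is multilinear in
  the tuple and takes the value \<open>det \<xi> ^ m\<close> if the \<open>k\<close>-th tensor is the \<open>m\<close>-th power of the \<open>k\<close>-th row of \<open>\<xi>\<close>.
\<close>

definition detpow :: "'n::finite set \<Rightarrow> nat \<Rightarrow> ('n \<Rightarrow> (nat \<Rightarrow> 'n) \<Rightarrow> complex) \<Rightarrow> complex" where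
  "detpow I m t = (\<Sum>P\<in>PiE {..<m} (\<lambda>_. {p. p permutes I}).
     (\<Prod>l<m. of_int (sign (P l))) * (\<Prod>k\<in>I. t k (\<lambda>l\<in>{..<m}. P l k)))"

lemma detpow_index:
  assumes "P \<in> PiE {..<m} (\<lambda>_. {p. p permutes I})" "k \<in> I"
  shows "(\<lambda>l\<in>{..<m}. P l k) \<in> PiE {..<m} (\<lambda>_. I)"
proof (rule restrict_PiE_iff [THEN iffD2], rule ballI)
  fix l assume "l \<in> {..<m}"
  then have "P l permutes I" using PiE_mem [OF assms(1)] by blast
  then show "P l k \<in> I" using assms(2) by (simp add: permutes_in_image)
qed

lemma prod_delta:
  assumes "i \<in> PiE {..<m::nat} A" "j \<in> PiE {..<m} B"
  shows "(\<Prod>l<m. if i l = j l then 1 else 0) = (if i = j then 1 else 0 :: complex)"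
proof (cases "i = j")
  case False
  have "\<exists>l<m. i l \<noteq> j l"
  proof (rule ccontr)
    assume "\<not> ?thesis"
    then have "i l = j l" for l using assms PiE_arb [of i "{..<m}" A l] PiE_arb [of j "{..<m}" B l] by (cases "l < m") auto
    then show False using False by blast
  qed
  then have "(\<Prod>l<m. if i l = j l then 1 else 0) = (0 :: complex)" by (intro prod_zero) auto
  then show ?thesis using False by simp
qed simp

lemma sum_perms_prod:
  fixes I :: "'n::finite set" and m :: nat
  shows "(\<Sum>P\<in>PiE {..<m} (\<lambda>_. {p. p permutes I}). \<Prod>l<m. of_int (sign (P l)) * (\<Prod>k\<in>I. \<xi> l k (P l k))) =
    (\<Prod>l<m. det (xmat I (\<xi> l)))"
  unfolding det_xmat by (rule prod_sum_PiE [symmetric]) (auto simp: finite_permutations)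

lemma detpow_rows:
  assumes "\<And>k i. k \<in> I \<Longrightarrow> i \<in> PiE {..<m} (\<lambda>_. I) \<Longrightarrow> t k i = (\<Prod>l<m. \<xi> l k (i l))"
  shows "detpow I m t = (\<Prod>l<m. det (xmat I (\<xi> l)))"
proof -
  have "detpow I m t = (\<Sum>P\<in>PiE {..<m} (\<lambda>_. {p. p permutes I}). \<Prod>l<m. of_int (sign (P l)) * (\<Prod>k\<in>I. \<xi> l k (P l k)))"
    unfolding detpow_def
  proof (rule sum.cong [OF refl])
    fix P assume P: "P \<in> PiE {..<m} (\<lambda>_. {p. p permutes I})"
    have "(\<Prod>k\<in>I. t k (\<lambda>l\<in>{..<m}. P l k)) = (\<Prod>k\<in>I. \<Prod>l<m. \<xi> l k (P l k))"
      by (rule prod.cong [OF refl]) (simp add: assms [OF _ detpow_index [OF P]])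
    also have "\<dots> = (\<Prod>l<m. \<Prod>k\<in>I. \<xi> l k (P l k))" by (rule prod.swap)
    finally show "(\<Prod>l<m. of_int (sign (P l))) * (\<Prod>k\<in>I. t k (\<lambda>l\<in>{..<m}. P l k)) =
        (\<Prod>l<m. of_int (sign (P l)) * (\<Prod>k\<in>I. \<xi> l k (P l k)))"
      by (simp add: prod.distrib)
  qed
  then show ?thesis by (simp only: sum_perms_prod)
qed

text \<open>Once the column tuples \<open>B\<close> are fixed, the signed sum over families of
  permutations factors over the slots into one determinant per slot.\<close>

lemma detpow_expand:
  fixes J :: "'n::finite \<Rightarrow> 'n \<Rightarrow> complex"
  assumes t: "\<And>k i. k \<in> I \<Longrightarrow> i \<in> PiE {..<m} (\<lambda>_. I) \<Longrightarrow>
      t k i = (\<Sum>j\<in>PiE {..<m} (\<lambda>_. I). (\<Prod>l<m. J (i l) (j l)) * t' k j)"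
  shows "detpow I m t = (\<Sum>B\<in>PiE I (\<lambda>_. PiE {..<m} (\<lambda>_. I)).
    (\<Prod>k\<in>I. t' k (B k)) * (\<Prod>l<m. det (xmat I (\<lambda>k a. J a (B k l)))))"
proof -
  let ?S = "PiE {..<m} (\<lambda>_. {p. p permutes I})" and ?T = "PiE {..<m} (\<lambda>_. I)"
  have fin: "finite ?T" by (intro finite_PiE) auto
  have "detpow I m t = (\<Sum>P\<in>?S. \<Sum>B\<in>PiE I (\<lambda>_. ?T).
      (\<Prod>k\<in>I. t' k (B k)) * (\<Prod>l<m. of_int (sign (P l)) * (\<Prod>k\<in>I. J (P l k) (B k l))))"
    unfolding detpow_def
  proof (rule sum.cong [OF refl])
    fix P assume P: "P \<in> ?S"
    have "(\<Prod>k\<in>I. t k (\<lambda>l\<in>{..<m}. P l k)) = (\<Prod>k\<in>I. \<Sum>j\<in>?T. (\<Prod>l<m. J (P l k) (j l)) * t' k j)"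
      by (rule prod.cong [OF refl]) (simp add: t [OF _ detpow_index [OF P]])
    also have "\<dots> = (\<Sum>B\<in>PiE I (\<lambda>_. ?T). \<Prod>k\<in>I. (\<Prod>l<m. J (P l k) (B k l)) * t' k (B k))"
      using fin by (intro prod_sum_PiE) auto
    also have "\<dots> = (\<Sum>B\<in>PiE I (\<lambda>_. ?T). (\<Prod>k\<in>I. t' k (B k)) * (\<Prod>l<m. \<Prod>k\<in>I. J (P l k) (B k l)))"
      unfolding prod.distrib by (subst prod.swap) (simp add: mult.commute)
    finally show "(\<Prod>l<m. of_int (sign (P l))) * (\<Prod>k\<in>I. t k (\<lambda>l\<in>{..<m}. P l k)) = (\<Sum>B\<in>PiE I (\<lambda>_. ?T).
      (\<Prod>k\<in>I. t' k (B k)) * (\<Prod>l<m. of_int (sign (P l)) * (\<Prod>k\<in>I. J (P l k) (B k l))))"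
      by (simp add: prod.distrib sum_distrib_left mult_ac)
  qed
  also have "\<dots> = (\<Sum>B\<in>PiE I (\<lambda>_. ?T). \<Sum>P\<in>?S.
      (\<Prod>k\<in>I. t' k (B k)) * (\<Prod>l<m. of_int (sign (P l)) * (\<Prod>k\<in>I. J (P l k) (B k l))))"
    by (rule sum.swap)
  also have "\<dots> = (\<Sum>B\<in>PiE I (\<lambda>_. ?T). (\<Prod>k\<in>I. t' k (B k)) * (\<Prod>l<m. det (xmat I (\<lambda>k a. J a (B k l)))))"
    by (simp only: sum_distrib_left [symmetric] sum_perms_prod [where \<xi> = "\<lambda>l k a. J a (B k l)" for B])
  finally show ?thesis .
qed

text \<open>The expansion is used twice, with \<open>J\<close> and with the identity matrix;
  corresponding determinants differ by \<open>det J\<close> in each of the \<open>m\<close>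
  slots.\<close>

lemma detpow_change:
  fixes J :: "'n::finite \<Rightarrow> 'n \<Rightarrow> complex"
  assumes t: "\<And>k i. k \<in> I \<Longrightarrow> i \<in> PiE {..<m} (\<lambda>_. I) \<Longrightarrow>
      t k i = (\<Sum>j\<in>PiE {..<m} (\<lambda>_. I). (\<Prod>l<m. J (i l) (j l)) * t' k j)"
  shows "detpow I m t = det (xmat I J) ^ m * detpow I m t'"
proof -
  let ?T = "PiE {..<m} (\<lambda>_. I)"
  let ?\<delta> = "\<lambda>a b. if a = b then 1 else 0 :: complex"
  have fin: "finite ?T" by (intro finite_PiE) auto
  have t': "t' k i = (\<Sum>j\<in>?T. (\<Prod>l<m. ?\<delta> (i l) (j l)) * t' k j)" if "i \<in> ?T" for k i
  proof -
    have "(\<Sum>j\<in>?T. (\<Prod>l<m. ?\<delta> (i l) (j l)) * t' k j) = (\<Sum>j\<in>?T. if i = j then t' k j else 0)"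
      by (rule sum.cong [OF refl]) (simp add: prod_delta [OF that])
    then show ?thesis using that fin by simp
  qed
  \<comment> \<open>Selecting columns of \<open>J\<close>, possibly with repetitions, is
    multiplication by the selection matrix.\<close>
  have *: "det (xmat I (\<lambda>k a. J a (b k))) = det (xmat I J) * det (xmat I (\<lambda>k a. ?\<delta> a (b k)))"
    if b: "\<And>k. k \<in> I \<Longrightarrow> b k \<in> I" for b
  proof -
    have "xmat I (\<lambda>k a. J a (b k)) = xmat I (\<lambda>k a. \<Sum>c\<in>I. ?\<delta> c (b k) * J a c)"
      by (rule xmat_cong) (simp add: if_distrib [of "\<lambda>z. z * _"] b cong: if_cong)
    also have "\<dots> = xmat I (\<lambda>k a. ?\<delta> a (b k)) ** transpose (xmat I J)"
      by (simp only: xmat_transpose xmat_mult)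
    finally show ?thesis by (simp add: det_mul det_transpose)
  qed
  have "detpow I m t = (\<Sum>B\<in>PiE I (\<lambda>_. ?T). (\<Prod>k\<in>I. t' k (B k)) * (\<Prod>l<m. det (xmat I (\<lambda>k a. J a (B k l)))))"
    by (rule detpow_expand [OF t])
  also have "\<dots> = (\<Sum>B\<in>PiE I (\<lambda>_. ?T). det (xmat I J) ^ m *
      ((\<Prod>k\<in>I. t' k (B k)) * (\<Prod>l<m. det (xmat I (\<lambda>k a. ?\<delta> a (B k l))))))"
  proof (rule sum.cong [OF refl])
    fix B assume B: "B \<in> PiE I (\<lambda>_. ?T)"
    have "(\<Prod>l<m. det (xmat I (\<lambda>k a. J a (B k l)))) = (\<Prod>l<m. det (xmat I J) * det (xmat I (\<lambda>k a. ?\<delta> a (B k l))))"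
      by (rule prod.cong [OF refl], rule *) (use PiE_mem [OF PiE_mem [OF B]] in blast)
    then show "(\<Prod>k\<in>I. t' k (B k)) * (\<Prod>l<m. det (xmat I (\<lambda>k a. J a (B k l)))) = det (xmat I J) ^ m *
        ((\<Prod>k\<in>I. t' k (B k)) * (\<Prod>l<m. det (xmat I (\<lambda>k a. ?\<delta> a (B k l)))))"
      by (simp add: prod.distrib)
  qed
  also have "\<dots> = det (xmat I J) ^ m * detpow I m t'"
    by (simp only: sum_distrib_left [symmetric] detpow_expand [where J = ?\<delta>, OF t'])
  finally show ?thesis .
qed

lemma detpow_linear:
  fixes I :: "'n::finite set"
  assumes a: "a \<in> I"
  shows "detpow I m (t(a := s)) = (\<Sum>i\<in>PiE {..<m} (\<lambda>_. I). s i * detpow I m (t(a := \<lambda>j. if j = i then 1 else 0)))"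
proof -
  let ?S = "PiE {..<m} (\<lambda>_. {p. p permutes I})" and ?T = "PiE {..<m} (\<lambda>_. I)"
  have fin: "finite ?T" by (intro finite_PiE) auto
  define R where "R P = (\<Prod>l<m. of_int (sign (P l))) * (\<Prod>k\<in>I - {a}. t k (\<lambda>l\<in>{..<m}. P l k))" for P
  have D: "detpow I m (t(a := s)) = (\<Sum>P\<in>?S. R P * s (\<lambda>l\<in>{..<m}. P l a))" for s
    unfolding detpow_def R_def
  proof (rule sum.cong [OF refl])
    fix P assume "P \<in> ?S"
    have "(\<Prod>k\<in>I. (t(a := s)) k (\<lambda>l\<in>{..<m}. P l k)) = s (\<lambda>l\<in>{..<m}. P l a) * (\<Prod>k\<in>I - {a}. t k (\<lambda>l\<in>{..<m}. P l k))"
      by (subst prod.remove [OF _ a]) auto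
    then show "(\<Prod>l<m. of_int (sign (P l))) * (\<Prod>k\<in>I. (t(a := s)) k (\<lambda>l\<in>{..<m}. P l k)) =
       (\<Prod>l<m. of_int (sign (P l))) * (\<Prod>k\<in>I - {a}. t k (\<lambda>l\<in>{..<m}. P l k)) * s (\<lambda>l\<in>{..<m}. P l a)"
      by simp
  qed
  have "(\<Sum>i\<in>?T. s i * detpow I m (t(a := \<lambda>j. if j = i then 1 else 0))) =
      (\<Sum>P\<in>?S. \<Sum>i\<in>?T. R P * (s i * (if (\<lambda>l\<in>{..<m}. P l a) = i then 1 else 0)))"
    unfolding D sum_distrib_left by (subst sum.swap) (simp only: mult.left_commute)
  also have "\<dots> = (\<Sum>P\<in>?S. R P * s (\<lambda>l\<in>{..<m}. P l a))"
  proof (rule sum.cong [OF refl])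
    fix P assume P: "P \<in> ?S"
    have "(\<Sum>i\<in>?T. s i * (if (\<lambda>l\<in>{..<m}. P l a) = i then 1 else 0)) = s (\<lambda>l\<in>{..<m}. P l a)"
      using detpow_index [OF P a] fin by (simp add: if_distrib [of "\<lambda>z. _ * z"] cong: if_cong)
    then show "(\<Sum>i\<in>?T. R P * (s i * (if (\<lambda>l\<in>{..<m}. P l a) = i then 1 else 0))) = R P * s (\<lambda>l\<in>{..<m}. P l a)"
      by (simp only: sum_distrib_left [symmetric])
  qed
  finally show ?thesis by (simp only: D)
qed

text \<open>The rows other than the one with index \<open>b\<close> span the annihilator of \<open>v\<close>, so the cofactors along this row are proportional to \<open>v\<close>.\<close>

lemma det_annihilator:
  fixes I :: "'n::finite set" and v :: "'n \<Rightarrow> complex" and b :: 'n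
  defines "A \<equiv> \<lambda>a k j. if k = b then (if j = a then 1 else 0)
    else (if j = k then 1 else 0) - v k / v b * (if j = b then 1 else 0)"
  assumes b0: "b \<in> I" "v b \<noteq> 0"
  shows "det (xmat I (A b)) \<noteq> 0"
    and "a \<in> I \<Longrightarrow> det (xmat I (A a)) = v a / v b * det (xmat I (A b))"
proof -
  show "det (xmat I (A b)) \<noteq> 0"
    unfolding det_xmat_nonzero_iff
  proof (intro allI impI)
    fix t assume t: "\<forall>j\<in>I. (\<Sum>k\<in>I. t k * A b k j) = 0"
    have z: "t j = 0" if j: "j \<in> I - {b}" for j
    proof -
      have "(\<Sum>k\<in>I. t k * A b k j) = (\<Sum>k\<in>I. if k = j then t k else 0)"
        by (rule sum.cong) (use j in \<open>auto simp: A_def\<close>)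
      then show ?thesis using t j by simp
    qed
    have "(\<Sum>k\<in>I. t k * A b k b) = t b * A b b b + (\<Sum>k\<in>I - {b}. t k * A b k b)"
      by (rule sum.remove) (use b0 in auto)
    also have "\<dots> = t b" using z by (simp add: A_def)
    finally have "t b = 0" using t b0 by simp
    then show "\<forall>k\<in>I. t k = 0" using z by blast
  qed
  show "det (xmat I (A a)) = v a / v b * det (xmat I (A b))" if a: "a \<in> I"
  proof (cases "a = b")
    case True
    then show ?thesis using b0 by simp
  next
    case False
    let ?c = "v a / v b"
    let ?B = "\<chi> k. if k = b then ?c *s row b (xmat I (A b)) else row k (xmat I (A b))"
    have "xmat I (A a) = (\<chi> k. if k = b then row b ?B + 1 *s row a ?B else row k ?B)"
      using b0 a False by (auto simp: vec_eq_iff xmat_nth row_def A_def)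
    then have "det (xmat I (A a)) = det ?B" using det_row_operation [of b a ?B 1] False by simp
    also have "\<dots> = ?c * det (\<chi> k. if k = b then row b (xmat I (A b)) else row k (xmat I (A b)))"
      by (rule det_row_mul)
    also have "(\<chi> k. if k = b then row b (xmat I (A b)) else row k (xmat I (A b))) = xmat I (A b)"
      by (simp add: vec_eq_iff row_def)
    finally show ?thesis .
  qed
qed

context cmanifold
begin

section \<open>Nonvanishing pluricanonical forms and dual sections from generators\<close>

lemma tsym_prod: "tsym m (\<lambda>i. \<Prod>l<m. w (i l))"
  unfolding tsym_def
proof (intro allI impI ballI)
  fix \<pi> i assume "\<pi> permutes {..<m}"
  then show "(\<Prod>l<m. w ((i \<circ> \<pi>) l)) = (\<Prod>l<m. w (i l))"
    using prod.permute [of \<pi> "{..<m}" "\<lambda>l. w (i l)"] by (simp add: comp_def)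
qed

lemma hol_at_detpow:
  assumes "\<And>k i. k \<in> I \<Longrightarrow> i \<in> TS m \<Longrightarrow> hol_at (\<lambda>y. t y k i) x"
  shows "hol_at (\<lambda>y. detpow I m (t y)) x"
  unfolding detpow_def
  by (intro hol_at_sum hol_at_mult hol_at_prod hol_at_const finite assms detpow_index)

lemma tens_change:
  assumes "tens_section m t" "c \<in> atlas M" "d \<in> atlas M" "x \<in> fst c" "x \<in> fst d" "i \<in> TS m"
  shows "t c x i = (\<Sum>j\<in>TS m. (\<Prod>l<m. Jac c d x (i l) (j l)) * t d x j)"
  using assms unfolding tens_section_def by blast

lemma kform_detpow:
  assumes "\<And>k. k \<in> I \<Longrightarrow> tens_section m (t k)"
  shows "kform m (\<lambda>c x. detpow I m (\<lambda>k. t k c x))"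
  unfolding kform_def
proof (intro conjI ballI)
  fix c x assume "c \<in> atlas M" "x \<in> fst c"
  then show "hol_at (\<lambda>y. detpow I m (\<lambda>k. t k c y)) x"
    using assms unfolding tens_section_def by (intro hol_at_detpow) blast
next
  fix c d x assume "c \<in> atlas M" "d \<in> atlas M" "x \<in> fst c \<inter> fst d"
  then show "detpow I m (\<lambda>k. t k c x) = det_Jac c d x ^ m * detpow I m (\<lambda>k. t k d x)"
    unfolding det_Jac_def using assms by (intro detpow_change tens_change) auto
qed

text \<open>The tensors are chosen with the \<open>m\<close>-th powers of the coordinate covectors
  as values at \<open>x\<close>; there the invariant is a power of the determinant of the
  identity.\<close>

lemma generated_kform:
  assumes gg: "globally_generated M (sym_power m (cotangent_bundle M))" and c: "c \<in> atlas M" "x \<in> fst c"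
  obtains w where "kform m w" "w c x \<noteq> 0"
proof -
  have "\<exists>t. \<forall>k. tens_section m (t k) \<and> (\<forall>i\<in>TS m. t k c x i = (\<Prod>l<m. if i l = k then 1 else 0))"
    using generated_tensors [OF gg c tsym_prod [of m "\<lambda>a. if a = k then 1 else 0" for k]] by (intro choice allI) blast
  then obtain t where t': "\<forall>k. tens_section m (t k) \<and> (\<forall>i\<in>TS m. t k c x i = (\<Prod>l<m. if i l = k then 1 else 0))" ..
  have t: "tens_section m (t k)" "i \<in> TS m \<Longrightarrow> t k c x i = (\<Prod>l<m. if i l = k then 1 else 0)" for k i
    using t' by blast+
  have "detpow I m (\<lambda>k. t k c x) = (\<Prod>l<m. det (xmat I (\<lambda>k a. if a = k then 1 else 0)))"
    by (rule detpow_rows) (rule t(2))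
  also have "xmat I (\<lambda>k a. if a = k then 1 else 0) = mat 1"
    by (auto simp: vec_eq_iff xmat_nth mat_def)
  finally have "detpow I m (\<lambda>k. t k c x) \<noteq> 0" by simp
  then show ?thesis using that kform_detpow [of m t] t(1) by blast
qed

text \<open>At a zero \<open>q\<close> of \<open>F\<close> generation provides a second form that is
  nonzero at \<open>q\<close>, so Kodaira dimension 0 makes \<open>F\<close> vanish near
  \<open>q\<close>. The zero set is thus open as well as closed, and it misses
  \<open>x\<close>.\<close>

lemma nonvanishing_kform:
  assumes kod: "kodaira_dimension M = 0" and m: "m > 0"
    and gg: "globally_generated M (sym_power m (cotangent_bundle M))" and c: "c \<in> atlas M" "x \<in> fst c"
  obtains F where "kform m F" "\<And>d y. d \<in> atlas M \<Longrightarrow> y \<in> fst d \<Longrightarrow> y \<in> comp_of x \<Longrightarrow> F d y \<noteq> 0"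
proof -
  obtain F where F: "kform m F" "F c x \<noteq> 0" using generated_kform [OF gg c] .
  define Z where "Z y \<longleftrightarrow> (\<exists>d\<in>atlas M. y \<in> fst d \<and> F d y = 0)" for y
  have Z: "Z y \<longleftrightarrow> F d y = 0" if d: "d \<in> atlas M" "y \<in> fst d" for d y
  proof
    assume "Z y"
    then obtain e where e: "e \<in> atlas M" "y \<in> fst e" "F e y = 0" unfolding Z_def by blast
    show "F d y = 0" using kformD(2) [OF F(1) d e(1,2)] e(3) by simp
  qed (use d in \<open>auto simp: Z_def\<close>)
  have xX: "x \<in> X" using chart_sub c by blast
  have loc: "\<exists>N. openin (mtop M) N \<and> q \<in> N \<and> (\<forall>y\<in>N. Z y = Z q)" if q: "q \<in> comp_of x" for q
  proof -
    obtain d where d: "d \<in> atlas M" "q \<in> fst d" using chart_at comp_of_sub q by blast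
    show ?thesis
    proof (cases "F d q = 0")
      case True
      obtain w where w: "kform m w" "w d q \<noteq> 0" using generated_kform [OF gg d] .
      obtain N where N: "openin (mtop M) N" "q \<in> N" "N \<subseteq> fst d" "\<And>y. y \<in> N \<Longrightarrow> F d y = 0"
        by (rule kform_zero_near [OF kod m F(1) w(1) d True w(2)]) blast
      have "Z y = Z q" if "y \<in> N" for y
        using Z [OF d(1), of y] Z [OF d] N that True by blast
      then show ?thesis using N by blast
    next
      case False
      have o: "open (- {0::complex})" by (rule open_Compl) simp
      have Fd: "F d q \<in> - {0}" using False by simp
      obtain N where N: "openin (mtop M) N" "q \<in> N" "N \<subseteq> fst d" "F d ` N \<subseteq> - {0}"
        using hol_at_nbhd [OF kformD(1) [OF F(1) d] chart_open [OF d(1)] d(2) o Fd] .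
      have "Z y = Z q" if "y \<in> N" for y
        using Z [OF d(1), of y] Z [OF d] N that False by blast
      then show ?thesis using N by blast
    qed
  qed
  have "F d y \<noteq> 0" if "d \<in> atlas M" "y \<in> fst d" "y \<in> comp_of x" for d y
    using comp_of_local_const [where f = Z, OF loc that(3) comp_of_self [OF xX]] Z [OF that(1,2)] Z [OF c] F(2) by simp
  then show ?thesis using that F(1) by blast
qed

text \<open>A cofactor construction: the argument with index \<open>b\<close> of the invariant is
  left free, and the others are powers of covectors annihilating \<open>v\<close>. At
  \<open>x\<close> the resulting dual tensor is a multiple of the power of \<open>v\<close>; its
  weight \<open>det ^ m\<close> is removed by dividing by \<open>F\<close>.\<close>

lemma dual_section_generated:
  assumes kod: "kodaira_dimension M = 0" and m: "m > 0"
    and gg: "globally_generated M (sym_power m (cotangent_bundle M))" and c: "c \<in> atlas M" "x \<in> fst c"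
  shows "\<exists>u. dual_section (comp_of x) m u \<and> (\<forall>i\<in>TS m. u c x i = (\<Prod>l<m. v (i l)))"
proof (cases "\<forall>a\<in>I. v a = 0")
  \<comment> \<open>A zero vector offers no pivot \<open>b\<close>; since \<open>m > 0\<close> its
    power is zero and is extended by the zero section.\<close>
  case True
  have "dual_section (comp_of x) m (\<lambda>_ _ _. 0)"
    unfolding dual_section_def by (simp add: hol_at_const)
  moreover have "(\<Prod>l<m. v (i l)) = 0" if "i \<in> TS m" for i
    using True m PiE_mem [OF that, of 0] by (intro prod_zero bexI [of _ 0]) auto
  ultimately show ?thesis by force
next
  case False
  then obtain b where b: "b \<in> I" "v b \<noteq> 0" by blast
  have xX: "x \<in> X" using chart_sub c by blast
  obtain F where F: "kform m F" "\<And>d y. d \<in> atlas M \<Longrightarrow> y \<in> fst d \<Longrightarrow> y \<in> comp_of x \<Longrightarrow> F d y \<noteq> 0"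
    using nonvanishing_kform [OF kod m gg c] by blast
  \<comment> \<open>Each of these covectors vanishes on \<open>v\<close>. For \<open>k = b\<close>
    the covector is zero, but this argument is overwritten in \<open>\<Delta>\<close>.\<close>
  define \<xi> where "\<xi> = (\<lambda>k a. (if a = k then 1 else 0) - v k / v b * (if a = b then 1 else 0))"
  have "\<exists>t. \<forall>k. tens_section m (t k) \<and> (\<forall>i\<in>TS m. t k c x i = (\<Prod>l<m. \<xi> k (i l)))"
    using generated_tensors [OF gg c tsym_prod [of m "\<xi> k" for k]] by (intro choice allI) blast
  then obtain t where t': "\<forall>k. tens_section m (t k) \<and> (\<forall>i\<in>TS m. t k c x i = (\<Prod>l<m. \<xi> k (i l)))" ..
  have t: "tens_section m (t k)" "i \<in> TS m \<Longrightarrow> t k c x i = (\<Prod>l<m. \<xi> k (i l))" for k i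
    using t' by blast+
  define \<Delta> where "\<Delta> d y i = detpow I m ((\<lambda>k. t k d y)(b := \<lambda>j. if j = i then 1 else 0))" for d y i
  define g where "g a = det (xmat I (\<lambda>k a'. if k = b then (if a' = a then 1 else 0) else \<xi> k a'))" for a
  \<comment> \<open>This constant normalizes the value at \<open>x\<close>, where
    \<open>\<Delta>\<close> is \<open>(g b / v b) ^ m\<close> times the power of
    \<open>v\<close>.\<close>
  define C where "C = (v b / g b) ^ m * F c x"
  define u where "u d y i = C * \<Delta> d y i / F d y" for d y i
  have g0: "g b \<noteq> 0" and g: "\<And>a. a \<in> I \<Longrightarrow> g a = v a / v b * g b"
    unfolding g_def \<xi>_def using det_annihilator [where v = v, OF b] by auto
  have "dual_section (comp_of x) m u"
    unfolding dual_section_def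
  proof (intro conjI ballI)
    fix d y i assume *: "d \<in> atlas M" "y \<in> fst d \<inter> comp_of x" "i \<in> TS m"
    have "hol_at (\<lambda>y. ((\<lambda>k. t k d y)(b := \<lambda>j. if j = i then 1 else 0)) k i') y" if "i' \<in> TS m" for k i'
    proof (cases "k = b")
      case False
      then show ?thesis using t(1) [of k] * that unfolding tens_section_def by simp
    qed (simp add: hol_at_const)
    then have "hol_at (\<lambda>y. \<Delta> d y i) y" unfolding \<Delta>_def by (rule hol_at_detpow)
    then show "hol_at (\<lambda>y. u d y i) y"
      unfolding u_def using * kformD(1) [OF F(1)] F(2) by (intro hol_at_divide hol_at_mult hol_at_const) auto
  next
    fix d e y j assume *: "d \<in> atlas M" "e \<in> atlas M" "y \<in> fst d \<inter> fst e \<inter> comp_of x" "j \<in> TS m"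
    let ?s = "\<lambda>i. \<Prod>l<m. Jac d e y (i l) (j l)"
    have "(\<Sum>i\<in>TS m. ?s i * \<Delta> d y i) = detpow I m ((\<lambda>k. t k d y)(b := ?s))"
      unfolding \<Delta>_def by (rule detpow_linear [OF b(1), symmetric])
    also have "\<dots> = det_Jac d e y ^ m * \<Delta> e y j"
      unfolding det_Jac_def \<Delta>_def
    proof (rule detpow_change)
      fix k i assume i: "i \<in> TS m"
      show "((\<lambda>k. t k d y)(b := ?s)) k i = (\<Sum>j'\<in>TS m. (\<Prod>l<m. Jac d e y (i l) (j' l)) *
          ((\<lambda>k. t k e y)(b := \<lambda>j'. if j' = j then 1 else 0)) k j')"
      proof (cases "k = b")
        case True
        then show ?thesis using *(4) finite_TS by (simp add: if_distrib [of "\<lambda>z. _ * z"] cong: if_cong)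
      next
        case False
        then show ?thesis using tens_change [OF t(1) *(1,2) _ _ i, of y k] * by simp
      qed
    qed
    finally have 1: "(\<Sum>i\<in>TS m. ?s i * \<Delta> d y i) = det_Jac d e y ^ m * \<Delta> e y j" .
    have 2: "F d y = det_Jac d e y ^ m * F e y" using kformD(2) [OF F(1)] * by blast
    have 3: "F d y \<noteq> 0" "F e y \<noteq> 0" using F(2) * by auto
    have "(\<Sum>i\<in>TS m. u d y i * ?s i) = C / F d y * (\<Sum>i\<in>TS m. ?s i * \<Delta> d y i)"
      unfolding u_def sum_distrib_left by (rule sum.cong) simp_all
    also have "\<dots> = u e y j" using 2 3 unfolding 1 u_def by auto
    finally show "u e y j = (\<Sum>i\<in>TS m. u d y i * ?s i)" ..
  qed
  moreover have "u c x i = (\<Prod>l<m. v (i l))" if i: "i \<in> TS m" for i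
  proof -
    have "\<Delta> c x i = (\<Prod>l<m. g (i l))"
      unfolding \<Delta>_def g_def
    proof (rule detpow_rows)
      fix k j assume j: "j \<in> TS m"
      show "((\<lambda>k. t k c x)(b := \<lambda>j. if j = i then 1 else 0)) k j =
          (\<Prod>l<m. if k = b then (if j l = i l then 1 else 0) else \<xi> k (j l))"
      proof (cases "k = b \<and> j \<noteq> i")
        case True
        then show ?thesis using prod_delta [OF j i] by simp
      qed (use t(2) j in auto)
    qed
    also have "\<dots> = (\<Prod>l<m. g b / v b * v (i l))"
      by (rule prod.cong [OF refl]) (use g PiE_mem [OF i] in simp)
    also have "\<dots> = (g b / v b) ^ m * (\<Prod>l<m. v (i l))" unfolding prod.distrib by simp
    finally have "\<Delta> c x i = (g b / v b) ^ m * (\<Prod>l<m. v (i l))" .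
    moreover have "F c x \<noteq> 0" using F(2) c comp_of_self [OF xX] by blast
    ultimately show ?thesis using g0 b by (simp add: u_def C_def power_divide)
  qed
  ultimately show ?thesis by blast
qed

end

section \<open>The equivalences\<close>

context cmanifold
begin

lemma parallelizable_if_generated:
  assumes cpt: "compact_space (mtop M)" and m: "m > 0"
    and gg: "globally_generated M (sym_power m (cotangent_bundle M))"
    and dual: "\<And>x c v. c \<in> atlas M \<Longrightarrow> x \<in> fst c \<Longrightarrow>
        \<exists>u. dual_section (comp_of x) m u \<and> (\<forall>i\<in>TS m. u c x i = (\<Prod>l<m. v (i l)))"
  shows "complex_parallelizable M"
proof (cases "I = {}")
  \<comment> \<open>In dimension 0 the roots of unity would not act freely on frames. The
    determinant of the padded empty block is 1, so the zero family is a frame.\<close>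
  case True
  then have "frame_on X (\<lambda>_ _ _ _. 0)" unfolding frame_on_def cov_section_def by (simp add: det_xmat)
  then show ?thesis by (rule parallelizable_if_frame)
next
  case False
  have "\<exists>e. frame_on (comp_of p) e" if p: "p \<in> X" for p
  proof -
    interpret tensor_gen M p m
    proof
      show "\<exists>u. dual_section (comp_of p) m u \<and> (\<forall>i\<in>TS m. u c x i = (\<Prod>l<m. v (i l)))"
        if "x \<in> comp_of p" "c \<in> atlas M" "x \<in> fst c" for x c v
        using dual [OF that(2,3)] comp_of_eq [OF that(1)] by simp
    qed (use cpt p m False generated_tensors [OF gg] in auto)
    show ?thesis by (rule frame_exists)
  qed
  then obtain e where "frame_on X e" by (rule frame_glue)
  then show ?thesis by (rule parallelizable_if_frame)
qed

end

theorem theorem1p3: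
  fixes M :: "('a, 'n::finite) manifold_data"
  assumes "complex_manifold M"
    and "compact_space (mtop M)"
    and "topspace (mtop M) \<noteq> {}"
  shows "(complex_parallelizable M \<longleftrightarrow>
            kodaira_dimension M = 0 \<and> strongly_semiample M (cotangent_bundle M)) \<and>
         (complex_parallelizable M \<longleftrightarrow>
            (\<exists>m>0. holo_trivial M (sym_power m (cotangent_bundle M))))"
proof -
  interpret cmanifold M by standard (rule assms)
  have "kodaira_dimension M = 0 \<and> strongly_semiample M (cotangent_bundle M)" if par: "complex_parallelizable M"
  proof -
    obtain e where "frame_on (topspace (mtop M)) e" using frame_if_parallelizable [OF par] .
    then show ?thesis
      using kodaira_zero_if_frame assms(2,3) trivial_sym_generated(1) [OF trivial_sym1 [OF par]] zero_less_one
      unfolding strongly_semiample_def by blast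
  qed
  moreover have "complex_parallelizable M"
    if k: "kodaira_dimension M = 0" and s: "strongly_semiample M (cotangent_bundle M)"
  proof -
    obtain m where m: "m > 0" "globally_generated M (sym_power m (cotangent_bundle M))"
      using s unfolding strongly_semiample_def by blast
    show ?thesis by (rule parallelizable_if_generated [OF assms(2) m dual_section_generated [OF k m]])
  qed
  moreover have "\<exists>m>0. holo_trivial M (sym_power m (cotangent_bundle M))" if "complex_parallelizable M"
    using trivial_sym1 [OF that] zero_less_one by blast
  moreover have "complex_parallelizable M" if m: "m > 0" and h: "holo_trivial M (sym_power m (cotangent_bundle M))" for m
    by (rule parallelizable_if_generated [OF assms(2) m trivial_sym_generated(1) [OF h] trivial_sym_generated(2) [OF h]])
  ultimately show ?thesis by blast
qed

end
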